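(* Let $H$ be a finite-dimensional semisimple Hopf algebra over $\mathbb{C}$. Frobenius theorem holds for $H$ if one of the following holds: (a) $H$ is isomorphic to a bismash product $\mathbb{C}^G \# \mathbb{C}F$ for some matched pair $(F,G)$ of finite groups; (b) $H$ is isomorphic to $H_{2N^2}(\xi)$ for some integer $N>1$ and some $\xi \in \mathbb{C}$ with $\xi^N=1$; (c) $H$ is isomorphic to $H_{N^3}(\xi,\zeta)$ for some positive odd integer $N$ and some $\xi,\zeta \in \mathbb{C}$ with $\xi^N=\zeta^N=1$; (d) $H$ is isomorphic to Suzuki's Hopf algebra $A_{NL}^{\alpha\beta}$ for some integers $N \ge 1$, $L \ge 2$ and $\alpha,\beta \in \{\pm 1\}$.
   Context: For a finite-dimensional semisimple Hopf algebra $H$ over $\mathbb{C}$ and $n\ge1$, $\nu_n(H) = \chi_H(\Lambda_{(1)} \cdots \Lambda_{(n)})$, where $\Lambda \in H$ is the integral with $\varepsilon(\Lambda)=1$ (Sweedler notation) and $\chi_H$ is the character of the regular representation. "Frobenius theorem holds for $H$" means: for every positive divisor $n$ of $\dim_{\mathbb{C}} H$, $\nu_n(H)$ is divisible by $n$ in the ring of algebraic integers. Bismash product: a matched pair $(F,G)$ of finite groups consists of a right action $\triangleleft: G \times F \to G$ of the group $F$ on the set $G$ and a left action $\triangleright: G \times F \to F$ of the group $G$ on the set $F$ with $g \triangleright (xy) = (g \triangleright x)((g \triangleleft x) \triangleright y)$ and $(gh) \triangleleft x = (g \triangleleft (h \triangleright x))(h \triangleleft x)$. With $e_g \in \mathbb{C}^G$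 the basis dual to $g\in G$, $\mathbb{C}^G \# \mathbb{C}F$ is the algebra generated by $\mathbb{C}^G$ and $u_x$ ($x \in F$) with $u_x u_y = u_{xy}$, $u_x e_g = e_{g \triangleleft x^{-1}} u_x$ (basis $e_g u_x$), and comultiplication $\Delta(u_x) = \sum_{g,h \in G} e_g u_{h \triangleright x} \otimes e_h u_x$, $\Delta(e_g) = \sum_{h} e_{gh^{-1}} \otimes e_h$. In the next two, $e_{ij}$ ($i,j \in \mathbb{Z}_N$) is the basis of $\mathbb{C}^{\mathbb{Z}_N\times\mathbb{Z}_N}$ dual to the group elements, $\Delta(e_{ij}) = \sum_{p,q} e_{i-p,j-q} \otimes e_{pq}$ and $\varepsilon(e_{ij}) = \delta_{i0}\delta_{j0}$. $H_{2N^2}(\xi)$ (dimension $2N^2$): generated by $\mathbb{C}^{\mathbb{Z}_N \times \mathbb{Z}_N}$ and $u$ with $u^2 = \sum_{i,j}\xi^{ij}e_{ij}$, $u e_{ij} = e_{ji}u$, $\Delta(u) = \sum_{i,j,k,l} \xi^{jk} e_{ij}u \otimes e_{kl}u$, $\varepsilon(u)=1$. $H_{N^3}(\xi,\zeta)$ (dimension $N^3$): generated by $\mathbb{C}^{\mathbb{Z}_N \times \mathbb{Z}_N}$ and $x$ with $x^N = \sum_{i,j}\xi^j e_{ij}$, $x e_{ij} = e_{i-j,j}x$, $\Delta(x) = \sum_{p,q,r,s}\zeta^{qr}e_{pq}x \otimes e_{rs}x$, $\varepsilon(x)=1$. $A_{NL}^{\alpha\beta}$ (dimension $4NL$): generated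 by $x_{ij}$ ($i,j \in \mathbb{Z}_2$) with relations $x_{00}^2 = x_{11}^2$; $x_{01}^2 = x_{10}^2$; $x_{00}^{2N} + \alpha x_{01}^{2N} = 1$; $x_{ij}x_{kl}=0$ if $i-j\ne k-l$; $x_{00}x_{11}x_{00}\cdots = x_{11}x_{00}x_{11}\cdots$ and $x_{01}x_{10}x_{01}\cdots = \beta x_{10}x_{01}x_{10}\cdots$ (alternating products with $L$ factors on each side); $\Delta(x_{ij}) = x_{i0}\otimes x_{0j}+x_{i1}\otimes x_{1j}$, $\varepsilon(x_{ij})=\delta_{ij}$, $S(x_{ij}) = x_{ji}^{4N-1}$. All these Hopf algebras are semisimple. *)

theory Defs
  imports
    Complex_Main
    "HOL-Library.Poly_Mapping"
    "HOL-Library.Z2"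
    "HOL-Computational_Algebra.Polynomial"
    "HOL-Algebra.Group"
begin

section \<open>Complex vector spaces and algebras\<close>

class complex_vector = ab_group_add +
  fixes scaleC :: "complex \<Rightarrow> 'a \<Rightarrow> 'a" (infixr \<open>*\<^sub>C\<close> 75)
  assumes scaleC_add_right: "c *\<^sub>C (x + y) = c *\<^sub>C x + c *\<^sub>C y"
    and scaleC_add_left: "(c + d) *\<^sub>C x = c *\<^sub>C x + d *\<^sub>C x"
    and scaleC_scaleC: "c *\<^sub>C d *\<^sub>C x = (c * d) *\<^sub>C x"
    and scaleC_one: "1 *\<^sub>C x = x"

global_interpretation cvec: vector_space "scaleC :: complex \<Rightarrow> 'a \<Rightarrow> 'a::complex_vector"
  by unfold_locales (simp_all add: scaleC_add_right scaleC_add_left scaleC_scaleC scaleC_one)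

abbreviation clinear :: "('a::complex_vector \<Rightarrow> 'b::complex_vector) \<Rightarrow> bool"
  where "clinear \<equiv> Vector_Spaces.linear scaleC scaleC"

definition cbilinear :: "('a::complex_vector \<Rightarrow> 'b::complex_vector \<Rightarrow> 'c::complex_vector) \<Rightarrow> bool"
  where "cbilinear B \<longleftrightarrow> (\<forall>a. clinear (B a)) \<and> (\<forall>b. clinear (\<lambda>a. B a b))"

class complex_algebra_1 = complex_vector + ring_1 +
  assumes scaleC_mult_left: "(c *\<^sub>C x) * y = c *\<^sub>C (x * y)"
    and scaleC_mult_right: "x * (c *\<^sub>C y) = c *\<^sub>C (x * y)"

definition finite_dimensional :: "'a::complex_vector itself \<Rightarrow> bool"
  where "finite_dimensional _ \<longleftrightarrow> (\<exists>B :: 'a set. finite B \<and> cvec.span B = UNIV)"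

text \<open>The trace, computed in some basis; it only depends on the endomorphism.\<close>

definition lin_trace :: "('a::complex_vector \<Rightarrow> 'a) \<Rightarrow> complex"
  where "lin_trace f =
    (let B = (SOME B. cvec.independent B \<and> cvec.span B = UNIV)
     in \<Sum>b\<in>B. cvec.representation B (f b) b)"

definition left_ideal :: "'a::complex_algebra_1 set \<Rightarrow> bool"
  where "left_ideal I \<longleftrightarrow> cvec.subspace I \<and> (\<forall>a. \<forall>x\<in>I. a * x \<in> I)"

text \<open>Semisimplicity of the algebra: the left regular module is semisimple, that is, every
  submodule of it is a direct summand.\<close>

definition semisimple_algebra :: "'a::complex_algebra_1 itself \<Rightarrow> bool"
  where "semisimple_algebra _ \<longleftrightarrow>
    (\<forall>I :: 'a set. left_ideal I \<longrightarrow>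
      (\<exists>J. left_ideal J \<and> I \<inter> J = {0} \<and> (\<forall>x. \<exists>a\<in>I. \<exists>b\<in>J. x = a + b)))"

instantiation complex :: complex_algebra_1
begin
definition scaleC_complex :: "complex \<Rightarrow> complex \<Rightarrow> complex"
  where "scaleC_complex = (*)"
instance by standard (simp_all add: scaleC_complex_def algebra_simps)
end


section \<open>Free vector spaces\<close>

text \<open>\<open>'k \<Rightarrow>\<^sub>0 complex\<close> is the vector space with basis \<open>'k\<close>.\<close>

instantiation poly_mapping :: (type, complex_vector) complex_vector
begin
definition scaleC_poly_mapping :: "complex \<Rightarrow> ('a \<Rightarrow>\<^sub>0 'b) \<Rightarrow> ('a \<Rightarrow>\<^sub>0 'b)"
  where "scaleC_poly_mapping c = Poly_Mapping.map (scaleC c)"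
instance
proof -
  have l: "Poly_Mapping.lookup (c *\<^sub>C p) k = c *\<^sub>C Poly_Mapping.lookup p k"
    for c and p :: "'a \<Rightarrow>\<^sub>0 'b" and k
    by (simp add: scaleC_poly_mapping_def Poly_Mapping.map.rep_eq when_def)
  show "OFCLASS('a \<Rightarrow>\<^sub>0 'b, complex_vector_class)"
    by standard (simp_all add: poly_mapping_eq_iff fun_eq_iff l lookup_add
        cvec.scale_right_distrib cvec.scale_left_distrib)
qed
end

lemma lookup_scaleC: "Poly_Mapping.lookup (c *\<^sub>C p) k = c *\<^sub>C Poly_Mapping.lookup p k"
  by (simp add: scaleC_poly_mapping_def Poly_Mapping.map.rep_eq when_def)

definition lin_ext :: "('k \<Rightarrow> 'v::complex_vector) \<Rightarrow> ('k \<Rightarrow>\<^sub>0 complex) \<Rightarrow> 'v"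
  where "lin_ext f p = (\<Sum>k\<in>Poly_Mapping.keys p. Poly_Mapping.lookup p k *\<^sub>C f k)"

lemma lin_ext_superset:
  assumes "finite A" "Poly_Mapping.keys p \<subseteq> A"
  shows "lin_ext f p = (\<Sum>k\<in>A. Poly_Mapping.lookup p k *\<^sub>C f k)"
  unfolding lin_ext_def by (rule sum.mono_neutral_left) (use assms in \<open>auto simp: in_keys_iff\<close>)

lemma clinear_lin_ext:
  fixes f :: "'k \<Rightarrow> 'v::complex_vector"
  shows "clinear (lin_ext f)"
proof
  fix p q :: "'k \<Rightarrow>\<^sub>0 complex" and c :: complex
  let ?A = "Poly_Mapping.keys p \<union> Poly_Mapping.keys q"
  have "lin_ext f (p + q) = (\<Sum>k\<in>?A. Poly_Mapping.lookup (p + q) k *\<^sub>C f k)"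
    by (rule lin_ext_superset) (use keys_add[of p q] in auto)
  also have "\<dots> = lin_ext f p + lin_ext f q"
    by (simp add: lin_ext_superset[of ?A p] lin_ext_superset[of ?A q] lookup_add
        cvec.scale_left_distrib sum.distrib)
  finally show "lin_ext f (p + q) = lin_ext f p + lin_ext f q" .
  have "lin_ext f (c *\<^sub>C p) = (\<Sum>k\<in>Poly_Mapping.keys p. Poly_Mapping.lookup (c *\<^sub>C p) k *\<^sub>C f k)"
    by (rule lin_ext_superset) (auto simp: in_keys_iff lookup_scaleC)
  then show "lin_ext f (c *\<^sub>C p) = c *\<^sub>C lin_ext f p"
    by (simp add: lin_ext_def lookup_scaleC cvec.scale_sum_right scaleC_complex_def)
qed

lemma lin_ext_single: "lin_ext f (Poly_Mapping.single k c) = c *\<^sub>C f k"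
  by (cases "c = 0") (simp_all add: lin_ext_def)


section \<open>Tensor products\<close>

text \<open>The tensor product is the free vector space on the pairs modulo the bilinearity relations.\<close>

abbreviation pair_gen :: "'a \<Rightarrow> 'b \<Rightarrow> ('a \<times> 'b \<Rightarrow>\<^sub>0 complex)"
  where "pair_gen a b \<equiv> Poly_Mapping.single (a, b) 1"

definition bilinearity_relations :: "('a::complex_vector \<times> 'b::complex_vector \<Rightarrow>\<^sub>0 complex) set"
  where "bilinearity_relations =
      {pair_gen (a + a') b - pair_gen a b - pair_gen a' b | a a' b. True}
    \<union> {pair_gen a (b + b') - pair_gen a b - pair_gen a b' | a b b'. True}
    \<union> {pair_gen (c *\<^sub>C a) b - c *\<^sub>C pair_gen a b | c a b. True}
    \<union> {pair_gen a (c *\<^sub>C b) - c *\<^sub>C pair_gen a b | c a b. True}"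

definition tensor_rel ::
    "('a::complex_vector \<times> 'b::complex_vector \<Rightarrow>\<^sub>0 complex) \<Rightarrow> ('a \<times> 'b \<Rightarrow>\<^sub>0 complex) \<Rightarrow> bool"
  where "tensor_rel p q \<longleftrightarrow> p - q \<in> cvec.span bilinearity_relations"

quotient_type (overloaded) ('a, 'b) tensor (infixr \<open>\<otimes>\<^sub>C\<close> 70) =
  "'a::complex_vector \<times> 'b::complex_vector \<Rightarrow>\<^sub>0 complex" / tensor_rel
proof (rule equivpI)
  show "reflp tensor_rel" by (rule reflpI) (simp add: tensor_rel_def cvec.span_zero)
  show "symp tensor_rel"
    by (rule sympI, unfold tensor_rel_def) (drule cvec.span_neg, simp)
  show "transp tensor_rel"
    by (rule transpI, unfold tensor_rel_def) (drule (1) cvec.span_add, simp)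
qed

instantiation tensor :: (complex_vector, complex_vector) complex_vector
begin

lift_definition zero_tensor :: "'a \<otimes>\<^sub>C 'b" is 0 .

lift_definition plus_tensor :: "'a \<otimes>\<^sub>C 'b \<Rightarrow> 'a \<otimes>\<^sub>C 'b \<Rightarrow> 'a \<otimes>\<^sub>C 'b" is "(+)"
  unfolding tensor_rel_def by (drule (1) cvec.span_add) (simp add: algebra_simps)

lift_definition uminus_tensor :: "'a \<otimes>\<^sub>C 'b \<Rightarrow> 'a \<otimes>\<^sub>C 'b" is uminus
  unfolding tensor_rel_def by (drule cvec.span_neg) simp

lift_definition minus_tensor :: "'a \<otimes>\<^sub>C 'b \<Rightarrow> 'a \<otimes>\<^sub>C 'b \<Rightarrow> 'a \<otimes>\<^sub>C 'b" is "(-)"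
  unfolding tensor_rel_def by (drule (1) cvec.span_diff) (simp add: algebra_simps)

lift_definition scaleC_tensor :: "complex \<Rightarrow> 'a \<otimes>\<^sub>C 'b \<Rightarrow> 'a \<otimes>\<^sub>C 'b" is scaleC
  unfolding tensor_rel_def by (simp add: cvec.span_scale flip: cvec.scale_right_diff_distrib)

instance
proof
  fix x y z :: "'a \<otimes>\<^sub>C 'b" and c d :: complex
  show "x + y + z = x + (y + z)" by transfer (simp add: tensor_rel_def cvec.span_zero algebra_simps)
  show "x + y = y + x" by transfer (simp add: tensor_rel_def cvec.span_zero algebra_simps)
  show "0 + x = x" by transfer (simp add: tensor_rel_def cvec.span_zero)
  show "- x + x = 0" by transfer (simp add: tensor_rel_def cvec.span_zero)
  show "x - y = x + - y" by transfer (simp add: tensor_rel_def cvec.span_zero)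
  show "c *\<^sub>C (x + y) = c *\<^sub>C x + c *\<^sub>C y"
    by transfer (simp add: tensor_rel_def cvec.span_zero cvec.scale_right_distrib)
  show "(c + d) *\<^sub>C x = c *\<^sub>C x + d *\<^sub>C x"
    by transfer (simp add: tensor_rel_def cvec.span_zero cvec.scale_left_distrib)
  show "c *\<^sub>C d *\<^sub>C x = (c * d) *\<^sub>C x" by transfer (simp add: tensor_rel_def cvec.span_zero)
  show "1 *\<^sub>C x = x" by transfer (simp add: tensor_rel_def cvec.span_zero)
qed

end

lift_definition tensor_elem ::
    "'a::complex_vector \<Rightarrow> 'b::complex_vector \<Rightarrow> 'a \<otimes>\<^sub>C 'b" (infixr \<open>\<otimes>\<^sub>C\<close> 76)
  is pair_gen .

lemma bilinearity_relationsI: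
  "pair_gen (a + a') b - pair_gen a b - pair_gen a' b \<in> bilinearity_relations"
  "pair_gen a (b + b') - pair_gen a b - pair_gen a b' \<in> bilinearity_relations"
  "pair_gen (c *\<^sub>C a) b - c *\<^sub>C pair_gen a b \<in> bilinearity_relations"
  "pair_gen a (c *\<^sub>C b) - c *\<^sub>C pair_gen a b \<in> bilinearity_relations"
  unfolding bilinearity_relations_def Un_iff mem_Collect_eq
  subgoal by (rule disjI1, rule disjI1, rule disjI1, rule exI[of _ a], rule exI[of _ a'], rule exI[of _ b]) simp
  subgoal by (rule disjI1, rule disjI1, rule disjI2, rule exI[of _ a], rule exI[of _ b], rule exI[of _ b']) simp
  subgoal by (rule disjI1, rule disjI2, rule exI[of _ c], rule exI[of _ a], rule exI[of _ b]) simp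
  subgoal by (rule disjI2, rule exI[of _ c], rule exI[of _ a], rule exI[of _ b]) simp
  done

lemma tensor_elem_bilinear:
  "(a + a') \<otimes>\<^sub>C b = a \<otimes>\<^sub>C b + a' \<otimes>\<^sub>C b"
  "a \<otimes>\<^sub>C (b + b') = a \<otimes>\<^sub>C b + a \<otimes>\<^sub>C b'"
  "(c *\<^sub>C a) \<otimes>\<^sub>C b = c *\<^sub>C (a \<otimes>\<^sub>C b)"
  "a \<otimes>\<^sub>C (c *\<^sub>C b) = c *\<^sub>C (a \<otimes>\<^sub>C b)"
  unfolding tensor_elem.abs_eq plus_tensor.abs_eq scaleC_tensor.abs_eq tensor.abs_eq_iff
    tensor_rel_def diff_diff_eq[symmetric]
  by (intro cvec.span_base bilinearity_relationsI)+

text \<open>For bilinear \<open>B\<close>, the induced linear map on the tensor product; see \<open>tensor_lift_elem\<close>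
  and \<open>clinear_tensor_lift\<close> below. (\<open>rep_tensor\<close> picks a representative.)\<close>

definition tensor_lift ::
    "('a::complex_vector \<Rightarrow> 'b::complex_vector \<Rightarrow> 'c::complex_vector) \<Rightarrow> 'a \<otimes>\<^sub>C 'b \<Rightarrow> 'c"
  where "tensor_lift B t = lin_ext (\<lambda>(a, b). B a b) (rep_tensor t)"

lemma lin_ext_tensor_rel:
  assumes B: "cbilinear B" and pq: "tensor_rel p q"
  shows "lin_ext (\<lambda>(a, b). B a b) p = lin_ext (\<lambda>(a, b). B a b) q"
proof -
  let ?f = "lin_ext (\<lambda>(a, b). B a b)"
  interpret f: Vector_Spaces.linear scaleC scaleC ?f by (rule clinear_lin_ext)
  have l: "module_hom scaleC scaleC (B a)" "module_hom scaleC scaleC (\<lambda>a. B a b)" for a b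
    using B by (simp_all add: cbilinear_def Vector_Spaces.linear.axioms(3))
  have "?f r = 0" if "r \<in> bilinearity_relations" for r
    using that unfolding bilinearity_relations_def Un_iff mem_Collect_eq
    by (elim disjE exE) (simp_all only: f.diff f.scale lin_ext_single prod.case scaleC_one
        module_hom.add[OF l(1)] module_hom.add[OF l(2)]
        module_hom.scale[OF l(1)] module_hom.scale[OF l(2)] add_diff_cancel_left' diff_self)
  then have "?f (p - q) = 0"
    using pq unfolding tensor_rel_def by (rule f.eq_0_on_span)
  then show ?thesis by (simp add: f.diff)
qed

lemma tensor_lift_abs:
  assumes "cbilinear B"
  shows "tensor_lift B (abs_tensor p) = lin_ext (\<lambda>(a, b). B a b) p"
  unfolding tensor_lift_def
  by (rule lin_ext_tensor_rel[OF assms]) (rule rep_abs_rsp_left[OF Quotient3_tensor], simp add: tensor_rel_def cvec.span_zero)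

lemma tensor_lift_elem:
  assumes "cbilinear B"
  shows "tensor_lift B (a \<otimes>\<^sub>C b) = B a b"
  by (simp add: tensor_elem.abs_eq tensor_lift_abs[OF assms] lin_ext_single scaleC_one)

lemma clinear_tensor_lift:
  assumes "cbilinear B"
  shows "clinear (tensor_lift B)"
proof
  interpret f: Vector_Spaces.linear scaleC scaleC "lin_ext (\<lambda>(a, b). B a b)"
    by (rule clinear_lin_ext)
  fix s t c
  show "tensor_lift B (s + t) = tensor_lift B s + tensor_lift B t"
    by (induct s, induct t) (simp add: plus_tensor.abs_eq tensor_lift_abs[OF assms] f.add)
  show "tensor_lift B (c *\<^sub>C s) = c *\<^sub>C tensor_lift B s"
    by (induct s) (simp add: scaleC_tensor.abs_eq tensor_lift_abs[OF assms] f.scale)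
qed

definition tensor_map ::
    "('a::complex_vector \<Rightarrow> 'c::complex_vector) \<Rightarrow> ('b::complex_vector \<Rightarrow> 'd::complex_vector)
      \<Rightarrow> 'a \<otimes>\<^sub>C 'b \<Rightarrow> 'c \<otimes>\<^sub>C 'd"
  where "tensor_map f g = tensor_lift (\<lambda>a b. f a \<otimes>\<^sub>C g b)"

definition tensor_assoc ::
    "('a::complex_vector \<otimes>\<^sub>C 'b::complex_vector) \<otimes>\<^sub>C 'c::complex_vector \<Rightarrow> 'a \<otimes>\<^sub>C ('b \<otimes>\<^sub>C 'c)"
  where "tensor_assoc = tensor_lift (\<lambda>t c. tensor_lift (\<lambda>a b. a \<otimes>\<^sub>C (b \<otimes>\<^sub>C c)) t)"

definition tensor_mult ::
    "'a::complex_algebra_1 \<otimes>\<^sub>C 'b::complex_algebra_1 \<Rightarrow> 'a \<otimes>\<^sub>C 'b \<Rightarrow> 'a \<otimes>\<^sub>C 'b"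
  where "tensor_mult s t =
    tensor_lift (\<lambda>a b. tensor_lift (\<lambda>c d. (a * c) \<otimes>\<^sub>C (b * d)) t) s"


section \<open>Hopf algebras and Frobenius--Schur indicators\<close>

locale hopf_algebra =
  fixes \<Delta> :: "'a::complex_algebra_1 \<Rightarrow> 'a \<otimes>\<^sub>C 'a"
    and \<epsilon> :: "'a \<Rightarrow> complex"
    and S :: "'a \<Rightarrow> 'a"
  assumes comult_linear: "clinear \<Delta>"
    and counit_linear: "clinear \<epsilon>"
    and antipode_linear: "clinear S"
    and coassoc: "tensor_assoc (tensor_map \<Delta> id (\<Delta> h)) = tensor_map id \<Delta> (\<Delta> h)"
    and counit_left: "tensor_lift (\<lambda>a b. \<epsilon> a *\<^sub>C b) (\<Delta> h) = h"
    and counit_right: "tensor_lift (\<lambda>a b. \<epsilon> b *\<^sub>C a) (\<Delta> h) = h"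
    and comult_mult: "\<Delta> (h * k) = tensor_mult (\<Delta> h) (\<Delta> k)"
    and comult_one: "\<Delta> 1 = 1 \<otimes>\<^sub>C 1"
    and counit_mult: "\<epsilon> (h * k) = \<epsilon> h * \<epsilon> k"
    and counit_one: "\<epsilon> 1 = 1"
    and antipode_left: "tensor_lift (\<lambda>a b. S a * b) (\<Delta> h) = \<epsilon> h *\<^sub>C 1"
    and antipode_right: "tensor_lift (\<lambda>a b. a * S b) (\<Delta> h) = \<epsilon> h *\<^sub>C 1"

text \<open>The Sweedler power \<open>h\<^sub>(\<^sub>1\<^sub>) h\<^sub>(\<^sub>2\<^sub>) \<cdots> h\<^sub>(\<^sub>n\<^sub>)\<close>, using
  \<open>h\<^sub>(\<^sub>1\<^sub>) \<otimes> \<cdots> \<otimes> h\<^sub>(\<^sub>n\<^sub>+\<^sub>1\<^sub>) = h\<^sub>(\<^sub>1\<^sub>)\<^sub>(\<^sub>1\<^sub>) \<otimes> \<cdots> \<otimes> h\<^sub>(\<^sub>1\<^sub>)\<^sub>(\<^sub>n\<^sub>) \<otimes> h\<^sub>(\<^sub>2\<^sub>)\<close>. The value at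
  \<open>n = 0\<close> is the empty product \<open>\<epsilon>(h) 1\<close>, so that the value at \<open>n = 1\<close> is \<open>\<epsilon>(h\<^sub>(\<^sub>1\<^sub>)) h\<^sub>(\<^sub>2\<^sub>) = h\<close>.\<close>

primrec sweedler_power ::
    "('a::complex_algebra_1 \<Rightarrow> 'a \<otimes>\<^sub>C 'a) \<Rightarrow> ('a \<Rightarrow> complex) \<Rightarrow> nat \<Rightarrow> 'a \<Rightarrow> 'a"
  where
    "sweedler_power \<Delta> \<epsilon> 0 = (\<lambda>h. \<epsilon> h *\<^sub>C 1)"
  | "sweedler_power \<Delta> \<epsilon> (Suc n) = (\<lambda>h. tensor_lift (\<lambda>a b. sweedler_power \<Delta> \<epsilon> n a * b) (\<Delta> h))"

definition integral_elem :: "('a::complex_algebra_1 \<Rightarrow> complex) \<Rightarrow> 'a \<Rightarrow> bool"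
  where "integral_elem \<epsilon> \<Lambda> \<longleftrightarrow> (\<forall>h. h * \<Lambda> = \<epsilon> h *\<^sub>C \<Lambda> \<and> \<Lambda> * h = \<epsilon> h *\<^sub>C \<Lambda>)"

text \<open>A finite-dimensional semisimple Hopf algebra has exactly one such element.\<close>

definition normalized_integral :: "('a::complex_algebra_1 \<Rightarrow> complex) \<Rightarrow> 'a"
  where "normalized_integral \<epsilon> = (THE \<Lambda>. integral_elem \<epsilon> \<Lambda> \<and> \<epsilon> \<Lambda> = 1)"

definition regular_character :: "'a::complex_algebra_1 \<Rightarrow> complex"
  where "regular_character a = lin_trace (\<lambda>x. a * x)"

definition FS_indicator ::
    "('a::complex_algebra_1 \<Rightarrow> 'a \<otimes>\<^sub>C 'a) \<Rightarrow> ('a \<Rightarrow> complex) \<Rightarrow> nat \<Rightarrow> complex"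
  where "FS_indicator \<Delta> \<epsilon> n =
    regular_character (sweedler_power \<Delta> \<epsilon> n (normalized_integral \<epsilon>))"

definition Frobenius_theorem_holds ::
    "('a::complex_algebra_1 \<Rightarrow> 'a \<otimes>\<^sub>C 'a) \<Rightarrow> ('a \<Rightarrow> complex) \<Rightarrow> bool"
  where "Frobenius_theorem_holds \<Delta> \<epsilon> \<longleftrightarrow>
    (\<forall>n>0. n dvd cvec.dim (UNIV :: 'a set) \<longrightarrow>
      (\<exists>z. algebraic_int z \<and> FS_indicator \<Delta> \<epsilon> n = of_nat n * z))"


section \<open>Algebras given by generators and relations\<close>

text \<open>Words form the free monoid, written additively so that the convolution product of
  \<^theory>\<open>HOL-Library.Poly_Mapping\<close> makes \<open>'x free_alg\<close> the free algebra on \<open>'x\<close>.\<close>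

datatype 'x fword = FWord (letters: "'x list")

instantiation fword :: (type) monoid_add
begin
definition zero_fword :: "'a fword" where "zero_fword = FWord []"
definition plus_fword :: "'a fword \<Rightarrow> 'a fword \<Rightarrow> 'a fword"
  where "plus_fword v w = FWord (letters v @ letters w)"
instance by standard (simp_all add: zero_fword_def plus_fword_def)
end

type_synonym 'x free_alg = "'x fword \<Rightarrow>\<^sub>0 complex"

definition fgen :: "'x \<Rightarrow> 'x free_alg"
  where "fgen x = Poly_Mapping.single (FWord [x]) 1"

definition free_alg_on :: "'x set \<Rightarrow> 'x free_alg set"
  where "free_alg_on X = {p. \<forall>w\<in>Poly_Mapping.keys p. set (letters w) \<subseteq> X}"

definition free_eval :: "('x \<Rightarrow> 'a::complex_algebra_1) \<Rightarrow> 'x free_alg \<Rightarrow> 'a"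
  where "free_eval \<gamma> = lin_ext (\<lambda>w. prod_list (map \<gamma> (letters w)))"

text \<open>The two-sided ideal of \<open>free_alg_on X\<close> generated by \<open>R\<close>.\<close>

inductive_set relation_ideal :: "'x set \<Rightarrow> 'x free_alg set \<Rightarrow> 'x free_alg set"
  for X :: "'x set" and R :: "'x free_alg set"
  where
    zero: "0 \<in> relation_ideal X R"
  | step: "p \<in> relation_ideal X R \<Longrightarrow> r \<in> R \<Longrightarrow> a \<in> free_alg_on X \<Longrightarrow> b \<in> free_alg_on X
      \<Longrightarrow> p + a * r * b \<in> relation_ideal X R"

text \<open>The map \<open>\<gamma>\<close> induces an isomorphism from the algebra with generators \<open>X\<close> and relations
  \<open>r = 0\<close> for \<open>r \<in> R\<close> onto \<open>'a\<close>: the homomorphism from the free algebra on \<open>X\<close>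
  extending \<open>\<gamma>\<close> is surjective and its kernel is the ideal generated by \<open>R\<close>.\<close>

definition presented_by :: "'x set \<Rightarrow> 'x free_alg set \<Rightarrow> ('x \<Rightarrow> 'a::complex_algebra_1) \<Rightarrow> bool"
  where "presented_by X R \<gamma> \<longleftrightarrow>
    free_eval \<gamma> ` free_alg_on X = UNIV \<and>
    {p \<in> free_alg_on X. free_eval \<gamma> p = 0} = relation_ideal X R"


section \<open>The four families\<close>

text \<open>Being isomorphic, as a Hopf algebra, to a given one is expressed by the existence of the
  images of its generators under an isomorphism. Since the comultiplication is an algebra
  homomorphism, it suffices to prescribe it on generators; a bialgebra isomorphism automatically
  respects counits and antipodes.\<close>

subsection \<open>Bismash products\<close>

definition matched_pair ::
    "'f monoid \<Rightarrow> 'g monoid \<Rightarrow> ('g \<Rightarrow> 'f \<Rightarrow> 'g) \<Rightarrow> ('g \<Rightarrow> 'f \<Rightarrow> 'f) \<Rightarrow> bool"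
  where "matched_pair F G ract lact \<longleftrightarrow>
    Group.group F \<and> finite (carrier F) \<and> Group.group G \<and> finite (carrier G) \<and>
    (\<forall>g\<in>carrier G. \<forall>x\<in>carrier F. ract g x \<in> carrier G \<and> lact g x \<in> carrier F) \<and>
    (\<forall>g\<in>carrier G. ract g \<one>\<^bsub>F\<^esub> = g) \<and>
    (\<forall>g\<in>carrier G. \<forall>x\<in>carrier F. \<forall>y\<in>carrier F.
      ract g (x \<otimes>\<^bsub>F\<^esub> y) = ract (ract g x) y) \<and>
    (\<forall>x\<in>carrier F. lact \<one>\<^bsub>G\<^esub> x = x) \<and>
    (\<forall>g\<in>carrier G. \<forall>h\<in>carrier G. \<forall>x\<in>carrier F.
      lact (g \<otimes>\<^bsub>G\<^esub> h) x = lact g (lact h x)) \<and>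
    (\<forall>g\<in>carrier G. \<forall>x\<in>carrier F. \<forall>y\<in>carrier F.
      lact g (x \<otimes>\<^bsub>F\<^esub> y) = lact g x \<otimes>\<^bsub>F\<^esub> lact (ract g x) y) \<and>
    (\<forall>g\<in>carrier G. \<forall>h\<in>carrier G. \<forall>x\<in>carrier F.
      ract (g \<otimes>\<^bsub>G\<^esub> h) x = ract g (lact h x) \<otimes>\<^bsub>G\<^esub> ract h x)"

definition iso_bismash_product ::
    "'f monoid \<Rightarrow> 'g monoid \<Rightarrow> ('g \<Rightarrow> 'f \<Rightarrow> 'g) \<Rightarrow> ('g \<Rightarrow> 'f \<Rightarrow> 'f)
      \<Rightarrow> ('a::complex_algebra_1 \<Rightarrow> 'a \<otimes>\<^sub>C 'a) \<Rightarrow> bool"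
  where "iso_bismash_product F G ract lact \<Delta> \<longleftrightarrow>
    (\<exists>(e :: 'g \<Rightarrow> 'a) (u :: 'f \<Rightarrow> 'a).
      inj_on (\<lambda>(g, x). e g * u x) (carrier G \<times> carrier F) \<and>
      cvec.independent ((\<lambda>(g, x). e g * u x) ` (carrier G \<times> carrier F)) \<and>
      cvec.span ((\<lambda>(g, x). e g * u x) ` (carrier G \<times> carrier F)) = UNIV \<and>
      (\<forall>g\<in>carrier G. \<forall>h\<in>carrier G. e g * e h = (if g = h then e g else 0)) \<and>
      (\<Sum>g\<in>carrier G. e g) = 1 \<and>
      (\<forall>x\<in>carrier F. \<forall>y\<in>carrier F. u x * u y = u (x \<otimes>\<^bsub>F\<^esub> y)) \<and>
      u \<one>\<^bsub>F\<^esub> = 1 \<and>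
      (\<forall>x\<in>carrier F. \<forall>g\<in>carrier G. u x * e g = e (ract g (inv\<^bsub>F\<^esub> x)) * u x) \<and>
      (\<forall>x\<in>carrier F. \<Delta> (u x) =
        (\<Sum>g\<in>carrier G. \<Sum>h\<in>carrier G. (e g * u (lact h x)) \<otimes>\<^sub>C (e h * u x))) \<and>
      (\<forall>g\<in>carrier G. \<Delta> (e g) =
        (\<Sum>h\<in>carrier G. e (g \<otimes>\<^bsub>G\<^esub> inv\<^bsub>G\<^esub> h) \<otimes>\<^sub>C e h)))"

subsection \<open>Two families generated by functions on \<open>\<int>\<^sub>N \<times> \<int>\<^sub>N\<close>\<close>

text \<open>Residue classes modulo \<open>N\<close> are represented by the integers in \<open>{0..<N}\<close>. The generators
  are the \<open>e\<^sub>i\<^sub>j\<close> and one further element.\<close>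

datatype egen = E int int | W

definition egens :: "nat \<Rightarrow> egen set"
  where "egens N = insert W {E i j | i j. i \<in> {0..<int N} \<and> j \<in> {0..<int N}}"

text \<open>The relations of the algebra of functions on \<open>\<int>\<^sub>N \<times> \<int>\<^sub>N\<close>: orthogonal idempotents with sum \<open>1\<close>.\<close>

definition idempotent_relations :: "nat \<Rightarrow> egen free_alg set"
  where "idempotent_relations N =
      {fgen (E i j) * fgen (E k l) - (if i = k \<and> j = l then fgen (E i j) else 0) | i j k l.
        i \<in> {0..<int N} \<and> j \<in> {0..<int N} \<and> k \<in> {0..<int N} \<and> l \<in> {0..<int N}}
    \<union> {(\<Sum>i\<in>{0..<int N}. \<Sum>j\<in>{0..<int N}. fgen (E i j)) - 1}"

definition idempotent_coalgebra ::
    "nat \<Rightarrow> (egen \<Rightarrow> 'a::complex_algebra_1) \<Rightarrow> ('a \<Rightarrow> 'a \<otimes>\<^sub>C 'a) \<Rightarrow> ('a \<Rightarrow> complex) \<Rightarrow> bool"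
  where "idempotent_coalgebra N \<gamma> \<Delta> \<epsilon> \<longleftrightarrow>
    (\<forall>i\<in>{0..<int N}. \<forall>j\<in>{0..<int N}.
      \<Delta> (\<gamma> (E i j)) = (\<Sum>p\<in>{0..<int N}. \<Sum>q\<in>{0..<int N}.
        \<gamma> (E ((i - p) mod int N) ((j - q) mod int N)) \<otimes>\<^sub>C \<gamma> (E p q)) \<and>
      \<epsilon> (\<gamma> (E i j)) = (if i = 0 \<and> j = 0 then 1 else 0))"

definition H2N2_relations :: "nat \<Rightarrow> complex \<Rightarrow> egen free_alg set"
  where "H2N2_relations N \<xi> =
      idempotent_relations N
    \<union> {fgen W ^ 2 - (\<Sum>i\<in>{0..<int N}. \<Sum>j\<in>{0..<int N}. (\<xi> powi (i * j)) *\<^sub>C fgen (E i j))}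
    \<union> {fgen W * fgen (E i j) - fgen (E j i) * fgen W | i j.
        i \<in> {0..<int N} \<and> j \<in> {0..<int N}}"

definition iso_H2N2 ::
    "nat \<Rightarrow> complex \<Rightarrow> ('a::complex_algebra_1 \<Rightarrow> 'a \<otimes>\<^sub>C 'a) \<Rightarrow> ('a \<Rightarrow> complex) \<Rightarrow> bool"
  where "iso_H2N2 N \<xi> \<Delta> \<epsilon> \<longleftrightarrow>
    (\<exists>\<gamma> :: egen \<Rightarrow> 'a.
      presented_by (egens N) (H2N2_relations N \<xi>) \<gamma> \<and>
      idempotent_coalgebra N \<gamma> \<Delta> \<epsilon> \<and>
      \<Delta> (\<gamma> W) = (\<Sum>i\<in>{0..<int N}. \<Sum>j\<in>{0..<int N}. \<Sum>k\<in>{0..<int N}. \<Sum>l\<in>{0..<int N}.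
        (\<xi> powi (j * k)) *\<^sub>C ((\<gamma> (E i j) * \<gamma> W) \<otimes>\<^sub>C (\<gamma> (E k l) * \<gamma> W))) \<and>
      \<epsilon> (\<gamma> W) = 1)"

definition HN3_relations :: "nat \<Rightarrow> complex \<Rightarrow> egen free_alg set"
  where "HN3_relations N \<xi> =
      idempotent_relations N
    \<union> {fgen W ^ N - (\<Sum>i\<in>{0..<int N}. \<Sum>j\<in>{0..<int N}. (\<xi> powi j) *\<^sub>C fgen (E i j))}
    \<union> {fgen W * fgen (E i j) - fgen (E ((i - j) mod int N) j) * fgen W | i j.
        i \<in> {0..<int N} \<and> j \<in> {0..<int N}}"

definition iso_HN3 ::
    "nat \<Rightarrow> complex \<Rightarrow> complex \<Rightarrow> ('a::complex_algebra_1 \<Rightarrow> 'a \<otimes>\<^sub>C 'a) \<Rightarrow> ('a \<Rightarrow> complex) \<Rightarrow> bool"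
  where "iso_HN3 N \<xi> \<zeta> \<Delta> \<epsilon> \<longleftrightarrow>
    (\<exists>\<gamma> :: egen \<Rightarrow> 'a.
      presented_by (egens N) (HN3_relations N \<xi>) \<gamma> \<and>
      idempotent_coalgebra N \<gamma> \<Delta> \<epsilon> \<and>
      \<Delta> (\<gamma> W) = (\<Sum>p\<in>{0..<int N}. \<Sum>q\<in>{0..<int N}. \<Sum>r\<in>{0..<int N}. \<Sum>s\<in>{0..<int N}.
        (\<zeta> powi (q * r)) *\<^sub>C ((\<gamma> (E p q) * \<gamma> W) \<otimes>\<^sub>C (\<gamma> (E r s) * \<gamma> W))) \<and>
      \<epsilon> (\<gamma> W) = 1)"

subsection \<open>Suzuki's Hopf algebras\<close>

text \<open>The alternating product \<open>a b a \<cdots>\<close> with \<open>n\<close> factors.\<close>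

primrec alt_prod :: "nat \<Rightarrow> 'a::monoid_mult \<Rightarrow> 'a \<Rightarrow> 'a"
  where
    "alt_prod 0 = (\<lambda>a b. 1)"
  | "alt_prod (Suc n) = (\<lambda>a b. a * alt_prod n b a)"

text \<open>The generator \<open>x\<^sub>i\<^sub>j\<close> is the pair \<open>(i, j)\<close>; the type \<^typ>\<open>bit\<close> is the field with two
  elements.\<close>

abbreviation xgen :: "bit \<Rightarrow> bit \<Rightarrow> (bit \<times> bit) free_alg"
  where "xgen i j \<equiv> fgen (i, j)"

definition Suzuki_relations :: "nat \<Rightarrow> nat \<Rightarrow> complex \<Rightarrow> complex \<Rightarrow> (bit \<times> bit) free_alg set"
  where "Suzuki_relations N L \<alpha> \<beta> =
      {xgen 0 0 ^ 2 - xgen 1 1 ^ 2, xgen 0 1 ^ 2 - xgen 1 0 ^ 2,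
       xgen 0 0 ^ (2 * N) + \<alpha> *\<^sub>C xgen 0 1 ^ (2 * N) - 1}
    \<union> {xgen i j * xgen k l | i j k l. i - j \<noteq> k - l}
    \<union> {alt_prod L (xgen 0 0) (xgen 1 1) - alt_prod L (xgen 1 1) (xgen 0 0),
       alt_prod L (xgen 0 1) (xgen 1 0) - \<beta> *\<^sub>C alt_prod L (xgen 1 0) (xgen 0 1)}"

definition iso_Suzuki ::
    "nat \<Rightarrow> nat \<Rightarrow> complex \<Rightarrow> complex
      \<Rightarrow> ('a::complex_algebra_1 \<Rightarrow> 'a \<otimes>\<^sub>C 'a) \<Rightarrow> ('a \<Rightarrow> complex) \<Rightarrow> ('a \<Rightarrow> 'a) \<Rightarrow> bool"
  where "iso_Suzuki N L \<alpha> \<beta> \<Delta> \<epsilon> S \<longleftrightarrow>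
    (\<exists>x :: bit \<Rightarrow> bit \<Rightarrow> 'a.
      presented_by UNIV (Suzuki_relations N L \<alpha> \<beta>) (\<lambda>(i, j). x i j) \<and>
      (\<forall>i j. \<Delta> (x i j) = x i 0 \<otimes>\<^sub>C x 0 j + x i 1 \<otimes>\<^sub>C x 1 j \<and>
        \<epsilon> (x i j) = (if i = j then 1 else 0) \<and>
        S (x i j) = x j i ^ (4 * N - 1)))"

end

theory Submission
  imports
    Defs
    "Jordan_Normal_Form.Char_Poly"
    "HOL-Algebra.Sylow"
    "HOL-Algebra.Group_Action"
    "HOL-Algebra.Multiplicative_Group"
    "HOL-Number_Theory.Totient"
    "HOL-Number_Theory.Cong"
begin

text \<open>In each family the Sweedler powers of the basis elements are computed explicitly. The integral is an
  average of basis elements and the regular character vanishes on most words, so the indicator becomes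
  a count or a small exponential sum.

  For a bismash product, \<open>\<nu>\<^sub>n\<close> is the number of solutions of \<open>a\<^sup>n = 1\<close> in the bicrossed product group
  of \<open>F\<close> and \<open>G\<close>, so the claim is Frobenius' classical theorem on groups. For the algebras of dimension
  \<open>2N\<^sup>2\<close>, it is \<open>gcd(n, N)\<^sup>2\<close>, plus \<open>N\<close> times a sum of signs if \<open>n\<close> is even. For those of dimension
  \<open>N\<^sup>3\<close>, it is \<open>gcd(n, N)\<close> times a sum over \<open>j, k < d = gcd(n, N)\<close> of \<open>d\<close>-th roots of unity whose exponents
  are \<open>j k\<close> and, with a cube root of unity, \<open>(j k)\<^sup>2\<close>; translations by subgroups of \<open>\<int>\<^sub>d \<times> \<int>\<^sub>d\<close> yield the
  remaining factor. For Suzuki's algebras, it is a combination of signed counts of multiples modulo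
  \<open>N\<close> and modulo \<open>L\<close>.

  That the spanning words of a presented algebra form a basis is seen from an explicit action on a
  free vector space.\<close>

section \<open>Sums of roots of unity\<close>

text \<open>The relations only yield a spanning set of words, that is, an upper bound for the
  dimension; the lower bound, and with it the trace, needs a concrete module. The module has to
  realise the multiplication only, because the comultiplication lives on the abstract algebra.
  Single summands of an indicator need not be divisible by \<open>n\<close>, and each family has its
  own obstacle. Twists leave triangular numbers and sums of squares in the exponents. The
  denominator 2 causes the sign in dimension \<open>2 * N^2\<close>; odd \<open>N\<close> removes it
  in dimension \<open>N^3\<close>, but the denominator 3 of \<open>0^2 + ... + (n-1)^2\<close>
  survives and produces the cube root of unity. There the sum is multiplied by a square prime to the
  missing factor, split by translations, and recovered through a Bezout identity; the quotient is an
  algebraic integer because it is an explicit integral combination of roots of unity. In Suzuki's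
  algebras the signs decide whether terms double or cancel, and this has to match the factor 2 of an
  even \<open>n\<close>.\<close>

lemma algebraic_int_eigenvalue:
  fixes A :: "int mat" and z :: complex
  assumes A: "A \<in> carrier_mat n n" and z: "eigenvalue (map_mat of_int A) z"
  shows "algebraic_int z"
proof -
  have A': "(map_mat of_int A :: complex mat) \<in> carrier_mat n n"
    using A by simp
  have hom: "char_poly (map_mat of_int A :: complex mat) = map_poly of_int (char_poly A)"
    using of_int_hom.char_poly_hom[OF A] .
  have "poly (map_poly of_int (char_poly A)) z = 0"
    using eigenvalue_root_char_poly[OF A'] z by (simp add: hom)
  moreover have "lead_coeff (char_poly A) = 1"
    using degree_monic_char_poly[OF A] by simp
  ultimately show ?thesis
    unfolding algebraic_int_altdef_ipoly by blast
qed

text \<open>Multiplication by the sum sends each power of \<omega> to an integral combination of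
  powers of \<omega>. The sum is therefore an eigenvalue of an integer matrix, with eigenvector
  \<open>(1, \<omega>, ..., \<omega>^(M-1))\<close>.\<close>

lemma algebraic_int_sum_roots_of_unity:
  fixes f :: "'a \<Rightarrow> complex"
  assumes M: "M > 0" and "finite X" and f: "\<And>x. x \<in> X \<Longrightarrow> f x ^ M = 1"
  shows "algebraic_int (\<Sum>x\<in>X. of_int (c x) * f x)"
proof -
  define \<omega> where "\<omega> = cis (2 * pi / real M)"
  have \<omega>M: "\<omega> ^ M = 1"
    using M by (simp add: \<omega>_def DeMoivre)
  have \<omega>: "\<omega> ^ a = \<omega> ^ (a mod M)" for a
    by (subst mult_div_mod_eq[of M a, symmetric], subst power_add) (simp add: power_mult \<omega>M)
  have "\<exists>k. f x = \<omega> ^ k" if x: "x \<in> X" for x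
  proof -
    have "f x \<in> (\<lambda>k. cis (2 * pi * real k / real M)) ` {..<M}"
      using bij_betw_roots_unity[OF M] f[OF x] by (auto simp: bij_betw_def)
    then obtain k where "f x = cis (2 * pi * real k / real M)"
      by auto
    then have "f x = \<omega> ^ k"
      by (simp add: \<omega>_def DeMoivre mult_ac)
    then show ?thesis ..
  qed
  then obtain k where k: "\<And>x. x \<in> X \<Longrightarrow> f x = \<omega> ^ k x"
    by metis
  let ?z = "\<Sum>x\<in>X. of_int (c x) * f x"
  define A :: "int mat" where
    "A = mat M M (\<lambda>(i, j). \<Sum>x\<in>X. if (i + k x) mod M = j then c x else 0)"
  define v where "v = vec M (\<lambda>i. \<omega> ^ i)"
  have "eigenvector (map_mat of_int A) v ?z"
    unfolding eigenvector_def
  proof (intro conjI)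
    show "v \<in> carrier_vec (dim_row (map_mat of_int A))"
      by (simp add: v_def A_def)
    show "v \<noteq> 0\<^sub>v (dim_row (map_mat of_int A))"
    proof
      assume "v = 0\<^sub>v (dim_row (map_mat of_int A))"
      then have "v $ 0 = 0"
        using M by (simp add: A_def)
      then show False
        using M by (simp add: v_def)
    qed
    show "map_mat of_int A *\<^sub>v v = ?z \<cdot>\<^sub>v v"
    proof (rule eq_vecI)
      fix i assume "i < dim_vec (?z \<cdot>\<^sub>v v)"
      then have i: "i < M" by (simp add: v_def)
      have "(map_mat of_int A *\<^sub>v v) $ i
          = (\<Sum>j<M. (\<Sum>x\<in>X. if (i + k x) mod M = j then of_int (c x) else 0) * \<omega> ^ j)"
        using i by (simp add: A_def v_def scalar_prod_def lessThan_atLeast0 if_distrib cong: if_cong)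
      also have "\<dots> = (\<Sum>j<M. \<Sum>x\<in>X. if j = (i + k x) mod M then of_int (c x) * \<omega> ^ j else 0)"
        by (auto simp: sum_distrib_right intro!: sum.cong)
      also have "\<dots> = (\<Sum>x\<in>X. of_int (c x) * \<omega> ^ ((i + k x) mod M))"
        using M by (subst sum.swap) (simp cong: if_cong)
      also have "\<dots> = (\<Sum>x\<in>X. of_int (c x) * f x) * \<omega> ^ i"
        by (simp add: k sum_distrib_right sum_distrib_left power_add mult_ac flip: \<omega>)
      finally show "(map_mat of_int A *\<^sub>v v) $ i = (?z \<cdot>\<^sub>v v) $ i"
        using i by (simp add: v_def)
    qed (simp add: A_def v_def)
  qed
  then show ?thesis
    by (intro algebraic_int_eigenvalue[of A M]) (auto simp: A_def eigenvalue_def)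
qed

section \<open>Frobenius' theorem for finite groups\<close>

lemma dvd_sum_fibres:
  fixes w :: "'a \<Rightarrow> nat"
  assumes "finite A" and "\<And>x. x \<in> A \<Longrightarrow> d dvd (\<Sum>y | y \<in> A \<and> f y = f x. w y)"
  shows "d dvd (\<Sum>x\<in>A. w x)"
proof -
  have "(\<Sum>x\<in>A. w x) = (\<Sum>b\<in>f ` A. \<Sum>y | y \<in> A \<and> f y = b. w y)"
    by (rule sum.image_gen[OF assms(1)])
  also have "d dvd \<dots>"
    by (rule dvd_sum) (use assms(2) in auto)
  finally show ?thesis .
qed

definition torsion :: "('a, 'b) monoid_scheme \<Rightarrow> nat \<Rightarrow> 'a set"
  where "torsion G n = {x \<in> carrier G. x [^]\<^bsub>G\<^esub> n = \<one>\<^bsub>G\<^esub>}"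

definition centralizer_of :: "('a, 'b) monoid_scheme \<Rightarrow> 'a \<Rightarrow> 'a set"
  where "centralizer_of G y = {z \<in> carrier G. z \<otimes>\<^bsub>G\<^esub> y = y \<otimes>\<^bsub>G\<^esub> z}"

text \<open>Meant for orders of elements of \<open>torsion G (n * p)\<close> outside
  \<open>torsion G n\<close>: such an order must contain the full power of \<open>p\<close>.\<close>

lemma prime_power_dvd_of_not_dvd:
  fixes p r d :: nat
  assumes p: "prime p" and "d dvd p ^ Suc k * r" "\<not> d dvd p ^ k * r"
  shows "p ^ Suc k dvd d"
proof -
  obtain a b where ab: "d = a * b" "a dvd p ^ Suc k" "b dvd r"
    using division_decomp[OF assms(2)] by blast
  then obtain i where i: "i \<le> Suc k" "a = p ^ i"
    using divides_primepow_nat[OF p] by blast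
  have "\<not> i \<le> k"
  proof
    assume "i \<le> k"
    then have "a * b dvd p ^ k * r"
      unfolding i(2) using ab(3) by (intro mult_dvd_mono le_imp_power_dvd)
    then show False
      using assms(3) ab(1) by simp
  qed
  then have "i = Suc k" using i by simp
  then show ?thesis using ab(1) i(2) by simp
qed

section \<open>Torsion counts: coprime splitting, conjugacy classes and cyclic subgroups\<close>

context group
begin

lemma pow_cong:
  assumes "x \<in> carrier G" "x [^] (q::nat) = \<one>" "[a = b] (mod q)"
  shows "x [^] a = x [^] b"
proof -
  have *: "x [^] c = x [^] (c mod q)" for c :: nat
  proof -
    have "x [^] c = x [^] (q * (c div q) + c mod q)"
      by simp
    also have "\<dots> = (x [^] q) [^] (c div q) \<otimes> x [^] (c mod q)"
      using assms(1) by (simp only: nat_pow_mult[symmetric] nat_pow_pow)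
    finally show ?thesis
      using assms by simp
  qed
  show ?thesis
    using *[of a] *[of b] assms(3) by (simp add: cong_def)
qed

lemma centralizer_of_subgroup:
  assumes "y \<in> carrier G"
  shows "subgroup (centralizer_of G y) G"
proof
  show "centralizer_of G y \<subseteq> carrier G"
    by (auto simp: centralizer_of_def)
  show "\<one> \<in> centralizer_of G y"
    using assms by (auto simp: centralizer_of_def)
  show "a \<otimes> b \<in> centralizer_of G y" if "a \<in> centralizer_of G y" "b \<in> centralizer_of G y" for a b
    using that assms by (auto simp: centralizer_of_def) (metis m_assoc)
  show "inv a \<in> centralizer_of G y" if "a \<in> centralizer_of G y" for a
    using that assms unfolding centralizer_of_def
    by (smt (verit) inv_closed inv_solve_left inv_solve_right m_assoc m_closed mem_Collect_eq)
qed

lemma torsion_subgroup_carrier: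
  assumes "subgroup H G"
  shows "torsion (G\<lparr>carrier := H\<rparr>) n = {z \<in> H. z [^] n = \<one>}"
  by (auto simp: torsion_def simp flip: nat_pow_consistent)

text \<open>By the Chinese remainder theorem there are exponents \<open>a\<close>, \<open>b\<close>
  with \<open>a + b = 1\<close> modulo \<open>q * r\<close> that split \<open>x\<close> as
  \<open>x^a x^b\<close>, a \<open>q\<close>-torsion element times a commuting
  \<open>r\<close>-torsion element. For a fixed first factor the second one runs through the
  \<open>r\<close>-torsion of its centralizer.\<close>

lemma card_torsion_coprime_mult:
  assumes fin: "finite (carrier G)" and qr: "coprime q r"
  shows "card (torsion G (q * r)) = (\<Sum>y\<in>torsion G q. card {z \<in> centralizer_of G y. z [^] r = \<one>})"
proof -
  obtain a where a: "[a = 1] (mod q)" "[a = 0] (mod r)"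
    using binary_chinese_remainder_nat[OF qr] by blast
  obtain b where b: "[b = 0] (mod q)" "[b = 1] (mod r)"
    using binary_chinese_remainder_nat[OF qr] by blast
  have "[a + b = 1 + 0] (mod q)" "[a + b = 0 + 1] (mod r)"
    using a b by (intro cong_add; simp)+
  then have ab: "[a + b = 1] (mod q * r)"
    using qr by (simp add: coprime_cong_mult_nat)
  let ?P = "SIGMA y:torsion G q. {z \<in> centralizer_of G y. z [^] r = \<one>}"
  have "bij_betw (\<lambda>(y, z). y \<otimes> z) ?P (torsion G (q * r))"
  proof (rule bij_betw_byWitness[where f' = "\<lambda>x. (x [^] a, x [^] b)"])
    show "\<forall>p\<in>?P. (\<lambda>x. (x [^] a, x [^] b)) ((\<lambda>(y, z). y \<otimes> z) p) = p"
    proof (clarsimp simp: torsion_def centralizer_of_def)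
      fix y z assume yz: "y \<in> carrier G" "y [^] q = \<one>" "z \<in> carrier G" "z \<otimes> y = y \<otimes> z" "z [^] r = \<one>"
      have *: "(y \<otimes> z) [^] c = y [^] c \<otimes> z [^] c" for c :: nat
        using yz by (simp add: pow_mult_distrib)
      have "y [^] a = y" "z [^] a = \<one>" "y [^] b = \<one>" "z [^] b = z"
        using pow_cong[OF _ yz(2) a(1)] pow_cong[OF _ yz(5) a(2)]
          pow_cong[OF _ yz(2) b(1)] pow_cong[OF _ yz(5) b(2)] yz by simp_all
      with * show "(y \<otimes> z) [^] a = y \<and> (y \<otimes> z) [^] b = z"
        using yz by simp
    qed
    show "\<forall>x\<in>torsion G (q * r). (\<lambda>(y, z). y \<otimes> z) (x [^] a, x [^] b) = x"
    proof (clarsimp simp: torsion_def)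
      fix x assume x: "x \<in> carrier G" "x [^] (q * r) = \<one>"
      show "x [^] a \<otimes> x [^] b = x"
        using pow_cong[OF x ab] x by (simp add: nat_pow_mult)
    qed
    show "(\<lambda>(y, z). y \<otimes> z) ` ?P \<subseteq> torsion G (q * r)"
    proof (clarsimp simp: torsion_def centralizer_of_def)
      fix y z assume yz: "y \<in> carrier G" "y [^] q = \<one>" "z \<in> carrier G" "z \<otimes> y = y \<otimes> z" "z [^] r = \<one>"
      have "y [^] (q * r) = \<one>" "z [^] (q * r) = \<one>"
        using yz by (metis nat_pow_pow nat_pow_one mult.commute)+
      then show "(y \<otimes> z) [^] (q * r) = \<one>"
        using yz by (simp add: pow_mult_distrib)
    qed
    show "(\<lambda>x. (x [^] a, x [^] b)) ` torsion G (q * r) \<subseteq> ?P"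
    proof (clarsimp simp: torsion_def centralizer_of_def)
      fix x assume x: "x \<in> carrier G" "x [^] (q * r) = \<one>"
      obtain a' b' where ab': "a = r * a'" "b = q * b'"
        using a b by (auto simp: cong_0_iff dvd_def)
      have "x [^] (a * q) = (x [^] (q * r)) [^] a'" "x [^] (b * r) = (x [^] (q * r)) [^] b'"
        using x(1) by (simp_all add: nat_pow_pow ab' mult_ac)
      then show "(x [^] a) [^] q = \<one> \<and> x [^] b \<otimes> x [^] a = x [^] a \<otimes> x [^] b \<and> (x [^] b) [^] r = \<one>"
        using x by (simp add: nat_pow_pow nat_pow_mult add.commute)
    qed
  qed
  then have "card ?P = card (torsion G (q * r))"
    by (rule bij_betw_same_card)
  moreover have "finite (torsion G q)"
    using fin by (simp add: torsion_def)
  moreover have "\<forall>y\<in>torsion G q. finite {z \<in> centralizer_of G y. z [^] r = \<one>}"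
    using fin by (simp add: centralizer_of_def)
  ultimately show ?thesis
    by (simp add: card_SigmaI)
qed

text \<open>Cauchy's theorem, here Sylow with exponent 1: a common prime of the order and
  \<open>r\<close> would give a nontrivial element whose order divides both this prime and
  \<open>q\<close>.\<close>

lemma coprime_order_of_exponent:
  assumes fin: "finite (carrier G)" and q: "\<And>x. x \<in> carrier G \<Longrightarrow> x [^] (q::nat) = \<one>"
    and qr: "coprime q r"
  shows "coprime (order G) r"
proof (rule ccontr)
  assume "\<not> coprime (order G) r"
  then have "gcd (order G) r \<noteq> 1"
    by (simp add: coprime_iff_gcd_eq_1)
  then obtain l where "prime l" "l dvd gcd (order G) r"
    using prime_factor_nat by blast
  then have l: "prime l" "l dvd order G" "l dvd r"
    by simp_all
  obtain m where "order G = l ^ 1 * m"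
    using l(2) by auto
  then obtain H where H: "subgroup H G" "card H = l ^ 1"
    using sylow_thm[OF l(1) is_group _ fin] by blast
  have "card H > 1"
    using H(2) prime_gt_1_nat[OF l(1)] by simp
  then have "\<not> H \<subseteq> {\<one>}"
    using card_mono[of "{\<one>}" H] by auto
  then obtain h where h: "h \<in> H" "h \<noteq> \<one>"
    by blast
  have hG: "h \<in> carrier G"
    using subgroup.mem_carrier[OF H(1) h(1)] .
  have "group (G\<lparr>carrier := H\<rparr>)"
    using H(1) by (rule subgroup_imp_group)
  from group.pow_order_eq_1[OF this, of h] have "h [^] l = \<one>"
    using H h(1) by (simp add: order_def flip: nat_pow_consistent)
  then have "ord h dvd l" "ord h dvd q"
    using q[OF hG] hG by (simp_all add: pow_eq_id)
  moreover have "coprime l q"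
    using l(3) qr by (meson coprime_commute coprime_divisors dvd_refl)
  ultimately have "ord h = 1"
    by (metis coprime_common_divisor nat_dvd_1_iff_1)
  then show False
    using h(2) ord_eq_1[OF hG] by simp
qed

lemma conjugate_class:
  assumes fin: "finite (carrier G)" and y: "y \<in> carrier G"
  shows "card {g \<otimes> y \<otimes> inv g | g. g \<in> carrier G} * card (centralizer_of G y) = order G"
proof -
  let ?\<phi> = "\<lambda>g. \<lambda>h \<in> carrier G. g \<otimes> h \<otimes> inv g"
  have "orbit G ?\<phi> y = {g \<otimes> y \<otimes> inv g | g. g \<in> carrier G}"
    using y by (auto simp: orbit_def)
  moreover have "stabilizer G ?\<phi> y = centralizer_of G y"
    using y by (auto simp: stabilizer_def centralizer_of_def inv_solve_right' inv_solve_right)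
  ultimately show ?thesis
    using group_action.orbit_stabilizer_theorem[OF action_by_conjugation y] by simp
qed

lemma pow_conjugate:
  assumes "g \<in> carrier G" "y \<in> carrier G"
  shows "(g \<otimes> y \<otimes> inv g) [^] (n::nat) = g \<otimes> y [^] n \<otimes> inv g"
proof (induction n)
  case (Suc n)
  then show ?case
    using assms by (simp add: m_assoc inv_solve_left)  (simp flip: m_assoc)
qed (use assms in simp)

lemma card_centralizer_torsion_conjugate:
  assumes g: "g \<in> carrier G" and y: "y \<in> carrier G"
  shows "card {z \<in> centralizer_of G (g \<otimes> y \<otimes> inv g). z [^] (r::nat) = \<one>}
    = card {z \<in> centralizer_of G y. z [^] r = \<one>}"
proof (rule bij_betw_same_card[symmetric], rule bij_betw_byWitness[where f' = "\<lambda>z. inv g \<otimes> z \<otimes> g"])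
  let ?A = "\<lambda>y. {z \<in> centralizer_of G y. z [^] r = \<one>}"
  have *: "(\<lambda>z. h \<otimes> z \<otimes> inv h) ` ?A x \<subseteq> ?A (h \<otimes> x \<otimes> inv h)"
    if h: "h \<in> carrier G" and x: "x \<in> carrier G" for h x
  proof clarsimp
    fix z assume z: "z \<in> centralizer_of G x" "z [^] r = \<one>"
    then have zG: "z \<in> carrier G" and zx: "z \<otimes> x = x \<otimes> z" by (auto simp: centralizer_of_def)
    have m: "(h \<otimes> a \<otimes> inv h) \<otimes> (h \<otimes> b \<otimes> inv h) = h \<otimes> (a \<otimes> b) \<otimes> inv h"
      if "a \<in> carrier G" "b \<in> carrier G" for a b
      using that h by (simp add: m_assoc) (simp flip: m_assoc)
    show "h \<otimes> z \<otimes> inv h \<in> centralizer_of G (h \<otimes> x \<otimes> inv h) \<and> (h \<otimes> z \<otimes> inv h) [^] r = \<one>"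
      using h x z zG zx by (simp add: centralizer_of_def m pow_conjugate)
  qed
  show "(\<lambda>z. g \<otimes> z \<otimes> inv g) ` ?A y \<subseteq> ?A (g \<otimes> y \<otimes> inv g)"
    using *[OF g y] .
  have "inv g \<otimes> (g \<otimes> y \<otimes> inv g) \<otimes> g = y"
    using g y by (simp add: m_assoc inv_solve_left') 
  then show "(\<lambda>z. inv g \<otimes> z \<otimes> g) ` ?A (g \<otimes> y \<otimes> inv g) \<subseteq> ?A y"
    using *[of "inv g" "g \<otimes> y \<otimes> inv g"] g y by simp
  show "\<forall>z\<in>?A y. inv g \<otimes> (g \<otimes> z \<otimes> inv g) \<otimes> g = z"
    using g by (auto simp: centralizer_of_def m_assoc inv_solve_left')
  show "\<forall>z\<in>?A (g \<otimes> y \<otimes> inv g). g \<otimes> (inv g \<otimes> z \<otimes> g) \<otimes> inv g = z"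
    using g by (auto simp: centralizer_of_def m_assoc) (simp flip: m_assoc)
qed

text \<open>The generators of a cyclic group are the powers with exponent prime to its order. The
  totient is what produces a \<open>p\<close>-power: \<open>p ^ k\<close> divides the totient of any
  multiple of \<open>p ^ Suc k\<close>.\<close>

lemma card_same_generate:
  assumes fin: "finite (carrier G)" and x: "x \<in> carrier G"
  shows "card {y \<in> carrier G. generate G {y} = generate G {x}} = totient (ord x)"
proof -
  have o: "ord x \<ge> 1"
    by (rule ord_ge_1[OF fin x])
  have gen: "generate G {y} = {y [^] k | k. k \<in> (UNIV::nat set)}" if "y \<in> carrier G" for y
    using generate_pow_on_finite_carrier[OF fin that] .
  have fing: "finite (generate G {y})" if "y \<in> carrier G" for y
    using generate_incl[of "{y}"] fin that by (meson empty_subsetI finite_subset insert_subset)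
  have "bij_betw (\<lambda>k. x [^] k) (totatives (ord x)) {y \<in> carrier G. generate G {y} = generate G {x}}"
    unfolding bij_betw_def
  proof
    show "inj_on (\<lambda>k. x [^] k) (totatives (ord x))"
      by (rule inj_on_subset[OF ord_inj'[OF x]]) (auto simp: totatives_def)
    show "(\<lambda>k. x [^] k) ` totatives (ord x) = {y \<in> carrier G. generate G {y} = generate G {x}}"
    proof (intro equalityI subsetI)
      fix y assume "y \<in> (\<lambda>k. x [^] k) ` totatives (ord x)"
      then obtain k where k: "y = x [^] k" "coprime k (ord x)"
        by (auto simp: totatives_def)
      have yG: "y \<in> carrier G" using k x by simp
      have "ord y = ord x"
        using pow_ord_eq_ord_iff[OF fin x] k by simp
      then have "card (generate G {y}) = card (generate G {x})"
        by (simp add: generate_pow_card[symmetric] x yG)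
      moreover have "generate G {y} \<subseteq> generate G {x}"
        unfolding gen[OF yG] gen[OF x] using k x by (auto simp: nat_pow_pow)
      ultimately show "y \<in> {y \<in> carrier G. generate G {y} = generate G {x}}"
        using card_subset_eq[OF fing[OF x]] yG by simp
    next
      fix y assume "y \<in> {y \<in> carrier G. generate G {y} = generate G {x}}"
      then have yG: "y \<in> carrier G" and yx: "generate G {y} = generate G {x}" by auto
      have "y \<in> generate G {x}"
        using generate.incl[of y "{y}" G] yx by simp
      then obtain k :: nat where "y = x [^] k"
        unfolding gen[OF x] by blast
      \<comment> \<open>\<open>totatives\<close> lie between 1 and \<open>ord x\<close>, so the
        residue 0 is represented by \<open>ord x\<close>; it occurs for trivial
        \<open>x\<close>.\<close>
      define j where "j = (if k mod ord x = 0 then ord x else k mod ord x)"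
      have "[k = j] (mod ord x)"
        by (simp add: j_def cong_def)
      then have j: "y = x [^] j"
        using pow_cong[OF x pow_ord_eq_1[OF x]] \<open>y = x [^] k\<close> by simp
      have "ord y = ord x"
        using generate_pow_card[OF x] generate_pow_card[OF yG] yx by simp
      then have "coprime j (ord x)"
        using pow_ord_eq_ord_iff[OF fin x] j by simp
      moreover have "0 < j" "j \<le> ord x"
        using o by (auto simp: j_def intro!: less_imp_le)
      ultimately show "y \<in> (\<lambda>k. x [^] k) ` totatives (ord x)"
        using j by (auto simp: totatives_def)
    qed
  qed
  then show ?thesis
    by (simp add: totient_def bij_betw_same_card)
qed

text \<open>The summand is constant on a conjugacy class \<open>K\<close>, and \<open>card K\<close>
  is the index of the centralizer \<open>C\<close>. As \<open>C\<close> is proper, the hypothesis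
  gives the factor \<open>e = gcd r (card C)\<close>, and
  \<open>card K * e = gcd (card K * r) (order G)\<close> is a multiple of \<open>r\<close>.\<close>

lemma dvd_sum_noncentral:
  assumes fin: "finite (carrier G)" and rG: "r dvd order G"
    and IH: "\<And>C e. subgroup C G \<Longrightarrow> C \<noteq> carrier G \<Longrightarrow> e dvd card C \<Longrightarrow> e dvd card {z \<in> C. z [^] e = \<one>}"
  shows "r dvd (\<Sum>y | y \<in> torsion G q \<and> centralizer_of G y \<noteq> carrier G.
    card {z \<in> centralizer_of G y. z [^] r = \<one>})"
proof (rule dvd_sum_fibres[where f = "\<lambda>y. {g \<otimes> y \<otimes> inv g | g. g \<in> carrier G}"])
  let ?Y = "{y. y \<in> torsion G q \<and> centralizer_of G y \<noteq> carrier G}"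
  show "finite ?Y" using fin by (simp add: torsion_def)
  fix y assume y: "y \<in> ?Y"
  let ?K = "\<lambda>y. {g \<otimes> y \<otimes> inv g | g. g \<in> carrier G}"
  let ?C = "centralizer_of G y"
  let ?w = "\<lambda>y. card {z \<in> centralizer_of G y. z [^] r = \<one>}"
  have yG: "y \<in> carrier G" and yp: "y [^] q = \<one>" and yC: "?C \<noteq> carrier G"
    using y by (auto simp: torsion_def)
  have C: "subgroup ?C G" by (rule centralizer_of_subgroup[OF yG])
  have cls: "card (?K y) * card ?C = order G"
    by (rule conjugate_class[OF fin yG])
  have refl: "x \<in> ?K x" if "x \<in> carrier G" for x
    using that by (auto intro!: exI[of _ "\<one>"])
  have Kcong: "?K (g \<otimes> y \<otimes> inv g) = ?K y" if g: "g \<in> carrier G" for g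
  proof (intro equalityI subsetI)
    fix x assume "x \<in> ?K (g \<otimes> y \<otimes> inv g)"
    then obtain h where h: "h \<in> carrier G" "x = h \<otimes> (g \<otimes> y \<otimes> inv g) \<otimes> inv h" by blast
    then have "x = (h \<otimes> g) \<otimes> y \<otimes> inv (h \<otimes> g)"
      using g yG by (simp add: inv_mult_group m_assoc)
    then show "x \<in> ?K y" using h g by blast
  next
    fix x assume "x \<in> ?K y"
    then obtain h where h: "h \<in> carrier G" "x = h \<otimes> y \<otimes> inv h" by blast
    have l: "inv g \<otimes> (g \<otimes> a) = a" if "a \<in> carrier G" for a
      using that g by (simp flip: m_assoc)
    have "x = (h \<otimes> inv g) \<otimes> (g \<otimes> y \<otimes> inv g) \<otimes> inv (h \<otimes> inv g)"
      using g yG h by (simp add: inv_mult_group m_assoc l)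
    then show "x \<in> ?K (g \<otimes> y \<otimes> inv g)" using h g by blast
  qed
  \<comment> \<open>The classes of \<open>y\<close> and of its conjugate coincide, so by the orbit
    formula both centralizers have the same size.\<close>
  have Cconj: "centralizer_of G (g \<otimes> y \<otimes> inv g) \<noteq> carrier G" if g: "g \<in> carrier G" for g
  proof
    assume "centralizer_of G (g \<otimes> y \<otimes> inv g) = carrier G"
    then have "card (?K (g \<otimes> y \<otimes> inv g)) * card (carrier G) = order G"
      using conjugate_class[OF fin, of "g \<otimes> y \<otimes> inv g"] g yG by simp
    then have "card (?K y) * card (carrier G) = card (?K y) * card ?C"
      using cls unfolding Kcong[OF g] by simp
    moreover have "order G > 0" using fin by (simp add: order_gt_0_iff_finite)
    then have "card (?K y) > 0" using cls by (cases "card (?K y)") auto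
    moreover have "card ?C < card (carrier G)"
      using yC fin subgroup.subset[OF C] by (intro psubset_card_mono) auto
    ultimately show False by simp
  qed
  have fib: "{x. x \<in> ?Y \<and> ?K x = ?K y} = ?K y"
  proof (intro equalityI subsetI)
    fix x assume x: "x \<in> {x. x \<in> ?Y \<and> ?K x = ?K y}"
    then have "x \<in> carrier G" by (auto simp: torsion_def)
    from refl[OF this] x show "x \<in> ?K y" by blast
  next
    fix x assume "x \<in> ?K y"
    then obtain g where g: "g \<in> carrier G" "x = g \<otimes> y \<otimes> inv g" by blast
    then have "x \<in> ?Y"
      using Cconj yG yp by (simp add: torsion_def pow_conjugate)
    then show "x \<in> {x. x \<in> ?Y \<and> ?K x = ?K y}" using g Kcong by blast
  qed
  have "(\<Sum>x | x \<in> ?Y \<and> ?K x = ?K y. ?w x) = (\<Sum>x\<in>?K y. ?w y)"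
    unfolding fib by (rule sum.cong) (auto simp: card_centralizer_torsion_conjugate[OF _ yG])
  also have "\<dots> = card (?K y) * ?w y" by simp
  finally have sum_eq: "(\<Sum>x | x \<in> ?Y \<and> ?K x = ?K y. ?w x) = card (?K y) * ?w y" .
  have grpC: "group (G\<lparr>carrier := ?C\<rparr>)" using C by (rule subgroup_imp_group)
  \<comment> \<open>Orders of elements of the centralizer divide its cardinality, so
    \<open>r\<close>-torsion in it is the same as \<open>e\<close>-torsion; unlike \<open>r\<close>,
    the number \<open>e\<close> divides that cardinality.\<close>
  define e where "e = gcd r (card ?C)"
  have "e dvd card {z \<in> ?C. z [^] e = \<one>}"
    using C yC by (rule IH) (simp add: e_def)
  also have "{z \<in> ?C. z [^] e = \<one>} = {z \<in> ?C. z [^] r = \<one>}"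
  proof -
    have "z [^] e = \<one> \<longleftrightarrow> z [^] r = \<one>" if z: "z \<in> ?C" for z
    proof -
      have zG: "z \<in> carrier G" using z by (simp add: centralizer_of_def)
      have "z [^] card ?C = \<one>"
        using group.pow_order_eq_1[OF grpC, of z] z by (simp add: order_def flip: nat_pow_consistent)
      then show ?thesis
        using zG by (simp add: pow_eq_id e_def)
    qed
    then show ?thesis by auto
  qed
  finally have "card (?K y) * e dvd card (?K y) * ?w y"
    by (rule mult_dvd_mono[OF dvd_refl])
  moreover have "card (?K y) * e = gcd (card (?K y) * r) (order G)"
    unfolding e_def cls[symmetric] by (simp add: gcd_mult_distrib_nat)
  then have "r dvd card (?K y) * e" using rG by simp
  ultimately show "r dvd (\<Sum>x | x \<in> ?Y \<and> ?K x = ?K y. ?w x)"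
    unfolding sum_eq by (rule dvd_trans[rotated])
qed

text \<open>The central \<open>q\<close>-torsion elements form a subgroup of exponent dividing
  \<open>q\<close>, whose order involves only primes of \<open>q\<close>.\<close>

lemma coprime_card_central_torsion:
  assumes fin: "finite (carrier G)" and qr: "coprime q r"
  shows "coprime (card {y \<in> torsion G q. centralizer_of G y = carrier G}) r"
proof -
  let ?Z = "{y \<in> torsion G q. centralizer_of G y = carrier G}"
  have cen: "y \<otimes> z = z \<otimes> y" if "y \<in> ?Z" "z \<in> carrier G" for y z
  proof -
    have "z \<in> centralizer_of G y" using that by simp
    then show ?thesis by (simp add: centralizer_of_def)
  qed
  have memZ: "y \<in> ?Z" if "y \<in> carrier G" "y [^] q = \<one>" "\<And>z. z \<in> carrier G \<Longrightarrow> z \<otimes> y = y \<otimes> z" for y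
    using that by (auto simp: torsion_def centralizer_of_def)
  have ZG: "y \<in> carrier G" "y [^] q = \<one>" if "y \<in> ?Z" for y
    using that by (auto simp: torsion_def)
  have Z: "subgroup ?Z G"
  proof
    show "?Z \<subseteq> carrier G" using ZG by blast
    show "\<one> \<in> ?Z" by (rule memZ) auto
    show "x \<otimes> y \<in> ?Z" if x: "x \<in> ?Z" and y: "y \<in> ?Z" for x y
    proof (rule memZ)
      show "x \<otimes> y \<in> carrier G" using x y ZG by simp
      show "(x \<otimes> y) [^] q = \<one>"
        using ZG[OF x] ZG[OF y] cen[OF x ZG(1)[OF y]] by (simp add: pow_mult_distrib)
      show "z \<otimes> (x \<otimes> y) = x \<otimes> y \<otimes> z" if z: "z \<in> carrier G" for z
        using z ZG(1)[OF x] ZG(1)[OF y] cen[OF x z] cen[OF y z] by (metis m_assoc)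
    qed
    show "inv x \<in> ?Z" if x: "x \<in> ?Z" for x
    proof (rule memZ)
      show "inv x \<in> carrier G" using ZG[OF x] by simp
      show "inv x [^] q = \<one>" using ZG[OF x] by (simp add: nat_pow_inv)
      show "z \<otimes> inv x = inv x \<otimes> z" if z: "z \<in> carrier G" for z
        using z ZG(1)[OF x] cen[OF x z]
        by (metis inv_closed inv_solve_left inv_solve_right m_assoc m_closed)
    qed
  qed
  have "coprime (order (G\<lparr>carrier := ?Z\<rparr>)) r"
  proof (rule group.coprime_order_of_exponent[OF subgroup_imp_group[OF Z] _ _ qr])
    show "finite (carrier (G\<lparr>carrier := ?Z\<rparr>))" using fin by (simp add: torsion_def)
    show "x [^]\<^bsub>G\<lparr>carrier := ?Z\<rparr>\<^esub> q = \<one>\<^bsub>G\<lparr>carrier := ?Z\<rparr>\<^esub>" if "x \<in> carrier (G\<lparr>carrier := ?Z\<rparr>)" for x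
      using that ZG(2)[of x] by (simp flip: nat_pow_consistent)
  qed
  then show ?thesis by (simp add: order_def)
qed

text \<open>Downward induction on \<open>n\<close>. Let \<open>p\<close> be a prime with \<open>n p\<close> dividing the order, and \<open>n = p\<^sup>k r\<close> with
  \<open>p\<close> not dividing \<open>r\<close>. The elements of \<open>torsion G (n p)\<close> outside \<open>torsion G n\<close> have order divisible by \<open>p\<^sup>k\<^sup>+\<^sup>1\<close>
  and fall into classes of generators of cyclic subgroups, which gives the factor \<open>p\<^sup>k\<close>. For the factor \<open>r\<close>, split off the
  \<open>p\<close>-part \<open>y\<close> of an element and count in the centralizer of \<open>y\<close>: conjugacy classes of noncentral \<open>y\<close>
  contribute multiples of \<open>r\<close>, and the number of central \<open>y\<close> is prime to \<open>r\<close>.\<close>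

lemma frobenius_step:
  assumes fin: "finite (carrier G)" and n: "n dvd order G" "n \<noteq> order G"
    and larger: "\<And>m. n < m \<Longrightarrow> m dvd order G \<Longrightarrow> m dvd card (torsion G m)"
    and smaller: "\<And>C e. subgroup C G \<Longrightarrow> C \<noteq> carrier G \<Longrightarrow> e dvd card C \<Longrightarrow> e dvd card {z \<in> C. z [^] e = \<one>}"
  shows "n dvd card (torsion G n)"
proof -
  have pos: "order G > 0"
    using fin by (simp add: order_gt_0_iff_finite)
  have fint: "finite (torsion G m)" for m
    using fin by (simp add: torsion_def)
  have n0: "n > 0" using n(1) pos by (auto intro: Nat.gr0I)
  obtain c where c: "order G = n * c" using n(1) by blast
  with n(2) pos have "c \<noteq> 1" "c > 0" by auto
  then obtain p where p: "prime p" "p dvd c"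
    using prime_factor_nat by blast
  have pn: "n * p dvd order G" "n < n * p"
    using p n0 c prime_gt_1_nat[OF p(1)] by auto
  have IH: "n * p dvd card (torsion G (n * p))"
    using pn(2,1) by (rule larger)
  obtain k r where kr: "n = p ^ k * r" "\<not> p dvd r"
    using prime_power_canonical[OF p(1) n0] by (metis mult.commute)
  have cop: "coprime (p ^ j) r" for j
    using prime_imp_coprime[OF p(1) kr(2)] by simp
  have np: "n * p = p ^ Suc k * r" by (simp add: kr)
  have rG: "r dvd order G" using n(1) unfolding kr by (rule dvd_mult_right)

  have sub: "torsion G n \<subseteq> torsion G (n * p)"
    by (auto simp: torsion_def simp flip: nat_pow_pow)
  let ?S = "torsion G (n * p) - torsion G n"
  have "p ^ k dvd (\<Sum>x\<in>?S. 1)"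
  proof (rule dvd_sum_fibres[where f = "\<lambda>x. generate G {x}"])
    show "finite ?S" using fint by simp
    fix x assume x: "x \<in> ?S"
    then have xG: "x \<in> carrier G" by (simp add: torsion_def)
    have mem: "y \<in> ?S \<longleftrightarrow> y \<in> carrier G \<and> ord y dvd n * p \<and> \<not> ord y dvd n" for y
      by (auto simp: torsion_def pow_eq_id)
    have "{y. y \<in> ?S \<and> generate G {y} = generate G {x}} = {y \<in> carrier G. generate G {y} = generate G {x}}"
      using x by (auto simp only: mem) (simp_all add: generate_pow_card)
    then have "(\<Sum>y | y \<in> ?S \<and> generate G {y} = generate G {x}. 1) = totient (ord x)"
      by (simp add: card_same_generate[OF fin xG] del: Diff_iff)
    moreover have "p ^ Suc k dvd ord x"
    proof (rule prime_power_dvd_of_not_dvd[OF p(1)])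
      show "ord x dvd p ^ Suc k * r" "\<not> ord x dvd p ^ k * r"
        using x unfolding mem np[symmetric] kr(1)[symmetric] by simp_all
    qed
    then have "totient (p ^ Suc k) dvd totient (ord x)"
      by (rule totient_dvd)
    then have "p ^ k dvd totient (ord x)"
      unfolding totient_prime_power_Suc[OF p(1)] by (rule dvd_mult_left)
    ultimately show "p ^ k dvd (\<Sum>y | y \<in> ?S \<and> generate G {y} = generate G {x}. 1)"
      by simp
  qed
  then have "p ^ k dvd card (torsion G (n * p)) - card (torsion G n)"
    using sub fint by (simp add: card_Diff_subset)
  moreover have "p ^ k dvd card (torsion G (n * p))"
    using IH kr(1) by (metis dvd_mult_left)
  ultimately have pk: "p ^ k dvd card (torsion G n)"
    using card_mono[OF fint sub] by (metis dvd_diff_nat diff_diff_cancel)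

  define m where "m = card (torsion G r)"
  \<comment> \<open>Modulo \<open>r\<close> only the central \<open>y\<close> contribute, so the
    count is a unit times \<open>m\<close>, with the same \<open>m\<close> for every
    \<open>j\<close>. For \<open>j = Suc k\<close> it is already known to vanish, which gives
    \<open>r dvd m\<close>; then the case \<open>j = k\<close> follows.\<close>
  have split: "\<exists>b. coprime b r \<and> [card (torsion G (p ^ j * r)) = b * m] (mod r)" for j
  proof -
    define w where "w y = card {z \<in> centralizer_of G y. z [^] r = \<one>}" for y
    let ?Z = "{y \<in> torsion G (p ^ j). centralizer_of G y = carrier G}"
    let ?Y = "{y. y \<in> torsion G (p ^ j) \<and> centralizer_of G y \<noteq> carrier G}"
    have "r dvd (\<Sum>y\<in>?Y. w y)"
      unfolding w_def by (rule dvd_sum_noncentral[OF fin rG smaller])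
    moreover have "(\<Sum>y\<in>?Z. w y) = card ?Z * m"
      by (simp add: w_def m_def torsion_def)
    moreover have "card (torsion G (p ^ j * r)) = (\<Sum>y\<in>?Z \<union> ?Y. w y)"
      unfolding card_torsion_coprime_mult[OF fin cop] w_def[symmetric]
      by (rule sum.cong) auto
    then have "card (torsion G (p ^ j * r)) = (\<Sum>y\<in>?Z. w y) + (\<Sum>y\<in>?Y. w y)"
      by (subst (asm) sum.union_disjoint) (use fint in auto)
    ultimately have "[card (torsion G (p ^ j * r)) = card ?Z * m] (mod r)"
      by (auto simp: cong_def elim!: dvdE)
    then show ?thesis
      using coprime_card_central_torsion[OF fin cop] by blast
  qed
  obtain b where b: "coprime b r" "[card (torsion G (n * p)) = b * m] (mod r)"
    using split[of "Suc k"] np by auto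
  obtain b' where b': "[card (torsion G n) = b' * m] (mod r)"
    using split[of k] kr(1) by auto
  have "r dvd card (torsion G (n * p))"
    using IH kr(1) by (metis dvd_mult_left mult.commute)
  then have "r dvd b * m" using b(2) by (metis cong_0_iff cong_sym cong_trans)
  then have "r dvd m" using b(1) by (metis coprime_commute coprime_dvd_mult_right_iff)
  then have "r dvd card (torsion G n)"
    using b' by (metis cong_0_iff cong_sym cong_trans dvd_mult)
  with pk have "p ^ k * r dvd card (torsion G n)"
    using cop by (rule divides_mult)
  then show ?thesis
    unfolding kr(1)[symmetric] .
qed

end

text \<open>Two nested inductions: the outer one on the order supplies the proper subgroups, the
  inner one descends from \<open>n = order G\<close>, where the torsion is the whole group.\<close>

theorem frobenius_dvd_card_torsion:
  assumes "group G" "finite (carrier G)" "n dvd order G"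
  shows "n dvd card (torsion G n)"
  using assms
proof (induction "order G" arbitrary: G n rule: less_induct)
  case (less G n)
  note G = less.prems(1)
  have smaller: "e dvd card {z \<in> C. z [^]\<^bsub>G\<^esub> e = \<one>\<^bsub>G\<^esub>}"
    if C: "subgroup C G" "C \<noteq> carrier G" "e dvd card C" for C e
  proof -
    have sub: "C \<subset> carrier G"
      using C(2) subgroup.subset[OF C(1)] by blast
    let ?C = "G\<lparr>carrier := C\<rparr>"
    have "order ?C < order G"
      using psubset_card_mono[OF less.prems(2) sub] by (simp add: order_def)
    moreover have "finite (carrier ?C)" "e dvd order ?C"
      using finite_subset[OF psubset_imp_subset[OF sub] less.prems(2)] C(3) by (simp_all add: order_def)
    ultimately have "e dvd card (torsion ?C e)"
      using group.subgroup_imp_group[OF G C(1)] by (intro less.hyps)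
    then show ?thesis
      by (simp add: group.torsion_subgroup_carrier[OF G C(1)])
  qed
  from less.prems(3) show ?case
  proof (induction "order G - n" arbitrary: n rule: less_induct)
    case (less n)
    show ?case
    proof (cases "n = order G")
      case True
      then have "torsion G n = carrier G"
        by (auto simp: torsion_def group.pow_order_eq_1[OF G])
      with True show ?thesis by (simp add: order_def)
    next
      case False
      have "order G > 0"
        using \<open>finite (carrier G)\<close> by (simp add: monoid.order_gt_0_iff_finite[OF group.is_monoid[OF G]])
      then have "n < order G"
        using False dvd_imp_le[OF less.prems] by simp
      then have "m dvd card (torsion G m)" if "n < m" "m dvd order G" for m
        using that by (intro less.hyps) (simp_all add: diff_less_mono2)
      then show ?thesis
        using smaller by (rule group.frobenius_step[OF G \<open>finite (carrier G)\<close> less.prems False])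
    qed
  qed
qed

section \<open>Tensor products, integrals and traces\<close>

lemma clinear_iff:
  "clinear f \<longleftrightarrow> (\<forall>x y. f (x + y) = f x + f y) \<and> (\<forall>c x. f (c *\<^sub>C x) = c *\<^sub>C f x)"
proof
  assume "clinear f"
  then interpret Vector_Spaces.linear scaleC scaleC f .
  show "(\<forall>x y. f (x + y) = f x + f y) \<and> (\<forall>c x. f (c *\<^sub>C x) = c *\<^sub>C f x)"
    by (simp add: add scale)
next
  assume *: "(\<forall>x y. f (x + y) = f x + f y) \<and> (\<forall>c x. f (c *\<^sub>C x) = c *\<^sub>C f x)"
  show "clinear f"
    by unfold_locales (use * in auto)
qed

lemma scaleC_complex [simp]: "c *\<^sub>C (z::complex) = c * z"
  by (simp add: scaleC_complex_def)

lemma clinear_add: "clinear f \<Longrightarrow> f (x + y) = f x + f y"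
  and clinear_scale: "clinear f \<Longrightarrow> f (c *\<^sub>C x) = c *\<^sub>C f x"
  by (simp_all add: clinear_iff)

lemma clinear_0: "clinear f \<Longrightarrow> f 0 = 0"
  using clinear_scale[of f 0 0] by simp

lemma clinear_diff:
  assumes "clinear f" shows "f (x - y) = f x - f y"
  using clinear_add[OF assms, of "x - y" y] by (simp add: algebra_simps)

lemma clinear_sum:
  assumes "clinear f" shows "f (\<Sum>x\<in>A. g x) = (\<Sum>x\<in>A. f (g x))"
  by (induction A rule: infinite_finite_induct) (simp_all add: clinear_add[OF assms] clinear_0[OF assms])

lemma clinear_eq_on_span:
  assumes "clinear f" "clinear g" "cvec.span B = UNIV" "\<And>b. b \<in> B \<Longrightarrow> f b = g b"
  shows "f x = g x"
proof -
  have "x \<in> cvec.span B" using assms(3) by simp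
  then show ?thesis
    by (induction rule: cvec.span_induct_alt)
      (simp_all add: clinear_0 clinear_add clinear_scale assms)
qed

lemma cbilinearI:
  assumes "\<And>a b b'. B a (b + b') = B a b + B a b'" "\<And>a c b. B a (c *\<^sub>C b) = c *\<^sub>C B a b"
    and "\<And>a a' b. B (a + a') b = B a b + B a' b" "\<And>a c b. B (c *\<^sub>C a) b = c *\<^sub>C B a b"
  shows "cbilinear B"
  using assms by (simp add: cbilinear_def clinear_iff)

lemma scaleC_sum_right: "c *\<^sub>C (\<Sum>x\<in>A. f x) = (\<Sum>x\<in>A. c *\<^sub>C f x)"
  by (rule cvec.scale_sum_right)

lemma tensor_elem_0 [simp]: "0 \<otimes>\<^sub>C b = 0" "a \<otimes>\<^sub>C 0 = 0"
  using tensor_elem_bilinear(3)[of 0 0 b] tensor_elem_bilinear(4)[of a 0 0] by simp_all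

lemma cbilinear_tensor_mult_aux:
  "cbilinear (\<lambda>c d. (a * c) \<otimes>\<^sub>C (b * d))" for a :: "'a::complex_algebra_1" and b :: "'b::complex_algebra_1"
  by (rule cbilinearI) (simp_all add: algebra_simps scaleC_mult_right tensor_elem_bilinear)

lemma tensor_induct:
  fixes t :: "'a::complex_vector \<otimes>\<^sub>C 'b::complex_vector"
  assumes "\<And>a b. P (a \<otimes>\<^sub>C b)" "\<And>s t. P s \<Longrightarrow> P t \<Longrightarrow> P (s + t)" "\<And>c t. P t \<Longrightarrow> P (c *\<^sub>C t)"
  shows "P t"
proof (induct t)
  fix p :: "'a \<times> 'b \<Rightarrow>\<^sub>0 complex"
  have P0: "P 0" using assms(3)[OF assms(1), of 0] by simp
  show "P (abs_tensor p)"
  proof (induction p rule: update_induct)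
    case const
    then show ?case using P0 by (simp add: zero_tensor.abs_eq)
  next
    case (update p k z)
    have "Poly_Mapping.update k z p = z *\<^sub>C pair_gen (fst k) (snd k) + p"
      using update(1) by (auto simp: poly_mapping_eq_iff fun_eq_iff update.rep_eq lookup_add lookup_scaleC
          lookup_single scaleC_complex in_keys_iff when_def)
    then have "abs_tensor (Poly_Mapping.update k z p) = z *\<^sub>C (fst k \<otimes>\<^sub>C snd k) + abs_tensor p"
      by (simp add: tensor_elem.abs_eq scaleC_tensor.abs_eq plus_tensor.abs_eq)
    then show ?case using assms update by simp
  qed
qed

text \<open>The two nested lifts in \<open>tensor_mult\<close> can be evaluated only once they are
  known to come from bilinear maps. For the outer one, bilinearity in \<open>a\<close> and
  \<open>b\<close> with a fixed tensor \<open>t\<close> is itself an induction over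
  \<open>t\<close>.\<close>

lemma tensor_mult_bilinear:
  fixes s s' t t' :: "'a::complex_algebra_1 \<otimes>\<^sub>C 'b::complex_algebra_1" and a c :: 'a and b d :: 'b
  shows "tensor_mult (s + s') t = tensor_mult s t + tensor_mult s' t" (is ?add_left)
    and "tensor_mult s (t + t') = tensor_mult s t + tensor_mult s t'" (is ?add_right)
    and "tensor_mult (z *\<^sub>C s) t = z *\<^sub>C tensor_mult s t" (is ?scale_left)
    and "tensor_mult s (z *\<^sub>C t) = z *\<^sub>C tensor_mult s t" (is ?scale_right)
    and tensor_mult_elem: "tensor_mult (a \<otimes>\<^sub>C b) (c \<otimes>\<^sub>C d) = (a * c) \<otimes>\<^sub>C (b * d)"
proof -
  define T :: "'a \<Rightarrow> 'b \<Rightarrow> 'a \<otimes>\<^sub>C 'b \<Rightarrow> 'a \<otimes>\<^sub>C 'b"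
    where "T a b = tensor_lift (\<lambda>c d. (a * c) \<otimes>\<^sub>C (b * d))" for a b
  have T_elem: "T a b (c \<otimes>\<^sub>C d) = (a * c) \<otimes>\<^sub>C (b * d)" for a b c d
    unfolding T_def by (rule tensor_lift_elem[OF cbilinear_tensor_mult_aux])
  have lin: "clinear (T a b)" for a b
    unfolding T_def by (rule clinear_tensor_lift[OF cbilinear_tensor_mult_aux])
  note T_simps = T_elem clinear_add[OF lin] clinear_scale[OF lin] scaleC_add_right scaleC_scaleC
    tensor_elem_bilinear scaleC_mult_left
  have bil: "cbilinear (\<lambda>a b. T a b t)" for t
  proof (rule cbilinearI)
    show "T a (b + b') t = T a b t + T a b' t" for a b b'
      by (induction t rule: tensor_induct) (simp_all add: T_simps algebra_simps)
    show "T (a + a') b t = T a b t + T a' b t" for a a' b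
      by (induction t rule: tensor_induct) (simp_all add: T_simps algebra_simps)
    show "T a (z *\<^sub>C b) t = z *\<^sub>C T a b t" for a z b
      by (induction t rule: tensor_induct) (simp_all add: T_simps mult.commute)
    show "T (z *\<^sub>C a) b t = z *\<^sub>C T a b t" for a z b
      by (induction t rule: tensor_induct) (simp_all add: T_simps mult.commute)
  qed
  define M where "M t = tensor_lift (\<lambda>a b. T a b t)" for t
  have mult: "tensor_mult s t = M t s" for s t
    by (simp add: tensor_mult_def T_def M_def)
  have M_elem: "M t (a \<otimes>\<^sub>C b) = T a b t" for t a b
    unfolding M_def by (rule tensor_lift_elem[OF bil])
  have "clinear (M t)" for t
    unfolding M_def by (rule clinear_tensor_lift[OF bil])
  note M_simps = clinear_add[OF this] clinear_scale[OF this] M_elem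
  show ?add_left ?scale_left by (simp_all add: mult M_simps)
  show ?add_right
    unfolding mult by (induction s rule: tensor_induct) (simp_all add: M_simps T_simps algebra_simps)
  show ?scale_right
    unfolding mult by (induction s rule: tensor_induct) (simp_all add: M_simps T_simps mult.commute)
  show "tensor_mult (a \<otimes>\<^sub>C b) (c \<otimes>\<^sub>C d) = (a * c) \<otimes>\<^sub>C (b * d)"
    by (simp add: mult M_simps T_elem)
qed

lemma tensor_mult_0: "tensor_mult 0 t = 0" "tensor_mult s 0 = 0"
  using tensor_mult_bilinear(3)[of 0 0 t] tensor_mult_bilinear(4)[of s 0 0] by simp_all

lemma tensor_mult_sum_left: "tensor_mult (\<Sum>x\<in>A. f x) t = (\<Sum>x\<in>A. tensor_mult (f x) t)"
  by (induction A rule: infinite_finite_induct) (simp_all add: tensor_mult_bilinear tensor_mult_0)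

lemma tensor_mult_sum_right: "tensor_mult s (\<Sum>x\<in>A. f x) = (\<Sum>x\<in>A. tensor_mult s (f x))"
  by (induction A rule: infinite_finite_induct) (simp_all add: tensor_mult_bilinear tensor_mult_0)

lemmas tensor_mult_simps = tensor_mult_elem tensor_mult_bilinear tensor_mult_0
  tensor_mult_sum_left tensor_mult_sum_right

context hopf_algebra
begin

lemmas comult_simps = clinear_add[OF comult_linear] clinear_scale[OF comult_linear]
  clinear_sum[OF comult_linear] clinear_0[OF comult_linear]
lemmas counit_simps = clinear_add[OF counit_linear] clinear_scale[OF counit_linear]
  clinear_sum[OF counit_linear] clinear_0[OF counit_linear]

lemma clinear_sweedler_power: "clinear (sweedler_power \<Delta> \<epsilon> n)"
  and cbilinear_sweedler_power: "cbilinear (\<lambda>a b. sweedler_power \<Delta> \<epsilon> n a * b)"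
proof -
  have bil: "cbilinear (\<lambda>a b. f a * b)" if "clinear f" for f :: "'a \<Rightarrow> 'a"
    by (rule cbilinearI) (simp_all add: that clinear_add clinear_scale algebra_simps
        scaleC_mult_left scaleC_mult_right)
  show lin: "clinear (sweedler_power \<Delta> \<epsilon> n)"
  proof (induction n)
    case 0
    then show ?case
      by (simp add: clinear_iff counit_simps scaleC_add_left scaleC_complex scaleC_scaleC)
  next
    case (Suc n)
    note lin = clinear_tensor_lift[OF bil[OF Suc]]
    show ?case
      by (simp add: clinear_iff comult_simps clinear_add[OF lin] clinear_scale[OF lin])
  qed
  show "cbilinear (\<lambda>a b. sweedler_power \<Delta> \<epsilon> n a * b)"
    by (rule bil[OF lin])
qed

lemmas sweedler_power_simps = clinear_add[OF clinear_sweedler_power] clinear_scale[OF clinear_sweedler_power]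
  clinear_sum[OF clinear_sweedler_power] clinear_0[OF clinear_sweedler_power]

lemmas sweedler_lift_simps = clinear_add[OF clinear_tensor_lift[OF cbilinear_sweedler_power]]
  clinear_scale[OF clinear_tensor_lift[OF cbilinear_sweedler_power]]
  clinear_sum[OF clinear_tensor_lift[OF cbilinear_sweedler_power]]
  clinear_0[OF clinear_tensor_lift[OF cbilinear_sweedler_power]]
  tensor_lift_elem[OF cbilinear_sweedler_power]

lemma counit_left_lift:
  "cbilinear (\<lambda>a b. \<epsilon> a *\<^sub>C b)"
  by (rule cbilinearI)
    (simp_all add: counit_simps scaleC_add_left scaleC_add_right scaleC_complex scaleC_scaleC mult.commute)

text \<open>Two normalized integrals both equal their product, by the integral property of either
  factor.\<close>

lemma normalized_integral_eq:
  assumes "integral_elem \<epsilon> \<Lambda>" "\<epsilon> \<Lambda> = 1"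
  shows "normalized_integral \<epsilon> = \<Lambda>"
  unfolding normalized_integral_def
proof (rule the_equality)
  show "integral_elem \<epsilon> \<Lambda> \<and> \<epsilon> \<Lambda> = 1" using assms by simp
  fix \<Lambda>' assume *: "integral_elem \<epsilon> \<Lambda>' \<and> \<epsilon> \<Lambda>' = 1"
  then have "\<Lambda>' * \<Lambda> = \<Lambda>" using assms(1) by (simp add: integral_elem_def scaleC_one)
  moreover have "\<Lambda>' * \<Lambda> = \<Lambda>'" using assms(2) * by (simp add: integral_elem_def scaleC_one)
  ultimately show "\<Lambda>' = \<Lambda>" by simp
qed

end

lemma (in hopf_algebra) integral_elem_of_span:
  assumes span: "cvec.span B = UNIV"
    and left: "\<And>b. b \<in> B \<Longrightarrow> b * \<Lambda> = \<epsilon> b *\<^sub>C \<Lambda>" and right: "\<And>b. b \<in> B \<Longrightarrow> \<Lambda> * b = \<epsilon> b *\<^sub>C \<Lambda>"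
  shows "integral_elem \<epsilon> \<Lambda>"
  unfolding integral_elem_def
proof (intro allI conjI)
  fix h
  show "h * \<Lambda> = \<epsilon> h *\<^sub>C \<Lambda>"
    by (rule clinear_eq_on_span[OF _ _ span left])
      (simp_all add: clinear_iff algebra_simps scaleC_mult_left counit_simps scaleC_add_left scaleC_scaleC)
  show "\<Lambda> * h = \<epsilon> h *\<^sub>C \<Lambda>"
    by (rule clinear_eq_on_span[OF _ _ span right])
      (simp_all add: clinear_iff algebra_simps scaleC_mult_right counit_simps scaleC_add_left scaleC_scaleC)
qed

text \<open>A finite spanning family with dual functionals; the functionals already force
  injectivity and independence. Working with an index set turns traces into sums over
  exponents.\<close>

locale coordinates =
  fixes I :: "'i set" and v :: "'i \<Rightarrow> 'a::complex_vector" and \<phi> :: "'i \<Rightarrow> 'a \<Rightarrow> complex"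
  assumes fin: "finite I"
    and coord_linear: "i \<in> I \<Longrightarrow> clinear (\<phi> i)"
    and coord_basis: "i \<in> I \<Longrightarrow> j \<in> I \<Longrightarrow> \<phi> i (v j) = (if i = j then 1 else 0)"
    and span_basis: "cvec.span (v ` I) = UNIV"
begin

lemmas coord_simps = clinear_add[OF coord_linear] clinear_scale[OF coord_linear]
  clinear_sum[OF coord_linear] clinear_0[OF coord_linear]

lemma expansion: "x = (\<Sum>i\<in>I. \<phi> i x *\<^sub>C v i)"
proof -
  have "clinear (\<lambda>x. \<Sum>i\<in>I. \<phi> i x *\<^sub>C v i)"
    by (simp add: clinear_iff coord_simps scaleC_add_left sum.distrib scaleC_sum_right scaleC_scaleC scaleC_complex)
  then have "(\<lambda>x. \<Sum>i\<in>I. \<phi> i x *\<^sub>C v i) x = (\<lambda>x. x) x"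
  proof (rule clinear_eq_on_span[OF _ _ span_basis])
    show "clinear (\<lambda>x. x)" by (simp add: clinear_iff)
    fix b assume "b \<in> v ` I"
    then obtain j where j: "j \<in> I" "b = v j" by auto
    have "(\<Sum>i\<in>I. \<phi> i (v j) *\<^sub>C v i) = (\<Sum>i\<in>I. if i = j then v i else 0)"
      by (rule sum.cong) (auto simp: coord_basis j(1) scaleC_one)
    then show "(\<Sum>i\<in>I. \<phi> i b *\<^sub>C v i) = b" using fin j by simp
  qed
  then show ?thesis by simp
qed

lemma inj_basis: "inj_on v I"
  by (rule inj_onI) (metis coord_basis zero_neq_one)

lemma independent_basis: "cvec.independent (v ` I)"
proof (rule cvec.independent_if_scalars_zero)
  show "finite (v ` I)" using fin by simp
  fix f x assume 0: "(\<Sum>x\<in>v ` I. f x *\<^sub>C x) = 0" and "x \<in> v ` I"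
  then obtain j where j: "j \<in> I" "x = v j" by auto
  have "0 = \<phi> j (\<Sum>i\<in>I. f (v i) *\<^sub>C v i)"
    using 0 j by (simp add: sum.reindex[OF inj_basis] coord_simps)
  also have "\<dots> = (\<Sum>i\<in>I. if i = j then f (v i) else 0)"
    using j by (simp add: coord_simps coord_basis scaleC_complex cong: sum.cong)
      (rule sum.cong, auto)
  finally show "f x = 0" using j fin by simp
qed

lemma dim_eq: "cvec.dim (UNIV :: 'a set) = card I"
proof -
  have "cvec.dim (UNIV :: 'a set) = card (v ` I)"
    by (rule cvec.dim_eq_card) (use independent_basis span_basis in \<open>simp_all add: cvec.span_UNIV\<close>)
  then show ?thesis by (simp add: card_image inj_basis)
qed

text \<open>This is \<open>tr (P Q) = tr (Q P)\<close>, applied to the change of basis between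
  \<open>v\<close> and the basis picked by \<open>SOME\<close> in \<open>lin_trace\<close>.\<close>

lemma lin_trace_eq:
  assumes f: "clinear f"
  shows "lin_trace f = (\<Sum>i\<in>I. \<phi> i (f (v i)))"
proof -
  define B where "B = (SOME B :: 'a set. cvec.independent B \<and> cvec.span B = UNIV)"
  have "cvec.independent B \<and> cvec.span B = UNIV"
    unfolding B_def by (rule someI_ex) (use independent_basis span_basis in blast)
  then have B: "cvec.independent B" "cvec.span B = UNIV" by auto
  have finB: "finite B"
    using cvec.independent_span_bound[of "v ` I" B] B fin span_basis by simp
  have rep_add: "cvec.representation B (x + y) b = cvec.representation B x b + cvec.representation B y b" for x y b
    using cvec.representation_add[OF B(1)] B(2) by simp
  have rep_scale: "cvec.representation B (c *\<^sub>C x) b = c * cvec.representation B x b" for c x b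
    using cvec.representation_scale[OF B(1)] B(2) by simp
  have rep: "clinear (\<lambda>x. cvec.representation B x b)" for b
    by (simp add: clinear_iff rep_add rep_scale scaleC_complex)
  have "lin_trace f = (\<Sum>b\<in>B. cvec.representation B (f (\<Sum>i\<in>I. \<phi> i b *\<^sub>C v i)) b)"
    unfolding lin_trace_def B_def[symmetric] Let_def by (simp flip: expansion)
  also have "\<dots> = (\<Sum>b\<in>B. \<Sum>i\<in>I. cvec.representation B (f (v i)) b * \<phi> i b)"
    by (simp add: clinear_sum[OF f] clinear_scale[OF f] clinear_sum[OF rep] rep_scale mult.commute)
  also have "\<dots> = (\<Sum>i\<in>I. \<Sum>b\<in>B. cvec.representation B (f (v i)) b * \<phi> i b)"
    by (rule sum.swap)
  also have "\<dots> = (\<Sum>i\<in>I. \<phi> i (\<Sum>b\<in>B. cvec.representation B (f (v i)) b *\<^sub>C b))"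
    by (simp add: coord_simps scaleC_complex)
  also have "\<dots> = (\<Sum>i\<in>I. \<phi> i (f (v i)))"
    using B finB by (simp add: cvec.sum_representation_eq)
  finally show ?thesis .
qed

end

lemma coordinates_of_basis:
  assumes "finite I" "inj_on v I" and ind: "cvec.independent (v ` I)" and span: "cvec.span (v ` I) = UNIV"
  shows "coordinates I v (\<lambda>i x. cvec.representation (v ` I) x (v i))"
proof (rule coordinates.intro)
  fix i j assume ij: "i \<in> I" "j \<in> I"
  show "clinear (\<lambda>x. cvec.representation (v ` I) x (v i))"
    by (simp add: clinear_iff scaleC_complex cvec.representation_add[OF ind]
        cvec.representation_scale[OF ind] span)
  show "cvec.representation (v ` I) (v j) (v i) = (if i = j then 1 else 0)"
    using ij assms(2) by (auto simp: cvec.representation_basis[OF ind] inj_on_eq_iff)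
qed (use assms in auto)

text \<open>For functionals read off from operators that permute basis vectors up to scalars: the
  diagonal values are merely nonzero and have to be divided out.\<close>

lemma coordinates_of_separating:
  assumes "finite I" and lin: "\<And>i. i \<in> I \<Longrightarrow> clinear (\<psi> i)"
    and ne: "\<And>i. i \<in> I \<Longrightarrow> \<psi> i (v i) \<noteq> 0"
    and sep: "\<And>i j. i \<in> I \<Longrightarrow> j \<in> I \<Longrightarrow> i \<noteq> j \<Longrightarrow> \<psi> i (v j) = 0"
    and span: "cvec.span (v ` I) = UNIV"
  shows "coordinates I v (\<lambda>i x. \<psi> i x / \<psi> i (v i))"
proof (rule coordinates.intro)
  fix i j assume ij: "i \<in> I" "j \<in> I"
  show "clinear (\<lambda>x. \<psi> i x / \<psi> i (v i))"
    using lin[OF ij(1)] by (simp add: clinear_iff add_divide_distrib)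
  show "\<psi> i (v j) / \<psi> i (v i) = (if i = j then 1 else 0)"
    using ne[OF ij(1)] sep[OF ij] by auto
qed (use assms in auto)

lemma clinear_mult_left: "clinear (\<lambda>x. a * x)" for a :: "'a::complex_algebra_1"
  by (simp add: clinear_iff algebra_simps scaleC_mult_right)

locale algebra_coordinates = coordinates I v \<phi>
  for I :: "'i set" and v :: "'i \<Rightarrow> 'a::complex_algebra_1" and \<phi> :: "'i \<Rightarrow> 'a \<Rightarrow> complex"
begin

lemma regular_character_eq: "regular_character a = (\<Sum>i\<in>I. \<phi> i (a * v i))"
  unfolding regular_character_def by (rule lin_trace_eq[OF clinear_mult_left])

lemma clinear_regular_character: "clinear (regular_character :: 'a \<Rightarrow> complex)"
  by (simp add: clinear_iff regular_character_eq[abs_def] algebra_simps scaleC_mult_left coord_simps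
      sum.distrib sum_distrib_left scaleC_complex)

lemmas regular_character_simps = clinear_add[OF clinear_regular_character]
  clinear_scale[OF clinear_regular_character] clinear_sum[OF clinear_regular_character]
  clinear_0[OF clinear_regular_character]

end

section \<open>Presented algebras\<close>

lemma poly_mapping_additive_induct:
  assumes "\<And>k c. P (Poly_Mapping.single k c)" "\<And>p q. P p \<Longrightarrow> P q \<Longrightarrow> P (p + q)"
  shows "P (p :: 'k \<Rightarrow>\<^sub>0 'b::monoid_add)"
proof (induction p rule: update_induct)
  case const
  show ?case using assms(1)[of _ 0] by simp
next
  case (update p k c)
  have "Poly_Mapping.update k c p = Poly_Mapping.single k c + p"
    using update(1) by (auto simp: poly_mapping_eq_iff fun_eq_iff update.rep_eq lookup_add
        lookup_single in_keys_iff when_def)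
  then show ?case using assms update by simp
qed

lemma scaleC_single: "c *\<^sub>C Poly_Mapping.single k (z::complex) = Poly_Mapping.single k (c * z)"
  by (auto simp: poly_mapping_eq_iff fun_eq_iff lookup_scaleC lookup_single when_def)

lemma clinear_free_eval: "clinear (free_eval \<gamma>)"
  unfolding free_eval_def by (rule clinear_lin_ext)

lemma free_eval_single:
  "free_eval \<gamma> (Poly_Mapping.single w c) = c *\<^sub>C prod_list (map \<gamma> (letters w))"
  by (simp add: free_eval_def lin_ext_single)

lemma free_eval_mult: "free_eval \<gamma> (p * q) = free_eval \<gamma> p * free_eval \<gamma> q"
proof (induction p rule: poly_mapping_additive_induct)
  case (1 v c)
  show ?case
    by (induction q rule: poly_mapping_additive_induct)
      (simp_all add: mult_single free_eval_single plus_fword_def scaleC_mult_left scaleC_mult_right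
        scaleC_scaleC mult.commute distrib_left clinear_add[OF clinear_free_eval])
qed (simp add: distrib_right clinear_add[OF clinear_free_eval])

lemma free_eval_1: "free_eval \<gamma> 1 = 1"
proof -
  have "free_eval \<gamma> (Poly_Mapping.single 0 1) = 1"
    unfolding free_eval_single by (simp add: zero_fword_def scaleC_one)
  then show ?thesis by simp
qed

lemma free_eval_fgen: "free_eval \<gamma> (fgen x) = \<gamma> x"
  by (simp add: fgen_def free_eval_single scaleC_one)

lemma free_eval_power: "free_eval \<gamma> (p ^ n) = free_eval \<gamma> p ^ n"
  by (induction n) (simp_all add: free_eval_1 free_eval_mult)

lemma free_eval_alt_prod: "free_eval \<gamma> (alt_prod n p q) = alt_prod n (free_eval \<gamma> p) (free_eval \<gamma> q)"
  by (induction n arbitrary: p q) (simp_all add: free_eval_1 free_eval_mult)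

lemmas free_eval_simps = free_eval_mult free_eval_1 free_eval_fgen free_eval_power free_eval_alt_prod
  clinear_add[OF clinear_free_eval] clinear_diff[OF clinear_free_eval] clinear_scale[OF clinear_free_eval]
  clinear_sum[OF clinear_free_eval] clinear_0[OF clinear_free_eval]

lemma free_alg_on_1: "1 \<in> free_alg_on X"
  by (simp add: free_alg_on_def zero_fword_def)

lemma free_alg_on_add: "p \<in> free_alg_on X \<Longrightarrow> q \<in> free_alg_on X \<Longrightarrow> p + q \<in> free_alg_on X"
  using keys_add[of p q] by (auto simp: free_alg_on_def)

lemma free_alg_on_scale: "p \<in> free_alg_on X \<Longrightarrow> c *\<^sub>C p \<in> free_alg_on X"
  by (auto simp: free_alg_on_def in_keys_iff lookup_scaleC)

lemma free_alg_on_mult: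
  assumes "p \<in> free_alg_on X" "q \<in> free_alg_on X" shows "p * q \<in> free_alg_on X"
proof -
  have "set (letters w) \<subseteq> X" if w: "w \<in> Poly_Mapping.keys (p * q)" for w
  proof -
    obtain a b where "a \<in> Poly_Mapping.keys p" "b \<in> Poly_Mapping.keys q" "w = a + b"
      using keys_mult[of p q] w by blast
    then show ?thesis using assms by (auto simp: free_alg_on_def plus_fword_def)
  qed
  then show ?thesis by (simp add: free_alg_on_def)
qed

lemma free_alg_on_diff: "p \<in> free_alg_on X \<Longrightarrow> q \<in> free_alg_on X \<Longrightarrow> p - q \<in> free_alg_on X"
  using free_alg_on_add[OF _ free_alg_on_scale[of q X "-1"], of p] by simp

lemma free_alg_on_fgen: "x \<in> X \<Longrightarrow> fgen x \<in> free_alg_on X"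
  by (simp add: free_alg_on_def fgen_def)

lemma free_eval_relation_ideal:
  assumes "p \<in> relation_ideal X R" "\<And>r. r \<in> R \<Longrightarrow> free_eval \<rho> r = 0"
  shows "free_eval \<rho> p = 0"
  using assms(1) by induction (simp_all add: free_eval_simps assms(2))

lemma presented_by_relation:
  assumes "presented_by X R \<gamma>" "r \<in> R"
  shows "free_eval \<gamma> r = 0"
  using relation_ideal.step[OF relation_ideal.zero assms(2) free_alg_on_1 free_alg_on_1] assms(1)
  by (auto simp: presented_by_def)

text \<open>The value at \<open>h\<close> may be computed from any representative in the free
  algebra, since two of them differ by an element of the relation ideal, on which
  \<open>free_eval \<rho>\<close> vanishes.\<close>

lemma presented_by_induced_hom:
  fixes \<gamma> :: "'x \<Rightarrow> 'a::complex_algebra_1" and \<rho> :: "'x \<Rightarrow> 'b::complex_algebra_1"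
  assumes pres: "presented_by X R \<gamma>" and rel: "\<And>r. r \<in> R \<Longrightarrow> free_eval \<rho> r = 0"
  obtains \<Phi> :: "'a \<Rightarrow> 'b" where "clinear \<Phi>" "\<Phi> 1 = 1" "\<And>a b. \<Phi> (a * b) = \<Phi> a * \<Phi> b"
    "\<And>x. x \<in> X \<Longrightarrow> \<Phi> (\<gamma> x) = \<rho> x"
proof -
  define P where "P h = (SOME p. p \<in> free_alg_on X \<and> free_eval \<gamma> p = h)" for h
  have P: "P h \<in> free_alg_on X" "free_eval \<gamma> (P h) = h" for h
  proof -
    have "h \<in> free_eval \<gamma> ` free_alg_on X"
      using pres by (simp add: presented_by_def)
    then have "\<exists>p. p \<in> free_alg_on X \<and> free_eval \<gamma> p = h" by blast
    from someI_ex[OF this] show "P h \<in> free_alg_on X" "free_eval \<gamma> (P h) = h"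
      unfolding P_def by auto
  qed
  define \<Phi> where "\<Phi> h = free_eval \<rho> (P h)" for h
  have \<Phi>: "\<Phi> h = free_eval \<rho> p" if p: "p \<in> free_alg_on X" "free_eval \<gamma> p = h" for h p
  proof -
    have "P h - p \<in> free_alg_on X" "free_eval \<gamma> (P h - p) = 0"
      using p P by (simp_all add: free_alg_on_diff free_eval_simps)
    then have "P h - p \<in> relation_ideal X R"
      using pres by (auto simp: presented_by_def)
    then have "free_eval \<rho> (P h - p) = 0"
      by (rule free_eval_relation_ideal[OF _ rel])
    then show ?thesis by (simp add: \<Phi>_def free_eval_simps)
  qed
  show ?thesis
  proof
    show "clinear \<Phi>"
      unfolding clinear_iff
    proof (intro conjI allI)
      show "\<Phi> (x + y) = \<Phi> x + \<Phi> y" for x y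
        using \<Phi>[of "P x + P y"] P by (simp add: \<Phi>_def free_eval_simps free_alg_on_add)
      show "\<Phi> (c *\<^sub>C x) = c *\<^sub>C \<Phi> x" for c x
        using \<Phi>[of "c *\<^sub>C P x"] P by (simp add: \<Phi>_def free_eval_simps free_alg_on_scale)
    qed
    show "\<Phi> 1 = 1"
      using \<Phi>[of 1] by (simp add: free_eval_simps free_alg_on_1)
    show "\<Phi> (x * y) = \<Phi> x * \<Phi> y" for x y
      using \<Phi>[of "P x * P y"] P by (simp add: \<Phi>_def free_eval_simps free_alg_on_mult)
    show "\<Phi> (\<gamma> x) = \<rho> x" if "x \<in> X" for x
      using \<Phi>[of "fgen x"] that by (simp add: free_eval_simps free_alg_on_fgen)
  qed
qed

text \<open>Words grow by prepending a letter, so only left multiplication by single generators has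
  to be controlled.\<close>

lemma presented_by_subspace_eq_UNIV:
  assumes pres: "presented_by X R \<gamma>" and V: "cvec.subspace V" "1 \<in> V"
    and mult: "\<And>x h. x \<in> X \<Longrightarrow> h \<in> V \<Longrightarrow> \<gamma> x * h \<in> V"
  shows "V = UNIV"
proof -
  have word: "prod_list (map \<gamma> w) \<in> V" if "set w \<subseteq> X" for w
    using that by (induction w) (simp_all add: V(2) mult)
  have "free_eval \<gamma> p \<in> V" if "p \<in> free_alg_on X" for p
    unfolding free_eval_def lin_ext_def
    using that by (intro cvec.subspace_sum[OF V(1)] cvec.subspace_scale[OF V(1)] word)
      (auto simp: free_alg_on_def)
  then have "free_eval \<gamma> ` free_alg_on X \<subseteq> V" by auto
  then show ?thesis
    using pres by (simp add: presented_by_def top.extremum_unique)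
qed

lemma presented_by_span_eq_UNIV:
  assumes pres: "presented_by X R \<gamma>" and one: "1 \<in> cvec.span B"
    and mult: "\<And>x b. x \<in> X \<Longrightarrow> b \<in> B \<Longrightarrow> \<gamma> x * b \<in> cvec.span B"
  shows "cvec.span B = UNIV"
proof (rule presented_by_subspace_eq_UNIV[OF pres cvec.subspace_span one])
  fix x h assume x: "x \<in> X" and "h \<in> cvec.span B"
  from this(2) show "\<gamma> x * h \<in> cvec.span B"
    by (induction rule: cvec.span_induct_alt)
      (simp_all add: cvec.span_zero cvec.span_add cvec.span_scale mult[OF x] distrib_left scaleC_mult_right)
qed

text \<open>Target algebra for homomorphisms out of presented algebras: independence of a spanning set
  of words is read off from the operators by which they act.\<close>

typedef 'k endo = "{f :: ('k \<Rightarrow>\<^sub>0 complex) \<Rightarrow> ('k \<Rightarrow>\<^sub>0 complex). clinear f}"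
  morphisms app Endo
  by (rule exI[of _ "\<lambda>x. x"]) (simp add: clinear_iff)

lemma clinear_app: "clinear (app f)"
  using app[of f] by simp

lemmas app_linear = clinear_add[OF clinear_app] clinear_scale[OF clinear_app] clinear_0[OF clinear_app]
  clinear_diff[OF clinear_app]

instantiation endo :: (type) complex_algebra_1
begin

definition "0 = Endo (\<lambda>x. 0)"
definition "1 = Endo (\<lambda>x. x)"
definition "f + g = Endo (\<lambda>x. app f x + app g x)"
definition "f - g = Endo (\<lambda>x. app f x - app g x)"
definition "- f = Endo (\<lambda>x. - app f x)"
definition "f * g = Endo (\<lambda>x. app f (app g x))"
definition "c *\<^sub>C f = Endo (\<lambda>x. c *\<^sub>C app f x)"

lemma app_Endo: "clinear f \<Longrightarrow> app (Endo f) = f"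
  by (simp add: Endo_inverse)

lemma app_simps:
  "app 0 x = 0" "app 1 x = x" "app (f + g) x = app f x + app g x" "app (f - g) x = app f x - app g x"
  "app (- f) x = - app f x" "app (f * g) x = app f (app g x)" "app (c *\<^sub>C f) x = c *\<^sub>C app f x"
  by (simp_all add: zero_endo_def one_endo_def plus_endo_def minus_endo_def uminus_endo_def times_endo_def
      scaleC_endo_def, (subst app_Endo; simp add: clinear_iff app_linear algebra_simps scaleC_add_right
      scaleC_scaleC cvec.scale_right_diff_distrib mult.commute)+)

instance
proof
  note eq = app_inject[symmetric] fun_eq_iff app_simps
  fix f g h :: "'a endo" and c d :: complex
  show "f + g + h = f + (g + h)" "f + g = g + f" "0 + f = f" "- f + f = 0" "f - g = f + - g"
    "f * g * h = f * (g * h)" "1 * f = f" "f * 1 = f" "(f + g) * h = f * h + g * h"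
    "f * (g + h) = f * g + f * h"
    by (simp_all add: eq app_linear algebra_simps)
  show "(0 :: 'a endo) \<noteq> 1"
    by (simp add: eq) (metis single_zero zero_neq_one lookup_single_eq lookup_zero)
  show "c *\<^sub>C (f + g) = c *\<^sub>C f + c *\<^sub>C g" "(c + d) *\<^sub>C f = c *\<^sub>C f + d *\<^sub>C f"
    "c *\<^sub>C d *\<^sub>C f = (c * d) *\<^sub>C f" "1 *\<^sub>C f = f" "(c *\<^sub>C f) * g = c *\<^sub>C (f * g)" "f * (c *\<^sub>C g) = c *\<^sub>C (f * g)"
    by (simp_all add: eq app_linear scaleC_add_right scaleC_add_left scaleC_scaleC scaleC_one)
qed

end

lemma app_sum: "app (\<Sum>a\<in>A. f a) x = (\<Sum>a\<in>A. app (f a) x)"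
  by (induction A rule: infinite_finite_induct) (simp_all add: app_simps)

lemma endo_eqI:
  assumes "\<And>k. app f (Poly_Mapping.single k 1) = app g (Poly_Mapping.single k 1)"
  shows "f = g"
proof -
  have "app f p = app g p" for p
  proof (induction p rule: poly_mapping_additive_induct)
    case (1 k c)
    then show ?case
      using assms[of k] app_linear(2)[of _ c "Poly_Mapping.single k 1"] by (simp add: scaleC_single)
  qed (simp add: app_linear)
  then show ?thesis by (simp add: app_inject[symmetric] fun_eq_iff)
qed

text \<open>All generators act in the models by weighted maps of the index set. This class is closed
  under products, so relations can be checked on one basis vector at a time.\<close>

definition monomial_op :: "('k \<Rightarrow> 'k) \<Rightarrow> ('k \<Rightarrow> complex) \<Rightarrow> 'k endo"
  where "monomial_op \<sigma> c = Endo (lin_ext (\<lambda>k. Poly_Mapping.single (\<sigma> k) (c k)))"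

lemma app_monomial_op:
  "app (monomial_op \<sigma> c) (Poly_Mapping.single k z) = Poly_Mapping.single (\<sigma> k) (c k * z)"
  by (simp add: monomial_op_def app_Endo clinear_lin_ext lin_ext_single scaleC_single mult.commute)

section \<open>Bismash products\<close>

locale matched_pair_groups =
  fixes F :: "'f monoid" and G :: "'g monoid" and ract :: "'g \<Rightarrow> 'f \<Rightarrow> 'g" and lact :: "'g \<Rightarrow> 'f \<Rightarrow> 'f"
  assumes matched: "matched_pair F G ract lact"
begin

lemma groupF: "Group.group F" and groupG: "Group.group G"
  and finF: "finite (carrier F)" and finG: "finite (carrier G)"
  using matched by (simp_all add: matched_pair_def)

sublocale F: Group.group F by (rule groupF)
sublocale G: Group.group G by (rule groupG)

lemma act_closed [simp]:
  "g \<in> carrier G \<Longrightarrow> x \<in> carrier F \<Longrightarrow> ract g x \<in> carrier G"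
  "g \<in> carrier G \<Longrightarrow> x \<in> carrier F \<Longrightarrow> lact g x \<in> carrier F"
  using matched by (simp_all add: matched_pair_def)

lemma ract_one [simp]: "g \<in> carrier G \<Longrightarrow> ract g \<one>\<^bsub>F\<^esub> = g"
  and ract_mult: "g \<in> carrier G \<Longrightarrow> x \<in> carrier F \<Longrightarrow> y \<in> carrier F \<Longrightarrow>
    ract g (x \<otimes>\<^bsub>F\<^esub> y) = ract (ract g x) y"
  and lact_one [simp]: "x \<in> carrier F \<Longrightarrow> lact \<one>\<^bsub>G\<^esub> x = x"
  and lact_mult: "g \<in> carrier G \<Longrightarrow> h \<in> carrier G \<Longrightarrow> x \<in> carrier F \<Longrightarrow>
    lact (g \<otimes>\<^bsub>G\<^esub> h) x = lact g (lact h x)"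
  and lact_F: "g \<in> carrier G \<Longrightarrow> x \<in> carrier F \<Longrightarrow> y \<in> carrier F \<Longrightarrow>
    lact g (x \<otimes>\<^bsub>F\<^esub> y) = lact g x \<otimes>\<^bsub>F\<^esub> lact (ract g x) y"
  and ract_G: "g \<in> carrier G \<Longrightarrow> h \<in> carrier G \<Longrightarrow> x \<in> carrier F \<Longrightarrow>
    ract (g \<otimes>\<^bsub>G\<^esub> h) x = ract g (lact h x) \<otimes>\<^bsub>G\<^esub> ract h x"
  using matched by (simp_all add: matched_pair_def)

lemma lact_unit [simp]: "g \<in> carrier G \<Longrightarrow> lact g \<one>\<^bsub>F\<^esub> = \<one>\<^bsub>F\<^esub>"
  using lact_F[of g "\<one>\<^bsub>F\<^esub>" "\<one>\<^bsub>F\<^esub>"] by simp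

lemma ract_unit [simp]: "x \<in> carrier F \<Longrightarrow> ract \<one>\<^bsub>G\<^esub> x = \<one>\<^bsub>G\<^esub>"
  using ract_G[of "\<one>\<^bsub>G\<^esub>" "\<one>\<^bsub>G\<^esub>" x] by simp

lemma lact_inv:
  assumes "g \<in> carrier G" "x \<in> carrier F"
  shows "lact (inv\<^bsub>G\<^esub> g) (lact g x) = x" "lact g (lact (inv\<^bsub>G\<^esub> g) x) = x"
  using assms by (simp_all flip: lact_mult)

lemma ract_inv:
  assumes "g \<in> carrier G" "x \<in> carrier F"
  shows "ract (ract g x) (inv\<^bsub>F\<^esub> x) = g" "ract (ract g (inv\<^bsub>F\<^esub> x)) x = g"
  using assms by (simp_all flip: ract_mult)

text \<open>The Zappa-Szep product: \<open>(x, g)\<close> stands for the product \<open>x g\<close>,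
  and the actions describe how \<open>g y\<close> is rewritten as an element of \<open>F\<close>
  times an element of \<open>G\<close>.\<close>

definition bicrossed :: "('f \<times> 'g) monoid"
  where "bicrossed = \<lparr>carrier = carrier F \<times> carrier G,
    mult = (\<lambda>(x, g) (y, h). (x \<otimes>\<^bsub>F\<^esub> lact g y, ract g y \<otimes>\<^bsub>G\<^esub> h)),
    one = (\<one>\<^bsub>F\<^esub>, \<one>\<^bsub>G\<^esub>)\<rparr>"

lemma bicrossed_simps [simp]:
  "carrier bicrossed = carrier F \<times> carrier G"
  "(x, g) \<otimes>\<^bsub>bicrossed\<^esub> (y, h) = (x \<otimes>\<^bsub>F\<^esub> lact g y, ract g y \<otimes>\<^bsub>G\<^esub> h)"
  "\<one>\<^bsub>bicrossed\<^esub> = (\<one>\<^bsub>F\<^esub>, \<one>\<^bsub>G\<^esub>)"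
  by (simp_all add: bicrossed_def)

lemma group_bicrossed: "Group.group bicrossed"
proof (rule groupI)
  show "a \<otimes>\<^bsub>bicrossed\<^esub> b \<otimes>\<^bsub>bicrossed\<^esub> c = a \<otimes>\<^bsub>bicrossed\<^esub> (b \<otimes>\<^bsub>bicrossed\<^esub> c)"
    if "a \<in> carrier bicrossed" "b \<in> carrier bicrossed" "c \<in> carrier bicrossed" for a b c
    using that by (auto simp: lact_mult lact_F ract_G ract_mult F.m_assoc G.m_assoc)
  show "\<exists>b\<in>carrier bicrossed. b \<otimes>\<^bsub>bicrossed\<^esub> a = \<one>\<^bsub>bicrossed\<^esub>" if a: "a \<in> carrier bicrossed" for a
  proof -
    obtain x g where xg: "a = (x, g)" "x \<in> carrier F" "g \<in> carrier G" using a by auto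
    let ?h = "ract (inv\<^bsub>G\<^esub> g) (inv\<^bsub>F\<^esub> x)"
    have "(inv\<^bsub>F\<^esub> (lact ?h x), ?h) \<otimes>\<^bsub>bicrossed\<^esub> a = \<one>\<^bsub>bicrossed\<^esub>"
      using xg by (simp add: ract_inv)
    moreover have "(inv\<^bsub>F\<^esub> (lact ?h x), ?h) \<in> carrier bicrossed" using xg by simp
    ultimately show ?thesis by blast
  qed
qed auto

sublocale B: Group.group bicrossed by (rule group_bicrossed)

lemma order_bicrossed: "order bicrossed = card (carrier G) * card (carrier F)"
  by (simp add: order_def card_cartesian_product)

text \<open>The iterated coproduct of a basis element of the bismash product has factors
  \<open>b (g_k, y_(k+1))\<close> with \<open>y_k = lact g_k y_(k+1)\<close>, and their product is
  nonzero just when \<open>g_(k+1) = ract g_k y_(k+1)\<close>. Hence the first pair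
  \<open>s = (g_0, y_0)\<close> determines a nonzero term. \<open>gprod n s\<close> is
  \<open>g_0 ... g_(n-1)\<close>, whereas \<open>yprod n s\<close> is \<open>y_1 ... y_n\<close>,
  shifted by one.\<close>

primrec orbit_seq :: "nat \<Rightarrow> 'g \<times> 'f \<Rightarrow> 'g \<times> 'f"
  where
    "orbit_seq 0 s = s"
  | "orbit_seq (Suc n) s = (case orbit_seq n s of (g, y) \<Rightarrow>
      (ract g (lact (inv\<^bsub>G\<^esub> g) y), lact (inv\<^bsub>G\<^esub> g) y))"

primrec gprod :: "nat \<Rightarrow> 'g \<times> 'f \<Rightarrow> 'g"
  where
    "gprod 0 s = \<one>\<^bsub>G\<^esub>"
  | "gprod (Suc n) s = gprod n s \<otimes>\<^bsub>G\<^esub> fst (orbit_seq n s)"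

primrec yprod :: "nat \<Rightarrow> 'g \<times> 'f \<Rightarrow> 'f"
  where
    "yprod 0 s = \<one>\<^bsub>F\<^esub>"
  | "yprod (Suc n) s = yprod n s \<otimes>\<^bsub>F\<^esub> snd (orbit_seq (Suc n) s)"

lemma orbit_seq_closed:
  assumes "s \<in> carrier G \<times> carrier F"
  shows "orbit_seq n s \<in> carrier G \<times> carrier F"
  by (induction n) (use assms in \<open>auto split: prod.split\<close>)

lemma orbit_seq_closed' [simp]:
  assumes "s \<in> carrier G \<times> carrier F"
  shows "fst (orbit_seq n s) \<in> carrier G" "snd (orbit_seq n s) \<in> carrier F"
  using orbit_seq_closed[OF assms, of n] by auto

lemma orbit_seq_Suc:
  "snd (orbit_seq (Suc n) s) = lact (inv\<^bsub>G\<^esub> (fst (orbit_seq n s))) (snd (orbit_seq n s))"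
  "fst (orbit_seq (Suc n) s) = ract (fst (orbit_seq n s)) (snd (orbit_seq (Suc n) s))"
  by (simp_all split: prod.split)

declare orbit_seq.simps(2) [simp del]

lemma prod_closed [simp]:
  assumes "s \<in> carrier G \<times> carrier F"
  shows "gprod n s \<in> carrier G" "yprod n s \<in> carrier F"
  by (induction n) (use assms in auto)

lemma ract_yprod:
  assumes s: "s \<in> carrier G \<times> carrier F"
  shows "ract (fst s) (yprod n s) = fst (orbit_seq n s)"
proof (induction n)
  case (Suc n)
  moreover have "fst s \<in> carrier G" using s by auto
  ultimately show ?case
    using s by (simp add: ract_mult orbit_seq_Suc(2))
qed (use s in auto)

text \<open>In the bicrossed product \<open>g_k y_(k+1) = y_k g_(k+1)\<close>, so
  \<open>g_0 y_1 ... y_n = y_0 ... y_(n-1) g_n\<close>. The right-hand side is the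
  \<open>F\<close>-part \<open>y_0 ... y_(n-1)\<close>, expressed through
  \<open>yprod\<close>.\<close>

lemma lact_yprod:
  assumes s: "s \<in> carrier G \<times> carrier F"
  shows "lact (fst s) (yprod n s) = snd s \<otimes>\<^bsub>F\<^esub> yprod n s \<otimes>\<^bsub>F\<^esub> inv\<^bsub>F\<^esub> (snd (orbit_seq n s))"
proof (induction n)
  case 0
  have "fst s \<in> carrier G" "snd s \<in> carrier F" using s by auto
  then show ?case by simp
next
  case (Suc n)
  have [simp]: "fst s \<in> carrier G" "snd s \<in> carrier F" using s by auto
  have "lact (fst (orbit_seq n s)) (snd (orbit_seq (Suc n) s)) = snd (orbit_seq n s)"
    unfolding orbit_seq_Suc(1) using s by (intro lact_inv) simp_all
  then have "lact (fst s) (yprod (Suc n) s)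
      = snd s \<otimes>\<^bsub>F\<^esub> yprod n s \<otimes>\<^bsub>F\<^esub> inv\<^bsub>F\<^esub> (snd (orbit_seq n s)) \<otimes>\<^bsub>F\<^esub> snd (orbit_seq n s)"
    using s by (simp add: lact_F Suc ract_yprod)
  then show ?case
    using s by (simp add: F.m_assoc)
qed

text \<open>Put \<open>a_k = y_k^(-1) g_k\<close> and \<open>Y_n = y_1 ... y_n\<close>. Then
  \<open>a_0 Y_n = Y_n a_n\<close> and \<open>a_n y_(n+1) = g_(n+1)\<close>, so every further factor
  \<open>a_0\<close>, moved through \<open>Y_n\<close>, contributes one \<open>g_(n+1)\<close>. The
  result is \<open>g_1 ... g_n\<close>.\<close>

lemma bicrossed_pow:
  assumes s: "s \<in> carrier G \<times> carrier F"
  shows "(inv\<^bsub>F\<^esub> (snd s), fst s) [^]\<^bsub>bicrossed\<^esub> n \<otimes>\<^bsub>bicrossed\<^esub> (yprod n s, \<one>\<^bsub>G\<^esub>)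
    = (\<one>\<^bsub>F\<^esub>, inv\<^bsub>G\<^esub> (fst s) \<otimes>\<^bsub>G\<^esub> gprod n s \<otimes>\<^bsub>G\<^esub> fst (orbit_seq n s))"
proof (induction n)
  case 0
  then show ?case using s by auto
next
  case (Suc n)
  let ?a = "(inv\<^bsub>F\<^esub> (snd s), fst s)"
  let ?g = "\<lambda>n. fst (orbit_seq n s)" and ?y = "\<lambda>n. snd (orbit_seq n s)" and ?Y = "\<lambda>n. (yprod n s, \<one>\<^bsub>G\<^esub>)"
  have [simp]: "fst s \<in> carrier G" "snd s \<in> carrier F" using s by auto
  have a: "?a \<in> carrier bicrossed" by simp
  have "?a \<otimes>\<^bsub>bicrossed\<^esub> ?Y n = ?Y n \<otimes>\<^bsub>bicrossed\<^esub> (inv\<^bsub>F\<^esub> (?y n), ?g n)"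
    using s by (simp add: lact_yprod ract_yprod F.m_assoc[symmetric])
  moreover have "(inv\<^bsub>F\<^esub> (?y n), ?g n) \<otimes>\<^bsub>bicrossed\<^esub> (?y (Suc n), \<one>\<^bsub>G\<^esub>) = (\<one>\<^bsub>F\<^esub>, ?g (Suc n))"
  proof -
    have "lact (?g n) (?y (Suc n)) = ?y n"
      unfolding orbit_seq_Suc(1) using s by (intro lact_inv) simp_all
    then show ?thesis using s by (simp add: orbit_seq_Suc(2))
  qed
  moreover have "?Y (Suc n) = ?Y n \<otimes>\<^bsub>bicrossed\<^esub> (?y (Suc n), \<one>\<^bsub>G\<^esub>)"
    using s by simp
  moreover have mem: "?a [^]\<^bsub>bicrossed\<^esub> n \<in> carrier bicrossed" "?Y n \<in> carrier bicrossed"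
      "(?y (Suc n), \<one>\<^bsub>G\<^esub>) \<in> carrier bicrossed" "(inv\<^bsub>F\<^esub> (?y n), ?g n) \<in> carrier bicrossed"
    using s by (simp_all only: B.nat_pow_closed[OF a]) simp_all
  ultimately have "?a [^]\<^bsub>bicrossed\<^esub> Suc n \<otimes>\<^bsub>bicrossed\<^esub> ?Y (Suc n)
      = (?a [^]\<^bsub>bicrossed\<^esub> n \<otimes>\<^bsub>bicrossed\<^esub> ?Y n) \<otimes>\<^bsub>bicrossed\<^esub> (\<one>\<^bsub>F\<^esub>, ?g (Suc n))"
    using a by (metis B.m_assoc B.m_closed B.nat_pow_Suc)
  then show ?case
    using s unfolding Suc by (simp add: G.m_assoc)
qed

text \<open>If the power is trivial, comparison of the \<open>F\<close>-parts gives
  \<open>yprod n s = 1\<close>; then the orbit closes, \<open>g_n = g_0\<close>, and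
  \<open>g_1 ... g_n\<close> becomes a conjugate of \<open>gprod n s\<close>.\<close>

lemma bicrossed_pow_eq_one_iff:
  assumes s: "s \<in> carrier G \<times> carrier F"
  shows "(inv\<^bsub>F\<^esub> (snd s), fst s) [^]\<^bsub>bicrossed\<^esub> n = \<one>\<^bsub>bicrossed\<^esub> \<longleftrightarrow>
    gprod n s = \<one>\<^bsub>G\<^esub> \<and> yprod n s = \<one>\<^bsub>F\<^esub>"
proof -
  have [simp]: "fst s \<in> carrier G" "snd s \<in> carrier F" using s by auto
  let ?a = "(inv\<^bsub>F\<^esub> (snd s), fst s)"
  have a: "?a \<in> carrier bicrossed" by simp
  have aY: "?a [^]\<^bsub>bicrossed\<^esub> n \<otimes>\<^bsub>bicrossed\<^esub> (yprod n s, \<one>\<^bsub>G\<^esub>)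
    = (\<one>\<^bsub>F\<^esub>, inv\<^bsub>G\<^esub> (fst s) \<otimes>\<^bsub>G\<^esub> gprod n s \<otimes>\<^bsub>G\<^esub> fst (orbit_seq n s))"
    by (rule bicrossed_pow[OF s])
  show ?thesis
  proof
    assume "?a [^]\<^bsub>bicrossed\<^esub> n = \<one>\<^bsub>bicrossed\<^esub>"
    with aY have y: "yprod n s = \<one>\<^bsub>F\<^esub>"
        and g: "inv\<^bsub>G\<^esub> (fst s) \<otimes>\<^bsub>G\<^esub> gprod n s \<otimes>\<^bsub>G\<^esub> fst (orbit_seq n s) = \<one>\<^bsub>G\<^esub>"
      using s by auto
    have "fst (orbit_seq n s) = fst s"
      using ract_yprod[OF s, of n] y by simp
    with g have "gprod n s = \<one>\<^bsub>G\<^esub>"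
      using s by (metis G.inv_closed G.inv_equality G.m_assoc G.m_closed G.r_inv G.l_cancel_one
          \<open>fst s \<in> carrier G\<close> prod_closed(1) G.inv_inv G.inv_comm)
    with y show "gprod n s = \<one>\<^bsub>G\<^esub> \<and> yprod n s = \<one>\<^bsub>F\<^esub>" by simp
  next
    assume *: "gprod n s = \<one>\<^bsub>G\<^esub> \<and> yprod n s = \<one>\<^bsub>F\<^esub>"
    then have "fst (orbit_seq n s) = fst s"
      using ract_yprod[OF s, of n] by simp
    then have "?a [^]\<^bsub>bicrossed\<^esub> n \<otimes>\<^bsub>bicrossed\<^esub> \<one>\<^bsub>bicrossed\<^esub> = \<one>\<^bsub>bicrossed\<^esub>"
      using aY * by simp
    then show "?a [^]\<^bsub>bicrossed\<^esub> n = \<one>\<^bsub>bicrossed\<^esub>"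
      using a by (metis B.nat_pow_closed B.r_one)
  qed
qed

lemma card_torsion_bicrossed:
  "card (torsion bicrossed n)
    = card {s \<in> carrier G \<times> carrier F. gprod n s = \<one>\<^bsub>G\<^esub> \<and> yprod n s = \<one>\<^bsub>F\<^esub>}"
proof (rule bij_betw_same_card[symmetric],
    rule bij_betw_byWitness[where f = "\<lambda>s. (inv\<^bsub>F\<^esub> (snd s), fst s)" and f' = "\<lambda>a. (snd a, inv\<^bsub>F\<^esub> (fst a))"])
  let ?S = "{s \<in> carrier G \<times> carrier F. gprod n s = \<one>\<^bsub>G\<^esub> \<and> yprod n s = \<one>\<^bsub>F\<^esub>}"
  show "(\<lambda>s. (inv\<^bsub>F\<^esub> (snd s), fst s)) ` ?S \<subseteq> torsion bicrossed n"
    using bicrossed_pow_eq_one_iff by (auto simp: torsion_def)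
  show "(\<lambda>a. (snd a, inv\<^bsub>F\<^esub> (fst a))) ` torsion bicrossed n \<subseteq> ?S"
  proof
    fix s assume "s \<in> (\<lambda>a. (snd a, inv\<^bsub>F\<^esub> (fst a))) ` torsion bicrossed n"
    then obtain a where a: "a \<in> torsion bicrossed n" "s = (snd a, inv\<^bsub>F\<^esub> (fst a))" by blast
    then have "s \<in> carrier G \<times> carrier F" "(inv\<^bsub>F\<^esub> (snd s), fst s) = a"
      by (auto simp: torsion_def)
    then show "s \<in> ?S"
      using bicrossed_pow_eq_one_iff[of s n] a(1) by (simp add: torsion_def)
  qed
qed (auto simp: torsion_def)

end

section \<open>Sweedler powers, integral and indicator of a bismash product\<close>

locale bismash = hopf_algebra \<Delta> \<epsilon> S + matched_pair_groups F G ract lact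
  for \<Delta> :: "'a::complex_algebra_1 \<Rightarrow> 'a \<otimes>\<^sub>C 'a" and \<epsilon> S
    and F :: "'f monoid" and G :: "'g monoid" and ract lact +
  fixes e :: "'g \<Rightarrow> 'a" and u :: "'f \<Rightarrow> 'a"
  assumes inj: "inj_on (\<lambda>(g, x). e g * u x) (carrier G \<times> carrier F)"
    and indep: "cvec.independent ((\<lambda>(g, x). e g * u x) ` (carrier G \<times> carrier F))"
    and spans: "cvec.span ((\<lambda>(g, x). e g * u x) ` (carrier G \<times> carrier F)) = UNIV"
    and e_e: "g \<in> carrier G \<Longrightarrow> h \<in> carrier G \<Longrightarrow> e g * e h = (if g = h then e g else 0)"
    and sum_e: "(\<Sum>g\<in>carrier G. e g) = 1"
    and u_u: "x \<in> carrier F \<Longrightarrow> y \<in> carrier F \<Longrightarrow> u x * u y = u (x \<otimes>\<^bsub>F\<^esub> y)"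
    and u_one: "u \<one>\<^bsub>F\<^esub> = 1"
    and u_e: "x \<in> carrier F \<Longrightarrow> g \<in> carrier G \<Longrightarrow> u x * e g = e (ract g (inv\<^bsub>F\<^esub> x)) * u x"
    and comult_u: "x \<in> carrier F \<Longrightarrow> \<Delta> (u x) =
        (\<Sum>g\<in>carrier G. \<Sum>h\<in>carrier G. (e g * u (lact h x)) \<otimes>\<^sub>C (e h * u x))"
    and comult_e: "g \<in> carrier G \<Longrightarrow> \<Delta> (e g) =
        (\<Sum>h\<in>carrier G. e (g \<otimes>\<^bsub>G\<^esub> inv\<^bsub>G\<^esub> h) \<otimes>\<^sub>C e h)"
begin

abbreviation "GF \<equiv> carrier G \<times> carrier F"

definition "b = (\<lambda>(g, x). e g * u x)"

definition "coord i = (\<lambda>h. cvec.representation (b ` GF) h (b i))"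

lemma finGF: "finite GF" using finF finG by simp

sublocale algebra_coordinates GF b coord
  unfolding algebra_coordinates_def coord_def b_def
  by (rule coordinates_of_basis) (use finF finG inj indep spans in auto)

lemma b_mult:
  assumes "g \<in> carrier G" "h \<in> carrier G" "x \<in> carrier F" "y \<in> carrier F"
  shows "b (g, x) * b (h, y) = (if h = ract g x then b (g, x \<otimes>\<^bsub>F\<^esub> y) else 0)"
proof -
  have "b (g, x) * b (h, y) = e g * (u x * e h) * u y"
    by (simp add: b_def mult.assoc)
  also have "\<dots> = (e g * e (ract h (inv\<^bsub>F\<^esub> x))) * (u x * u y)"
    by (simp add: u_e assms mult.assoc)
  also have "\<dots> = (if g = ract h (inv\<^bsub>F\<^esub> x) then e g else 0) * u (x \<otimes>\<^bsub>F\<^esub> y)"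
    by (simp add: e_e u_u assms)
  also have "g = ract h (inv\<^bsub>F\<^esub> x) \<longleftrightarrow> h = ract g x"
    using assms ract_inv by metis
  finally show ?thesis by (simp add: b_def)
qed

lemma comult_b:
  assumes g: "g \<in> carrier G" and x: "x \<in> carrier F"
  shows "\<Delta> (b (g, x)) = (\<Sum>h\<in>carrier G. b (g \<otimes>\<^bsub>G\<^esub> inv\<^bsub>G\<^esub> h, lact h x) \<otimes>\<^sub>C b (h, x))"
proof -
  have ee: "e h * (e k * w) = (if h = k then e h * w else 0)" if "h \<in> carrier G" "k \<in> carrier G" for h k w
    using that by (simp add: e_e flip: mult.assoc)
  have "\<Delta> (b (g, x)) = (\<Sum>h\<in>carrier G. \<Sum>k\<in>carrier G. \<Sum>l\<in>carrier G.
      (e (g \<otimes>\<^bsub>G\<^esub> inv\<^bsub>G\<^esub> h) * (e k * u (lact l x))) \<otimes>\<^sub>C (e h * (e l * u x)))"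
    unfolding b_def prod.case comult_mult comult_e[OF g] comult_u[OF x] tensor_mult_sum_left
    by (simp only: tensor_mult_sum_right tensor_mult_elem)
  also have "\<dots> = (\<Sum>h\<in>carrier G. \<Sum>k\<in>carrier G. \<Sum>l\<in>carrier G. if l = h then
      (if k = g \<otimes>\<^bsub>G\<^esub> inv\<^bsub>G\<^esub> h then (e k * u (lact l x)) \<otimes>\<^sub>C (e l * u x) else 0) else 0)"
    using assms by (intro sum.cong refl) (simp add: ee)
  also have "\<dots> = (\<Sum>h\<in>carrier G. b (g \<otimes>\<^bsub>G\<^esub> inv\<^bsub>G\<^esub> h, lact h x) \<otimes>\<^sub>C b (h, x))"
    using assms finG by (simp add: b_def cong: sum.cong)
  finally show ?thesis .
qed

text \<open>The isomorphism is described without the counit, which is recovered by comparing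
  coefficients of \<open>b (1, x)\<close> in the left counit axiom.\<close>

lemma counit_b:
  assumes g: "g \<in> carrier G" and x: "x \<in> carrier F"
  shows "\<epsilon> (b (g, x)) = (if g = \<one>\<^bsub>G\<^esub> then 1 else 0)"
proof -
  note lin = clinear_tensor_lift[OF counit_left_lift]
  have one: "(\<one>\<^bsub>G\<^esub>, x) \<in> GF" using x by simp
  have "b (g, x) = (\<Sum>h\<in>carrier G. \<epsilon> (b (g \<otimes>\<^bsub>G\<^esub> inv\<^bsub>G\<^esub> h, lact h x)) *\<^sub>C b (h, x))"
    using counit_left[of "b (g, x)"] assms
    by (simp add: comult_b clinear_sum[OF lin] tensor_lift_elem[OF counit_left_lift])
  then have "coord (\<one>\<^bsub>G\<^esub>, x) (b (g, x))
      = (\<Sum>h\<in>carrier G. \<epsilon> (b (g \<otimes>\<^bsub>G\<^esub> inv\<^bsub>G\<^esub> h, lact h x)) * coord (\<one>\<^bsub>G\<^esub>, x) (b (h, x)))"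
    by (simp add: coord_simps[OF one])
  also have "\<dots> = (\<Sum>h\<in>carrier G. if h = \<one>\<^bsub>G\<^esub> then \<epsilon> (b (g \<otimes>\<^bsub>G\<^esub> inv\<^bsub>G\<^esub> h, lact h x)) else 0)"
    using x by (intro sum.cong) (auto simp: coord_basis[OF one])
  also have "\<dots> = \<epsilon> (b (g, x))"
    using assms finG by simp
  finally show ?thesis
    using assms by (auto simp: coord_basis[OF one] split: if_splits)
qed

text \<open>Multiplication by the last coproduct factor \<open>b (h, x)\<close> keeps only the terms
  in which \<open>h\<close> is the current entry \<open>g_n\<close>; the first coproduct factor then
  makes \<open>x\<close> the next entry \<open>y_(n+1)\<close>. So the parametrisation by orbits
  extends by one step.\<close>

lemma sweedler_power_b:
  assumes "g \<in> carrier G" "x \<in> carrier F"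
  shows "sweedler_power \<Delta> \<epsilon> n (b (g, x))
    = (\<Sum>s\<in>GF. if gprod n s = g \<and> snd (orbit_seq n s) = x then b (fst s, yprod n s) else 0)"
  using assms
proof (induction n arbitrary: g x)
  case 0
  have "(\<Sum>s\<in>GF. if gprod 0 s = g \<and> snd (orbit_seq 0 s) = x then b (fst s, yprod 0 s) else 0)
      = (\<Sum>h\<in>carrier G. \<Sum>y\<in>carrier F. if y = x then (if g = \<one>\<^bsub>G\<^esub> then e h else 0) else 0)"
    by (subst sum.cartesian_product) (auto intro!: sum.cong simp: b_def u_one)
  also have "\<dots> = (if g = \<one>\<^bsub>G\<^esub> then 1 else 0)"
    using 0 finF by (simp add: sum_e)
  finally show ?case
    using 0 by (simp add: counit_b scaleC_one)
next
  case (Suc n)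
  have "sweedler_power \<Delta> \<epsilon> (Suc n) (b (g, x))
      = (\<Sum>h\<in>carrier G. sweedler_power \<Delta> \<epsilon> n (b (g \<otimes>\<^bsub>G\<^esub> inv\<^bsub>G\<^esub> h, lact h x)) * b (h, x))"
    using Suc.prems by (simp add: comult_b sweedler_lift_simps)
  also have "\<dots> = (\<Sum>h\<in>carrier G. \<Sum>s\<in>GF.
      (if gprod n s = g \<otimes>\<^bsub>G\<^esub> inv\<^bsub>G\<^esub> h \<and> snd (orbit_seq n s) = lact h x
        then b (fst s, yprod n s) else 0) * b (h, x))"
    using Suc.prems by (simp add: Suc.IH sum_distrib_right)
  also have "\<dots> = (\<Sum>h\<in>carrier G. \<Sum>s\<in>GF. if h = fst (orbit_seq n s) then
      (if gprod n s = g \<otimes>\<^bsub>G\<^esub> inv\<^bsub>G\<^esub> h \<and> snd (orbit_seq n s) = lact h x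
        then b (fst s, yprod n s \<otimes>\<^bsub>F\<^esub> x) else 0) else 0)"
  proof (intro sum.cong refl)
    fix h s assume h: "h \<in> carrier G" and s: "s \<in> GF"
    then have "fst s \<in> carrier G" by auto
    then have "b (fst s, yprod n s) * b (h, x)
        = (if h = fst (orbit_seq n s) then b (fst s, yprod n s \<otimes>\<^bsub>F\<^esub> x) else 0)"
      using b_mult[of "fst s" h "yprod n s" x] h s Suc.prems by (simp add: ract_yprod)
    then show "(if gprod n s = g \<otimes>\<^bsub>G\<^esub> inv\<^bsub>G\<^esub> h \<and> snd (orbit_seq n s) = lact h x
        then b (fst s, yprod n s) else 0) * b (h, x) = (if h = fst (orbit_seq n s) then
      (if gprod n s = g \<otimes>\<^bsub>G\<^esub> inv\<^bsub>G\<^esub> h \<and> snd (orbit_seq n s) = lact h x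
        then b (fst s, yprod n s \<otimes>\<^bsub>F\<^esub> x) else 0) else 0)"
      by (cases "h = fst (orbit_seq n s)") simp_all
  qed
  also have "\<dots> = (\<Sum>s\<in>GF. if gprod n s = g \<otimes>\<^bsub>G\<^esub> inv\<^bsub>G\<^esub> (fst (orbit_seq n s)) \<and>
      snd (orbit_seq n s) = lact (fst (orbit_seq n s)) x then b (fst s, yprod n s \<otimes>\<^bsub>F\<^esub> x) else 0)"
    using finG by (subst sum.swap) (simp cong: sum.cong)
  also have "\<dots> = (\<Sum>s\<in>GF. if gprod (Suc n) s = g \<and> snd (orbit_seq (Suc n) s) = x
      then b (fst s, yprod (Suc n) s) else 0)"
  proof (rule sum.cong[OF refl])
    fix s assume s: "s \<in> GF"
    let ?g = "fst (orbit_seq n s)" and ?y = "snd (orbit_seq n s)"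
    have "gprod n s = g \<otimes>\<^bsub>G\<^esub> inv\<^bsub>G\<^esub> ?g \<longleftrightarrow> gprod (Suc n) s = g"
      using s Suc.prems by (auto simp: G.inv_solve_right)
    moreover have "?y = lact ?g x \<longleftrightarrow> snd (orbit_seq (Suc n) s) = x"
      unfolding orbit_seq_Suc using s Suc.prems lact_inv[of ?g ?y] lact_inv[of ?g x] by auto
    ultimately show "(if gprod n s = g \<otimes>\<^bsub>G\<^esub> inv\<^bsub>G\<^esub> ?g \<and> ?y = lact ?g x
        then b (fst s, yprod n s \<otimes>\<^bsub>F\<^esub> x) else 0)
      = (if gprod (Suc n) s = g \<and> snd (orbit_seq (Suc n) s) = x then b (fst s, yprod (Suc n) s) else 0)"
      by auto
  qed
  finally show ?case .
qed

lemma sum_translate_left: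
  assumes "y \<in> carrier F"
  shows "(\<Sum>x\<in>carrier F. f (y \<otimes>\<^bsub>F\<^esub> x)) = (\<Sum>x\<in>carrier F. f x)"
  by (rule sum.reindex_bij_witness[of _ "\<lambda>x. inv\<^bsub>F\<^esub> y \<otimes>\<^bsub>F\<^esub> x" "\<lambda>x. y \<otimes>\<^bsub>F\<^esub> x"])
    (use assms in \<open>auto simp: F.m_assoc[symmetric]\<close>)

lemma sum_translate_right:
  assumes "y \<in> carrier F"
  shows "(\<Sum>x\<in>carrier F. f (x \<otimes>\<^bsub>F\<^esub> y)) = (\<Sum>x\<in>carrier F. f x)"
  by (rule sum.reindex_bij_witness[of _ "\<lambda>x. x \<otimes>\<^bsub>F\<^esub> inv\<^bsub>F\<^esub> y" "\<lambda>x. x \<otimes>\<^bsub>F\<^esub> y"])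
    (use assms in \<open>auto simp: F.m_assoc\<close>)

lemma card_F: "(of_nat (card (carrier F)) :: complex) \<noteq> 0"
  using finF by auto

definition "\<Lambda> = (1 / of_nat (card (carrier F))) *\<^sub>C (\<Sum>x\<in>carrier F. b (\<one>\<^bsub>G\<^esub>, x))"

lemma normalized_integral: "normalized_integral \<epsilon> = \<Lambda>"
proof (rule normalized_integral_eq)
  show "\<epsilon> \<Lambda> = 1"
    using card_F by (simp add: \<Lambda>_def counit_simps counit_b)
  have left: "b i * \<Lambda> = \<epsilon> (b i) *\<^sub>C \<Lambda>" if iGF: "i \<in> GF" for i
  proof -
    obtain g y where i: "i = (g, y)" "g \<in> carrier G" "y \<in> carrier F" using iGF by auto
    have "\<one>\<^bsub>G\<^esub> = ract g y \<longleftrightarrow> g = \<one>\<^bsub>G\<^esub>"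
      using i ract_inv(1)[of g y] by (metis F.inv_closed ract_unit)
    then show ?thesis
      using i by (simp add: \<Lambda>_def scaleC_mult_right sum_distrib_left b_mult counit_b scaleC_scaleC
          scaleC_one sum_translate_left[where f = "\<lambda>x. b (\<one>\<^bsub>G\<^esub>, x)"] cong: sum.cong)
  qed
  have right: "\<Lambda> * b i = \<epsilon> (b i) *\<^sub>C \<Lambda>" if iGF: "i \<in> GF" for i
  proof -
    obtain g y where i: "i = (g, y)" "g \<in> carrier G" "y \<in> carrier F" using iGF by auto
    then show ?thesis
      by (simp add: \<Lambda>_def scaleC_mult_left sum_distrib_right b_mult counit_b scaleC_scaleC
          scaleC_one sum_translate_right[where f = "\<lambda>x. b (\<one>\<^bsub>G\<^esub>, x)"] cong: sum.cong)
  qed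
  show "integral_elem \<epsilon> \<Lambda>"
    by (rule integral_elem_of_span[OF span_basis]) (use left right in auto)
qed

lemma regular_character_b:
  assumes p: "p \<in> carrier G" and y: "y \<in> carrier F"
  shows "regular_character (b (p, y)) = (if y = \<one>\<^bsub>F\<^esub> then of_nat (card (carrier F)) else 0)"
proof -
  have "coord i (b (p, y) * b i) = (if fst i = p \<and> y = \<one>\<^bsub>F\<^esub> then 1 else 0)" if i: "i \<in> GF" for i
  proof -
    obtain h z where hz: "i = (h, z)" "h \<in> carrier G" "z \<in> carrier F" using i by auto
    have "y \<otimes>\<^bsub>F\<^esub> z = z \<longleftrightarrow> y = \<one>\<^bsub>F\<^esub>" using hz y by auto
    moreover have "coord (h, z) 0 = 0" using coord_simps(4)[OF i] hz by simp
    ultimately show ?thesis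
      using hz p y by (auto simp: b_mult coord_basis)
  qed
  then have "regular_character (b (p, y)) = (\<Sum>i\<in>GF. if fst i = p \<and> y = \<one>\<^bsub>F\<^esub> then 1 else 0)"
    unfolding regular_character_eq by (rule sum.cong[OF refl])
  also have "\<dots> = (\<Sum>h\<in>carrier G. \<Sum>z\<in>carrier F. if h = p then (if y = \<one>\<^bsub>F\<^esub> then 1 else 0) else 0)"
    by (subst sum.cartesian_product) (auto intro!: sum.cong)
  also have "\<dots> = (if y = \<one>\<^bsub>F\<^esub> then of_nat (card (carrier F)) else 0)"
    using finG p by (simp add: if_distrib[of "times _"] cong: if_cong)
  finally show ?thesis .
qed

text \<open>Averaging over \<open>x\<close> in the integral removes the condition on the last orbit
  entry, and the character keeps the terms with trivial \<open>F\<close>-part. What remains are the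
  \<open>s\<close> with both products trivial.\<close>

lemma FS_indicator_eq: "FS_indicator \<Delta> \<epsilon> n = of_nat (card (torsion bicrossed n))"
proof -
  have "sweedler_power \<Delta> \<epsilon> n \<Lambda> = (1 / of_nat (card (carrier F))) *\<^sub>C (\<Sum>x\<in>carrier F. \<Sum>s\<in>GF.
      if gprod n s = \<one>\<^bsub>G\<^esub> \<and> snd (orbit_seq n s) = x then b (fst s, yprod n s) else 0)"
    by (simp add: \<Lambda>_def sweedler_power_simps sweedler_power_b)
  also have "(\<Sum>x\<in>carrier F. \<Sum>s\<in>GF.
      if gprod n s = \<one>\<^bsub>G\<^esub> \<and> snd (orbit_seq n s) = x then b (fst s, yprod n s) else 0)
    = (\<Sum>s\<in>GF. \<Sum>x\<in>carrier F. if snd (orbit_seq n s) = x then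
      (if gprod n s = \<one>\<^bsub>G\<^esub> then b (fst s, yprod n s) else 0) else 0)"
    by (subst sum.swap) (auto intro!: sum.cong)
  also have "\<dots> = (\<Sum>s\<in>GF. if gprod n s = \<one>\<^bsub>G\<^esub> then b (fst s, yprod n s) else 0)"
    using finF by (intro sum.cong) auto
  finally have "FS_indicator \<Delta> \<epsilon> n = (1 / of_nat (card (carrier F))) *
      (\<Sum>s\<in>GF. regular_character (if gprod n s = \<one>\<^bsub>G\<^esub> then b (fst s, yprod n s) else 0))"
    by (simp add: FS_indicator_def normalized_integral regular_character_simps)
  also have "(\<Sum>s\<in>GF. regular_character (if gprod n s = \<one>\<^bsub>G\<^esub> then b (fst s, yprod n s) else 0))
    = (\<Sum>s\<in>GF. if gprod n s = \<one>\<^bsub>G\<^esub> \<and> yprod n s = \<one>\<^bsub>F\<^esub> then of_nat (card (carrier F)) else 0)"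
    by (intro sum.cong) (auto simp: regular_character_b regular_character_simps)
  also have "\<dots> = of_nat (card {s \<in> GF. gprod n s = \<one>\<^bsub>G\<^esub> \<and> yprod n s = \<one>\<^bsub>F\<^esub>}) * of_nat (card (carrier F))"
    using finGF by (simp add: sum.If_cases Int_def)
  finally show ?thesis
    using card_F by (simp add: card_torsion_bicrossed)
qed

lemma Frobenius_theorem: "Frobenius_theorem_holds \<Delta> \<epsilon>"
  unfolding Frobenius_theorem_holds_def
proof (intro allI impI)
  fix n :: nat assume "n > 0" and "n dvd cvec.dim (UNIV :: 'a set)"
  then have "n dvd order bicrossed"
    by (simp add: dim_eq card_cartesian_product order_bicrossed)
  then have "n dvd card (torsion bicrossed n)"
    using finF finG by (intro frobenius_dvd_card_torsion group_bicrossed) simp_all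
  then obtain k where "card (torsion bicrossed n) = n * k" by blast
  then have "FS_indicator \<Delta> \<epsilon> n = of_nat n * of_nat k"
    by (simp add: FS_indicator_eq)
  moreover have "algebraic_int (of_nat k :: complex)"
    by (rule int_imp_algebraic_int) simp
  ultimately show "\<exists>z. algebraic_int z \<and> FS_indicator \<Delta> \<epsilon> n = of_nat n * z" by blast
qed

end

lemma Frobenius_theorem_bismash_product:
  assumes "hopf_algebra \<Delta> \<epsilon> S" "matched_pair F G ract lact" "iso_bismash_product F G ract lact \<Delta>"
  shows "Frobenius_theorem_holds \<Delta> \<epsilon>"
proof -
  obtain e u where "bismash \<Delta> \<epsilon> S F G ract lact e u"
    using assms unfolding iso_bismash_product_def bismash_def matched_pair_groups_def bismash_axioms_def by blast
  then show ?thesis by (rule bismash.Frobenius_theorem)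
qed

section \<open>Extensions of the functions on a finite torus\<close>

lemma power_int_cong_of_root_of_unity:
  fixes \<xi> :: complex
  assumes "\<xi> ^ N = 1" "N > 0" "[a = b] (mod int N)"
  shows "\<xi> powi a = \<xi> powi b"
proof -
  have "\<xi> \<noteq> 0" using assms by (metis power_eq_0_iff zero_neq_one)
  obtain k where "a = b + int N * k"
    using assms(3) by (metis cong_iff_lin cong_sym)
  then show ?thesis
    using \<open>\<xi> \<noteq> 0\<close> assms(1) by (simp add: power_int_add power_int_mult)
qed

lemma sum_residues_shift:
  fixes f :: "int \<Rightarrow> 'a::comm_monoid_add"
  assumes per: "\<And>s. f (s mod int N) = f s"
  shows "(\<Sum>s\<in>{0..<int N}. f (s + c)) = (\<Sum>s\<in>{0..<int N}. f s)"
proof (rule sum.reindex_bij_witness[of _ "\<lambda>s. (s - c) mod int N" "\<lambda>s. (s + c) mod int N"])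
  fix s assume "s \<in> {0..<int N}"
  then show "((s + c) mod int N - c) mod int N = s" "((s - c) mod int N + c) mod int N = s"
    "(s + c) mod int N \<in> {0..<int N}" "(s - c) mod int N \<in> {0..<int N}"
    by (simp_all add: mod_simps)
  show "f ((s + c) mod int N) = f (s + c)" by (rule per)
qed

lemma dvd_mult_iff_gcd:
  fixes m n s :: int
  assumes "n > 0"
  shows "n dvd m * s \<longleftrightarrow> n div gcd m n dvd s"
proof -
  have g: "gcd m n > 0" using assms by (simp add: gcd_pos_int)
  define a b where "a = m div gcd m n" and "b = n div gcd m n"
  have ab: "m = gcd m n * a" "n = gcd m n * b" by (simp_all add: a_def b_def)
  have "coprime a b" unfolding a_def b_def using assms by (intro div_gcd_coprime) auto
  have "n dvd m * s \<longleftrightarrow> gcd m n * b dvd gcd m n * (a * s)"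
    using ab by (metis mult.assoc)
  also have "\<dots> \<longleftrightarrow> b dvd s"
    using g assms \<open>coprime a b\<close> by (auto simp: coprime_dvd_mult_right_iff coprime_commute)
  finally show ?thesis by (simp add: b_def)
qed

text \<open>As \<open>m div d\<close> is prime to \<open>N div d\<close>, the residues annihilated
  by \<open>m\<close> are the \<open>d\<close> multiples of \<open>N div d\<close>.\<close>

lemma sum_annihilator:
  fixes g :: "int \<Rightarrow> 'a::comm_monoid_add" and m :: int
  assumes N: "N > 0"
  defines "d \<equiv> gcd m (int N)"
  shows "(\<Sum>s\<in>{0..<int N}. if int N dvd m * s then g s else 0) = (\<Sum>j\<in>{0..<d}. g (int N div d * j))"
proof -
  have d: "d > 0" "d dvd int N" using N by (simp_all add: d_def gcd_pos_int)
  then obtain b where b: "int N = d * b" by blast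
  have b0: "b > 0" using b d N by (metis of_nat_0_less_iff zero_less_mult_pos)
  have bd: "int N div d = b" using b d by simp
  have iff: "int N dvd m * s \<longleftrightarrow> b dvd s" for s
    using dvd_mult_iff_gcd[of "int N" m s] N bd by (simp add: d_def)
  have "(\<Sum>s\<in>{0..<int N}. if int N dvd m * s then g s else 0) = (\<Sum>s\<in>{s \<in> {0..<int N}. b dvd s}. g s)"
    unfolding iff by (rule sum.inter_filter[symmetric]) simp
  also have "\<dots> = (\<Sum>j\<in>{0..<d}. g (b * j))"
  proof (rule sum.reindex_bij_witness[of _ "\<lambda>j. b * j" "\<lambda>s. s div b"])
    fix s assume "s \<in> {s \<in> {0..<int N}. b dvd s}"
    then obtain j where "s = b * j" "0 \<le> b * j" "b * j < d * b" unfolding b by auto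
    then show "b * (s div b) = s" "s div b \<in> {0..<d}" "g (b * (s div b)) = g s"
      using b0 by (auto simp: zero_le_mult_iff mult.commute[of d])
  next
    fix j assume "j \<in> {0..<d}"
    then show "b * j div b = j" "b * j \<in> {s \<in> {0..<int N}. b dvd s}"
      using b0 b by (auto simp: mult.commute[of d])
  qed
  finally show ?thesis by (simp add: bd)
qed

lemma card_annihilator:
  assumes "N > 0"
  shows "(\<Sum>s\<in>{0..<int N}. if int N dvd m * s then 1 else 0) = (of_int (gcd m (int N)) :: 'a::ring_1)"
  using sum_annihilator[OF assms, of m "\<lambda>_. 1::'a"] by simp

lemma sum_delta_pair:
  assumes "finite A" "finite B" "a \<in> A" "b \<in> B"
  shows "(\<Sum>k\<in>A. \<Sum>l\<in>B. if k = a \<and> l = b then f k l else 0) = (f a b :: 'b::comm_monoid_add)"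
proof -
  have "(\<Sum>k\<in>A. \<Sum>l\<in>B. if k = a \<and> l = b then f k l else 0)
      = (\<Sum>k\<in>A. if k = a then (\<Sum>l\<in>B. if l = b then f k l else 0) else 0)"
    by (intro sum.cong) auto
  then show ?thesis using assms by simp
qed

lemma scaleC_if_mult:
  fixes v u v' :: "'a::complex_algebra_1"
  assumes "v * u = (if d then v' else 0)" "c \<Longrightarrow> d \<Longrightarrow> x * y = z"
  shows "x *\<^sub>C ((if c then y *\<^sub>C v else 0) * u) = (if d then (if c then z *\<^sub>C v' else 0) else 0)"
  using assms by (cases c; cases d) (simp_all add: scaleC_mult_left scaleC_scaleC)

lemma sum_swap_pairs:
  "(\<Sum>a\<in>A. \<Sum>b\<in>B. \<Sum>c\<in>C. \<Sum>d\<in>D. f a b c d) = (\<Sum>c\<in>C. \<Sum>d\<in>D. \<Sum>a\<in>A. \<Sum>b\<in>B. f a b c d)"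
proof -
  have "(\<Sum>a\<in>A. \<Sum>b\<in>B. \<Sum>c\<in>C. \<Sum>d\<in>D. f a b c d) = (\<Sum>a\<in>A. \<Sum>c\<in>C. \<Sum>b\<in>B. \<Sum>d\<in>D. f a b c d)"
    by (intro sum.cong refl sum.swap)
  also have "\<dots> = (\<Sum>c\<in>C. \<Sum>a\<in>A. \<Sum>d\<in>D. \<Sum>b\<in>B. f a b c d)"
    by (subst sum.swap) (intro sum.cong refl sum.swap)
  also have "\<dots> = (\<Sum>c\<in>C. \<Sum>d\<in>D. \<Sum>a\<in>A. \<Sum>b\<in>B. f a b c d)"
    by (intro sum.cong refl sum.swap)
  finally show ?thesis .
qed

text \<open>The structure shared by the two families: the functions on \<open>\<int>\<^sub>N \<times> \<int>\<^sub>N\<close> together with one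
  further generator whose coproduct is twisted by the bicharacter \<open>\<theta>\<close>. The family \<open>e\<close> is indexed
  by all integers and periodic.\<close>

locale torus_extension = hopf_algebra \<Delta> \<epsilon> S
  for \<Delta> :: "'a::complex_algebra_1 \<Rightarrow> 'a \<otimes>\<^sub>C 'a" and \<epsilon> S +
  fixes N :: nat and R :: "egen free_alg set" and \<gamma> :: "egen \<Rightarrow> 'a" and \<theta> :: complex
  assumes N_pos: "N > 0" and theta: "\<theta> ^ N = 1"
    and pres: "presented_by (egens N) R \<gamma>" and idem: "idempotent_relations N \<subseteq> R"
    and coalg: "idempotent_coalgebra N \<gamma> \<Delta> \<epsilon>"
    and comult_W: "\<Delta> (\<gamma> W) = (\<Sum>i\<in>{0..<int N}. \<Sum>j\<in>{0..<int N}. \<Sum>k\<in>{0..<int N}. \<Sum>l\<in>{0..<int N}.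
        (\<theta> powi (j * k)) *\<^sub>C ((\<gamma> (E i j) * \<gamma> W) \<otimes>\<^sub>C (\<gamma> (E k l) * \<gamma> W)))"
    and counit_W: "\<epsilon> (\<gamma> W) = 1"
begin

abbreviation "Z \<equiv> {0..<int N}"

definition e :: "int \<Rightarrow> int \<Rightarrow> 'a"
  where "e i j = \<gamma> (E (i mod int N) (j mod int N))"

abbreviation w :: 'a where "w \<equiv> \<gamma> W"

lemma mod_Z [simp]: "i mod int N \<in> Z"
  using N_pos by simp

lemma e_Z: "i \<in> Z \<Longrightarrow> j \<in> Z \<Longrightarrow> \<gamma> (E i j) = e i j"
  by (simp add: e_def)

lemma e_mod: "e (i mod int N) j = e i j" "e i (j mod int N) = e i j"
  by (simp_all add: e_def)

lemma e_cong: "[i = i'] (mod int N) \<Longrightarrow> [j = j'] (mod int N) \<Longrightarrow> e i j = e i' j'"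
  by (simp add: e_def cong_def)

lemma relation: "r \<in> R \<Longrightarrow> free_eval \<gamma> r = 0"
  by (rule presented_by_relation[OF pres])

lemma e_mult: "e i j * e k l = (if [i = k] (mod int N) \<and> [j = l] (mod int N) then e i j else 0)"
proof -
  let ?m = "\<lambda>i. i mod int N"
  have "fgen (E i j) * fgen (E k l) - (if i = k \<and> j = l then fgen (E i j) else 0) \<in> idempotent_relations N"
    if "i \<in> Z" "j \<in> Z" "k \<in> Z" "l \<in> Z" for i j k l
    using that unfolding idempotent_relations_def by blast
  then have "fgen (E (?m i) (?m j)) * fgen (E (?m k) (?m l))
      - (if ?m i = ?m k \<and> ?m j = ?m l then fgen (E (?m i) (?m j)) else 0) \<in> idempotent_relations N"
    using mod_Z by blast
  from relation[OF subsetD[OF idem this]] show ?thesis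
    by (simp add: free_eval_simps e_def cong_def split: if_splits)
qed

lemma e_mult_Z:
  assumes "i \<in> Z" "j \<in> Z" "k \<in> Z" "l \<in> Z"
  shows "e i j * e k l = (if k = i \<and> l = j then e i j else 0)"
  using assms by (auto simp: e_mult cong_def)

lemma sum_e: "(\<Sum>i\<in>Z. \<Sum>j\<in>Z. e i j) = 1"
proof -
  have "(\<Sum>i\<in>Z. \<Sum>j\<in>Z. fgen (E i j)) - 1 \<in> idempotent_relations N"
    unfolding idempotent_relations_def by simp
  from relation[OF subsetD[OF idem this]] show ?thesis
    by (simp add: free_eval_simps e_def)
qed

lemma comult_e: "\<Delta> (e i j) = (\<Sum>p\<in>Z. \<Sum>q\<in>Z. e (i - p) (j - q) \<otimes>\<^sub>C e p q)"
proof -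
  have "\<Delta> (e i j) = (\<Sum>p\<in>Z. \<Sum>q\<in>Z. \<gamma> (E ((i mod int N - p) mod int N) ((j mod int N - q) mod int N)) \<otimes>\<^sub>C \<gamma> (E p q))"
    using coalg mod_Z[of i] mod_Z[of j] by (simp only: idempotent_coalgebra_def e_def)
  also have "\<dots> = (\<Sum>p\<in>Z. \<Sum>q\<in>Z. e (i - p) (j - q) \<otimes>\<^sub>C e p q)"
    by (intro sum.cong refl) (simp add: e_def mod_simps)
  finally show ?thesis .
qed

lemma counit_e: "\<epsilon> (e i j) = (if int N dvd i \<and> int N dvd j then 1 else 0)"
  using coalg mod_Z[of i] mod_Z[of j] unfolding idempotent_coalgebra_def e_def
  by (simp add: dvd_eq_mod_eq_0)

lemma theta_cong: "[a = b] (mod int N) \<Longrightarrow> \<theta> powi a = \<theta> powi b"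
  by (rule power_int_cong_of_root_of_unity[OF theta N_pos])

lemma theta_add: "\<theta> powi (a + b) = \<theta> powi a * \<theta> powi b"
  using theta N_pos by (intro power_int_add) (metis power_eq_0_iff zero_neq_one)

lemma comult_w: "\<Delta> w = (\<Sum>i\<in>Z. \<Sum>j\<in>Z. \<Sum>k\<in>Z. \<Sum>l\<in>Z.
    (\<theta> powi (j * k)) *\<^sub>C ((e i j * w) \<otimes>\<^sub>C (e k l * w)))"
  unfolding comult_W by (intro sum.cong refl) (simp add: e_Z)

lemma sum_Z_delta2:
  assumes "a \<in> Z" "b \<in> Z" "a' \<in> Z" "b' \<in> Z"
  shows "(\<Sum>i\<in>Z. \<Sum>j\<in>Z. \<Sum>k\<in>Z. \<Sum>l\<in>Z.
      if (i = a \<and> j = b) \<and> (k = a' \<and> l = b') then f i j k l else 0) = (f a b a' b' :: 'b::comm_monoid_add)"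
proof -
  have "(\<Sum>i\<in>Z. \<Sum>j\<in>Z. \<Sum>k\<in>Z. \<Sum>l\<in>Z.
      if (i = a \<and> j = b) \<and> (k = a' \<and> l = b') then f i j k l else 0)
    = (\<Sum>i\<in>Z. \<Sum>j\<in>Z. if i = a \<and> j = b then
        (\<Sum>k\<in>Z. \<Sum>l\<in>Z. if k = a' \<and> l = b' then f i j k l else 0) else 0)"
    by (intro sum.cong) auto
  then show ?thesis using assms by (simp add: sum_delta_pair)
qed

lemma e_mult_assoc: "e i j * (e k l * x) = (if [i = k] (mod int N) \<and> [j = l] (mod int N) then e i j * x else 0)"
  by (simp add: e_mult flip: mult.assoc)

lemma e_mult_assoc_Z:
  assumes "k \<in> Z" "l \<in> Z"
  shows "e i j * (e k l * x) = (if k = i mod int N \<and> l = j mod int N then e k l * x else 0)"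
  using assms by (auto simp: e_mult_assoc cong_def e_mod)

lemma comult_ew:
  "\<Delta> (e i j * w) = (\<Sum>r\<in>Z. \<Sum>s\<in>Z.
    (\<theta> powi ((j - s) * r)) *\<^sub>C ((e (i - r) (j - s) * w) \<otimes>\<^sub>C (e r s * w)))"
proof -
  have "\<Delta> (e i j * w) = (\<Sum>r\<in>Z. \<Sum>s\<in>Z. \<Sum>i'\<in>Z. \<Sum>j'\<in>Z. \<Sum>k\<in>Z. \<Sum>l\<in>Z.
      (\<theta> powi (j' * k)) *\<^sub>C ((e (i - r) (j - s) * (e i' j' * w)) \<otimes>\<^sub>C (e r s * (e k l * w))))"
    unfolding comult_mult comult_e comult_w tensor_mult_sum_left
    by (simp only: tensor_mult_sum_right tensor_mult_bilinear tensor_mult_elem)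
  also have "\<dots> = (\<Sum>r\<in>Z. \<Sum>s\<in>Z. \<Sum>i'\<in>Z. \<Sum>j'\<in>Z. \<Sum>k\<in>Z. \<Sum>l\<in>Z.
      if (i' = (i - r) mod int N \<and> j' = (j - s) mod int N) \<and> (k = r \<and> l = s)
      then (\<theta> powi (j' * k)) *\<^sub>C ((e i' j' * w) \<otimes>\<^sub>C (e k l * w)) else 0)"
    by (intro sum.cong refl) (auto simp: e_mult_assoc_Z)
  also have "\<dots> = (\<Sum>r\<in>Z. \<Sum>s\<in>Z. (\<theta> powi (((j - s) mod int N) * r)) *\<^sub>C
      ((e (i - r) (j - s) * w) \<otimes>\<^sub>C (e r s * w)))"
    by (intro sum.cong refl) (simp only: sum_Z_delta2 mod_Z e_mod)
  also have "\<dots> = (\<Sum>r\<in>Z. \<Sum>s\<in>Z.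
    (\<theta> powi ((j - s) * r)) *\<^sub>C ((e (i - r) (j - s) * w) \<otimes>\<^sub>C (e r s * w)))"
    by (intro sum.cong refl arg_cong2[where f = scaleC] theta_cong) (simp add: cong_def mod_simps)
  finally show ?thesis .
qed

lemma counit_ew: "\<epsilon> (e i j * w) = (if int N dvd i \<and> int N dvd j then 1 else 0)"
  by (simp add: counit_mult counit_e counit_W)

text \<open>The \<open>e i j\<close> are delta functions on a commutative group, where the Sweedler
  power is the pullback along multiplication by \<open>n\<close>.\<close>

lemma sweedler_power_e:
  "sweedler_power \<Delta> \<epsilon> n (e i j) = (\<Sum>p\<in>Z. \<Sum>q\<in>Z.
    if [int n * p = i] (mod int N) \<and> [int n * q = j] (mod int N) then e p q else 0)"
proof (induction n arbitrary: i j)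
  case 0
  have "(\<Sum>p\<in>Z. \<Sum>q\<in>Z. if [0 = i] (mod int N) \<and> [0 = j] (mod int N) then e p q else 0)
      = (if int N dvd i \<and> int N dvd j then 1 else 0)"
    by (cases "int N dvd i \<and> int N dvd j") (auto simp: sum_e cong_0_iff cong_sym_eq[of 0])
  then show ?case by (simp add: counit_e scaleC_one del: of_nat_0) simp
next
  case (Suc n)
  let ?c = "\<lambda>p q i j. [int n * p = i] (mod int N) \<and> [int n * q = j] (mod int N)"
  have "sweedler_power \<Delta> \<epsilon> (Suc n) (e i j) = (\<Sum>r\<in>Z. \<Sum>s\<in>Z.
      (\<Sum>p\<in>Z. \<Sum>q\<in>Z. if ?c p q (i - r) (j - s) then e p q else 0) * e r s)"
    by (simp add: comult_e sweedler_lift_simps Suc)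
  also have "\<dots> = (\<Sum>r\<in>Z. \<Sum>s\<in>Z. \<Sum>p\<in>Z. \<Sum>q\<in>Z.
      if p = r \<and> q = s then (if ?c p q (i - p) (j - q) then e p q else 0) else 0)"
    unfolding sum_distrib_right by (intro sum.cong refl) (auto simp: e_mult_Z)
  also have "\<dots> = (\<Sum>r\<in>Z. \<Sum>s\<in>Z. if ?c r s (i - r) (j - s) then e r s else 0)"
    by (intro sum.cong refl) (simp add: sum_delta_pair)
  also have "\<dots> = (\<Sum>p\<in>Z. \<Sum>q\<in>Z.
    if [int (Suc n) * p = i] (mod int N) \<and> [int (Suc n) * q = j] (mod int N) then e p q else 0)"
  proof -
    have "[int n * p = i - p] (mod int N) \<longleftrightarrow> [int (Suc n) * p = i] (mod int N)" for p i
      by (simp add: cong_iff_dvd_diff algebra_simps)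
    then show ?thesis by simp
  qed
  finally show ?case .
qed

end

text \<open>The first two indices run over all integers and matter modulo \<open>N\<close>; the
  third is left free to record powers of the extra generator, so that both families share this
  operator.\<close>

definition idempotent_op :: "nat \<Rightarrow> int \<Rightarrow> int \<Rightarrow> (int \<times> int \<times> 'm) endo"
  where "idempotent_op N i j = monomial_op (\<lambda>k. k)
    (\<lambda>(k, l, m). if k mod int N = i \<and> l mod int N = j then 1 else 0)"

lemma free_eval_idempotent_relations:
  fixes \<rho> :: "egen \<Rightarrow> (int \<times> int \<times> 'm) endo"
  assumes N: "N > 0" and r: "r \<in> idempotent_relations N"
    and \<rho>: "\<And>i j. \<rho> (E i j) = idempotent_op N i j"
  shows "free_eval \<rho> r = 0"
proof -
  have "idempotent_op N i j * (idempotent_op N k l :: (int \<times> int \<times> 'm) endo) = (if i = k \<and> j = l then idempotent_op N i j else 0)" for i j k l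
    by (rule endo_eqI) (auto simp: idempotent_op_def app_simps app_monomial_op split: prod.split)
  moreover have "(\<Sum>i\<in>{0..<int N}. \<Sum>j\<in>{0..<int N}. idempotent_op N i j) = (1 :: (int \<times> int \<times> 'm) endo)"
  proof (rule endo_eqI, clarify)
    fix k l :: int and m :: 'm
    have "app (\<Sum>i\<in>{0..<int N}. \<Sum>j\<in>{0..<int N}. idempotent_op N i j) (Poly_Mapping.single (k, l, m) 1)
        = (\<Sum>i\<in>{0..<int N}. \<Sum>j\<in>{0..<int N}.
            if i = k mod int N \<and> j = l mod int N then Poly_Mapping.single (k, l, m) 1 else 0)"
      by (auto simp: app_sum idempotent_op_def app_monomial_op intro!: sum.cong)
    then show "app (\<Sum>i\<in>{0..<int N}. \<Sum>j\<in>{0..<int N}. idempotent_op N i j) (Poly_Mapping.single (k, l, m) 1)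
        = app 1 (Poly_Mapping.single (k, l, m) 1)"
      using N by (simp add: app_simps sum_delta_pair)
  qed
  ultimately show ?thesis
    using r by (auto simp: idempotent_relations_def free_eval_simps \<rho> split: if_splits)
qed

section \<open>The algebras of dimension twice a square\<close>

locale H2N2 = torus_extension \<Delta> \<epsilon> S N "H2N2_relations N \<xi>" \<gamma> \<xi>
  for \<Delta> :: "'a::complex_algebra_1 \<Rightarrow> 'a \<otimes>\<^sub>C 'a" and \<epsilon> S N \<gamma> \<xi>
begin

lemma w_e: "w * e i j = e j i * w"
proof -
  have "fgen W * fgen (E i j) - fgen (E j i) * fgen W \<in> H2N2_relations N \<xi>" if "i \<in> Z" "j \<in> Z" for i j
    using that unfolding H2N2_relations_def by blast
  from relation[OF this[OF mod_Z[of i] mod_Z[of j]]] show ?thesis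
    by (simp add: free_eval_simps e_def)
qed

lemma w_w: "w * w = (\<Sum>i\<in>Z. \<Sum>j\<in>Z. (\<xi> powi (i * j)) *\<^sub>C e i j)"
proof -
  have "fgen W ^ 2 - (\<Sum>i\<in>Z. \<Sum>j\<in>Z. (\<xi> powi (i * j)) *\<^sub>C fgen (E i j)) \<in> H2N2_relations N \<xi>"
    by (simp add: H2N2_relations_def)
  from relation[OF this] show ?thesis
    by (simp add: free_eval_simps e_def power2_eq_square)
qed

lemma e_w_w: "e i j * (w * w) = (\<xi> powi (i * j)) *\<^sub>C e i j"
proof -
  have "e i j * (w * w) = (\<Sum>k\<in>Z. \<Sum>l\<in>Z.
      if k = i mod int N \<and> l = j mod int N then (\<xi> powi (k * l)) *\<^sub>C e k l else 0)"
    unfolding w_w sum_distrib_left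
    by (intro sum.cong refl) (auto simp: scaleC_mult_right e_mult cong_def e_mod)
  also have "\<dots> = (\<xi> powi ((i mod int N) * (j mod int N))) *\<^sub>C e i j"
    using mod_Z by (simp only: sum_delta_pair finite_atLeastLessThan_int e_mod)
  also have "\<xi> powi ((i mod int N) * (j mod int N)) = \<xi> powi (i * j)"
    by (rule theta_cong) (simp add: cong_def mod_simps)
  finally show ?thesis .
qed

definition I :: "(int \<times> int \<times> bool) set" where "I = Z \<times> Z \<times> UNIV"

definition b :: "int \<times> int \<times> bool \<Rightarrow> 'a"
  where "b = (\<lambda>(i, j, t). e i j * (if t then w else 1))"

lemma span_b: "cvec.span (b ` I) = UNIV"
proof (rule presented_by_span_eq_UNIV[OF pres])
  have mem: "e i j * (if t then w else 1) \<in> cvec.span (b ` I)" for i j t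
  proof -
    have "(i mod int N, j mod int N, t) \<in> I" by (simp only: I_def mem_Sigma_iff mod_Z UNIV_I simp_thms)
    then have "b (i mod int N, j mod int N, t) \<in> cvec.span (b ` I)"
      by (intro cvec.span_base imageI)
    then show ?thesis by (simp add: b_def e_mod)
  qed
  have mem0: "e i j \<in> cvec.span (b ` I)" and mem1: "e i j * w \<in> cvec.span (b ` I)" for i j
    using mem[of i j False] mem[of i j True] by simp_all
  show "1 \<in> cvec.span (b ` I)"
    unfolding sum_e[symmetric] by (intro cvec.span_sum mem0)
  fix x h assume x: "x \<in> egens N" and "h \<in> b ` I"
  then obtain k l t where h: "h = e k l * (if t then w else 1)" by (auto simp: b_def)
  show "\<gamma> x * h \<in> cvec.span (b ` I)"
  proof (cases x)
    case (E i j)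
    then have "\<gamma> x = e i j" using x by (auto simp: egens_def e_def)
    then show ?thesis
      using mem[of i j t] by (simp add: h e_mult_assoc cvec.span_zero)
  next
    case W
    then have "\<gamma> x * h = e l k * (if t then w * w else w)"
      by (simp add: h w_e flip: mult.assoc)
    then show ?thesis
      using mem0[of l k] mem1[of l k] by (simp add: e_w_w cvec.span_scale)
  qed
qed

lemma ex_coordinates: "\<exists>\<phi>. coordinates I b \<phi>"
proof -
  \<comment> \<open>\<open>W\<close> is going to swap the two indices with weight
    \<open>\<eta>^(k l)\<close>, so two swaps give \<open>\<xi>^(k l)\<close>. In the weight the
    indices are reduced modulo \<open>N\<close>, because \<eta> need not be an \<open>N\<close>-th
    root of unity.\<close>
  define \<eta> where "\<eta> = csqrt \<xi>"
  have \<xi>0: "\<xi> \<noteq> 0" using theta N_pos by (metis power_eq_0_iff zero_neq_one)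
  then have \<eta>0: "\<eta> \<noteq> 0" by (simp add: \<eta>_def)
  have "\<eta> * \<eta> = \<xi>" by (simp add: \<eta>_def flip: power2_eq_square)
  then have \<eta>2: "\<eta> powi a * \<eta> powi a = \<xi> powi a" for a
    using power_int_mult_distrib[of \<eta> \<eta> a] by simp
  define c where "c = (\<lambda>(k, l, m :: bool). \<eta> powi ((k mod int N) * (l mod int N)))"
  define \<rho> :: "egen \<Rightarrow> (int \<times> int \<times> bool) endo" where
    "\<rho> = case_egen (idempotent_op N) (monomial_op (\<lambda>(k, l, m). (l, k, \<not> m)) c)"
  have \<rho>_simps: "\<rho> (E i j) = idempotent_op N i j" "\<rho> W = monomial_op (\<lambda>(k, l, m). (l, k, \<not> m)) c" for i j
    by (simp_all add: \<rho>_def)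
  have rel: "free_eval \<rho> r = 0" if r: "r \<in> H2N2_relations N \<xi>" for r
  proof -
    have "\<rho> W * \<rho> W = (\<Sum>i\<in>Z. \<Sum>j\<in>Z. (\<xi> powi (i * j)) *\<^sub>C \<rho> (E i j))"
    proof (rule endo_eqI, clarify)
      fix k l :: int and m :: bool
      have "app (\<Sum>i\<in>Z. \<Sum>j\<in>Z. (\<xi> powi (i * j)) *\<^sub>C \<rho> (E i j)) (Poly_Mapping.single (k, l, m) 1)
          = (\<Sum>i\<in>Z. \<Sum>j\<in>Z. if i = k mod int N \<and> j = l mod int N
              then Poly_Mapping.single (k, l, m) (\<xi> powi (i * j)) else 0)"
        by (auto simp: app_sum app_simps \<rho>_simps idempotent_op_def app_monomial_op scaleC_single intro!: sum.cong)
      also have "\<dots> = Poly_Mapping.single (k, l, m) (\<xi> powi ((k mod int N) * (l mod int N)))"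
        using mod_Z by (simp only: sum_delta_pair finite_atLeastLessThan_int)
      finally show "app (\<rho> W * \<rho> W) (Poly_Mapping.single (k, l, m) 1)
        = app (\<Sum>i\<in>Z. \<Sum>j\<in>Z. (\<xi> powi (i * j)) *\<^sub>C \<rho> (E i j)) (Poly_Mapping.single (k, l, m) 1)"
        by (simp add: app_simps \<rho>_simps app_monomial_op c_def \<eta>2 mult.commute)
    qed
    moreover have "\<rho> W * \<rho> (E i j) = \<rho> (E j i) * \<rho> W" for i j
      by (rule endo_eqI) (auto simp: \<rho>_simps idempotent_op_def app_simps app_monomial_op)
    ultimately show ?thesis
      using r free_eval_idempotent_relations[OF N_pos _ \<rho>_simps(1), of r]
      by (auto simp: H2N2_relations_def free_eval_simps power2_eq_square)
  qed
  obtain \<Phi> where \<Phi>: "clinear \<Phi>" "\<Phi> 1 = 1" "\<And>x y. \<Phi> (x * y) = \<Phi> x * \<Phi> y"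
      "\<And>x. x \<in> egens N \<Longrightarrow> \<Phi> (\<gamma> x) = \<rho> x"
    using presented_by_induced_hom[OF pres rel] by blast
  have \<Phi>e: "\<Phi> (e i j) = idempotent_op N (i mod int N) (j mod int N)" for i j
  proof -
    have "E (i mod int N) (j mod int N) \<in> egens N"
      using mod_Z[of i] mod_Z[of j] by (auto simp: egens_def)
    then show ?thesis by (simp add: e_def \<Phi>(4) \<rho>_simps)
  qed
  have \<Phi>w: "\<Phi> w = monomial_op (\<lambda>(k, l, m). (l, k, \<not> m)) c"
    by (simp add: \<Phi>(4) egens_def \<rho>_simps)
  \<comment> \<open>The source vector is the one that the word \<open>b (i, j, t)\<close> carries to
    the index \<open>(i, j, t)\<close>; a factor \<open>w\<close> swaps the first two
    indices.\<close>
  define \<psi> where "\<psi> = (\<lambda>(i, j, t) h. Poly_Mapping.lookup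
    (app (\<Phi> h) (Poly_Mapping.single (if t then (j, i, False) else (i, j, False)) 1)) (i, j, t))"
  have b\<psi>: "\<psi> (i, j, t) (b (i', j', t')) = (if (i', j', t') = (i, j, t) then if t then \<eta> powi (i * j) else 1 else 0)"
    if "i \<in> Z" "j \<in> Z" "i' \<in> Z" "j' \<in> Z" for i j t i' j' t'
    using that by (auto simp: \<psi>_def b_def \<Phi> \<Phi>e \<Phi>w app_simps app_monomial_op idempotent_op_def c_def
        lookup_single mult.commute)
  have "coordinates I b (\<lambda>i x. \<psi> i x / \<psi> i (b i))"
  proof (rule coordinates_of_separating[OF _ _ _ _ span_b])
    show "finite I" by (simp add: I_def)
    show "clinear (\<psi> i)" for i
      by (cases i) (simp add: \<psi>_def clinear_iff clinear_add[OF \<Phi>(1)] clinear_scale[OF \<Phi>(1)] app_simps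
          lookup_add lookup_scaleC)
    fix i j assume ij: "i \<in> I" "j \<in> I"
    obtain i1 i2 t where i: "i = (i1, i2, t)" "i1 \<in> Z" "i2 \<in> Z"
      using ij(1) unfolding I_def by blast
    obtain j1 j2 s where j: "j = (j1, j2, s)" "j1 \<in> Z" "j2 \<in> Z"
      using ij(2) unfolding I_def by blast
    show "\<psi> i (b i) \<noteq> 0"
      unfolding i(1) b\<psi>[OF i(2,3) i(2,3)] using \<eta>0 by (simp add: power_int_eq_0_iff)
    show "\<psi> i (b j) = 0" if "i \<noteq> j"
      using that unfolding i(1) j(1) b\<psi>[OF i(2,3) j(2,3)] by (simp only: if_False prod.inject simp_thms eq_commute[of j1] eq_commute[of j2] eq_commute[of s])
  qed
  then show ?thesis by blast
qed

definition "coord = (SOME \<phi>. coordinates I b \<phi>)"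

sublocale algebra_coordinates I b coord
  unfolding algebra_coordinates_def coord_def by (rule someI_ex[OF ex_coordinates])

lemma dim: "cvec.dim (UNIV :: 'a set) = 2 * N\<^sup>2"
  by (simp add: dim_eq I_def card_cartesian_product power2_eq_square)

text \<open>In a nonzero product of factors \<open>e i j * w\<close> the index pairs alternate
  between \<open>(p, q)\<close> and \<open>(q, p)\<close>, because \<open>w\<close> swaps them.
  \<open>A n p q\<close> and \<open>A n q p\<close> are the sums of the first and of the second
  indices of \<open>n\<close> factors.\<close>

primrec A :: "nat \<Rightarrow> int \<Rightarrow> int \<Rightarrow> int"
  where "A 0 p q = 0" | "A (Suc n) p q = A n p q + (if even n then p else q)"

text \<open>The accumulated exponent of the twist: each new factor pairs the sum of all earlier
  second indices with its own first index.\<close>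

primrec P :: "nat \<Rightarrow> int \<Rightarrow> int \<Rightarrow> int"
  where "P 0 p q = 0" | "P (Suc n) p q = P n p q + A n q p * (if even n then p else q)"

lemma wpow_e: "w ^ n * e i j = (if even n then e i j else e j i) * w ^ n"
proof (induction n)
  case (Suc n)
  have "w * (e k l * x) = e l k * (w * x)" for k l x
    by (simp add: w_e flip: mult.assoc)
  with Suc show ?case by (simp add: mult.assoc)
qed simp

lemma sweedler_power_ew:
  "sweedler_power \<Delta> \<epsilon> n (e i j * w) = (\<Sum>p\<in>Z. \<Sum>q\<in>Z.
    if [A n p q = i] (mod int N) \<and> [A n q p = j] (mod int N) then (\<xi> powi P n p q) *\<^sub>C (e p q * w ^ n) else 0)"
proof (induction n arbitrary: i j)
  case 0
  have "(\<Sum>p\<in>Z. \<Sum>q\<in>Z. if [0 = i] (mod int N) \<and> [0 = j] (mod int N) then e p q else 0)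
      = (if int N dvd i \<and> int N dvd j then 1 else 0)"
    by (cases "int N dvd i \<and> int N dvd j") (auto simp: sum_e cong_0_iff cong_sym_eq[of 0])
  then show ?case by (simp add: counit_ew scaleC_one cong: if_cong)
next
  case (Suc n)
  let ?c = "\<lambda>p q i j. [A n p q = i] (mod int N) \<and> [A n q p = j] (mod int N)"
  let ?p = "\<lambda>p q. if even n then p else q"
  have "sweedler_power \<Delta> \<epsilon> (Suc n) (e i j * w) = (\<Sum>r\<in>Z. \<Sum>s\<in>Z. (\<xi> powi ((j - s) * r)) *\<^sub>C
      ((\<Sum>p\<in>Z. \<Sum>q\<in>Z. if ?c p q (i - r) (j - s) then (\<xi> powi P n p q) *\<^sub>C (e p q * w ^ n) else 0) * (e r s * w)))"
    by (simp add: comult_ew sweedler_lift_simps Suc)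
  also have "\<dots> = (\<Sum>r\<in>Z. \<Sum>s\<in>Z. \<Sum>p\<in>Z. \<Sum>q\<in>Z. if r = ?p p q \<and> s = ?p q p then
      (if ?c p q (i - r) (j - s) then (\<xi> powi (P n p q + A n q p * r)) *\<^sub>C (e p q * w ^ Suc n) else 0) else 0)"
    unfolding sum_distrib_right scaleC_sum_right
  proof (intro sum.cong refl)
    fix r s p q assume Z: "r \<in> Z" "s \<in> Z" "p \<in> Z" "q \<in> Z"
    have "e p q * w ^ n * (e r s * w) = (e p q * (if even n then e r s else e s r)) * w ^ Suc n"
    proof -
      have "e p q * w ^ n * (e r s * w) = e p q * (w ^ n * e r s) * w" by (simp add: mult.assoc)
      then show ?thesis unfolding wpow_e by (simp add: mult.assoc power_commutes)
    qed
    also have "\<dots> = (if r = ?p p q \<and> s = ?p q p then e p q * w ^ Suc n else 0)"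
      using Z by (cases "even n") (simp_all only: e_mult_Z if_True if_False if_distrib[of "\<lambda>y. y * _"] mult_zero_left simp_thms conj_commute[of "s = _"])
    finally have ew: "e p q * w ^ n * (e r s * w) = (if r = ?p p q \<and> s = ?p q p then e p q * w ^ Suc n else 0)" .
    show "(\<xi> powi ((j - s) * r)) *\<^sub>C ((if ?c p q (i - r) (j - s) then (\<xi> powi P n p q) *\<^sub>C (e p q * w ^ n) else 0) * (e r s * w))
      = (if r = ?p p q \<and> s = ?p q p then
      (if ?c p q (i - r) (j - s) then (\<xi> powi (P n p q + A n q p * r)) *\<^sub>C (e p q * w ^ Suc n) else 0) else 0)"
    proof (rule scaleC_if_mult[OF ew])
      \<comment> \<open>The support condition fixes the sum of the earlier second indices, so
        \<open>j - s\<close> may be replaced by \<open>A n q p\<close> in the exponent of a root of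
        unity.\<close>
      assume "?c p q (i - r) (j - s)"
      then have "\<xi> powi ((j - s) * r) = \<xi> powi (A n q p * r)"
        by (intro theta_cong cong_mult cong_refl) (rule cong_sym, simp)
      then show "\<xi> powi ((j - s) * r) * \<xi> powi P n p q = \<xi> powi (P n p q + A n q p * r)"
        by (simp add: theta_add mult.commute)
    qed
  qed
  also have "\<dots> = (\<Sum>p\<in>Z. \<Sum>q\<in>Z. \<Sum>r\<in>Z. \<Sum>s\<in>Z. if r = ?p p q \<and> s = ?p q p then
      (if ?c p q (i - r) (j - s) then (\<xi> powi (P n p q + A n q p * r)) *\<^sub>C (e p q * w ^ Suc n) else 0) else 0)"
    by (rule sum_swap_pairs)
  also have "\<dots> = (\<Sum>p\<in>Z. \<Sum>q\<in>Z. if ?c p q (i - ?p p q) (j - ?p q p)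
      then (\<xi> powi P (Suc n) p q) *\<^sub>C (e p q * w ^ Suc n) else 0)"
    by (intro sum.cong refl, subst sum_delta_pair) auto
  also have "\<dots> = (\<Sum>p\<in>Z. \<Sum>q\<in>Z. if [A (Suc n) p q = i] (mod int N) \<and> [A (Suc n) q p = j] (mod int N)
      then (\<xi> powi P (Suc n) p q) *\<^sub>C (e p q * w ^ Suc n) else 0)"
  proof -
    have "[A n p q = i - r] (mod int N) \<longleftrightarrow> [A n p q + r = i] (mod int N)" for p q i r
      by (simp add: cong_iff_dvd_diff algebra_simps)
    then show ?thesis by simp
  qed
  finally show ?case .
qed

definition "\<Lambda> = (1 / 2) *\<^sub>C (e 0 0 + e 0 0 * w)"

lemma normalized_integral: "normalized_integral \<epsilon> = \<Lambda>"
proof (rule normalized_integral_eq)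
  show "\<epsilon> \<Lambda> = 1"
    by (simp add: \<Lambda>_def counit_simps counit_e counit_ew)
  have z: "e i j * e 0 0 = (if int N dvd i \<and> int N dvd j then e 0 0 else 0)"
      "e 0 0 * e i j = (if int N dvd i \<and> int N dvd j then e 0 0 else 0)" for i j
    using e_cong[of i 0 j 0] by (auto simp: e_mult cong_0_iff cong_sym_eq[of 0])
  have zz: "e 0 0 * (w * w) = e 0 0"
    using e_w_w[of 0 0] by (simp add: scaleC_one)
  have wz: "w * (e 0 0 * x) = e 0 0 * (w * x)" for x
    by (simp add: w_e flip: mult.assoc)
  have w\<Lambda>: "w * \<Lambda> = \<Lambda>" "\<Lambda> * w = \<Lambda>"
    by (simp_all add: \<Lambda>_def scaleC_mult_right scaleC_mult_left algebra_simps w_e wz zz)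
  have e\<Lambda>: "e i j * \<Lambda> = \<epsilon> (e i j) *\<^sub>C \<Lambda>" "\<Lambda> * e i j = \<epsilon> (e i j) *\<^sub>C \<Lambda>" for i j
  proof -
    show "e i j * \<Lambda> = \<epsilon> (e i j) *\<^sub>C \<Lambda>"
      by (simp add: \<Lambda>_def scaleC_mult_right distrib_left z counit_e scaleC_one flip: mult.assoc)
    have "e 0 0 * w * e i j = (e 0 0 * e j i) * w"
      by (simp add: mult.assoc w_e)
    then show "\<Lambda> * e i j = \<epsilon> (e i j) *\<^sub>C \<Lambda>"
      by (auto simp: \<Lambda>_def scaleC_mult_left distrib_right z counit_e scaleC_one)
  qed
  have "e i j * w * \<Lambda> = \<epsilon> (e i j) *\<^sub>C \<Lambda>" "\<Lambda> * (e i j * w) = \<epsilon> (e i j) *\<^sub>C \<Lambda>" for i j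
    by (simp_all add: mult.assoc w\<Lambda> e\<Lambda>) (simp add: w\<Lambda> e\<Lambda> scaleC_mult_left flip: mult.assoc)
  then show "integral_elem \<epsilon> \<Lambda>"
    by (intro integral_elem_of_span[OF span_basis])
      (auto simp: b_def e\<Lambda> counit_mult counit_W counit_one)
qed

lemma coord_e:
  assumes "i \<in> Z" "j \<in> Z" "k \<in> Z" "l \<in> Z"
  shows "coord (k, l, t) (e i j) = (if k = i \<and> l = j \<and> \<not> t then 1 else 0)"
    and "coord (k, l, t) (e i j * w) = (if k = i \<and> l = j \<and> t then 1 else 0)"
proof -
  have mem: "(i, j, s) \<in> I" "(k, l, t) \<in> I" for s
    using assms by (simp_all add: I_def)
  show "coord (k, l, t) (e i j) = (if k = i \<and> l = j \<and> \<not> t then 1 else 0)"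
    using coord_basis[OF mem(2) mem(1)[of False]] by (auto simp: b_def)
  show "coord (k, l, t) (e i j * w) = (if k = i \<and> l = j \<and> t then 1 else 0)"
    using coord_basis[OF mem(2) mem(1)[of True]] by (auto simp: b_def)
qed

lemma coord_lin:
  assumes "k \<in> Z" "l \<in> Z"
  shows "coord (k, l, t) 0 = 0" "coord (k, l, t) (c *\<^sub>C x) = c * coord (k, l, t) x"
proof -
  have "(k, l, t) \<in> I" using assms by (simp add: I_def)
  from coord_simps(4)[OF this] coord_simps(2)[OF this, of c x]
  show "coord (k, l, t) 0 = 0" "coord (k, l, t) (c *\<^sub>C x) = c * coord (k, l, t) x" by simp_all
qed

lemma sum_I: "(\<Sum>i\<in>I. f i) = (\<Sum>k\<in>Z. \<Sum>l\<in>Z. f (k, l, False) + f (k, l, True))"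
  by (simp add: I_def UNIV_bool sum.cartesian_product' flip: sum.cartesian_product)

text \<open>Left multiplication by \<open>e p q\<close> fixes two basis words, one with and one
  without \<open>w\<close>. An additional \<open>w\<close> exchanges these two kinds of words, so no
  diagonal entries remain.\<close>

lemma regular_character_e:
  assumes Z: "p \<in> Z" "q \<in> Z"
  shows "regular_character (e p q) = 2" and "regular_character (e p q * w) = 0"
proof -
  have "regular_character (e p q) = (\<Sum>k\<in>Z. \<Sum>l\<in>Z. if k = p \<and> l = q then 2 else 0)"
    unfolding regular_character_eq sum_I
  proof (intro sum.cong refl)
    fix k l assume kl: "k \<in> Z" "l \<in> Z"
    show "coord (k, l, False) (e p q * b (k, l, False)) + coord (k, l, True) (e p q * b (k, l, True))
      = (if k = p \<and> l = q then 2 else 0)"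
      using Z kl by (cases "k = p \<and> l = q") (auto simp: b_def e_mult_Z coord_e coord_lin simp flip: mult.assoc)
  qed
  then show "regular_character (e p q) = 2"
    using Z by (simp add: sum_delta_pair)
  have "regular_character (e p q * w) = (\<Sum>k\<in>Z. \<Sum>l\<in>Z. 0)"
    unfolding regular_character_eq sum_I
  proof (intro sum.cong refl)
    fix k l assume kl: "k \<in> Z" "l \<in> Z"
    have *: "e p q * w * b (k, l, False) = (if l = p \<and> k = q then e p q * w else 0)"
      using Z kl by (simp add: b_def mult.assoc w_e) (simp add: e_mult_Z flip: mult.assoc)
    have **: "e p q * w * b (k, l, True) = (if l = p \<and> k = q then (\<xi> powi (p * q)) *\<^sub>C e p q else 0)"
    proof -
      have "e p q * w * b (k, l, True) = (e p q * e l k) * (w * w)"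
        by (simp add: b_def mult.assoc) (simp add: w_e flip: mult.assoc)
      then show ?thesis
        using Z kl by (simp add: e_mult_Z e_w_w)
    qed
    show "coord (k, l, False) (e p q * w * b (k, l, False)) + coord (k, l, True) (e p q * w * b (k, l, True)) = 0"
      using Z kl unfolding * ** by (auto simp: coord_e coord_lin)
  qed
  then show "regular_character (e p q * w) = 0" by simp
qed

lemma e_w_power: "e p q * w ^ (2 * m) = (\<xi> powi (int m * p * q)) *\<^sub>C e p q"
proof (induction m)
  case (Suc m)
  have "2 * Suc m = 2 * m + 2" by simp
  then have "e p q * w ^ (2 * Suc m) = e p q * w ^ (2 * m) * (w * w)"
    by (simp only: power_add power2_eq_square mult.assoc)
  also have "\<dots> = (\<xi> powi (int m * p * q) * \<xi> powi (p * q)) *\<^sub>C e p q"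
    unfolding Suc by (simp add: scaleC_mult_left e_w_w scaleC_scaleC)
  finally show ?case
    by (simp add: algebra_simps flip: theta_add)
qed (simp add: scaleC_one)

lemma regular_character_ew_power:
  assumes Z: "p \<in> Z" "q \<in> Z"
  shows "regular_character (e p q * w ^ n) = (if even n then 2 * \<xi> powi (int (n div 2) * p * q) else 0)"
proof (cases "even n")
  case True
  then obtain m where n: "n = 2 * m" by blast
  show ?thesis unfolding n e_w_power by (simp add: regular_character_simps regular_character_e[OF Z])
next
  case False
  then obtain m where n: "n = 2 * m + 1" by (metis oddE)
  have "e p q * w ^ n = e p q * w ^ (2 * m) * w"
    by (simp only: n power_add power_one_right mult.assoc)
  then have "e p q * w ^ n = (\<xi> powi (int m * p * q)) *\<^sub>C (e p q * w)"
    by (simp add: e_w_power scaleC_mult_left)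
  then show ?thesis using False by (simp add: regular_character_simps regular_character_e[OF Z])
qed

lemma FS_indicator_eq:
  "FS_indicator \<Delta> \<epsilon> n = (\<Sum>p\<in>Z. \<Sum>q\<in>Z. if int N dvd int n * p \<and> int N dvd int n * q then 1 else 0)
    + (if even n then \<Sum>p\<in>Z. \<Sum>q\<in>Z. if int N dvd A n p q \<and> int N dvd A n q p
        then \<xi> powi (P n p q + int (n div 2) * p * q) else 0 else 0)"
proof -
  let ?c = "\<lambda>p q. int N dvd int n * p \<and> int N dvd int n * q"
  let ?d = "\<lambda>p q. int N dvd A n p q \<and> int N dvd A n q p"
  have "regular_character (sweedler_power \<Delta> \<epsilon> n \<Lambda>) = (1 / 2) *
    ((\<Sum>p\<in>Z. \<Sum>q\<in>Z. regular_character (if ?c p q then e p q else 0)) +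
     (\<Sum>p\<in>Z. \<Sum>q\<in>Z. regular_character (if ?d p q then (\<xi> powi P n p q) *\<^sub>C (e p q * w ^ n) else 0)))"
    by (simp add: \<Lambda>_def sweedler_power_simps sweedler_power_e sweedler_power_ew regular_character_simps cong_0_iff)
  also have "(\<Sum>p\<in>Z. \<Sum>q\<in>Z. regular_character (if ?c p q then e p q else 0))
      = (\<Sum>p\<in>Z. \<Sum>q\<in>Z. 2 * (if ?c p q then 1 else 0))"
    by (intro sum.cong refl) (simp add: regular_character_e regular_character_simps)
  also have "(\<Sum>p\<in>Z. \<Sum>q\<in>Z. regular_character (if ?d p q then (\<xi> powi P n p q) *\<^sub>C (e p q * w ^ n) else 0))
      = (\<Sum>p\<in>Z. \<Sum>q\<in>Z. 2 * (if even n then if ?d p q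
        then \<xi> powi (P n p q + int (n div 2) * p * q) else 0 else 0))"
    by (intro sum.cong refl) (simp add: regular_character_ew_power regular_character_simps theta_add)
  finally show ?thesis
    by (cases "even n") (simp_all add: FS_indicator_def normalized_integral distrib_left flip: sum_distrib_left)
qed

lemma A_even: "A (2 * m) p q = int m * (p + q)"
  by (induction m) (simp_all add: algebra_simps)

lemma P_even: "P (2 * m) p q = int (m choose 2) * (p + q)\<^sup>2 + int m * q\<^sup>2"
proof (induction m)
  case (Suc m)
  have "P (2 * Suc m) p q = P (2 * m) p q + A (2 * m) q p * p + (A (2 * m) q p + q) * q"
    by simp
  also have "\<dots> = int (m + (m choose 2)) * (p + q)\<^sup>2 + int (Suc m) * q\<^sup>2"
    unfolding A_even Suc by (simp add: algebra_simps power2_eq_square)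
  also have "m + (m choose 2) = Suc m choose 2"
    by (simp add: numeral_2_eq_2)
  finally show ?case .
qed simp

lemma FS_indicator_odd:
  assumes "odd n"
  shows "FS_indicator \<Delta> \<epsilon> n = of_nat ((gcd n N)\<^sup>2)"
proof -
  have "FS_indicator \<Delta> \<epsilon> n = (\<Sum>p\<in>Z. \<Sum>q\<in>Z. (if int N dvd int n * p then 1 else 0) * (if int N dvd int n * q then 1 else 0))"
    unfolding FS_indicator_eq using assms by (simp add: if_distrib cong: if_cong) (intro sum.cong refl, simp)
  also have "\<dots> = (of_int (gcd (int n) (int N)))\<^sup>2"
    by (simp add: power2_eq_square card_annihilator[OF N_pos] flip: sum_distrib_left sum_distrib_right)
  also have "\<dots> = of_nat ((gcd n N)\<^sup>2)" by simp
  finally show ?thesis .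
qed

text \<open>On the support \<open>N dvd m * (p + q)\<close> the exponent differs from a function of
  \<open>p + q\<close> by the multiple \<open>m * (p + q) * q\<close> of \<open>N\<close>. Each
  residue of \<open>p + q\<close> arises from \<open>N\<close> pairs, which explains the factor
  \<open>N\<close>.\<close>

lemma FS_indicator_even:
  "FS_indicator \<Delta> \<epsilon> (2 * m) = of_nat ((gcd (2 * m) N)\<^sup>2) + of_nat N *
    (\<Sum>j\<in>{0..<gcd (int m) (int N)}. \<xi> powi (int (m choose 2) * (int N div gcd (int m) (int N) * j)\<^sup>2))"
proof -
  define f where "f s = (if int N dvd int m * s then \<xi> powi (int (m choose 2) * s\<^sup>2) else 0)" for s
  have per: "f (s mod int N) = f s" for s
  proof -
    have "int N dvd int m * (s mod int N) \<longleftrightarrow> int N dvd int m * s"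
      by (simp add: dvd_eq_mod_eq_0 mod_simps)
    moreover have "\<xi> powi (int (m choose 2) * (s mod int N)\<^sup>2) = \<xi> powi (int (m choose 2) * s\<^sup>2)"
      by (intro theta_cong cong_mult cong_refl cong_pow) (simp add: cong_def)
    ultimately show ?thesis by (simp add: f_def)
  qed
  have "(\<Sum>p\<in>Z. \<Sum>q\<in>Z. if int N dvd int (2 * m) * p \<and> int N dvd int (2 * m) * q then 1 else 0)
      = (\<Sum>p\<in>Z. \<Sum>q\<in>Z. (if int N dvd int (2 * m) * p then 1 else 0) * (if int N dvd int (2 * m) * q then 1 else (0::complex)))"
    by (intro sum.cong refl) simp
  also have "\<dots> = (of_int (gcd (int (2 * m)) (int N)))\<^sup>2"
    by (simp add: power2_eq_square card_annihilator[OF N_pos] flip: sum_distrib_left sum_distrib_right)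
  also have "\<dots> = of_nat ((gcd (2 * m) N)\<^sup>2)" by (simp only: gcd_int_int_eq of_int_of_nat_eq of_nat_power)
  finally have 1: "(\<Sum>p\<in>Z. \<Sum>q\<in>Z. if int N dvd int (2 * m) * p \<and> int N dvd int (2 * m) * q then 1 else 0)
    = (of_nat ((gcd (2 * m) N)\<^sup>2) :: complex)" .
  have "(\<Sum>p\<in>Z. \<Sum>q\<in>Z. if int N dvd A (2 * m) p q \<and> int N dvd A (2 * m) q p
        then \<xi> powi (P (2 * m) p q + int m * p * q) else 0) = (\<Sum>p\<in>Z. \<Sum>q\<in>Z. f (q + p))"
  proof (intro sum.cong refl)
    fix p q
    have "\<xi> powi (P (2 * m) p q + int m * p * q) = \<xi> powi (int (m choose 2) * (q + p)\<^sup>2)" if "int N dvd int m * (p + q)"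
    proof (rule theta_cong)
      have "P (2 * m) p q + int m * p * q - int (m choose 2) * (q + p)\<^sup>2 = (int m * (p + q)) * q"
        unfolding P_even by (simp add: algebra_simps power2_eq_square)
      then show "[P (2 * m) p q + int m * p * q = int (m choose 2) * (q + p)\<^sup>2] (mod int N)"
        using that by (simp add: cong_iff_dvd_diff)
    qed
    then show "(if int N dvd A (2 * m) p q \<and> int N dvd A (2 * m) q p
        then \<xi> powi (P (2 * m) p q + int m * p * q) else 0) = f (q + p)"
      by (simp add: f_def A_even add.commute)
  qed
  also have "\<dots> = of_nat N * (\<Sum>s\<in>Z. f s)"
    by (simp add: sum_residues_shift[of f, OF per])
  also have "(\<Sum>s\<in>Z. f s) = (\<Sum>j\<in>{0..<gcd (int m) (int N)}. \<xi> powi (int (m choose 2) * (int N div gcd (int m) (int N) * j)\<^sup>2))"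
    unfolding f_def by (rule sum_annihilator[OF N_pos])
  finally show ?thesis
    unfolding FS_indicator_eq 1 by (simp cong: if_cong)
qed

end

section \<open>Arithmetic of the indicators in dimension \<open>2 * N^2\<close>\<close>

lemma sum_alternating_squares:
  assumes "even d"
  shows "(\<Sum>j\<in>{0..<d}. (-1 :: complex) powi (j\<^sup>2)) = 0"
proof (cases "d > 0")
  case True
  define f where "f j = (-1 :: complex) powi (j\<^sup>2)" for j :: int
  have f: "f j = (if even j then 1 else -1)" for j
    by (simp add: f_def power_int_minus_left)
  have "(\<Sum>j\<in>{0..<int (nat d)}. f (j + 1)) = (\<Sum>j\<in>{0..<int (nat d)}. f j)"
    by (rule sum_residues_shift) (use assms True in \<open>simp add: f even_mod_2_iff dvd_mod_iff\<close>)
  moreover have "f (j + 1) = - f j" for j by (simp add: f)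
  ultimately have "(\<Sum>j\<in>{0..<d}. f j) = 0" using True by (simp add: sum_negf)
  then show ?thesis by (simp add: f_def)
qed simp

lemma two_mult_choose_two: "2 * int (m choose 2) = int m * (int m - 1)"
  by (induction m) (simp_all add: numeral_2_eq_2 algebra_simps)

text \<open>With \<open>d = gcd m N\<close>, \<open>m = d * a\<close> and \<open>N = d * b\<close>
  the hypothesis yields \<open>a dvd d\<close>, so \<open>d * d\<close> is a multiple of
  \<open>m\<close> and only a factor 2 is missing. The quadratic sum is the sum of
  \<open>\<omega>^(j^2)\<close> over \<open>j < d\<close> for a sign \<omega>: doubling the
  triangular number \<open>m choose 2\<close> gives an exponent divisible by
  \<open>N\<close>.\<close>

lemma two_mult_dvd_H2N2_indicator:
  fixes m N :: nat
  assumes pos: "m > 0" "N > 0" and dvd: "2 * m dvd 2 * N\<^sup>2" and xi: "\<xi> ^ N = (1::complex)"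
  shows "\<exists>z. of_nat ((gcd (2 * m) N)\<^sup>2) + of_nat N *
    (\<Sum>j\<in>{0..<gcd (int m) (int N)}. \<xi> powi (int (m choose 2) * (int N div gcd (int m) (int N) * j)\<^sup>2))
    = of_nat (2 * m) * (of_int z :: complex)"
proof -
  define d where "d = gcd m N"
  define a b where "a = m div d" and "b = N div d"
  have d0: "d > 0" using pos by (simp add: d_def)
  have m: "m = d * a" and N: "N = d * b" by (simp_all add: a_def b_def d_def)
  have cop: "coprime a b" unfolding a_def b_def d_def using pos by (intro div_gcd_coprime) auto
  have b0: "b > 0" using N pos by (cases b) auto
  have "m dvd N\<^sup>2" using dvd by simp
  then have "d * a dvd d * (b * b * d)"
    by (simp add: m N power2_eq_square mult_ac)
  then have "a dvd b * b * d" using d0 by simp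
  then have "a dvd d" using cop by (simp add: coprime_dvd_mult_right_iff)
  then obtain c where c: "d = a * c" by blast
  define D where "D = gcd (2 * m) N"
  have D: "D = d * gcd 2 b"
  proof -
    have "D = d * gcd (2 * a) b"
      unfolding D_def by (subst m, subst N) (simp add: gcd_mult_distrib_nat mult_ac)
    also have "gcd (2 * a) b = gcd 2 b"
      using cop by (simp add: gcd_mult_left_left_cancel gcd_mult_left_right_cancel coprime_commute)
    finally show ?thesis .
  qed
  have gcd2: "gcd 2 b = (if even b then 2 else 1)"
    by (simp add: coprime_iff_gcd_eq_1[symmetric] gcd_nat.absorb1)
  have gd: "gcd (int m) (int N) = int d" and bd: "int N div int d = int b"
    using d0 by (simp_all add: d_def b_def zdiv_int)
  define \<omega> where "\<omega> = \<xi> powi (int (m choose 2) * (int b)\<^sup>2)"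
  have pow: "\<xi> powi (int (m choose 2) * (int N div int d * j)\<^sup>2) = \<omega> powi (j\<^sup>2)" for j
    by (simp add: bd \<omega>_def power_mult_distrib mult.assoc flip: power_int_mult)
  have xi_1: "\<xi> powi k = 1" if "int N dvd k" for k
    using power_int_cong_of_root_of_unity[OF xi pos(2), of k 0] that by (simp add: cong_0_iff)
  note C2 = two_mult_choose_two[of m]
  have "\<omega> powi 2 = 1"
  proof -
    have "int (m choose 2) * (int b)\<^sup>2 * 2 = int N * (int a * int b * (int m - 1))"
    proof -
      have "int (m choose 2) * (int b)\<^sup>2 * 2 = (2 * int (m choose 2)) * (int b)\<^sup>2" by simp
      also have "\<dots> = int N * (int a * int b * (int m - 1))"
        unfolding C2 by (simp add: N power2_eq_square m)
      finally show ?thesis .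
    qed
    then show ?thesis unfolding \<omega>_def by (subst power_int_mult[symmetric]) (simp add: xi_1)
  qed
  then have "\<omega> * \<omega> = 1" by (simp add: power2_eq_square)
  then have \<omega>: "\<omega> = 1 \<or> \<omega> = -1" by (metis square_eq_1_iff)
  show ?thesis
  proof (cases "\<omega> = 1")
    case True
    \<comment> \<open>Here the quadratic sum is \<open>d\<close>, and the missing 2 comes from
      \<open>gcd 2 b\<close> and \<open>b\<close> having the same parity.\<close>
    have "even ((gcd 2 b)\<^sup>2 + b)"
      unfolding gcd2 by simp
    then obtain k where k: "(gcd 2 b)\<^sup>2 + b = 2 * k" by blast
    have "D\<^sup>2 + N * d = d * d * ((gcd 2 b)\<^sup>2 + b)"
      by (simp add: D N power2_eq_square algebra_simps)
    also have "\<dots> = 2 * m * (c * k)" by (simp add: k m) (simp add: c)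
    finally have "D\<^sup>2 + N * d = 2 * m * (c * k)" .
    then have "of_nat (D\<^sup>2 + N * d) = (of_nat (2 * m * (c * k)) :: complex)" by simp
    then show ?thesis
      unfolding gd pow D_def[symmetric] by (intro exI[of _ "int (c * k)"]) (simp add: True)
  next
    case False
    \<comment> \<open>The sign -1 excludes even \<open>a\<close> and even \<open>b\<close> and
      forces \<open>d\<close> to be even. The quadratic sum then vanishes, and
      \<open>d = a * c\<close> with odd \<open>a\<close> makes \<open>c\<close> even, which supplies
      the missing 2.\<close>
    with \<omega> have w: "\<omega> = -1" by simp
    have ndvd: "\<not> int N dvd int (m choose 2) * (int b)\<^sup>2"
      using xi_1 False by (auto simp: \<omega>_def)
    have "odd b"
    proof
      assume "even b"
      then obtain b' where b': "b = 2 * b'" by blast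
      have "int (m choose 2) * (int b)\<^sup>2 = (2 * int (m choose 2)) * (int b * int b')"
        by (simp add: b' power2_eq_square)
      also have "\<dots> = int N * (int a * (int m - 1) * int b')"
        unfolding C2 by (simp add: N m)
      finally show False using ndvd by simp
    qed
    moreover have "odd a"
    proof
      assume "even a"
      then obtain a' where a': "a = 2 * a'" by blast
      have "int (m choose 2) = int d * int a' * (int m - 1)"
        using C2 by (simp add: m a')
      then have "int (m choose 2) * (int b)\<^sup>2 = int N * (int a' * (int m - 1) * int b)"
        by (simp add: N power2_eq_square)
      then show False using ndvd by simp
    qed
    moreover have "even d"
    proof -
      have "\<omega> powi int d = 1"
      proof -
        have "int N dvd int (m choose 2) * (int b)\<^sup>2 * int d"
          by (simp add: N power2_eq_square)
        then show ?thesis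
          unfolding \<omega>_def power_int_mult[symmetric] by (rule xi_1)
      qed
      then show ?thesis using w by (cases "even d") auto
    qed
    ultimately have "even c" using c by auto
    then obtain k where k: "c = 2 * k" by blast
    have "gcd 2 b = 1" using \<open>odd b\<close> by (simp add: gcd2)
    then have "D\<^sup>2 = d * d" by (simp add: D power2_eq_square)
    also have "\<dots> = 2 * m * k" by (simp add: m) (simp add: c k)
    finally have "of_nat (D\<^sup>2) = (of_nat (2 * m * k) :: complex)" by simp
    then show ?thesis
      unfolding gd pow D_def[symmetric] w using sum_alternating_squares[of "int d"] \<open>even d\<close>
      by (intro exI[of _ "int k"]) simp
  qed
qed

text \<open>The square is the gcd of \<open>n * gcd n N\<close>, \<open>N * n\<close> and
  \<open>N^2\<close>, all multiples of \<open>n\<close>.\<close>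

lemma dvd_gcd_square:
  fixes n N :: nat
  assumes "odd n" "n dvd 2 * N\<^sup>2"
  shows "n dvd (gcd n N)\<^sup>2"
proof -
  have "n dvd N\<^sup>2" using assms by (simp add: coprime_dvd_mult_right_iff)
  moreover have "(gcd n N)\<^sup>2 = gcd (n * gcd n N) (N * gcd n N)"
    by (simp add: power2_eq_square gcd_mult_distrib_nat mult.commute)
  moreover have "N * gcd n N = gcd (N * n) (N\<^sup>2)"
    by (simp add: gcd_mult_distrib_nat power2_eq_square)
  ultimately show ?thesis by simp
qed

lemma (in H2N2) Frobenius_theorem: "Frobenius_theorem_holds \<Delta> \<epsilon>"
  unfolding Frobenius_theorem_holds_def dim
proof (intro allI impI)
  fix n :: nat assume n: "n > 0" "n dvd 2 * N\<^sup>2"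
  have "\<exists>z. FS_indicator \<Delta> \<epsilon> n = of_nat n * of_int z"
  proof (cases "even n")
    case True
    then obtain m where m: "n = 2 * m" by blast
    show ?thesis
      unfolding m FS_indicator_even
      by (rule two_mult_dvd_H2N2_indicator) (use n m N_pos theta in auto)
  next
    case False
    then obtain k where "(gcd n N)\<^sup>2 = n * k"
      using dvd_gcd_square n(2) by blast
    then show ?thesis
      unfolding FS_indicator_odd[OF False] by (intro exI[of _ "int k"]) simp
  qed
  then obtain z where "FS_indicator \<Delta> \<epsilon> n = of_nat n * of_int z" by blast
  then show "\<exists>z. algebraic_int z \<and> FS_indicator \<Delta> \<epsilon> n = of_nat n * z"
    by (intro exI[of _ "of_int z"]) (simp add: int_imp_algebraic_int)
qed

lemma Frobenius_theorem_H2N2: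
  assumes "hopf_algebra \<Delta> \<epsilon> S" "N > 0" "\<xi> ^ N = 1" "iso_H2N2 N \<xi> \<Delta> \<epsilon>"
  shows "Frobenius_theorem_holds \<Delta> \<epsilon>"
proof -
  obtain \<gamma> where "H2N2 \<Delta> \<epsilon> S N \<gamma> \<xi>"
    using assms unfolding iso_H2N2_def H2N2_def torus_extension_def torus_extension_axioms_def
    by (auto simp: H2N2_relations_def)
  then show ?thesis by (rule H2N2.Frobenius_theorem)
qed

section \<open>The algebras of cube dimension\<close>

lemma sum_lessThan_add:
  "(\<Sum>j<a + b. g j) = (\<Sum>j<a. g j) + (\<Sum>j<b. g (a + j :: nat) :: 'a::comm_monoid_add)"
  by (induction b) (simp_all add: add.assoc)

lemma sum_lessThan_mult_periodic:
  fixes g :: "nat \<Rightarrow> 'a::comm_semiring_1"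
  assumes "\<And>j. g (j + d) = g j"
  shows "(\<Sum>j<t * d. g j) = of_nat t * (\<Sum>j<d. g j)"
proof -
  have per: "g (s * d + j) = g j" for s j
  proof (induction s)
    case (Suc s)
    have "g (Suc s * d + j) = g ((s * d + j) + d)" by (simp add: ac_simps)
    then show ?case by (simp add: assms Suc)
  qed simp
  show ?thesis
proof (induction t)
  case (Suc t)
  have "(\<Sum>j<Suc t * d. g j) = (\<Sum>j<t * d. g j) + (\<Sum>j<d. g (t * d + j))"
    using sum_lessThan_add[of g "t * d" d] by (simp add: add.commute)
  also have "\<dots> = of_nat (Suc t) * (\<Sum>j<d. g j)"
    unfolding per Suc.IH by (simp add: algebra_simps)
  finally show ?case .
qed simp
qed

lemma sum_lessThan_mult_split:
  "(\<Sum>j<d * t. g j) = (\<Sum>j0<t. \<Sum>j1<d. g (j0 + t * j1 :: nat))"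
proof (induction d)
  case (Suc d)
  have "(\<Sum>j<Suc d * t. g j) = (\<Sum>j<d * t. g j) + (\<Sum>j<t. g (d * t + j))"
    using sum_lessThan_add[of g "d * t" t] by (simp add: add.commute)
  then show ?case by (simp add: Suc sum.distrib add.commute mult.commute)
qed simp

lemma sum_geometric_root_of_unity:
  fixes x :: "'a::field"
  assumes "x ^ d = 1"
  shows "(\<Sum>j<d. x ^ j) = (if x = 1 then of_nat d else 0)"
  using assms by (simp add: sum_gp_strict)

text \<open>The exponential sums of the second family. Both variables are shifted by subgroups on which the
  summand is a character; multiplication by \<open>t\<close> removes the obstruction coming from \<open>\<omega>\<close>.\<close>

lemma dvd_exponential_sum:
  fixes \<omega> \<theta> \<eta> :: complex and d t n :: nat
  assumes d: "d > 0" and t: "t > 0" "\<omega> ^ t = 1" "coprime t n" and \<omega>d: "\<omega> ^ d = 1"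
    and \<theta>: "\<theta> ^ d = 1" and \<eta>: "\<eta> = \<theta> ^ n" and n: "n > 0" "n dvd d\<^sup>2"
  shows "\<exists>z. algebraic_int z \<and> (\<Sum>j<d. \<Sum>k<d. \<omega> ^ (j\<^sup>2 * k\<^sup>2) * \<eta> ^ (j * k)) = of_nat n * z"
proof -
  define f where "f j k = \<omega> ^ (j\<^sup>2 * k\<^sup>2) * \<eta> ^ (j * k)" for j k
  define c where "c k = (if \<eta> ^ (t * k) = 1 then 1 else 0 :: int)" for k
  define y where "y k = (\<Sum>j<t. f j k)" for k
  define h where "h k = (\<Sum>j<d. f j k)" for k
  let ?T = "\<Sum>j<d. \<Sum>k<d. f j k"
  have \<eta>d: "\<eta> ^ d = 1"
  proof -
    have "\<eta> ^ d = (\<theta> ^ d) ^ n"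
      unfolding \<eta> by (simp add: mult.commute flip: power_mult)
    then show ?thesis by (simp add: \<theta>)
  qed
  have pow_mult: "x ^ (M * a) = 1" if "x ^ M = 1" for x :: complex and M a
    using that by (simp add: power_mult)
  have f_sym: "f j k = f k j" for j k
    by (simp add: f_def mult.commute)
  have f_shift: "f (j + M) k = f j k" if "\<omega> ^ M = 1" "\<eta> ^ (M * k) = 1" for j k M
  proof -
    have "(j + M)\<^sup>2 * k\<^sup>2 = j\<^sup>2 * k\<^sup>2 + M * ((2 * j + M) * k\<^sup>2)"
      by (simp add: power2_eq_square algebra_simps)
    then show ?thesis
      using that by (simp add: f_def power_add add_mult_distrib pow_mult)
  qed
  have f_per: "f (j + d) k = f j k" for j k
    by (rule f_shift) (simp_all add: \<omega>d \<eta>d pow_mult)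
  \<comment> \<open>Over \<open>t\<close> periods write \<open>j = j0 + t * j1\<close>. Since
    \<open>\<omega>^t = 1\<close>, the quadratic factor does not see \<open>j1\<close>; what is left
    is a geometric sum, equal to \<open>d\<close> or 0, and \<open>c k\<close> records
    which.\<close>
  have th: "of_nat t * h k = of_nat d * (of_int (c k) * y k)" for k
  proof -
    have "of_nat t * h k = (\<Sum>j<t * d. f j k)"
      unfolding h_def by (rule sum_lessThan_mult_periodic[symmetric]) (rule f_per)
    also have "\<dots> = (\<Sum>j0<t. \<Sum>j1<d. f (j0 + t * j1) k)"
      using sum_lessThan_mult_split[of "\<lambda>j. f j k" d t] by (simp add: mult.commute)
    also have "\<dots> = (\<Sum>j0<t. f j0 k * (\<Sum>j1<d. (\<eta> ^ (t * k)) ^ j1))"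
    proof -
      have "f (j0 + t * j1) k = f j0 k * (\<eta> ^ (t * k)) ^ j1" for j0 j1
      proof -
        have "(j0 + t * j1)\<^sup>2 * k\<^sup>2 = j0\<^sup>2 * k\<^sup>2 + t * ((2 * j0 * j1 + t * j1\<^sup>2) * k\<^sup>2)"
          by (simp add: power2_eq_square algebra_simps)
        moreover have "(j0 + t * j1) * k = j0 * k + t * k * j1"
          by (simp add: algebra_simps)
        ultimately show ?thesis
          by (simp add: f_def power_add pow_mult[OF t(2)] flip: power_mult)
      qed
      then show ?thesis by (simp add: sum_distrib_left)
    qed
    also have "\<dots> = (\<Sum>j0<t. f j0 k * (of_nat d * of_int (c k)))"
    proof -
      have "(\<eta> ^ (t * k)) ^ d = 1"
        using pow_mult[OF \<eta>d, of "t * k"] by (simp add: mult.commute flip: power_mult)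
      then have "(\<Sum>j1<d. (\<eta> ^ (t * k)) ^ j1) = of_nat d * of_int (c k)"
        by (simp add: sum_geometric_root_of_unity c_def)
      then show ?thesis by simp
    qed
    finally show ?thesis by (simp add: y_def sum_distrib_left sum_distrib_right mult_ac)
  qed
  \<comment> \<open>Besides \<open>d\<close>, also \<open>M = t * (d div G)\<close> is a period of
    \<open>h\<close>: this uses \<open>\<eta> = \<theta> ^ n\<close>, as \<open>d\<close> divides
    \<open>n * (d div G)\<close>. So \<open>t\<close> periods of length \<open>d\<close> are
    \<open>G\<close> periods of length \<open>M\<close>.\<close>
  define G where "G = gcd d n"
  define M where "M = t * (d div G)"
  have Gd: "G dvd d" "G dvd n" "G > 0" using d by (simp_all add: G_def)
  have GM: "t * d = G * M" using Gd by (simp add: M_def)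
  have h_per: "h (k + M) = h k" for k
  proof -
    have "f j (k + M) = f j k" for j
    proof -
      have "\<omega> ^ M = 1" unfolding M_def by (rule pow_mult[OF t(2)])
      moreover have "\<eta> ^ (M * j) = 1"
      proof -
        obtain n' where n': "n = G * n'" using Gd(2) by blast
        obtain d' where d': "d = G * d'" using Gd(1) by blast
        have "M = t * d'" using Gd(3) d' by (simp add: M_def)
        then have "n * (M * j) = (G * d') * (n' * t * j)"
          by (subst n') (simp add: mult_ac)
        then have nM: "n * (M * j) = d * (n' * t * j)"
          unfolding d'[symmetric] .
        show ?thesis unfolding \<eta> power_mult[symmetric] nM by (rule pow_mult[OF \<theta>])
      qed
      ultimately show ?thesis using f_shift[of M j k] by (simp add: f_sym)
    qed
    then show ?thesis by (simp add: h_def)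
  qed
  have h_per': "h (k + d) = h k" for k
    unfolding h_def using f_per by (simp add: f_sym)
  have T_h: "?T = (\<Sum>k<d. h k)"
    unfolding h_def by (rule sum.swap)
  have "of_nat t * ?T = of_nat G * (\<Sum>k<M. h k)"
    unfolding T_h sum_lessThan_mult_periodic[of h d t, OF h_per', symmetric] GM
    by (rule sum_lessThan_mult_periodic) (rule h_per)
  then have "of_nat (t * t) * ?T = of_nat G * (\<Sum>k<M. of_nat t * h k)"
    by (simp add: mult.left_commute mult.assoc flip: sum_distrib_left)
  also have "\<dots> = of_nat (G * d) * (\<Sum>k<M. of_int (c k) * y k)"
    unfolding th by (simp add: mult.assoc flip: sum_distrib_left)
  finally have main: "of_nat (t * t) * ?T = of_nat (G * d) * (\<Sum>k<M. of_int (c k) * y k)" .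
  have "G * d = gcd (d\<^sup>2) (n * d)"
    by (simp add: G_def power2_eq_square gcd_mult_distrib_nat mult.commute)
  then have "n dvd G * d" using n(2) by simp
  then obtain r where r: "G * d = n * r" by blast
  \<comment> \<open>\<open>t * t\<close> is invertible modulo \<open>n\<close>, so a Bezout identity
    removes it and leaves a cofactor that is an integral combination of values of
    \<open>f\<close>.\<close>
  have "coprime (int (t * t)) (int n)"
    using t(3) by simp
  then have "gcd (int (t * t)) (int n) = 1"
    by (simp only: coprime_iff_gcd_eq_1)
  then obtain u v where uv: "u * int (t * t) + v * int n = 1"
    using bezout_int[of "int (t * t)" "int n"] by auto
  define z where "z = of_int (u * int r) * (\<Sum>k<M. of_int (c k) * y k) + of_int v * ?T"
  have "?T = of_int (u * int (t * t) + v * int n) * ?T"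
    unfolding uv by simp
  also have "\<dots> = of_int u * (of_nat (t * t) * ?T) + of_nat n * (of_int v * ?T)"
    by (simp add: algebra_simps)
  also have "\<dots> = of_nat n * z"
    unfolding main r z_def by (simp add: algebra_simps)
  finally have Tz: "?T = of_nat n * z" .
  \<comment> \<open>A disjoint union of index sets merges both parts of \<open>z\<close> into a
    single sum of roots of unity with integer coefficients.\<close>
  have "z = (\<Sum>x\<in>({..<M} \<times> {..<t}) <+> ({..<d} \<times> {..<d}).
      of_int (case x of Inl (k, j) \<Rightarrow> u * int r * c k | Inr _ \<Rightarrow> v)
      * (case x of Inl (k, j) \<Rightarrow> f j k | Inr (j, k) \<Rightarrow> f j k))"
    by (subst sum.Plus)
      (simp_all add: z_def y_def sum_distrib_left sum.cartesian_product case_prod_unfold mult_ac)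
  also have "algebraic_int \<dots>"
  proof (rule algebraic_int_sum_roots_of_unity[OF d])
    have "f j k ^ d = 1" for j k
    proof -
      have "f j k ^ d = \<omega> ^ (d * (j\<^sup>2 * k\<^sup>2)) * \<eta> ^ (d * (j * k))"
        by (simp add: f_def power_mult_distrib mult.commute[of d] flip: power_mult)
      then show ?thesis by (simp add: pow_mult \<omega>d \<eta>d)
    qed
    then show "(case x of Inl (k, j) \<Rightarrow> f j k | Inr (j, k) \<Rightarrow> f j k) ^ d = 1" for x
      by (auto split: sum.split)
  qed simp
  finally have "algebraic_int z" .
  with Tz show ?thesis
    unfolding f_def by blast
qed

text \<open>Adds \<open>d\<close> to \<open>k\<close> cyclically inside the block \<open>{N q..<N (q + 1)}\<close> containing \<open>k\<close>. This realises
  \<open>\<int>\<^sub>N\<close>-indexed operators on a space with basis \<open>int\<close>, since no type has \<open>N\<close> elements for a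
  variable \<open>N\<close>.\<close>

definition cyc :: "nat \<Rightarrow> int \<Rightarrow> int \<Rightarrow> int"
  where "cyc N k d = int N * (k div int N) + (k + d) mod int N"

lemma cyc_mod: "cyc N k d mod int N = (k + d) mod int N"
  by (simp add: cyc_def)

lemma cyc_div: "N > 0 \<Longrightarrow> cyc N k d div int N = k div int N"
  by (simp add: cyc_def div_pos_pos_trivial)

lemma cyc_add: "N > 0 \<Longrightarrow> cyc N (cyc N k d) d' = cyc N k (d + d')"
proof -
  assume N: "N > 0"
  have "(cyc N k d + d') mod int N = (cyc N k d mod int N + d') mod int N"
    by (simp add: mod_simps)
  also have "\<dots> = (k + (d + d')) mod int N"
    unfolding cyc_mod by (simp add: mod_simps add.assoc)
  finally show ?thesis
    unfolding cyc_def[of N "cyc N k d"] cyc_div[OF N] by (simp add: cyc_def)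
qed

lemma cyc_mult: "cyc N k (int N * c) = k"
  by (simp add: cyc_def)

lemma cyc_0: "cyc N k 0 = k"
  by (simp add: cyc_def)

lemma cyc_range: "k \<in> {0..<int N} \<Longrightarrow> cyc N k d = (k + d) mod int N"
  by (simp add: cyc_def)

lemma ex_root_of_root_of_unity:
  fixes \<xi> :: complex
  assumes "\<xi> ^ N = 1" "N > 0" "M > 0"
  obtains \<eta> where "\<eta> ^ M = \<xi>" "\<eta> \<noteq> 0"
proof -
  have "\<xi> \<in> (\<lambda>k. cis (2 * pi * real k / real N)) ` {..<N}"
    using bij_betw_roots_unity[OF assms(2)] assms(1) by (auto simp: bij_betw_def)
  then obtain t where t: "\<xi> = cis t" by auto
  have "cis (t / real M) ^ M = \<xi>"
    using assms(3) by (simp add: DeMoivre t)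
  moreover have "cis (t / real M) \<noteq> 0" by simp
  ultimately show ?thesis by (rule that)
qed

section \<open>Commutation rules, basis and dimension in the cubic family\<close>

locale HN3 = torus_extension \<Delta> \<epsilon> S N "HN3_relations N \<xi>" \<gamma> \<zeta>
  for \<Delta> :: "'a::complex_algebra_1 \<Rightarrow> 'a \<otimes>\<^sub>C 'a" and \<epsilon> S N \<gamma> \<xi> \<zeta> +
  assumes xi: "\<xi> ^ N = 1"
begin

lemma xi_cong: "[a = b] (mod int N) \<Longrightarrow> \<xi> powi a = \<xi> powi b"
  by (rule power_int_cong_of_root_of_unity[OF xi N_pos])

lemma xi_add: "\<xi> powi (a + b) = \<xi> powi a * \<xi> powi b"
  using xi N_pos by (intro power_int_add) (metis power_eq_0_iff zero_neq_one)

lemma w_e: "w * e i j = e (i - j) j * w"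
proof -
  have "fgen W * fgen (E i j) - fgen (E ((i - j) mod int N) j) * fgen W \<in> HN3_relations N \<xi>" if "i \<in> Z" "j \<in> Z" for i j
    using that unfolding HN3_relations_def by blast
  from relation[OF this[OF mod_Z[of i] mod_Z[of j]]] show ?thesis
    by (simp add: free_eval_simps e_def mod_simps)
qed

lemma w_power_N: "w ^ N = (\<Sum>i\<in>Z. \<Sum>j\<in>Z. (\<xi> powi j) *\<^sub>C e i j)"
proof -
  have "fgen W ^ N - (\<Sum>i\<in>Z. \<Sum>j\<in>Z. (\<xi> powi j) *\<^sub>C fgen (E i j)) \<in> HN3_relations N \<xi>"
    by (simp add: HN3_relations_def)
  from relation[OF this] show ?thesis
    by (simp add: free_eval_simps e_def)
qed

lemma e_w_power_N: "e i j * w ^ N = (\<xi> powi j) *\<^sub>C e i j"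
proof -
  have "e i j * w ^ N = (\<Sum>k\<in>Z. \<Sum>l\<in>Z.
      if k = i mod int N \<and> l = j mod int N then (\<xi> powi l) *\<^sub>C e k l else 0)"
    unfolding w_power_N sum_distrib_left
    by (intro sum.cong refl) (auto simp: scaleC_mult_right e_mult cong_def e_mod)
  also have "\<dots> = (\<xi> powi (j mod int N)) *\<^sub>C e i j"
    using mod_Z by (simp only: sum_delta_pair finite_atLeastLessThan_int e_mod)
  also have "\<xi> powi (j mod int N) = \<xi> powi j"
    by (rule xi_cong) simp
  finally show ?thesis .
qed

lemma e_w_power: "e i j * w ^ b = (\<xi> powi (j * int (b div N))) *\<^sub>C (e i j * w ^ (b mod N))"
proof -
  have "e i j * w ^ (N * c) = (\<xi> powi (j * int c)) *\<^sub>C e i j" for c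
  proof (induction c)
    case (Suc c)
    have "e i j * w ^ (N * Suc c) = e i j * w ^ (N * c) * w ^ N"
      by (simp only: mult.assoc power_add[symmetric] mult_Suc_right add.commute)
    then show ?case
      unfolding Suc by (simp add: scaleC_mult_left e_w_power_N scaleC_scaleC algebra_simps flip: xi_add)
  qed (simp add: scaleC_one)
  then have "e i j * w ^ (N * (b div N) + b mod N) = (\<xi> powi (j * int (b div N))) *\<^sub>C (e i j * w ^ (b mod N))"
    unfolding power_add mult.assoc[symmetric] by (simp add: scaleC_mult_left)
  then show ?thesis by simp
qed

lemma wpow_e: "w ^ a * e i j = e (i - int a * j) j * w ^ a"
proof (induction a)
  case (Suc a)
  have "w ^ Suc a * e i j = (w * e (i - int a * j) j) * w ^ a"
    using Suc by (simp add: mult.assoc)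
  also have "\<dots> = e (i - int a * j - j) j * w ^ Suc a"
    unfolding w_e by (simp add: mult.assoc)
  finally show ?case by (simp add: algebra_simps)
qed simp

lemma e_wpow_e:
  assumes "k \<in> Z" "l \<in> Z"
  shows "e i j * w ^ a * (e k l * x)
    = (if k = (i + int a * j) mod int N \<and> l = j mod int N then e i j * w ^ a * x else 0)"
proof -
  have "e i j * w ^ a * (e k l * x) = e i j * e (k - int a * l) l * (w ^ a * x)"
    by (metis mult.assoc wpow_e)
  moreover have "[i = k - int a * l] (mod int N) \<and> [j = l] (mod int N) \<longleftrightarrow>
      k = (i + int a * j) mod int N \<and> l = j mod int N" (is "?L \<longleftrightarrow> ?R")
  proof -
    have "[i = k - int a * l] (mod int N) \<longleftrightarrow> [k = i + int a * j] (mod int N)" if "[j = l] (mod int N)"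
    proof -
      have eq: "i - (k - int a * l) = (i + int a * j - k) - int a * (j - l)"
        by (simp add: algebra_simps)
      have dvd: "int N dvd int a * (j - l)"
        using that by (simp add: cong_iff_dvd_diff)
      show ?thesis
        unfolding cong_sym_eq[of k] unfolding cong_iff_dvd_diff eq
        by (rule dvd_diff_left_iff[OF dvd])
    qed
    moreover have "[k = i + int a * j] (mod int N) \<longleftrightarrow> k = (i + int a * j) mod int N"
      "[j = l] (mod int N) \<longleftrightarrow> l = j mod int N"
      using assms by (auto simp: cong_def)
    ultimately show ?thesis by blast
  qed
  ultimately show ?thesis by (simp add: e_mult mult.assoc)
qed

definition I :: "(int \<times> int \<times> nat) set" where "I = Z \<times> Z \<times> {..<N}"

definition b :: "int \<times> int \<times> nat \<Rightarrow> 'a"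
  where "b = (\<lambda>(i, j, a). e i j * w ^ a)"

lemma span_b: "cvec.span (b ` I) = UNIV"
proof (rule presented_by_span_eq_UNIV[OF pres])
  have mem: "e i j * w ^ a \<in> cvec.span (b ` I)" for i j a
  proof -
    have "(i mod int N, j mod int N, a mod N) \<in> I"
      unfolding I_def mem_Sigma_iff using mod_Z N_pos by auto
    then have "b (i mod int N, j mod int N, a mod N) \<in> cvec.span (b ` I)"
      by (intro cvec.span_base imageI)
    then have "e i j * w ^ (a mod N) \<in> cvec.span (b ` I)"
      by (simp add: b_def e_mod)
    then show ?thesis
      unfolding e_w_power[of i j a] by (rule cvec.span_scale)
  qed
  have mem0: "e i j \<in> cvec.span (b ` I)" for i j
    using mem[of i j 0] by simp
  show "1 \<in> cvec.span (b ` I)"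
    unfolding sum_e[symmetric] by (intro cvec.span_sum mem0)
  fix x h assume x: "x \<in> egens N" and "h \<in> b ` I"
  then obtain k l a where h: "h = e k l * w ^ a" by (auto simp: b_def)
  show "\<gamma> x * h \<in> cvec.span (b ` I)"
  proof (cases x)
    case (E i j)
    then have "\<gamma> x = e i j" using x by (auto simp: egens_def e_def)
    then show ?thesis
      using mem[of i j a] by (simp add: h e_mult_assoc cvec.span_zero)
  next
    case W
    then have "\<gamma> x * h = e (k - l) l * w ^ Suc a"
      by (simp add: h w_e flip: mult.assoc)
    then show ?thesis using mem[of "k - l" l "Suc a"] by simp
  qed
qed

lemma ex_coordinates: "\<exists>\<phi>. coordinates I b \<phi>"
proof -
  \<comment> \<open>Each application of \<open>V\<close> contributes
    \<open>\<eta>^(l mod N)\<close>, so an \<open>N\<close>-th root of \<xi> makes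
    \<open>V ^ N\<close> act by \<open>\<xi>^(l mod N)\<close>. The third index of \<open>V\<close>
    counts powers of \<open>w\<close> modulo \<open>N\<close>.\<close>
  obtain \<eta> where \<eta>: "\<eta> ^ N = \<xi>" "\<eta> \<noteq> 0"
    using ex_root_of_root_of_unity[OF xi N_pos N_pos] .
  define V :: "(int \<times> int \<times> int) endo" where
    "V = monomial_op (\<lambda>(k, l, m). (cyc N k (- l), l, cyc N m 1)) (\<lambda>(k, l, m). \<eta> powi (l mod int N))"
  have V_pow: "V ^ a = monomial_op (\<lambda>(k, l, m). (cyc N k (- int a * l), l, cyc N m (int a)))
      (\<lambda>(k, l, m). \<eta> powi (int a * (l mod int N)))" for a
  proof (induction a)
    case 0
    show ?case by (rule endo_eqI) (auto simp: app_simps app_monomial_op cyc_0)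
  next
    case (Suc a)
    show ?case
      unfolding power_Suc Suc unfolding V_def
      by (rule endo_eqI) (auto simp: app_simps app_monomial_op cyc_add[OF N_pos] algebra_simps power_int_add \<eta>(2))
  qed
  define \<rho> :: "egen \<Rightarrow> (int \<times> int \<times> int) endo" where "\<rho> = case_egen (idempotent_op N) V"
  have \<rho>_simps: "\<rho> (E i j) = idempotent_op N i j" "\<rho> W = V" for i j
    by (simp_all add: \<rho>_def)
  have rel: "free_eval \<rho> r = 0" if r: "r \<in> HN3_relations N \<xi>" for r
  proof -
    have "V ^ N = (\<Sum>i\<in>Z. \<Sum>j\<in>Z. (\<xi> powi j) *\<^sub>C \<rho> (E i j))"
    proof (rule endo_eqI, clarify)
      fix k l m :: int
      have "app (\<Sum>i\<in>Z. \<Sum>j\<in>Z. (\<xi> powi j) *\<^sub>C \<rho> (E i j)) (Poly_Mapping.single (k, l, m) 1)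
          = (\<Sum>i\<in>Z. \<Sum>j\<in>Z. if i = k mod int N \<and> j = l mod int N
              then Poly_Mapping.single (k, l, m) (\<xi> powi j) else 0)"
        by (auto simp: app_sum app_simps \<rho>_simps idempotent_op_def app_monomial_op scaleC_single intro!: sum.cong)
      also have "\<dots> = Poly_Mapping.single (k, l, m) (\<xi> powi (l mod int N))"
        using mod_Z by (simp only: sum_delta_pair finite_atLeastLessThan_int)
      also have "\<dots> = app (V ^ N) (Poly_Mapping.single (k, l, m) 1)"
        unfolding V_pow using cyc_mult[of N k "- l"] cyc_mult[of N m 1]
        by (simp add: app_monomial_op \<eta>(1)[symmetric] power_int_mult)
      finally show "app (V ^ N) (Poly_Mapping.single (k, l, m) 1)
        = app (\<Sum>i\<in>Z. \<Sum>j\<in>Z. (\<xi> powi j) *\<^sub>C \<rho> (E i j)) (Poly_Mapping.single (k, l, m) 1)" ..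
    qed
    moreover have "V * \<rho> (E i j) = \<rho> (E ((i - j) mod int N) j) * V" if "i \<in> Z" "j \<in> Z" for i j
    proof (rule endo_eqI, clarify)
      fix k l m :: int
      have "k mod int N = i \<and> l mod int N = j \<longleftrightarrow> (k - l) mod int N = (i - j) mod int N \<and> l mod int N = j"
      proof -
        have "k mod int N = i" if kl: "(k - l) mod int N = (i - j) mod int N" "l mod int N = j"
        proof -
          have "((k - l) + l) mod int N = ((i - j) + j) mod int N"
            using kl by (metis mod_add_cong mod_mod_trivial)
          then show ?thesis using \<open>i \<in> Z\<close> by simp
        qed
        then show ?thesis by (auto simp: mod_simps)
      qed
      then show "app (V * \<rho> (E i j)) (Poly_Mapping.single (k, l, m) 1)
        = app (\<rho> (E ((i - j) mod int N) j) * V) (Poly_Mapping.single (k, l, m) 1)"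
        by (auto simp: \<rho>_simps idempotent_op_def V_def app_simps app_monomial_op cyc_mod)
    qed
    ultimately show ?thesis
      using r free_eval_idempotent_relations[OF N_pos _ \<rho>_simps(1), of r]
      by (auto simp: HN3_relations_def free_eval_simps \<rho>_simps(2))
  qed
  obtain \<Phi> where \<Phi>: "clinear \<Phi>" "\<Phi> 1 = 1" "\<And>x y. \<Phi> (x * y) = \<Phi> x * \<Phi> y"
      "\<And>x. x \<in> egens N \<Longrightarrow> \<Phi> (\<gamma> x) = \<rho> x"
    using presented_by_induced_hom[OF pres rel] by blast
  have \<Phi>e: "\<Phi> (e i j) = idempotent_op N (i mod int N) (j mod int N)" for i j
  proof -
    have "E (i mod int N) (j mod int N) \<in> egens N"
      using mod_Z[of i] mod_Z[of j] by (auto simp: egens_def)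
    then show ?thesis by (simp add: e_def \<Phi>(4) \<rho>_simps)
  qed
  have \<Phi>w: "\<Phi> (w ^ a) = V ^ a" for a
    by (induction a) (simp_all add: \<Phi> egens_def \<rho>_simps)
  \<comment> \<open>Every factor \<open>w\<close> lowers the first index by \<open>j\<close>, so
    \<open>a\<close> of them lead from \<open>i + a * j\<close> to \<open>i\<close>.\<close>
  define \<psi> where "\<psi> = (\<lambda>(i, j, a) h. Poly_Mapping.lookup
    (app (\<Phi> h) (Poly_Mapping.single ((i + int a * j) mod int N, j, 0) 1)) (i, j, int a))"
  have b\<psi>: "\<psi> (i, j, a) (b (i', j', a')) = (if (i', j', a') = (i, j, a) then \<eta> powi (int a * j) else 0)"
    if Z: "i \<in> Z" "j \<in> Z" "i' \<in> Z" "j' \<in> Z" and a: "a < N" "a' < N" for i j a i' j' a'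
  proof -
    have c0: "cyc N 0 (int a') = int a'"
      using a by (simp add: cyc_def)
    let ?k = "cyc N ((i + int a * j) mod int N) (- (int a' * j))"
    have k: "?k = (i + int a * j - int a' * j) mod int N"
      by (subst cyc_range[OF mod_Z]) (simp add: mod_simps)
    have "\<psi> (i, j, a) (b (i', j', a')) = (if i' = ?k \<and> j' = j \<and> i = ?k \<and> a' = a then \<eta> powi (int a' * j) else 0)"
      using Z by (auto simp: \<psi>_def b_def \<Phi>(3) \<Phi>e \<Phi>w V_pow app_simps app_monomial_op c0
          idempotent_op_def lookup_single when_def k)
    also have "\<dots> = (if (i', j', a') = (i, j, a) then \<eta> powi (int a * j) else 0)"
      unfolding k using Z by auto
    finally show ?thesis .
  qed
  have "coordinates I b (\<lambda>i x. \<psi> i x / \<psi> i (b i))"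
  proof (rule coordinates_of_separating[OF _ _ _ _ span_b])
    show "finite I" by (simp add: I_def)
    show "clinear (\<psi> i)" for i
      by (cases i) (simp add: \<psi>_def clinear_iff clinear_add[OF \<Phi>(1)] clinear_scale[OF \<Phi>(1)] app_simps
          lookup_add lookup_scaleC)
    fix i j assume ij: "i \<in> I" "j \<in> I"
    obtain i1 i2 a where i: "i = (i1, i2, a)" "i1 \<in> Z" "i2 \<in> Z" "a < N"
      using ij(1) unfolding I_def by blast
    obtain j1 j2 c where j: "j = (j1, j2, c)" "j1 \<in> Z" "j2 \<in> Z" "c < N"
      using ij(2) unfolding I_def by blast
    show "\<psi> i (b i) \<noteq> 0"
      unfolding i(1) b\<psi>[OF i(2,3) i(2,3) i(4,4)] using \<eta>(2) by (simp add: power_int_eq_0_iff)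
    show "\<psi> i (b j) = 0" if "i \<noteq> j"
      using that unfolding i(1) j(1) b\<psi>[OF i(2,3) j(2,3) i(4) j(4)]
      by (simp only: if_False prod.inject simp_thms eq_commute[of j1] eq_commute[of j2] eq_commute[of c])
  qed
  then show ?thesis by blast
qed

definition "coord = (SOME \<phi>. coordinates I b \<phi>)"

sublocale algebra_coordinates I b coord
  unfolding algebra_coordinates_def coord_def by (rule someI_ex[OF ex_coordinates])

lemma dim: "cvec.dim (UNIV :: 'a set) = N ^ 3"
  by (simp add: dim_eq I_def card_cartesian_product power3_eq_cube)

end

section \<open>Coproducts of words, Sweedler powers and indicator in the cubic family\<close>

context HN3
begin

lemma ew_power_mult:
  assumes "k \<in> Z" "l \<in> Z"
  shows "e i j * w ^ a * (e k l * w ^ c)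
    = (if k = (i + int a * j) mod int N \<and> l = j mod int N then e i j * w ^ (a + c) else 0)"
  unfolding e_wpow_e[OF assms] by (simp add: power_add mult.assoc)

lemma ew_power_mult_w:
  assumes "k \<in> Z" "l \<in> Z"
  shows "e i j * w ^ a * (e k l * w)
    = (if k = (i + int a * j) mod int N \<and> l = j mod int N then e i j * w ^ Suc a else 0)"
  using ew_power_mult[OF assms, of i j a 1] by simp

text \<open>Moving \<open>w ^ a\<close> past an idempotent shifts its first index by
  \<open>a\<close> times the second, so the next factor \<open>w\<close> adds the twist
  \<open>(j - s) * (r + a * s)\<close>. Summation over the factors produces the triangular number
  \<open>a choose 2\<close>.\<close>

lemma comult_ew_power:
  "\<Delta> (e i j * w ^ a) = (\<Sum>r\<in>Z. \<Sum>s\<in>Z. (\<zeta> powi ((j - s) * (int a * r + int (a choose 2) * s))) *\<^sub>C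
    ((e (i - r) (j - s) * w ^ a) \<otimes>\<^sub>C (e r s * w ^ a)))"
proof (induction a)
  case 0
  show ?case by (simp add: comult_e scaleC_one binomial_eq_0)
next
  case (Suc a)
  let ?x = "\<lambda>r s. \<zeta> powi ((j - s) * (int a * r + int (a choose 2) * s))"
  let ?k = "\<lambda>r s. (i - r + int a * (j - s)) mod int N" and ?l = "\<lambda>s. (j - s) mod int N"
  have "\<Delta> (e i j * w ^ Suc a) = tensor_mult (\<Delta> (e i j * w ^ a)) (\<Delta> w)"
    by (simp add: mult.assoc power_commutes flip: comult_mult)
  also have "\<dots> = (\<Sum>r\<in>Z. \<Sum>s\<in>Z. \<Sum>i'\<in>Z. \<Sum>j'\<in>Z. \<Sum>k\<in>Z. \<Sum>l\<in>Z.
      (\<zeta> powi (j' * k)) *\<^sub>C ?x r s *\<^sub>C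
      ((e (i - r) (j - s) * w ^ a * (e i' j' * w)) \<otimes>\<^sub>C (e r s * w ^ a * (e k l * w))))"
    unfolding Suc comult_w tensor_mult_sum_left
    by (simp only: tensor_mult_sum_right tensor_mult_bilinear tensor_mult_elem)
  also have "\<dots> = (\<Sum>r\<in>Z. \<Sum>s\<in>Z. \<Sum>i'\<in>Z. \<Sum>j'\<in>Z. \<Sum>k\<in>Z. \<Sum>l\<in>Z.
      if (i' = ?k r s \<and> j' = ?l s) \<and> (k = (r + int a * s) mod int N \<and> l = s)
      then (\<zeta> powi (j' * k)) *\<^sub>C ?x r s *\<^sub>C
        ((e (i - r) (j - s) * w ^ Suc a) \<otimes>\<^sub>C (e r s * w ^ Suc a)) else 0)"
    by (intro sum.cong refl) (auto simp: ew_power_mult_w simp del: power_Suc)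
  also have "\<dots> = (\<Sum>r\<in>Z. \<Sum>s\<in>Z. (\<zeta> powi (?l s * ((r + int a * s) mod int N))) *\<^sub>C ?x r s *\<^sub>C
      ((e (i - r) (j - s) * w ^ Suc a) \<otimes>\<^sub>C (e r s * w ^ Suc a)))"
    by (intro sum.cong refl) (simp only: sum_Z_delta2 mod_Z)
  also have "\<dots> = (\<Sum>r\<in>Z. \<Sum>s\<in>Z. (\<zeta> powi ((j - s) * (int (Suc a) * r + int (Suc a choose 2) * s))) *\<^sub>C
    ((e (i - r) (j - s) * w ^ Suc a) \<otimes>\<^sub>C (e r s * w ^ Suc a)))"
  proof (intro sum.cong refl)
    fix r s
    have "\<zeta> powi (?l s * ((r + int a * s) mod int N)) = \<zeta> powi ((j - s) * (r + int a * s))"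
      by (rule theta_cong) (simp add: cong_def mod_simps)
    moreover have "(j - s) * (r + int a * s) + (j - s) * (int a * r + int (a choose 2) * s)
        = (j - s) * (int (Suc a) * r + int (Suc a choose 2) * s)"
      by (simp add: algebra_simps numeral_2_eq_2)
    ultimately show "(\<zeta> powi (?l s * ((r + int a * s) mod int N))) *\<^sub>C ?x r s *\<^sub>C
      ((e (i - r) (j - s) * w ^ Suc a) \<otimes>\<^sub>C (e r s * w ^ Suc a))
      = (\<zeta> powi ((j - s) * (int (Suc a) * r + int (Suc a choose 2) * s))) *\<^sub>C
      ((e (i - r) (j - s) * w ^ Suc a) \<otimes>\<^sub>C (e r s * w ^ Suc a))"
      by (simp only: scaleC_scaleC theta_add[symmetric])
  qed
  finally show ?case .
qed

lemma counit_ew_power: "\<epsilon> (e i j * w ^ a) = (if int N dvd i \<and> int N dvd j then 1 else 0)"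
proof -
  have "\<epsilon> (w ^ a) = 1"
    by (induction a) (simp_all add: counit_one counit_mult counit_W)
  then show ?thesis by (simp add: counit_mult counit_e)
qed

text \<open>In a nonzero term, factor number \<open>n\<close>, counted from 0, has the index
  \<open>(p + n * a * q, q)\<close>, while the second indices before it add up to
  \<open>n * q\<close>. Inserting this into the twist of \<open>comult_ew_power\<close> gives the
  increment.\<close>

primrec P :: "nat \<Rightarrow> nat \<Rightarrow> int \<Rightarrow> int \<Rightarrow> int"
  where
    "P 0 a p q = 0"
  | "P (Suc n) a p q = P n a p q + int n * q * (int a * (p + int n * int a * q) + int (a choose 2) * q)"

lemma sweedler_power_ew:
  "sweedler_power \<Delta> \<epsilon> n (e i j * w ^ a) = (\<Sum>p\<in>Z. \<Sum>q\<in>Z.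
    if [int n * p + int (n choose 2) * int a * q = i] (mod int N) \<and> [int n * q = j] (mod int N)
    then (\<zeta> powi P n a p q) *\<^sub>C (e p q * w ^ (a * n)) else 0)"
proof (induction n arbitrary: i j)
  case 0
  have "(\<Sum>p\<in>Z. \<Sum>q\<in>Z. if [0 = i] (mod int N) \<and> [0 = j] (mod int N) then e p q else 0)
      = (if int N dvd i \<and> int N dvd j then 1 else 0)"
    by (cases "int N dvd i \<and> int N dvd j") (auto simp: sum_e cong_0_iff cong_sym_eq[of 0])
  then show ?case by (simp add: counit_ew_power scaleC_one binomial_eq_0 cong: if_cong)
next
  case (Suc n)
  let ?c = "\<lambda>p q i j. [int n * p + int (n choose 2) * int a * q = i] (mod int N) \<and> [int n * q = j] (mod int N)"
  let ?r = "\<lambda>p q. (p + int (a * n) * q) mod int N"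
  let ?x = "\<lambda>r s. \<zeta> powi ((j - s) * (int a * r + int (a choose 2) * s))"
  have "sweedler_power \<Delta> \<epsilon> (Suc n) (e i j * w ^ a) = (\<Sum>r\<in>Z. \<Sum>s\<in>Z. ?x r s *\<^sub>C
      ((\<Sum>p\<in>Z. \<Sum>q\<in>Z. if ?c p q (i - r) (j - s) then (\<zeta> powi P n a p q) *\<^sub>C (e p q * w ^ (a * n)) else 0) * (e r s * w ^ a)))"
    by (simp add: comult_ew_power sweedler_lift_simps Suc)
  also have "\<dots> = (\<Sum>r\<in>Z. \<Sum>s\<in>Z. \<Sum>p\<in>Z. \<Sum>q\<in>Z. if r = ?r p q \<and> s = q then
      (if ?c p q (i - r) (j - s) then (\<zeta> powi P (Suc n) a p q) *\<^sub>C (e p q * w ^ (a * Suc n)) else 0) else 0)"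
    unfolding sum_distrib_right scaleC_sum_right
  proof (intro sum.cong refl)
    fix r s p q assume Z: "r \<in> Z" "s \<in> Z" "p \<in> Z" "q \<in> Z"
    have ew: "e p q * w ^ (a * n) * (e r s * w ^ a) = (if r = ?r p q \<and> s = q then e p q * w ^ (a * Suc n) else 0)"
      using ew_power_mult[OF Z(1,2), of p q "a * n" a] Z by (simp add: add.commute)
    show "?x r s *\<^sub>C ((if ?c p q (i - r) (j - s) then (\<zeta> powi P n a p q) *\<^sub>C (e p q * w ^ (a * n)) else 0) * (e r s * w ^ a))
      = (if r = ?r p q \<and> s = q then
      (if ?c p q (i - r) (j - s) then (\<zeta> powi P (Suc n) a p q) *\<^sub>C (e p q * w ^ (a * Suc n)) else 0) else 0)"
    proof (rule scaleC_if_mult[OF ew])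
      assume True: "?c p q (i - r) (j - s)" "r = ?r p q \<and> s = q"
      have r: "[r = p + int n * int a * q] (mod int N)"
        using True by (simp add: cong_def mult_ac)
      have j: "[j - s = int n * q] (mod int N)" and s: "s = q"
        using True cong_sym[of "int n * q" "j - s"] by blast+
      have "?x r s = \<zeta> powi (int n * q * (int a * (p + int n * int a * q) + int (a choose 2) * q))"
        unfolding s by (intro theta_cong cong_mult cong_add cong_refl r j[unfolded s])
      then show "?x r s * \<zeta> powi P n a p q = \<zeta> powi P (Suc n) a p q"
        by (simp add: theta_add mult.commute)
    qed
  qed
  also have "\<dots> = (\<Sum>p\<in>Z. \<Sum>q\<in>Z. \<Sum>r\<in>Z. \<Sum>s\<in>Z. if r = ?r p q \<and> s = q then
      (if ?c p q (i - r) (j - s) then (\<zeta> powi P (Suc n) a p q) *\<^sub>C (e p q * w ^ (a * Suc n)) else 0) else 0)"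
    by (rule sum_swap_pairs)
  also have "\<dots> = (\<Sum>p\<in>Z. \<Sum>q\<in>Z. if ?c p q (i - ?r p q) (j - q)
      then (\<zeta> powi P (Suc n) a p q) *\<^sub>C (e p q * w ^ (a * Suc n)) else 0)"
    by (intro sum.cong refl) (subst sum_delta_pair, simp_all only: mod_Z finite_atLeastLessThan_int)
  also have "\<dots> = (\<Sum>p\<in>Z. \<Sum>q\<in>Z.
    if [int (Suc n) * p + int (Suc n choose 2) * int a * q = i] (mod int N) \<and> [int (Suc n) * q = j] (mod int N)
    then (\<zeta> powi P (Suc n) a p q) *\<^sub>C (e p q * w ^ (a * Suc n)) else 0)"
  proof -
    have "[int n * p + int (n choose 2) * int a * q = i - ?r p q] (mod int N) \<longleftrightarrow>
        [int (Suc n) * p + int (Suc n choose 2) * int a * q = i] (mod int N)" for p q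
    proof -
      have "[int n * p + int (n choose 2) * int a * q = i - ?r p q] (mod int N) \<longleftrightarrow>
          [int n * p + int (n choose 2) * int a * q = i - (p + int (a * n) * q)] (mod int N)"
        by (simp add: cong_def mod_simps)
      then show ?thesis
        by (simp add: cong_iff_dvd_diff algebra_simps numeral_2_eq_2)
    qed
    moreover have "[int n * q = j - q] (mod int N) \<longleftrightarrow> [int (Suc n) * q = j] (mod int N)" for q
      by (simp add: cong_iff_dvd_diff algebra_simps)
    ultimately show ?thesis by simp
  qed
  finally show ?case .
qed

lemma N_complex: "(of_nat N :: complex) \<noteq> 0"
  using N_pos by simp

definition "\<Lambda> = (1 / of_nat N) *\<^sub>C (\<Sum>a<N. e 0 0 * w ^ a)"

lemma normalized_integral: "normalized_integral \<epsilon> = \<Lambda>"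
proof (rule normalized_integral_eq)
  show "\<epsilon> \<Lambda> = 1"
    using N_complex by (simp add: \<Lambda>_def counit_simps counit_ew_power)
  have z: "e i j * e 0 0 = (if int N dvd i \<and> int N dvd j then e 0 0 else 0)"
      "e 0 0 * e i j = (if int N dvd i \<and> int N dvd j then e 0 0 else 0)" for i j
    using e_cong[of i 0 j 0] by (auto simp: e_mult cong_0_iff cong_sym_eq[of 0])
  have zN: "e 0 0 * w ^ N = e 0 0"
    using e_w_power_N[of 0 0] by (simp add: scaleC_one)
  have shift: "(\<Sum>a<N. e 0 0 * w ^ Suc a) = (\<Sum>a<N. e 0 0 * w ^ a)"
  proof -
    have "e 0 0 * w ^ 0 + (\<Sum>a<N. e 0 0 * w ^ Suc a) = (\<Sum>a<Suc N. e 0 0 * w ^ a)"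
      by (rule sum.lessThan_Suc_shift[symmetric])
    also have "\<dots> = (\<Sum>a<N. e 0 0 * w ^ a) + e 0 0 * w ^ N" by simp
    finally show ?thesis by (simp add: zN)
  qed
  have w\<Lambda>: "w * \<Lambda> = \<Lambda>" "\<Lambda> * w = \<Lambda>"
  proof -
    have "w * (e 0 0 * w ^ a) = e 0 0 * w ^ Suc a" for a
      by (simp add: w_e flip: mult.assoc)
    then show "w * \<Lambda> = \<Lambda>"
      using shift by (simp add: \<Lambda>_def scaleC_mult_right sum_distrib_left)
    show "\<Lambda> * w = \<Lambda>"
      using shift by (simp add: \<Lambda>_def scaleC_mult_left sum_distrib_right mult.assoc power_commutes)
  qed
  have w\<Lambda>': "w ^ a * \<Lambda> = \<Lambda>" "\<Lambda> * w ^ a = \<Lambda>" for a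
    by (induction a) (simp_all add: w\<Lambda> mult.assoc, simp add: w\<Lambda> flip: mult.assoc)
  have e\<Lambda>: "e i j * \<Lambda> = \<epsilon> (e i j) *\<^sub>C \<Lambda>" "\<Lambda> * e i j = \<epsilon> (e i j) *\<^sub>C \<Lambda>" for i j
  proof -
    show "e i j * \<Lambda> = \<epsilon> (e i j) *\<^sub>C \<Lambda>"
      by (simp add: \<Lambda>_def scaleC_mult_right sum_distrib_left z counit_e scaleC_one flip: mult.assoc)
    have "e 0 0 * w ^ a * e i j = \<epsilon> (e i j) *\<^sub>C (e 0 0 * w ^ a)" for a
    proof -
      have "e 0 0 * w ^ a * e i j = e 0 0 * e (i - int a * j) j * w ^ a"
        by (simp add: mult.assoc wpow_e)
      moreover have "int N dvd i - int a * j \<longleftrightarrow> int N dvd i" if "int N dvd j"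
        using that by (simp add: dvd_diff_left_iff)
      ultimately show ?thesis
        by (cases "int N dvd j"; cases "int N dvd i") (simp_all add: z counit_e scaleC_one)
    qed
    then show "\<Lambda> * e i j = \<epsilon> (e i j) *\<^sub>C \<Lambda>"
      by (simp add: \<Lambda>_def scaleC_mult_left sum_distrib_right scaleC_sum_right scaleC_scaleC mult.commute)
  qed
  have "\<Lambda> * (e i j * w ^ a) = \<epsilon> (e i j) *\<^sub>C \<Lambda>" for i j a
    by (simp add: e\<Lambda> w\<Lambda>' scaleC_mult_left flip: mult.assoc)
  then show "integral_elem \<epsilon> \<Lambda>"
    by (intro integral_elem_of_span[OF span_basis])
      (auto simp: b_def e\<Lambda> w\<Lambda>' counit_ew_power counit_e mult.assoc)
qed

lemma coord_ew_power:
  assumes "p \<in> Z" "q \<in> Z" "k \<in> Z" "l \<in> Z" "a < N"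
  shows "coord (k, l, a) (e p q * w ^ c)
    = (if k = p \<and> l = q \<and> a = c mod N then \<xi> powi (q * int (c div N)) else 0)"
proof -
  have mem: "(p, q, c mod N) \<in> I" "(k, l, a) \<in> I"
    using assms N_pos by (simp_all add: I_def)
  have "coord (k, l, a) (e p q * w ^ c) = \<xi> powi (q * int (c div N)) * coord (k, l, a) (b (p, q, c mod N))"
    by (subst e_w_power) (simp add: coord_simps[OF mem(2)] b_def)
  then show ?thesis
    unfolding coord_basis[OF mem(2,1)] by auto
qed

lemma coord_0: "k \<in> Z \<Longrightarrow> l \<in> Z \<Longrightarrow> a < N \<Longrightarrow> coord (k, l, a) 0 = 0"
  by (rule coord_simps(4)) (simp add: I_def)

text \<open>Left multiplication shifts the exponent of \<open>w\<close> by \<open>c\<close> modulo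
  \<open>N\<close>, so there are no diagonal entries unless \<open>N dvd c\<close>. In that case the
  word acts as one scalar on the \<open>N\<close> basis words with index
  \<open>(p, q)\<close>.\<close>

lemma regular_character_ew_power:
  assumes Z: "p \<in> Z" "q \<in> Z"
  shows "regular_character (e p q * w ^ c) = (if N dvd c then of_nat N * \<xi> powi (q * int (c div N)) else 0)"
proof -
  have "regular_character (e p q * w ^ c)
      = (\<Sum>k\<in>Z. \<Sum>l\<in>Z. \<Sum>a<N. coord (k, l, a) (e p q * w ^ c * b (k, l, a)))"
    unfolding regular_character_eq I_def by (simp add: sum.cartesian_product)
  also have "\<dots> = (\<Sum>k\<in>Z. \<Sum>l\<in>Z. if k = p \<and> l = q
      then \<Sum>a<N. if N dvd c then \<xi> powi (q * int (c div N)) else 0 else 0)"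
  proof (intro sum.cong refl)
    fix k l assume kl: "k \<in> Z" "l \<in> Z"
    have *: "coord (k, l, a) (e p q * w ^ c * b (k, l, a))
        = (if k = p \<and> l = q then if N dvd c then \<xi> powi (q * int (c div N)) else 0 else 0)" if a: "a < N" for a
    proof -
      have m: "a = (c + a) mod N \<longleftrightarrow> N dvd c"
      proof
        assume "a = (c + a) mod N"
        then have "[c + a = 0 + a] (mod N)" using a by (simp add: cong_def)
        then have "[c = 0] (mod N)" by (simp only: cong_add_rcancel_nat)
        then show "N dvd c" by (simp add: cong_0_iff)
      next
        assume "N dvd c"
        then show "a = (c + a) mod N" using a by (auto elim!: dvdE)
      qed
      have d: "(c + a) div N = c div N" if "N dvd c"
        using that a N_pos by (auto elim!: dvdE)
      have k: "(p + int c * q) mod int N = p" if "N dvd c"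
        using that Z(1) by (auto elim!: dvdE simp: mult.assoc)
      have "e p q * w ^ c * b (k, l, a) = (if k = (p + int c * q) mod int N \<and> l = q then e p q * w ^ (c + a) else 0)"
        using ew_power_mult[OF kl, of p q c a] Z by (simp add: b_def)
      then show ?thesis
        using Z kl a m d k by (auto simp: coord_ew_power coord_0)
    qed
    show "(\<Sum>a<N. coord (k, l, a) (e p q * w ^ c * b (k, l, a))) = (if k = p \<and> l = q
      then \<Sum>a<N. if N dvd c then \<xi> powi (q * int (c div N)) else 0 else 0)"
    proof -
      have "(\<Sum>a<N. coord (k, l, a) (e p q * w ^ c * b (k, l, a)))
        = (\<Sum>a<N. if k = p \<and> l = q then if N dvd c then \<xi> powi (q * int (c div N)) else 0 else 0)"
        by (intro sum.cong refl *) simp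
      then show ?thesis by simp
    qed
  qed
  also have "\<dots> = (\<Sum>a<N. if N dvd c then \<xi> powi (q * int (c div N)) else 0)"
    using Z by (simp add: sum_delta_pair)
  finally show ?thesis by simp
qed

lemma FS_indicator_eq:
  "FS_indicator \<Delta> \<epsilon> n = (\<Sum>a<N. \<Sum>p\<in>Z. \<Sum>q\<in>Z.
    if int N dvd int n * p + int (n choose 2) * int a * q \<and> int N dvd int n * q \<and> N dvd a * n
    then \<zeta> powi P n a p q * \<xi> powi (q * int (a * n div N)) else 0)"
proof -
  let ?c = "\<lambda>a p q. int N dvd int n * p + int (n choose 2) * int a * q \<and> int N dvd int n * q"
  have "regular_character (sweedler_power \<Delta> \<epsilon> n \<Lambda>) = (1 / of_nat N) *
    (\<Sum>a<N. \<Sum>p\<in>Z. \<Sum>q\<in>Z. regular_character (if ?c a p q then (\<zeta> powi P n a p q) *\<^sub>C (e p q * w ^ (a * n)) else 0))"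
    by (simp add: \<Lambda>_def sweedler_power_simps sweedler_power_ew regular_character_simps cong_0_iff)
  also have "\<dots> = (1 / of_nat N) * (\<Sum>a<N. \<Sum>p\<in>Z. \<Sum>q\<in>Z. of_nat N *
    (if ?c a p q \<and> N dvd a * n then \<zeta> powi P n a p q * \<xi> powi (q * int (a * n div N)) else 0))"
    by (intro arg_cong2[where f = times] sum.cong refl) (simp add: regular_character_ew_power regular_character_simps)
  finally show ?thesis
    using N_complex by (simp add: FS_indicator_def normalized_integral conj_assoc flip: sum_distrib_left)
qed

text \<open>The increments are separated into the part linear in the position of a factor, which
  gives the triangular number, and the quadratic part, which gives a sum of squares.\<close>

lemma P_eq:
  "P n a p q = int (n choose 2) * (q * (int a * p + int (a choose 2) * q)) + (\<Sum>l<n. (int l)\<^sup>2) * (int a * q)\<^sup>2"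
proof (induction n)
  case (Suc n)
  have "Suc n choose 2 = n + (n choose 2)" by (simp add: numeral_2_eq_2)
  then show ?case
    by (simp add: Suc algebra_simps power2_eq_square)
qed (simp add: binomial_eq_0)

text \<open>For odd \<open>n\<close> the triangular number \<open>n choose 2\<close> is a multiple
  of \<open>n\<close>. So, on the support of the indicator, the terms with it vanish modulo
  \<open>N\<close> and only the sum of squares stays in the exponent.\<close>

lemma dvd_choose_two:
  assumes "odd n" "int N dvd int n * q"
  shows "int N dvd int (n choose 2) * (q * x)"
proof -
  obtain h where h: "n = 2 * h + 1" using assms(1) by (metis oddE)
  have "int (n choose 2) = int n * int h"
    using two_mult_choose_two[of n] by (simp add: h)
  then have "int (n choose 2) * (q * x) = (int n * q) * (int h * x)" by simp
  then show ?thesis using assms(2) by (metis dvd_mult2)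
qed

text \<open>The variable \<open>p\<close> occurs only in a linear condition and contributes
  \<open>d\<close>. The other conditions make \<open>a\<close> and \<open>q\<close> multiples of
  \<open>N div d\<close>, by \<open>j\<close> and \<open>k\<close>, so that \<open>(a q)^2\<close>
  becomes \<open>(N div d)^4 j^2 k^2\<close>.\<close>

lemma FS_indicator_odd:
  fixes n :: nat
  assumes n: "odd n"
  defines "d \<equiv> gcd n N"
  shows "FS_indicator \<Delta> \<epsilon> n = of_nat d * (\<Sum>j<d. \<Sum>k<d.
    (\<zeta> powi ((\<Sum>l<n. (int l)\<^sup>2) * (int (N div d)) ^ 4)) ^ (j\<^sup>2 * k\<^sup>2) * ((\<xi> ^ (N div d)) ^ (n div d)) ^ (j * k))"
proof -
  define Q where "Q = (\<Sum>l<n. (int l)\<^sup>2)"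
  define g where "g a q = \<zeta> powi (Q * (a * q)\<^sup>2) * \<xi> powi (q * (int n * a div int N))" for a q
  define f where "f a = (if int N dvd int n * a then \<Sum>q\<in>Z. if int N dvd int n * q then g a q else 0 else 0)" for a
  have "FS_indicator \<Delta> \<epsilon> n = (\<Sum>a<N. \<Sum>p\<in>Z. \<Sum>q\<in>Z. (if int N dvd int n * p then 1 else 0) *
      (if int N dvd int n * int a then if int N dvd int n * q then g (int a) q else 0 else 0))"
    unfolding FS_indicator_eq
  proof (intro sum.cong refl)
    fix a p q
    let ?c = "int N dvd int n * p + int (n choose 2) * int a * q \<and> int N dvd int n * q \<and> N dvd a * n"
    let ?d = "int N dvd int n * p \<and> int N dvd int n * int a \<and> int N dvd int n * q"
    have "N dvd a * n \<longleftrightarrow> int N dvd int n * int a"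
      unfolding of_nat_mult[symmetric] int_dvd_int_iff by (simp only: mult.commute)
    moreover have "int N dvd int n * p + int (n choose 2) * int a * q \<longleftrightarrow> int N dvd int n * p" if "int N dvd int n * q"
      using dvd_choose_two[OF n that, of "int a"] by (simp add: dvd_add_left_iff mult_ac)
    ultimately have cd: "?c \<longleftrightarrow> ?d" by blast
    have "\<zeta> powi P n a p q = \<zeta> powi (Q * (int a * q)\<^sup>2)" if "int N dvd int n * q"
    proof (rule theta_cong)
      show "[P n a p q = Q * (int a * q)\<^sup>2] (mod int N)"
        unfolding P_eq Q_def cong_iff_dvd_diff using dvd_choose_two[OF n that] by simp
    qed
    moreover have "int (a * n div N) = int n * int a div int N"
      by (simp add: zdiv_int mult.commute)
    ultimately have "\<zeta> powi P n a p q * \<xi> powi (q * int (a * n div N)) = g (int a) q" if ?d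
      using that by (simp only: g_def)
    then have "(if ?c then \<zeta> powi P n a p q * \<xi> powi (q * int (a * n div N)) else 0) = (if ?d then g (int a) q else 0)"
      unfolding cd by (simp only: cong: if_cong)
    then show "(if ?c then \<zeta> powi P n a p q * \<xi> powi (q * int (a * n div N)) else 0)
      = (if int N dvd int n * p then 1 else 0) *
      (if int N dvd int n * int a then if int N dvd int n * q then g (int a) q else 0 else 0)"
      by (simp only:) simp
  qed
  also have "\<dots> = (\<Sum>a<N. of_nat d * f (int a))"
  proof (intro sum.cong refl)
    fix a
    have "(\<Sum>p\<in>Z. \<Sum>q\<in>Z. (if int N dvd int n * p then 1 else 0) *
      (if int N dvd int n * int a then if int N dvd int n * q then g (int a) q else 0 else 0))
      = (\<Sum>p\<in>Z. if int N dvd int n * p then 1 else 0) *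
        (\<Sum>q\<in>Z. if int N dvd int n * int a then if int N dvd int n * q then g (int a) q else 0 else 0)"
      by (rule sum_product[symmetric])
    also have "(\<Sum>p\<in>Z. if int N dvd int n * p then 1 else 0) = (of_nat d :: complex)"
      unfolding card_annihilator[OF N_pos] d_def by simp
    also have "(\<Sum>q\<in>Z. if int N dvd int n * int a then if int N dvd int n * q then g (int a) q else 0 else 0) = f (int a)"
      unfolding f_def by (cases "int N dvd int n * int a") (simp_all only: if_True if_False sum.neutral_const)
    finally show "(\<Sum>p\<in>Z. \<Sum>q\<in>Z. (if int N dvd int n * p then 1 else 0) *
      (if int N dvd int n * int a then if int N dvd int n * q then g (int a) q else 0 else 0)) = of_nat d * f (int a)" .
  qed
  also have "\<dots> = of_nat d * (\<Sum>a\<in>Z. f a)"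
    unfolding sum_distrib_left[symmetric]
    by (rule arg_cong2[where f = times, OF refl]) (rule sum.reindex_bij_witness[of _ nat int], auto)
  also have "(\<Sum>a\<in>Z. f a) = (\<Sum>j\<in>{0..<int d}. \<Sum>k\<in>{0..<int d}. g (int N div int d * j) (int N div int d * k))"
    unfolding f_def sum_annihilator[OF N_pos] by (simp add: d_def)
  also have "\<dots> = (\<Sum>j<d. \<Sum>k<d. g (int N div int d * int j) (int N div int d * int k))"
  proof -
    have "(\<Sum>j\<in>{0..<int d}. h j) = (\<Sum>j<d. h (int j))" for h :: "int \<Rightarrow> complex"
      by (rule sum.reindex_bij_witness[of _ int nat]) auto
    then show ?thesis by simp
  qed
  also have "\<dots> = (\<Sum>j<d. \<Sum>k<d.
    (\<zeta> powi (Q * (int (N div d)) ^ 4)) ^ (j\<^sup>2 * k\<^sup>2) * ((\<xi> ^ (N div d)) ^ (n div d)) ^ (j * k))"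
  proof (intro sum.cong refl arg_cong2[where f = times])
    fix j k
    define b c where "b = N div d" and "c = n div d"
    have d0: "d > 0" using N_pos by (simp add: d_def)
    have N: "N = d * b" and nc: "n = d * c" by (simp_all add: b_def c_def d_def)
    have bd: "int N div int d = int b" by (simp add: b_def zdiv_int)
    have "int n * (int b * int j) div int N = int c * int j"
    proof -
      have "int n * (int b * int j) = int N * (int c * int j)" by (simp add: N nc)
      then show ?thesis using N_pos by (simp only:) (intro nonzero_mult_div_cancel_left, simp)
    qed
    then have "int b * int k * (int n * (int b * int j) div int N) = int (b * c * (j * k))"
      by simp
    then have "\<xi> powi (int b * int k * (int n * (int b * int j) div int N)) = ((\<xi> ^ b) ^ c) ^ (j * k)"
      by (simp only: power_int_of_nat power_mult)
    moreover have "Q * (int b * int j * (int b * int k))\<^sup>2 = (Q * int b ^ 4) * int (j\<^sup>2 * k\<^sup>2)"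
      by (simp add: power2_eq_square power4_eq_xxxx mult_ac)
    then have "\<zeta> powi (Q * (int b * int j * (int b * int k))\<^sup>2) = (\<zeta> powi (Q * int b ^ 4)) ^ (j\<^sup>2 * k\<^sup>2)"
      by (simp only: power_int_mult power_int_of_nat)
    ultimately show "g (int N div int d * int j) (int N div int d * int k)
      = (\<zeta> powi (Q * (int (N div d)) ^ 4)) ^ (j\<^sup>2 * k\<^sup>2) * ((\<xi> ^ (N div d)) ^ (n div d)) ^ (j * k)"
      unfolding g_def bd b_def[symmetric] c_def[symmetric] by simp
  qed
  finally show ?thesis unfolding Q_def .
qed

lemma Frobenius_theorem:
  assumes "odd N"
  shows "Frobenius_theorem_holds \<Delta> \<epsilon>"
  unfolding Frobenius_theorem_holds_def dim
proof (intro allI impI)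
  fix n :: nat assume n: "n > 0" "n dvd N ^ 3"
  have "odd n" using assms n(2) by (metis dvd_trans even_power)
  then obtain h where h: "n = 2 * h + 1" by (metis oddE)
  define d b c where "d = gcd n N" and "b = N div d" and "c = n div d"
  have d0: "d > 0" using N_pos by (simp add: d_def)
  have N: "N = d * b" and nc: "n = d * c" by (simp_all add: b_def c_def d_def)
  have c0: "c > 0" using n(1) nc by (cases c) auto
  have cop: "coprime c b" unfolding b_def c_def d_def using n(1) by (intro div_gcd_coprime) auto
  have "d * c dvd d * (d\<^sup>2 * b ^ 3)"
    using n(2) unfolding nc N by (simp add: power_mult_distrib power2_eq_square power3_eq_cube mult_ac)
  then have "c dvd d\<^sup>2 * b ^ 3" using d0 by simp
  then have cd: "c dvd d\<^sup>2" using cop by (simp add: coprime_dvd_mult_left_iff)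
  define Q where "Q = (\<Sum>l<n. (int l)\<^sup>2)"
  define \<omega> where "\<omega> = \<zeta> powi (Q * int b ^ 4)"
  \<comment> \<open>\<open>6 * Q = n * (n - 1) * (2 * n - 1)\<close> with
    \<open>n = 2 * h + 1\<close>: the 2 cancels against \<open>n - 1\<close>, the 3 remains.\<close>
  have Q3: "3 * Q = int n * (int h * (4 * int h + 1))"
    unfolding Q_def h by (induction h) (simp_all add: algebra_simps power2_eq_square)
  have zeta_1: "\<zeta> powi k = 1" if "int N dvd k" for k
    using theta_cong[of k 0] that by (simp add: cong_0_iff)
  have \<omega>_1: "\<omega> ^ t = 1" if "int N dvd Q * int b ^ 4 * int t" for t
  proof -
    have "\<omega> ^ t = \<zeta> powi (Q * int b ^ 4 * int t)"
      unfolding \<omega>_def by (simp only: power_int_mult power_int_of_nat)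
    then show ?thesis using zeta_1[OF that] by simp
  qed
  have b4: "int N dvd int d * int b ^ 4"
    by (simp add: N power4_eq_xxxx)
  \<comment> \<open>If 3 divides \<open>c\<close>, the denominator 3 is absorbed and \<omega> is 1;
    otherwise \<open>\<omega>^3 = 1\<close> and 3 is prime to \<open>c\<close>. So \<open>t\<close>
    is 1 or 3.\<close>
  have "\<exists>t > 0. \<omega> ^ t = 1 \<and> coprime t c"
  proof (cases "3 dvd c")
    case True
    then obtain c' where c': "c = 3 * c'" by blast
    have "Q = int d * (int c' * (int h * (4 * int h + 1)))"
      using Q3 by (simp add: nc c')
    then have "Q * int b ^ 4 * int 1 = (int d * int b ^ 4) * (int c' * (int h * (4 * int h + 1)))"
      by simp
    then have "\<omega> ^ 1 = 1"
      using b4 by (intro \<omega>_1) (metis dvd_mult2)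
    then show ?thesis by (intro exI[of _ 1]) simp
  next
    case False
    have "Q * int b ^ 4 * int 3 = (3 * Q) * int b ^ 4" by simp
    also have "\<dots> = (int d * int b ^ 4) * (int c * (int h * (4 * int h + 1)))"
      unfolding Q3 by (simp add: nc)
    finally have "\<omega> ^ 3 = 1"
      using b4 by (intro \<omega>_1) (metis dvd_mult2)
    moreover have "coprime 3 c"
      using False by (intro prime_imp_coprime) simp_all
    ultimately show ?thesis by (intro exI[of _ 3]) simp
  qed
  then obtain t where t: "t > 0" "\<omega> ^ t = 1" "coprime t c" by blast
  have "int N dvd Q * int b ^ 4 * int d"
    using b4 by (metis dvd_mult mult.assoc mult.commute)
  then have \<omega>d: "\<omega> ^ d = 1" by (rule \<omega>_1)
  have "(\<xi> ^ b) ^ d = 1" using xi by (simp add: N mult.commute flip: power_mult)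
  from dvd_exponential_sum[OF d0 t \<omega>d this refl c0 cd]
  obtain z where z: "algebraic_int z"
      "(\<Sum>j<d. \<Sum>k<d. \<omega> ^ (j\<^sup>2 * k\<^sup>2) * ((\<xi> ^ b) ^ c) ^ (j * k)) = of_nat c * z"
    by blast
  have "FS_indicator \<Delta> \<epsilon> n = of_nat d * (\<Sum>j<d. \<Sum>k<d. \<omega> ^ (j\<^sup>2 * k\<^sup>2) * ((\<xi> ^ b) ^ c) ^ (j * k))"
    unfolding \<omega>_def Q_def b_def c_def d_def by (rule FS_indicator_odd[OF \<open>odd n\<close>])
  also have "\<dots> = of_nat (d * c) * z"
    unfolding z(2) by (simp add: mult.assoc)
  finally have "FS_indicator \<Delta> \<epsilon> n = of_nat n * z"
    unfolding nc[symmetric] .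
  with z(1) show "\<exists>z. algebraic_int z \<and> FS_indicator \<Delta> \<epsilon> n = of_nat n * z" by blast
qed

end

lemma Frobenius_theorem_HN3:
  assumes "hopf_algebra \<Delta> \<epsilon> S" "odd N" "\<xi> ^ N = 1" "\<zeta> ^ N = 1" "iso_HN3 N \<xi> \<zeta> \<Delta> \<epsilon>"
  shows "Frobenius_theorem_holds \<Delta> \<epsilon>"
proof -
  have "N > 0" using assms(2) by (cases N) auto
  then obtain \<gamma> where "HN3 \<Delta> \<epsilon> S N \<gamma> \<xi> \<zeta>"
    using assms unfolding iso_HN3_def HN3_def torus_extension_def torus_extension_axioms_def HN3_axioms_def
    by (auto simp: HN3_relations_def)
  then show ?thesis using assms(2) by (rule HN3.Frobenius_theorem)
qed

section \<open>Signed counts of multiples\<close>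

text \<open>Traces of powers of words lead to such sums: a generator has \<open>M\<close>-th power
  \<sigma> on a graded component, so only exponents divisible by \<open>M\<close> count, each with
  its sign. \<open>odd_sum\<close> is the counterpart for odd exponents.\<close>

definition even_sum :: "nat \<Rightarrow> nat \<Rightarrow> int \<Rightarrow> int"
  where "even_sum m M \<sigma> = (\<Sum>i<M. if M dvd 2 * m * i then \<sigma> ^ (2 * m * i div M) else 0)"

definition odd_sum :: "nat \<Rightarrow> nat \<Rightarrow> int \<Rightarrow> int"
  where "odd_sum m M \<sigma> = (\<Sum>i<M. if M dvd m * (2 * i + 1) then \<sigma> ^ (m * (2 * i + 1) div M) else 0)"

lemma dvd_mult_gcd_iff:
  fixes a b d i :: nat
  assumes "coprime a b" "d > 0"
  shows "d * b dvd d * a * i \<longleftrightarrow> b dvd i"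
  using assms by (simp add: mult.assoc coprime_commute coprime_dvd_mult_right_iff)

lemma sum_multiples:
  fixes b d :: nat
  assumes "b > 0"
  shows "(\<Sum>i<b * d. if b dvd i then g i else 0) = (\<Sum>i<d. g (b * i) :: 'a::comm_monoid_add)"
proof -
  have "(\<Sum>i<b * d. if b dvd i then g i else 0) = (\<Sum>i\<in>{i \<in> {..<b * d}. b dvd i}. g i)"
    by (rule sum.inter_filter[symmetric]) simp
  also have "\<dots> = (\<Sum>i<d. g (b * i))"
    by (rule sum.reindex_bij_witness[of _ "\<lambda>i. b * i" "\<lambda>i. i div b"]) (use assms in \<open>auto elim!: dvdE\<close>)
  finally show ?thesis .
qed

lemma sum_alternating: "(\<Sum>i<2 * d. (-1 :: int) ^ i) = 0"
  by (induction d) simp_all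

context
  fixes m M d a b :: nat
  assumes m: "m = d * a" and M: "M = d * b" and cop: "coprime a b" and pos: "d > 0" "b > 0"
begin

private lemma div_M: "x = M * q \<Longrightarrow> x div M = q"
  using M pos by simp

lemma even_sum_odd:
  assumes "odd b" "\<sigma> \<in> {1, -1}"
  shows "even_sum m M \<sigma> = int d"
proof -
  have "coprime (2 * a) b" using cop assms(1) by simp
  note iff = dvd_mult_gcd_iff[OF this pos(1)]
  have "M dvd 2 * m * i \<longleftrightarrow> b dvd i" for i
  proof -
    have "2 * m * i = d * (2 * a) * i" by (simp add: m)
    then show ?thesis using iff by (simp only: M)
  qed
  then have "even_sum m M \<sigma> = (\<Sum>i<b * d. if b dvd i then \<sigma> ^ (2 * m * i div M) else 0)"
    unfolding even_sum_def by (simp add: M mult.commute)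
  also have "\<dots> = (\<Sum>i<d. \<sigma> ^ (2 * m * (b * i) div M))"
    by (rule sum_multiples[OF pos(2)])
  also have "\<dots> = (\<Sum>i<d. 1)"
  proof (rule sum.cong[OF refl])
    fix i
    have "2 * m * (b * i) = M * (2 * (a * i))" by (simp add: m M)
    then have "2 * m * (b * i) div M = 2 * (a * i)" by (rule div_M)
    then show "\<sigma> ^ (2 * m * (b * i) div M) = 1"
      using assms(2) by (auto simp: power_mult)
  qed
  finally show ?thesis by simp
qed

text \<open>Twice as many indices contribute as for odd \<open>b\<close>, now with exponents
  \<open>a * i\<close>. Since \<open>a\<close> is odd, the sign -1 alternates and the terms cancel
  in pairs.\<close>

lemma even_sum_even:
  assumes "even b" "\<sigma> \<in> {1, -1}"
  shows "even_sum m M \<sigma> = (if \<sigma> = 1 then 2 * int d else 0)"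
proof -
  obtain b' where b': "b = 2 * b'" using assms(1) by blast
  have "odd a" using cop assms(1) by auto
  have cop': "coprime a b'" using cop b' by simp
  have "M dvd 2 * m * i \<longleftrightarrow> b' dvd i" for i
  proof -
    have eqs: "2 * m * i = (2 * d) * a * i" "M = (2 * d) * b'" by (simp_all add: m M b')
    have "2 * d > 0" using pos(1) by simp
    from dvd_mult_gcd_iff[OF cop' this] show ?thesis unfolding eqs .
  qed
  then have "even_sum m M \<sigma> = (\<Sum>i<b' * (2 * d). if b' dvd i then \<sigma> ^ (2 * m * i div M) else 0)"
    unfolding even_sum_def by (simp add: M b' mult_ac)
  also have "\<dots> = (\<Sum>i<2 * d. \<sigma> ^ (2 * m * (b' * i) div M))"
    by (rule sum_multiples) (use pos b' in simp)
  also have "\<dots> = (\<Sum>i<2 * d. \<sigma> ^ i)"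
  proof (rule sum.cong[OF refl])
    fix i
    have "2 * m * (b' * i) = M * (a * i)" by (simp add: m M b')
    then have "2 * m * (b' * i) div M = a * i" by (rule div_M)
    moreover have "\<sigma> ^ a = \<sigma>" using assms(2) \<open>odd a\<close> by auto
    ultimately show "\<sigma> ^ (2 * m * (b' * i) div M) = \<sigma> ^ i"
      by (simp add: power_mult)
  qed
  also have "\<dots> = (if \<sigma> = 1 then 2 * int d else 0)"
    using assms(2) sum_alternating[of d] by auto
  finally show ?thesis .
qed

lemma odd_sum_even:
  assumes "even b"
  shows "odd_sum m M \<sigma> = 0"
proof -
  have "\<not> M dvd m * (2 * i + 1)" for i
  proof
    assume "M dvd m * (2 * i + 1)"
    then have "b dvd 2 * i + 1"
      using dvd_mult_gcd_iff[OF cop pos(1), of "2 * i + 1"] by (simp only: m M)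
    then have "even (2 * i + 1)" using assms by (rule dvd_trans[rotated])
    then show False by simp
  qed
  then show ?thesis by (simp add: odd_sum_def)
qed

lemma odd_sum_odd:
  assumes "odd b" "\<sigma> \<in> {1, -1}"
  shows "odd_sum m M \<sigma> = int d * \<sigma> ^ a"
proof -
  obtain c where c: "b = 2 * c + 1" using assms(1) by (rule oddE)
  have iff: "M dvd m * (2 * i + 1) \<longleftrightarrow> b dvd 2 * i + 1" for i
    using dvd_mult_gcd_iff[OF cop pos(1), of "2 * i + 1"] by (simp only: m M)
  have "odd_sum m M \<sigma> = (\<Sum>i\<in>{i \<in> {..<M}. b dvd 2 * i + 1}. \<sigma> ^ (m * (2 * i + 1) div M))"
    unfolding odd_sum_def iff by (rule sum.inter_filter[symmetric]) simp
  also have "\<dots> = (\<Sum>i<d. \<sigma> ^ a)"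
  \<comment> \<open>From \<open>b = 2 * c + 1\<close> follows
    \<open>b * (2 * i + 1) = 2 * (b * i + c) + 1\<close>: the odd multiples of \<open>b\<close> sit
    at the indices \<open>b * i + c\<close>.\<close>
  proof (rule sum.reindex_bij_witness[of _ "\<lambda>i. b * i + c" "\<lambda>i. i div b"])
    fix i assume i: "i \<in> {i \<in> {..<M}. b dvd 2 * i + 1}"
    then obtain k where k: "2 * i + 1 = b * k" by auto
    have "odd (b * k)" using k[symmetric] by simp
    then have "odd k" by simp
    then obtain h where h: "k = 2 * h + 1" by (rule oddE)
    have i_eq: "i = b * h + c" using k by (simp add: h c algebra_simps)
    have "c < b" using c by simp
    then have div: "i div b = h" using pos(2) by (simp add: i_eq)
    show "b * (i div b) + c = i" by (simp only: div) (rule i_eq[symmetric])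
    have "i < b * d" using i by (simp add: M mult.commute)
    then have "b * h < b * d" unfolding i_eq by (rule le_less_trans[OF le_add1])
    then show "i div b \<in> {..<d}" by (simp add: div)
    have "m * (2 * i + 1) = M * (a * k)" unfolding k by (simp add: m M)
    then have "m * (2 * i + 1) div M = a * k" by (rule div_M)
    then show "\<sigma> ^ a = \<sigma> ^ (m * (2 * i + 1) div M)"
      using assms(2) \<open>odd k\<close> by (simp only:) (auto simp: minus_one_power_iff)
  next
    fix i assume i: "i \<in> {..<d}"
    have "c < b" using c by simp
    then show "(b * i + c) div b = i" using pos(2) by simp
    have "b * i + c < b * (i + 1)" using \<open>c < b\<close> by simp
    also have "\<dots> \<le> b * d" using i by (intro mult_left_mono) auto
    finally have "b * i + c < M" by (simp add: M mult.commute)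
    moreover have "2 * (b * i + c) + 1 = b * (2 * i + 1)" by (simp add: c algebra_simps)
    then have "b dvd 2 * (b * i + c) + 1" by (rule dvdI)
    ultimately show "b * i + c \<in> {i \<in> {..<M}. b dvd 2 * i + 1}" by simp
  qed
  finally show ?thesis by simp
qed

lemma gcd_double: "gcd (2 * m) M = d * gcd 2 b"
proof -
  have "gcd (2 * m) M = d * gcd (2 * a) b"
    by (simp add: m M gcd_mult_distrib_nat mult_ac)
  also have "gcd (2 * a) b = gcd 2 b"
    using cop by (simp add: gcd_mult_left_right_cancel coprime_commute)
  finally show ?thesis .
qed

end

lemma gcd_factors:
  fixes m M :: nat
  assumes "m > 0" "M > 0"
  obtains d a b where "m = d * a" "M = d * b" "coprime a b" "d > 0" "b > 0"
proof (rule that[of "gcd m M" "m div gcd m M" "M div gcd m M"])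
  show "coprime (m div gcd m M) (M div gcd m M)" using assms by (intro div_gcd_coprime) simp
  show "M div gcd m M > 0" using assms by (simp add: div_greater_zero_iff gcd_le2_nat)
qed (use assms in simp_all)

text \<open>With \<open>d = gcd m N\<close> and \<open>m = d * a\<close>, every term contains
  \<open>d\<close>, and it remains to show that \<open>2 * a\<close> divides the cofactor. The
  hypothesis gives \<open>a dvd 2 * L\<close>. The sums over \<open>L\<close> are compared in the
  same way through \<open>d' = gcd m L\<close>.\<close>

lemma two_mult_dvd_Suzuki_indicator:
  fixes m N L :: nat
  assumes pos: "m > 0" "N > 0" "L > 0" and dvd: "2 * m dvd 4 * N * L"
    and \<alpha>: "\<alpha> \<in> {1, -1}" and \<beta>: "\<beta> \<in> {1, -1}"
  shows "int (2 * m) dvd even_sum m N 1 * even_sum m L 1 + int L * even_sum m N \<alpha>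
    + int L * odd_sum m N 1 + odd_sum m N \<alpha> * odd_sum m L \<beta>"
proof -
  obtain d a b where 1: "m = d * a" "N = d * b" "coprime a b" "d > 0" "b > 0"
    by (rule gcd_factors[OF pos(1,2)])
  obtain d' a' b' where 2: "m = d' * a'" "L = d' * b'" "coprime a' b'" "d' > 0" "b' > 0"
    by (rule gcd_factors[OF pos(1,3)])
  note sumN = even_sum_odd[OF 1] even_sum_even[OF 1] odd_sum_even[OF 1] odd_sum_odd[OF 1]
  note sumL = even_sum_odd[OF 2] even_sum_even[OF 2] odd_sum_even[OF 2] odd_sum_odd[OF 2]
  have "2 * (d * a) dvd 2 * (d * (b * (2 * L)))" using dvd by (simp add: 1 mult_ac)
  then have "a dvd b * (2 * L)" using 1(4) by (simp add: mult_ac)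
  then have a2L: "a dvd 2 * L" using 1(3) by (simp add: coprime_dvd_mult_right_iff)
  have am: "a dvd m" using 1 by simp
  have EL: "even_sum m L 1 = int (gcd (2 * m) L)"
    using sumL(1)[of 1] sumL(2)[of 1] by (cases "even b'") (simp_all add: gcd_double[OF 2])
  have dvd_dI: "int (2 * m) dvd int d * x" if "2 * int a dvd x" for x
    using that by (simp add: 1 mult.left_commute)
  show ?thesis
  proof (cases "even b")
    case True
    have "odd a" using 1(3) True by auto
    then have aL: "a dvd L" using a2L by (simp add: coprime_dvd_mult_right_iff)
    have "even_sum m N 1 * even_sum m L 1 + int L * even_sum m N \<alpha> + int L * odd_sum m N 1
        + odd_sum m N \<alpha> * odd_sum m L \<beta>
      = int d * (2 * int (gcd (2 * m) L) + (if \<alpha> = 1 then 2 * int L else 0))"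
      unfolding EL using sumN(2,3) True \<alpha> by (simp add: algebra_simps)
    also have "int (2 * m) dvd \<dots>"
    proof (rule dvd_dI)
      have "a dvd gcd (2 * m) L" using aL am by simp
      then show "2 * int a dvd 2 * int (gcd (2 * m) L) + (if \<alpha> = 1 then 2 * int L else 0)"
        using aL by (intro dvd_add) (auto simp: int_dvd_int_iff)
    qed
    finally show ?thesis .
  next
    case False
    have "even_sum m N 1 * even_sum m L 1 + int L * even_sum m N \<alpha> + int L * odd_sum m N 1
        + odd_sum m N \<alpha> * odd_sum m L \<beta>
      = int d * (even_sum m L 1 + 2 * int L + \<alpha> ^ a * odd_sum m L \<beta>)"
      using sumN(1,4) False \<alpha> by (simp add: algebra_simps)
    also have "int (2 * m) dvd \<dots>"
    proof (rule dvd_dI)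
      \<comment> \<open>This gcd is \<open>d' * gcd a' 2\<close>, so \<open>a\<close> divides
        \<open>d'\<close> up to a factor 2 that can be missing only for even
        \<open>a'\<close>.\<close>
      have "a dvd gcd m (2 * L)" using am a2L by simp
      also have "gcd m (2 * L) = d' * gcd a' 2"
      proof -
        have "gcd m (2 * L) = d' * gcd a' (2 * b')"
          by (simp add: 2 gcd_mult_distrib_nat mult_ac)
        then show ?thesis using 2(3) by (simp add: gcd_mult_right_right_cancel)
      qed
      finally have ad: "a dvd d' * gcd a' 2" .
      have ad_odd: "a dvd d'" if "odd a'"
      proof -
        have "gcd a' 2 = 1" using that by (simp add: coprime_iff_gcd_eq_1[symmetric])
        then show ?thesis using ad by simp
      qed
      show "2 * int a dvd even_sum m L 1 + 2 * int L + \<alpha> ^ a * odd_sum m L \<beta>"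
      proof (cases "even b'")
        case True
        then have "odd a'" using 2(3) by auto
        then have "a dvd d' + L" using ad_odd 2(2) by simp
        then have "int a dvd int (d' + L)" by (simp only: int_dvd_int_iff)
        then have "2 * int a dvd 2 * int (d' + L)" by (rule mult_dvd_mono[OF dvd_refl])
        then show ?thesis using sumL(2)[of 1] sumL(3)[of \<beta>] True by (simp add: distrib_left)
      next
        case odd_b': False
        \<comment> \<open>For odd \<open>b'\<close> the cofactor is
          \<open>2 * L + (1 + \<sigma>) * d'\<close>, that is \<open>2 * (L + d')\<close> or
          \<open>2 * L\<close> according to the total sign.\<close>
        define \<sigma> where "\<sigma> = \<alpha> ^ a * \<beta> ^ a'"
        have \<sigma>: "\<sigma> = 1 \<or> \<sigma> = -1"
          using \<alpha> \<beta> by (cases "even a"; cases "even a'") (auto simp: \<sigma>_def minus_one_power_iff)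
        have eq: "even_sum m L 1 + 2 * int L + \<alpha> ^ a * odd_sum m L \<beta> = int d' + 2 * int L + \<sigma> * int d'"
          using sumL(1,4) odd_b' \<beta> by (simp add: \<sigma>_def)
        have aL: "a dvd L" if "a dvd d'" using that 2(2) by simp
        have ad_cases: "a dvd d' \<or> (even a \<and> even a')"
        proof (cases "even a'")
          case True
          then have "gcd a' 2 = 2" by (simp add: gcd_nat.absorb2)
          then have "a dvd 2 * d'" using ad by (simp add: mult.commute)
          then show ?thesis using True by (cases "even a") (simp_all add: coprime_dvd_mult_right_iff coprime_commute)
        qed (use ad_odd in simp)
        \<comment> \<open>If \<open>a\<close> does not divide \<open>d'\<close>, the missing 2 is
          found in \<open>d' + L = d' * (1 + b')\<close>, since \<open>b'\<close> is odd.\<close>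
        have sum_dvd: "a dvd d' + L"
        proof (cases "a dvd d'")
          case False
          then have "even a'" using ad_cases by simp
          then have "a dvd d' * 2" using ad by (simp add: gcd_nat.absorb2)
          moreover have "d' * 2 dvd d' * (1 + b')" using odd_b' by (intro mult_dvd_mono) simp_all
          moreover have "d' * (1 + b') = d' + L" by (simp add: 2(2))
          ultimately show ?thesis by (simp only:) (erule dvd_trans)
        qed (use aL in simp)
        show ?thesis
        proof (cases "\<sigma> = 1")
          case True
          have "int a dvd int (d' + L)" using sum_dvd by (simp only: int_dvd_int_iff)
          then have "2 * int a dvd 2 * int (d' + L)" by (rule mult_dvd_mono[OF dvd_refl])
          then show ?thesis unfolding eq True by (simp add: algebra_simps)
        next
          case False
          \<comment> \<open>Otherwise \<open>a\<close> and \<open>a'\<close> would both be even,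
            which makes the total sign 1.\<close>
          have "a dvd L"
          proof (cases "a dvd d'")
            case ndvd: False
            then have "even a" "even a'" using ad_cases by simp_all
            then have "\<sigma> = 1" using \<alpha> \<beta> by (auto simp: \<sigma>_def)
            with False show ?thesis by simp
          qed (use aL in simp)
          then have "2 * int a dvd 2 * int L" by (simp add: int_dvd_int_iff)
          then show ?thesis unfolding eq using \<sigma> False by simp
        qed
      qed
    qed
    finally show ?thesis .
  qed
qed

text \<open>The product is the gcd of \<open>gcd n N * n\<close>, \<open>n * L\<close> and
  \<open>N * L\<close>, all multiples of \<open>n\<close>.\<close>

lemma dvd_gcd_mult_gcd:
  fixes n N L :: nat
  assumes "n dvd N * L"
  shows "n dvd gcd n N * gcd n L"
proof -
  have "gcd n N * gcd n L = gcd (gcd n N * n) (gcd n N * L)"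
    by (simp add: gcd_mult_distrib_nat)
  moreover have "gcd n N * L = gcd (n * L) (N * L)"
    by (simp add: gcd_mult_distrib_nat mult.commute)
  ultimately show ?thesis using assms by simp
qed

section \<open>Suzuki's algebras\<close>

lemma power_mult_commuting:
  fixes x y :: "'a::monoid_mult"
  assumes "x * y = y * x"
  shows "(x * y) ^ n = x ^ n * y ^ n"
proof (induction n)
  case (Suc n)
  have "(x * y) ^ Suc n = x * (y * x ^ n) * y ^ n" by (simp add: Suc mult.assoc)
  also have "y * x ^ n = x ^ n * y" by (rule power_commuting_commutes[OF assms, symmetric])
  finally show ?case by (simp add: mult.assoc)
qed simp

text \<open>The length is \<open>Suc n\<close> because the empty product is 1 and contains no factor
  \<open>f\<close>.\<close>

lemma alt_prod_idempotent:
  fixes f :: "'a::monoid_mult"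
  assumes "f * f = f"
  shows "f * x = x * f \<Longrightarrow> f * y = y * f \<Longrightarrow> alt_prod (Suc n) (f * x) (f * y) = f * alt_prod (Suc n) x y"
proof (induction n arbitrary: x y)
  case (Suc n)
  have "alt_prod (Suc (Suc n)) (f * x) (f * y) = f * x * (f * alt_prod (Suc n) y x)"
    using Suc.IH[OF Suc.prems(2,1)] by simp
  also have "\<dots> = f * (f * x) * alt_prod (Suc n) y x"
    by (metis Suc.prems(1) mult.assoc)
  also have "\<dots> = f * alt_prod (Suc (Suc n)) x y"
    by (simp add: assms flip: mult.assoc)
  finally show ?case .
qed simp

lemma alt_prod_right_inverse:
  fixes x y :: "'a::monoid_mult"
  assumes "x * x' = 1" "y * y' = 1"
  obtains z where "alt_prod n x y * z = 1"
proof -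
  have "\<exists>z. alt_prod n x y * z = 1"
    using assms
  proof (induction n arbitrary: x y x' y')
    case (Suc n)
    obtain z where "alt_prod n y x * z = 1" using Suc.IH[OF Suc.prems(2,1)] by blast
    then have "x * alt_prod n y x * (z * x') = x * x'" by (metis mult.assoc mult_1_left)
    then show ?case using Suc.prems by (intro exI[of _ "z * x'"]) simp
  qed simp
  then show ?thesis using that by blast
qed

lemma power_div_mod_scale:
  fixes f g :: "'a::complex_algebra_1"
  assumes "f * g ^ M = c *\<^sub>C f"
  shows "f * g ^ a = (c ^ (a div M)) *\<^sub>C (f * g ^ (a mod M))"
proof -
  have "f * g ^ (M * q) = (c ^ q) *\<^sub>C f" for q
  proof (induction q)
    case (Suc q)
    have "f * g ^ (M * Suc q) = f * g ^ M * g ^ (M * q)"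
      by (simp add: power_add mult.assoc)
    then show ?case by (simp add: assms scaleC_mult_left Suc scaleC_scaleC)
  qed (simp add: scaleC_one)
  moreover have "f * g ^ a = f * g ^ (M * (a div M)) * g ^ (a mod M)"
    by (simp add: mult.assoc flip: power_add)
  ultimately show ?thesis by (simp add: scaleC_mult_left)
qed

text \<open>The generators \<open>u = x\<^sub>0\<^sub>0 + x\<^sub>0\<^sub>1\<close> and \<open>v = x\<^sub>1\<^sub>1 + x\<^sub>1\<^sub>0\<close> of Suzuki's algebra behave like the reflections
  of a dihedral group with rotation \<open>s = u v\<^sup>-\<^sup>1\<close>, except that \<open>u\<^sup>2 = v\<^sup>2\<close> is only central.\<close>

locale reflection =
  fixes u v s s' :: "'a::monoid_mult"
  assumes s_v: "s * v = u" and u_s: "u * s = s' * u" and inv: "s * s' = 1" "s' * s = 1"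
begin

lemma cancel: "s * (s' * x) = x" "s' * (s * x) = x"
  using inv by (simp_all flip: mult.assoc)

lemma v_eq: "v = s' * u"
  by (simp add: cancel flip: s_v)

lemma u_s': "u * s' = s * u"
proof -
  have "u * s' = s * (s' * u) * s'" by (simp only: cancel)
  also have "\<dots> = s * u * (s * s')" by (simp only: mult.assoc flip: u_s)
  finally show ?thesis by (simp add: inv)
qed

lemma u_spow: "u * s ^ n = s' ^ n * u" "u * s' ^ n = s ^ n * u"
proof -
  have "u * (s * x) = s' * (u * x)" "u * (s' * x) = s * (u * x)" for x
    by (simp_all add: u_s u_s' flip: mult.assoc)
  then show "u * s ^ n = s' ^ n * u" "u * s' ^ n = s ^ n * u"
    by (induction n) (simp_all add: mult.assoc)
qed

lemma upow_spow:
  "u ^ k * s ^ n = (if even k then s else s') ^ n * u ^ k"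
  "u ^ k * s' ^ n = (if even k then s' else s) ^ n * u ^ k"
proof -
  have "u * (s ^ n * x) = s' ^ n * (u * x)" "u * (s' ^ n * x) = s ^ n * (u * x)" for x
    by (simp_all add: u_spow flip: mult.assoc)
  then show "u ^ k * s ^ n = (if even k then s else s') ^ n * u ^ k"
    "u ^ k * s' ^ n = (if even k then s' else s) ^ n * u ^ k"
    by (induction k) (simp_all add: mult.assoc)
qed

lemma vpow: "v ^ k = (if even k then 1 else s') * u ^ k"
proof (induction k)
  case (Suc k)
  have "u * (s' * x) = s * (u * x)" for x by (simp add: u_s' flip: mult.assoc)
  with Suc show ?case by (simp add: v_eq mult.assoc cancel)
qed simp

text \<open>By \<open>u = s * v\<close> and \<open>u * s = s' * u\<close>, the two alternating words
  differ by a power of the rotation, as in a dihedral group. A relation between them is thus a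
  relation for \<open>s ^ n\<close>.\<close>

lemma alt_prod_swap: "s ^ n * alt_prod n v u = alt_prod n u v"
proof (induction n)
  case (Suc n)
  have "s ^ Suc n * alt_prod (Suc n) v u = s ^ n * u * alt_prod n u v"
    by (simp only: power_Suc2 alt_prod.simps mult.assoc flip: s_v)
  also have "\<dots> = u * (s' ^ n * (s ^ n * alt_prod n v u))"
    unfolding Suc by (simp add: u_spow flip: mult.assoc)
  also have "\<dots> = alt_prod (Suc n) u v"
    by (simp add: left_right_inverse_power[OF inv(2)] flip: mult.assoc)
  finally show ?case .
qed simp

lemma word_power_even:
  assumes "even k"
  shows "(s ^ j * u ^ k) ^ n = s ^ (n * j) * u ^ (n * k)"
proof -
  have "s ^ j * u ^ k = u ^ k * s ^ j" using assms by (simp add: upow_spow)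
  then have "(s ^ j * u ^ k) ^ n = (s ^ j) ^ n * (u ^ k) ^ n" by (rule power_mult_commuting)
  then show ?thesis by (simp add: mult.commute[of n] power_mult)
qed

lemma word_square_odd:
  assumes "odd k"
  shows "(s ^ j * u ^ k) * (s ^ j * u ^ k) = u ^ (2 * k)"
proof -
  have "(s ^ j * u ^ k) * (s ^ j * u ^ k) = s ^ j * (u ^ k * s ^ j) * u ^ k"
    by (simp only: mult.assoc)
  also have "\<dots> = s ^ j * s' ^ j * (u ^ k * u ^ k)"
    using assms by (simp add: upow_spow mult.assoc)
  finally show ?thesis by (simp add: left_right_inverse_power[OF inv(1)] mult_2 power_add)
qed

text \<open>The partner word exchanges \<open>u\<close> with \<open>v\<close> and \<open>s\<close>
  with its inverse. For even \<open>k\<close> the rotations cancel; an odd power of \<open>u\<close>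
  inverts them, so they add up, and \<open>v ^ k = s' * u ^ k\<close> accounts for the extra
  1.\<close>

lemma word_mult_partner:
  "(s ^ j * u ^ k) * (s' ^ j * v ^ k) = (if even k then 1 else s ^ (2 * j + 1)) * u ^ (2 * k)"
proof (cases "even k")
  case True
  have "(s ^ j * u ^ k) * (s' ^ j * v ^ k) = s ^ j * (u ^ k * s' ^ j) * u ^ k"
    using True by (simp add: vpow mult.assoc)
  also have "\<dots> = s ^ j * s' ^ j * (u ^ k * u ^ k)"
    using True by (simp add: upow_spow mult.assoc)
  finally show ?thesis using True by (simp add: left_right_inverse_power[OF inv(1)] mult_2 power_add)
next
  case False
  have "(s ^ j * u ^ k) * (s' ^ j * v ^ k) = s ^ j * (u ^ k * s' ^ Suc j) * u ^ k"
    using False by (simp only: vpow if_False power_Suc2 mult.assoc)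
  also have "\<dots> = s ^ (j + Suc j) * (u ^ k * u ^ k)"
    using False by (simp only: upow_spow if_False power_add mult.assoc)
  finally show ?thesis using False by (simp add: mult_2 power_add)
qed

end

text \<open>The \<open>e i\<close> project onto the components in which the generators
  \<open>x i j\<close> have a fixed difference of indices. They commute with both reflections, so
  each component may have its own signs.\<close>

locale graded_reflection = reflection u v s s' for u v s s' :: "'a::ring_1" +
  fixes e :: "bit \<Rightarrow> 'a"
  assumes e_mult: "e i * e j = (if i = j then e i else 0)"
    and e_u: "e i * u = u * e i" and e_s: "e i * s = s * e i"
begin

lemma e_s': "e i * s' = s' * e i"
proof -
  have "e i * s' = s' * (s * e i) * s'" by (simp only: cancel)
  also have "\<dots> = s' * e i" by (simp add: mult.assoc inv flip: e_s)
  finally show ?thesis .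
qed

lemma e_v: "e i * v = v * e i"
  by (simp add: v_eq mult.assoc e_s' flip: e_u) (simp add: e_s' flip: mult.assoc)

lemma e_left: "e i * (e j * x) = (if i = j then e i * x else 0)"
  by (simp add: e_mult flip: mult.assoc)

lemma e_commute_left: "u * (e i * x) = e i * (u * x)" "v * (e i * x) = e i * (v * x)"
  "s * (e i * x) = e i * (s * x)" "s' * (e i * x) = e i * (s' * x)"
  by (simp_all add: e_u e_v e_s e_s' flip: mult.assoc)

text \<open>Positive exponents only: the power with exponent 0 is 1 and not
  \<open>e i\<close>.\<close>

lemma e_power: "x * e i = e i * x \<Longrightarrow> (e i * x) ^ Suc n = e i * x ^ Suc n"
proof (induction n)
  case (Suc n)
  have "(e i * x) ^ Suc (Suc n) = e i * (x * e i) * x ^ Suc n"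
    unfolding power_Suc[of _ "Suc n"] Suc.IH[OF Suc.prems] by (simp only: mult.assoc)
  also have "\<dots> = e i * x ^ Suc (Suc n)"
    by (simp only: Suc.prems e_left if_True simp_thms mult.assoc power_Suc)
  finally show ?case .
qed simp

lemma e_alt_prod:
  "alt_prod (Suc n) (e i * u) (e i * v) = e i * alt_prod (Suc n) u v"
  "alt_prod (Suc n) (e i * v) (e i * u) = e i * alt_prod (Suc n) v u"
  by (rule alt_prod_idempotent; simp add: e_mult e_u e_v)+

lemma e_words_commute:
  "s ^ j * u ^ k * e i = e i * (s ^ j * u ^ k)" "s' ^ j * v ^ k * e i = e i * (s' ^ j * v ^ k)"
proof -
  have "u ^ k * e i = e i * u ^ k" "v ^ k * e i = e i * v ^ k" "s ^ j * e i = e i * s ^ j" "s' ^ j * e i = e i * s' ^ j"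
    by (simp_all add: power_commuting_commutes e_u e_v e_s e_s')
  then show "s ^ j * u ^ k * e i = e i * (s ^ j * u ^ k)" "s' ^ j * v ^ k * e i = e i * (s' ^ j * v ^ k)"
    by (simp_all add: mult.assoc) (simp_all flip: mult.assoc)
qed

end

lemma minus_1_minus_div_mod:
  fixes a n :: int
  assumes "n > 0"
  shows "(- 1 - a) div n = - 1 - a div n" "(- 1 - a) mod n = n - 1 - a mod n"
proof -
  have eq: "- 1 - a = n * (- 1 - a div n) + (n - 1 - a mod n)"
    using mult_div_mod_eq[of n a] by (simp add: algebra_simps)
  have "0 \<le> a mod n" "a mod n < n" using assms by simp_all
  then have "0 \<le> n - 1 - a mod n" "n - 1 - a mod n < n" by linarith+
  then show "(- 1 - a) div n = - 1 - a div n" "(- 1 - a) mod n = n - 1 - a mod n"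
    using int_div_pos_eq[OF eq] int_mod_pos_eq[OF eq] by simp_all
qed

text \<open>The reflection \<open>-1 - k\<close> maps the block number \<open>q\<close> onto the
  block number \<open>-1 - q\<close> and therefore inverts cyclic shifts. The reflection
  \<open>-k\<close> would not respect the blocks.\<close>

lemma cyc_reflect:
  assumes "N > 0"
  shows "- 1 - cyc N k d = cyc N (- 1 - k) (- d)"
proof -
  have "(- 1 - k) + - d = - 1 - (k + d)" by simp
  then show ?thesis
    using assms by (simp only: cyc_def minus_1_minus_div_mod of_nat_0_less_iff) (simp add: algebra_simps)
qed

lemma UNIV_bit: "(UNIV :: bit set) = {0, 1}"
  by (auto intro: bit.exhaust)

definition grade_sign :: "bit \<Rightarrow> int \<Rightarrow> int"
  where "grade_sign i \<sigma> = (if i = 0 then 1 else \<sigma>)"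

lemma grade_sign_square: "\<sigma> \<in> {1, -1} \<Longrightarrow> grade_sign i \<sigma> * grade_sign i \<sigma> = 1"
  by (auto simp: grade_sign_def)

section \<open>Suzuki's algebra rewritten with reflections; spanning words\<close>

locale Suzuki = hopf_algebra \<Delta> \<epsilon> S
  for \<Delta> :: "'a::complex_algebra_1 \<Rightarrow> 'a \<otimes>\<^sub>C 'a" and \<epsilon> S +
  fixes N L :: nat and \<alpha> \<beta> :: int and x :: "bit \<Rightarrow> bit \<Rightarrow> 'a"
  assumes N_pos: "N > 0" and L_ge: "L \<ge> 2" and signs: "\<alpha> \<in> {1, -1}" "\<beta> \<in> {1, -1}"
    and pres: "presented_by UNIV (Suzuki_relations N L (of_int \<alpha>) (of_int \<beta>)) (\<lambda>(i, j). x i j)"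
    and comult_x: "\<Delta> (x i j) = x i 0 \<otimes>\<^sub>C x 0 j + x i 1 \<otimes>\<^sub>C x 1 j"
    and counit_x: "\<epsilon> (x i j) = (if i = j then 1 else 0)"
begin

abbreviation a\<^sub>s :: "bit \<Rightarrow> complex" where "a\<^sub>s i \<equiv> of_int (grade_sign i \<alpha>)"
abbreviation b\<^sub>s :: "bit \<Rightarrow> complex" where "b\<^sub>s i \<equiv> of_int (grade_sign i \<beta>)"

lemma sign_square: "a\<^sub>s i * a\<^sub>s i = 1" "b\<^sub>s i * b\<^sub>s i = 1"
  using signs by (simp_all add: grade_sign_square flip: of_int_mult)

lemma relation: "r \<in> Suzuki_relations N L (of_int \<alpha>) (of_int \<beta>) \<Longrightarrow> free_eval (\<lambda>(i, j). x i j) r = 0"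
  by (rule presented_by_relation[OF pres])

lemma x_squares: "x 0 0 * x 0 0 = x 1 1 * x 1 1" "x 0 1 * x 0 1 = x 1 0 * x 1 0"
  using relation[of "xgen 0 0 ^ 2 - xgen 1 1 ^ 2"] relation[of "xgen 0 1 ^ 2 - xgen 1 0 ^ 2"]
  by (simp_all add: Suzuki_relations_def free_eval_simps power2_eq_square)

lemma x_zero: "i - j \<noteq> k - l \<Longrightarrow> x i j * x k l = 0"
proof -
  assume "i - j \<noteq> k - l"
  then have "xgen i j * xgen k l \<in> Suzuki_relations N L (of_int \<alpha>) (of_int \<beta>)"
    unfolding Suzuki_relations_def by blast
  from relation[OF this] show ?thesis by (simp add: free_eval_simps)
qed

lemma x_alt:
  "alt_prod L (x 0 i) (x 1 (1 - i)) = b\<^sub>s i *\<^sub>C alt_prod L (x 1 (1 - i)) (x 0 i)"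
  using relation[of "alt_prod L (xgen 0 0) (xgen 1 1) - alt_prod L (xgen 1 1) (xgen 0 0)"]
    relation[of "alt_prod L (xgen 0 1) (xgen 1 0) - of_int \<beta> *\<^sub>C alt_prod L (xgen 1 0) (xgen 0 1)"]
  by (cases i) (simp_all add: Suzuki_relations_def free_eval_simps grade_sign_def scaleC_one)

text \<open>The sign makes the relation for the \<open>2 * N\<close>-th powers read
  \<open>e 0 + e 1 = 1\<close>.\<close>

definition e :: "bit \<Rightarrow> 'a" where "e i = a\<^sub>s i *\<^sub>C x 0 i ^ (2 * N)"
definition u :: 'a where "u = x 0 0 + x 0 1"
definition v :: 'a where "v = x 1 1 + x 1 0"
text \<open>The inverse of \<open>u\<close>: its \<open>2 * N\<close>-th power is a sign on each
  component, so the \<open>4 * N\<close>-th power is 1.\<close>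

definition u' :: 'a where "u' = u ^ (4 * N - 1)"
definition v' :: 'a where "v' = v ^ (4 * N - 1)"
definition s :: 'a where "s = u * v'"
definition s' :: 'a where "s' = v * u'"

lemma sum_e: "e 0 + e 1 = 1"
  using relation[of "xgen 0 0 ^ (2 * N) + of_int \<alpha> *\<^sub>C xgen 0 1 ^ (2 * N) - 1"]
  by (simp add: Suzuki_relations_def free_eval_simps e_def grade_sign_def scaleC_one)

lemma e_x: "e k * x i j = (if k = i - j then x i j else 0)" "x i j * e k = (if k = i - j then x i j else 0)"
proof -
  obtain n where n: "2 * N = Suc n" using N_pos by (cases N) auto
  have 0: "e k * x i j = 0" "x i j * e k = 0" if "k \<noteq> i - j" for k
  proof -
    have ne: "0 - k \<noteq> i - j" using that by (cases k; simp)
    have "x 0 k ^ Suc n * x i j = x 0 k ^ n * (x 0 k * x i j)" by (simp only: power_Suc2 mult.assoc)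
    moreover have "x i j * x 0 k ^ Suc n = (x i j * x 0 k) * x 0 k ^ n" by (simp only: power_Suc mult.assoc)
    ultimately show "e k * x i j = 0" "x i j * e k = 0"
      by (simp_all only: e_def n scaleC_mult_left scaleC_mult_right x_zero[OF ne] x_zero[OF ne[symmetric]]
          mult_zero_left mult_zero_right cvec.scale_zero_right)
  qed
  have 1: "e k + e (1 + k) = 1" using sum_e by (cases k) (simp_all add: add.commute)
  have "e k * x i j = x i j" "x i j * e k = x i j" if "k = i - j"
  proof -
    have "1 + k \<noteq> i - j" using that by (cases k) auto
    then show "e k * x i j = x i j" "x i j * e k = x i j"
      using 0[of "1 + k"] arg_cong[OF 1, of "\<lambda>y. y * x i j"] arg_cong[OF 1, of "\<lambda>y. x i j * y"]
      by (simp_all add: distrib_left distrib_right)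
  qed
  with 0[of k] show "e k * x i j = (if k = i - j then x i j else 0)" "x i j * e k = (if k = i - j then x i j else 0)"
    by auto
qed

lemma e_uv: "e i * u = x 0 i" "u * e i = x 0 i" "e i * v = x 1 (1 - i)" "v * e i = x 1 (1 - i)"
  by (cases i; simp add: u_def v_def distrib_left distrib_right e_x)+

lemma e_upow: "e i * u ^ Suc n = x 0 i ^ Suc n"
proof (induction n)
  case (Suc n)
  have "e i * u ^ Suc (Suc n) = x 0 i * u ^ Suc n"
    by (simp only: power_Suc[of u "Suc n"] e_uv flip: mult.assoc)
  also have "\<dots> = x 0 i * (e i * u ^ Suc n)"
    by (simp add: e_x flip: mult.assoc)
  finally show ?case unfolding Suc by simp
qed (simp add: e_uv)

lemma e_u_2N: "e i * u ^ (2 * N) = a\<^sub>s i *\<^sub>C e i"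
proof -
  obtain n where n: "2 * N = Suc n" using N_pos by (cases N) auto
  have "e i * u ^ (2 * N) = x 0 i ^ (2 * N)" unfolding n by (rule e_upow)
  then show ?thesis by (simp add: e_def scaleC_scaleC sign_square scaleC_one)
qed

lemma split_e: "y = e 0 * y + e 1 * y"
  by (simp add: sum_e flip: distrib_right)

lemma u_4N: "u ^ (4 * N) = 1"
proof -
  have "e i * u ^ (4 * N) = e i" for i
  proof -
    have "u ^ (4 * N) = u ^ (2 * N) * u ^ (2 * N)" by (simp flip: power_add)
    then show ?thesis
      by (simp add: e_u_2N scaleC_mult_left scaleC_scaleC sign_square scaleC_one flip: mult.assoc)
  qed
  then show ?thesis using split_e[of "u ^ (4 * N)"] by (simp add: sum_e)
qed

lemma u_u: "u * u = v * v"
  by (simp add: u_def v_def distrib_left distrib_right x_zero x_squares)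

lemma v_4N: "v ^ (4 * N) = 1"
proof -
  have "v ^ (4 * N) = (v * v) ^ (2 * N)" by (simp flip: power2_eq_square power_mult)
  also have "\<dots> = (u * u) ^ (2 * N)" by (simp only: u_u)
  also have "\<dots> = u ^ (4 * N)" by (simp flip: power2_eq_square power_mult)
  finally show ?thesis by (simp add: u_4N)
qed

lemma uv_inverse: "u' * u = 1" "u * u' = 1" "v' * v = 1" "v * v' = 1"
  using u_4N v_4N N_pos power_minus_mult[of "4 * N" u] power_minus_mult[of "4 * N" v]
  by (simp_all add: u'_def v'_def power_commutes[symmetric])

lemma uv_inverse_left: "u' * (u * y) = y" "u * (u' * y) = y" "v' * (v * y) = y" "v * (v' * y) = y"
  by (simp_all add: uv_inverse flip: mult.assoc)

sublocale graded_reflection u v s s' e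
proof
  show "s * v = u" by (simp add: s_def mult.assoc uv_inverse)
  have "u * s = v" by (simp add: s_def mult.assoc uv_inverse u_u flip: mult.assoc[of u u])
  then show "u * s = s' * u" by (simp add: s'_def mult.assoc uv_inverse)
  show "s * s' = 1" "s' * s = 1"
    by (simp_all add: s_def s'_def mult.assoc uv_inverse uv_inverse_left)
  fix i j
  show "e i * u = u * e i" by (simp add: e_uv)
  have v': "e i * v' = v' * e i"
    unfolding v'_def by (rule power_commuting_commutes[symmetric]) (simp add: e_uv)
  have "e i * s = u * (e i * v')" by (simp add: s_def e_uv flip: mult.assoc)
  then show "e i * s = s * e i" by (simp add: v' s_def mult.assoc)
  obtain n where n: "2 * N = Suc n" using N_pos by (cases N) auto
  show "e i * e j = (if i = j then e i else 0)"
  proof -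
    have "e i * e j = a\<^sub>s j *\<^sub>C (e i * x 0 j * x 0 j ^ n)"
      by (simp only: e_def[of j] n power_Suc scaleC_mult_right mult.assoc)
    then show ?thesis by (simp add: e_x) (simp add: e_def n)
  qed
qed

text \<open>On a component, the relation compares the two alternating words up to a sign, and
  \<open>alt_prod_swap\<close> writes their quotient as \<open>s ^ L\<close>. The alternating word
  is right invertible and can be cancelled.\<close>

lemma e_s_L: "e i * s ^ L = b\<^sub>s i *\<^sub>C e i"
proof -
  obtain z where z: "alt_prod L v u * z = 1"
    using uv_inverse(4,2) by (rule alt_prod_right_inverse)
  obtain n where n: "L = Suc n" using L_ge by (cases L) auto
  have "e i * s ^ L * alt_prod L v u = e i * alt_prod L u v"
    by (simp add: mult.assoc alt_prod_swap)
  also have "\<dots> = alt_prod L (x 0 i) (x 1 (1 - i))"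
    unfolding n e_alt_prod(1)[symmetric] by (simp only: e_uv)
  also have "\<dots> = b\<^sub>s i *\<^sub>C alt_prod L (x 1 (1 - i)) (x 0 i)"
    by (rule x_alt)
  also have "alt_prod L (x 1 (1 - i)) (x 0 i) = e i * alt_prod L v u"
    unfolding n e_alt_prod(2)[symmetric] by (simp only: e_uv)
  finally have "e i * s ^ L * alt_prod L v u * z = (b\<^sub>s i *\<^sub>C (e i * alt_prod L v u)) * z" by simp
  then show ?thesis by (simp add: mult.assoc z scaleC_mult_left)
qed

lemma s_2L: "s ^ (2 * L) = 1"
proof -
  have "e i * s ^ (2 * L) = e i" for i
    by (simp add: mult_2 power_add e_s_L scaleC_mult_left scaleC_scaleC sign_square scaleC_one flip: mult.assoc)
  then show ?thesis using split_e[of "s ^ (2 * L)"] by (simp add: sum_e)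
qed

text \<open>Inverse rotations become positive powers, so products of words keep the form
  \<open>s ^ a * u ^ c\<close> with natural exponents.\<close>

lemma s'_pow: "s' ^ n = s ^ ((2 * L - 1) * n)"
proof -
  have "s' = s' * (s * s ^ (2 * L - 1))"
    using L_ge s_2L power_minus_mult[of "2 * L" s] by (simp add: power_commutes)
  then have "s' = s ^ (2 * L - 1)" by (simp add: cancel)
  then show ?thesis by (simp add: power_mult)
qed

definition I :: "(bit \<times> nat \<times> nat) set" where "I = UNIV \<times> {..<L} \<times> {..<2 * N}"

definition b :: "bit \<times> nat \<times> nat \<Rightarrow> 'a" where "b = (\<lambda>(i, j, k). e i * (s ^ j * u ^ k))"

lemma e_word: "e i * (s ^ a * u ^ c) = (b\<^sub>s i ^ (a div L) * a\<^sub>s i ^ (c div (2 * N))) *\<^sub>C b (i, a mod L, c mod (2 * N))"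
proof -
  have "e i * (s ^ a * u ^ c) = (b\<^sub>s i ^ (a div L)) *\<^sub>C (e i * s ^ (a mod L) * u ^ c)"
    by (simp add: power_div_mod_scale[OF e_s_L, of _ a] scaleC_mult_left flip: mult.assoc)
  also have "e i * s ^ (a mod L) * u ^ c = s ^ (a mod L) * (e i * u ^ c)"
    by (simp add: power_commuting_commutes e_s flip: mult.assoc)
  also have "\<dots> = (a\<^sub>s i ^ (c div (2 * N))) *\<^sub>C (s ^ (a mod L) * e i * u ^ (c mod (2 * N)))"
    by (simp add: power_div_mod_scale[OF e_u_2N, of _ c] scaleC_mult_right mult.assoc)
  also have "s ^ (a mod L) * e i = e i * s ^ (a mod L)"
    by (simp add: power_commuting_commutes e_s)
  finally show ?thesis by (simp add: b_def scaleC_scaleC mult.assoc)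
qed

lemma index_mod: "(i, a mod L, c mod (2 * N)) \<in> I"
  using N_pos L_ge by (simp add: I_def)

lemma x_eq: "x i j = e (i - j) * (if i = 0 then u else s' * u)"
  by (cases i; cases j) (simp_all add: e_uv flip: v_eq)

lemma span_b: "cvec.span (b ` I) = UNIV"
proof (rule presented_by_span_eq_UNIV[OF pres])
  have mem: "e i * (s ^ a * u ^ c) \<in> cvec.span (b ` I)" for i a c
    unfolding e_word by (intro cvec.span_scale cvec.span_base imageI index_mod)
  have "e i \<in> cvec.span (b ` I)" for i using mem[of i 0 0] by simp
  then show "1 \<in> cvec.span (b ` I)" unfolding sum_e[symmetric] by (intro cvec.span_add)
  fix p :: "bit \<times> bit" and h assume "p \<in> UNIV" "h \<in> b ` I"
  from this(2) obtain k a c where h: "h = e k * (s ^ a * u ^ c)" by (auto simp: b_def)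
  obtain i j where p: "p = (i, j)" by force
  have us: "u * (s ^ a * y) = s' ^ a * (u * y)" for y by (simp add: u_spow flip: mult.assoc)
  have "e k * (u * (s ^ a * u ^ c)) = e k * (s ^ ((2 * L - 1) * a) * u ^ Suc c)"
    by (simp add: us s'_pow)
  moreover have "e k * (s' * (u * (s ^ a * u ^ c))) = e k * (s ^ ((2 * L - 1) * Suc a) * u ^ Suc c)"
    unfolding us s'_pow[symmetric] by (simp add: mult.assoc)
  ultimately have words: "e k * (u * (s ^ a * u ^ c)) \<in> cvec.span (b ` I)" "e k * (s' * (u * (s ^ a * u ^ c))) \<in> cvec.span (b ` I)"
    by (simp_all only: mem)
  have main: "e d * t * h \<in> cvec.span (b ` I)"
    if t: "\<And>y. t * (e k * y) = e k * (t * y)" and mem: "e k * (t * (s ^ a * u ^ c)) \<in> cvec.span (b ` I)" for d t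
  proof (cases "d = k")
    case True
    then show ?thesis using mem by (simp only: h mult.assoc t e_left if_True simp_thms)
  next
    case False
    have "e d * t * h = 0" unfolding h mult.assoc t e_left using False by (simp only: if_False)
    then show ?thesis by (simp only: cvec.span_zero)
  qed
  have "s' * u * (e k * y) = e k * (s' * u * y)" for y
    by (simp only: mult.assoc e_commute_left)
  from main[OF this] words(2) have "e d * (s' * u) * h \<in> cvec.span (b ` I)" for d
    by (simp only: mult.assoc)
  moreover have "e d * u * h \<in> cvec.span (b ` I)" for d
    by (rule main[OF e_commute_left(1) words(1)])
  ultimately have "x i j * h \<in> cvec.span (b ` I)"
    by (cases "i = 0") (simp_all only: x_eq if_True if_False simp_thms)
  then show "(case p of (i, j) \<Rightarrow> x i j) * h \<in> cvec.span (b ` I)"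
    unfolding p prod.case .
qed

end

lemma hom_power:
  fixes f :: "'a::monoid_mult \<Rightarrow> 'b::monoid_mult"
  assumes "f 1 = 1" "\<And>a b. f (a * b) = f a * f b"
  shows "f (a ^ n) = f a ^ n"
  by (induction n) (simp_all add: assms)

text \<open>A faithful representation; \<open>\<kappa>\<close> and \<open>\<mu>\<close> spread the signs evenly over the two cyclic directions.\<close>

locale Suzuki_model =
  fixes N L :: nat and \<kappa> \<mu> a\<^sub>s b\<^sub>s :: "bit \<Rightarrow> complex"
  assumes N: "N > 0" and L: "L \<ge> 2"
    and \<kappa>: "\<And>i. \<kappa> i ^ (2 * N) = a\<^sub>s i" "\<And>i. \<kappa> i \<noteq> 0" and \<mu>: "\<And>i. \<mu> i ^ L = b\<^sub>s i" "\<And>i. \<mu> i \<noteq> 0"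
    and signs: "\<And>i. a\<^sub>s i * a\<^sub>s i = 1" "\<And>i. b\<^sub>s i * b\<^sub>s i = 1" "a\<^sub>s 0 = 1" "b\<^sub>s 0 = 1"
begin

definition E\<^sub>m :: "bit \<Rightarrow> (bit \<times> int \<times> int) endo"
  where "E\<^sub>m i = monomial_op (\<lambda>p. p) (\<lambda>(d, j, k). if d = i then 1 else 0)"

text \<open>The rotation index is reflected. If \<open>f j\<close> is the weight in
  \<open>\<mu> d\<close>, the relation \<open>U s = s' U\<close> requires
  \<open>f (j + 1) = \<mu>^(-2) * f j\<close>, hence the exponent \<open>-2 * j\<close>; the further
  -1 makes \<open>f j * f (-1 - j) = 1\<close>, so that the square of \<open>U\<^sub>m\<close> has
  the weight \<open>\<kappa>^2\<close>.\<close>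

definition U\<^sub>m :: "(bit \<times> int \<times> int) endo"
  where "U\<^sub>m = monomial_op (\<lambda>(d, j, k). (d, - 1 - j, cyc (2 * N) k 1)) (\<lambda>(d, j, k). \<kappa> d * \<mu> d powi (- 2 * j - 1))"

definition S\<^sub>m :: "(bit \<times> int \<times> int) endo"
  where "S\<^sub>m = monomial_op (\<lambda>(d, j, k). (d, cyc L j 1, k)) (\<lambda>(d, j, k). \<mu> d)"

definition S'\<^sub>m :: "(bit \<times> int \<times> int) endo"
  where "S'\<^sub>m = monomial_op (\<lambda>(d, j, k). (d, cyc L j (- 1), k)) (\<lambda>(d, j, k). inverse (\<mu> d))"

lemma L_pos: "L > 0" using L by simp

lemma app_model:
  "app (E\<^sub>m i) (Poly_Mapping.single (d, j, k) z) = (if d = i then Poly_Mapping.single (d, j, k) z else 0)"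
  "app U\<^sub>m (Poly_Mapping.single (d, j, k) z)
    = Poly_Mapping.single (d, - 1 - j, cyc (2 * N) k 1) (\<kappa> d * \<mu> d powi (- 2 * j - 1) * z)"
  "app S\<^sub>m (Poly_Mapping.single (d, j, k) z) = Poly_Mapping.single (d, cyc L j 1, k) (\<mu> d * z)"
  "app S'\<^sub>m (Poly_Mapping.single (d, j, k) z) = Poly_Mapping.single (d, cyc L j (- 1), k) (inverse (\<mu> d) * z)"
  by (simp_all add: E\<^sub>m_def U\<^sub>m_def S\<^sub>m_def S'\<^sub>m_def app_monomial_op)

sublocale graded_reflection U\<^sub>m "S'\<^sub>m * U\<^sub>m" S\<^sub>m S'\<^sub>m E\<^sub>m
proof
  show inv: "S\<^sub>m * S'\<^sub>m = 1" "S'\<^sub>m * S\<^sub>m = 1"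
    by (rule endo_eqI; clarify; simp add: app_simps app_model cyc_add[OF L_pos] cyc_0 \<mu>)+
  show "S\<^sub>m * (S'\<^sub>m * U\<^sub>m) = U\<^sub>m" by (simp add: inv flip: mult.assoc)
  show "U\<^sub>m * S\<^sub>m = S'\<^sub>m * U\<^sub>m"
  proof (rule endo_eqI, clarify)
    fix d :: bit and j k :: int
    \<comment> \<open>At the end of a block \<open>cyc L j 1\<close> agrees with
      \<open>j + 1\<close> only modulo \<open>L\<close>. The exponent contains it doubled, so a
      \<open>2 * L\<close>-th root of unity suffices.\<close>
    have "\<mu> d ^ (2 * L) = 1" using \<mu>(1)[of d] signs(2)[of d] by (simp add: mult_2 power_add)
    then have "\<mu> d powi (- 2 * cyc L j 1 - 1) = \<mu> d powi (- 2 * (j + 1) - 1)"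
    proof (rule power_int_cong_of_root_of_unity)
      have "[cyc L j 1 = j + 1] (mod int L)" by (simp add: cong_def cyc_mod)
      then obtain q where "cyc L j 1 - (j + 1) = int L * q" by (auto simp: cong_iff_dvd_diff)
      then have "- 2 * cyc L j 1 - 1 - (- 2 * (j + 1) - 1) = int (2 * L) * (- q)" by simp
      then show "[- 2 * cyc L j 1 - 1 = - 2 * (j + 1) - 1] (mod int (2 * L))"
        by (simp only: cong_iff_dvd_diff dvd_triv_left)
    qed (use L in simp)
    also have "\<dots> = \<mu> d powi (- 2 * j - 1) * \<mu> d powi (- 2)"
      by (simp add: \<mu>(2) flip: power_int_add)
    finally have "\<mu> d powi (- 2 * cyc L j 1 - 1) * \<mu> d = inverse (\<mu> d) * \<mu> d powi (- 2 * j - 1)"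
      by (simp add: \<mu>(2) power_int_minus power2_eq_square)
    then show "app (U\<^sub>m * S\<^sub>m) (Poly_Mapping.single (d, j, k) 1) = app (S'\<^sub>m * U\<^sub>m) (Poly_Mapping.single (d, j, k) 1)"
      by (simp add: app_simps app_model cyc_reflect[OF L_pos] mult_ac)
  qed
  fix i i'
  show "E\<^sub>m i * E\<^sub>m i' = (if i = i' then E\<^sub>m i else 0)"
    by (rule endo_eqI) (auto simp: app_simps app_model app_linear)
  show "E\<^sub>m i * U\<^sub>m = U\<^sub>m * E\<^sub>m i" "E\<^sub>m i * S\<^sub>m = S\<^sub>m * E\<^sub>m i"
    by (rule endo_eqI; clarify; simp add: app_simps app_model app_linear)+
qed

lemma app_upow_even:
  "app (U\<^sub>m ^ (2 * i)) (Poly_Mapping.single (d, j, k) z)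
    = Poly_Mapping.single (d, j, cyc (2 * N) k (2 * int i)) (\<kappa> d ^ (2 * i) * z)"
proof (induction i)
  case 0
  show ?case by (simp add: app_simps cyc_0)
next
  case (Suc i)
  have "\<mu> d powi (- 2 * j - 1) * \<mu> d powi (- 2 * (- 1 - j) - 1) = 1"
    using \<mu>(2) by (simp flip: power_int_add)
  then show ?case
    using Suc N by (simp add: app_simps app_model cyc_add algebra_simps)
qed

lemma app_upow:
  "\<exists>c. c \<noteq> 0 \<and> app (U\<^sub>m ^ n) (Poly_Mapping.single (d, j, k) 1)
    = Poly_Mapping.single (d, if even n then j else - 1 - j, cyc (2 * N) k (int n)) c"
proof (induction n)
  case 0
  show ?case by (rule exI[of _ 1]) (simp add: app_simps cyc_0)
next
  case (Suc n)
  then obtain c where "c \<noteq> 0" "app (U\<^sub>m ^ n) (Poly_Mapping.single (d, j, k) 1)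
    = Poly_Mapping.single (d, if even n then j else - 1 - j, cyc (2 * N) k (int n)) c" by blast
  then show ?case
    using N \<kappa>(2) \<mu>(2) by (intro exI[of _ "\<kappa> d * \<mu> d powi (- 2 * (if even n then j else - 1 - j) - 1) * c"])
      (auto simp: app_simps app_model cyc_add power_int_eq_0_iff add.commute)
qed

lemma app_spow:
  "app (S\<^sub>m ^ n) (Poly_Mapping.single (d, j, k) z) = Poly_Mapping.single (d, cyc L j (int n), k) (\<mu> d ^ n * z)"
  by (induction n) (simp_all add: app_simps app_model cyc_0 cyc_add[OF L_pos] add.commute mult.assoc)

definition X\<^sub>m :: "bit \<times> bit \<Rightarrow> (bit \<times> int \<times> int) endo"
  where "X\<^sub>m = (\<lambda>(i, j). E\<^sub>m (i - j) * (if i = 0 then U\<^sub>m else S'\<^sub>m * U\<^sub>m))"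

lemma E_sum: "E\<^sub>m 0 + E\<^sub>m 1 = 1"
proof (rule endo_eqI, clarify)
  fix d :: bit and j k :: int
  show "app (E\<^sub>m 0 + E\<^sub>m 1) (Poly_Mapping.single (d, j, k) 1) = app 1 (Poly_Mapping.single (d, j, k) 1)"
    by (cases d) (simp_all add: app_simps app_model)
qed

lemma E_upow: "(E\<^sub>m i * U\<^sub>m) ^ (2 * N) = a\<^sub>s i *\<^sub>C E\<^sub>m i"
proof -
  obtain n where n: "2 * N = Suc n" using N by (cases N) auto
  have "(E\<^sub>m i * U\<^sub>m) ^ (2 * N) = E\<^sub>m i * U\<^sub>m ^ (2 * N)"
    unfolding n by (rule e_power) (simp add: e_u)
  also have "\<dots> = a\<^sub>s i *\<^sub>C E\<^sub>m i"
  proof (rule endo_eqI, clarify)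
    fix d :: bit and j k :: int
    have "cyc (2 * N) k (2 * int N) = k" using cyc_mult[of "2 * N" k 1] by simp
    then show "app (E\<^sub>m i * U\<^sub>m ^ (2 * N)) (Poly_Mapping.single (d, j, k) 1) = app (a\<^sub>s i *\<^sub>C E\<^sub>m i) (Poly_Mapping.single (d, j, k) 1)"
      by (simp add: app_simps app_model app_upow_even \<kappa>(1) scaleC_single)
  qed
  finally show ?thesis .
qed

lemma E_spow: "E\<^sub>m i * S\<^sub>m ^ L = b\<^sub>s i *\<^sub>C E\<^sub>m i"
proof (rule endo_eqI, clarify)
  fix d :: bit and j k :: int
  have "cyc L j (int L) = j" using cyc_mult[of L j 1] by simp
  then show "app (E\<^sub>m i * S\<^sub>m ^ L) (Poly_Mapping.single (d, j, k) 1) = app (b\<^sub>s i *\<^sub>C E\<^sub>m i) (Poly_Mapping.single (d, j, k) 1)"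
    by (simp add: app_simps app_model app_spow \<mu>(1) scaleC_single)
qed

lemma E_alt:
  "alt_prod L (E\<^sub>m i * U\<^sub>m) (E\<^sub>m i * (S'\<^sub>m * U\<^sub>m)) = b\<^sub>s i *\<^sub>C alt_prod L (E\<^sub>m i * (S'\<^sub>m * U\<^sub>m)) (E\<^sub>m i * U\<^sub>m)"
proof -
  have SucL: "Suc (L - 1) = L" using L by simp
  note e_alt_prod = e_alt_prod[of "L - 1" i, unfolded SucL]
  have "alt_prod L (E\<^sub>m i * U\<^sub>m) (E\<^sub>m i * (S'\<^sub>m * U\<^sub>m)) = E\<^sub>m i * alt_prod L U\<^sub>m (S'\<^sub>m * U\<^sub>m)"
    by (rule e_alt_prod)
  also have "\<dots> = E\<^sub>m i * S\<^sub>m ^ L * alt_prod L (S'\<^sub>m * U\<^sub>m) U\<^sub>m"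
    by (simp only: mult.assoc alt_prod_swap)
  also have "\<dots> = b\<^sub>s i *\<^sub>C (E\<^sub>m i * alt_prod L (S'\<^sub>m * U\<^sub>m) U\<^sub>m)"
    by (simp only: E_spow scaleC_mult_left)
  also have "E\<^sub>m i * alt_prod L (S'\<^sub>m * U\<^sub>m) U\<^sub>m = alt_prod L (E\<^sub>m i * (S'\<^sub>m * U\<^sub>m)) (E\<^sub>m i * U\<^sub>m)"
    by (rule e_alt_prod(2)[symmetric])
  finally show ?thesis .
qed

lemma model_relations:
  assumes "r \<in> Suzuki_relations N L (a\<^sub>s 1) (b\<^sub>s 1)"
  shows "free_eval X\<^sub>m r = 0"
proof -
  have "(E\<^sub>m i * U\<^sub>m) ^ 2 = (E\<^sub>m i * (S'\<^sub>m * U\<^sub>m)) ^ 2" for i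
  proof -
    have "(E\<^sub>m i * U\<^sub>m) ^ Suc 1 = E\<^sub>m i * U\<^sub>m ^ Suc 1" by (rule e_power) (simp add: e_u)
    also have "U\<^sub>m ^ Suc 1 = (S'\<^sub>m * U\<^sub>m) ^ Suc 1" using vpow[of 2] by (simp add: numeral_2_eq_2)
    also have "E\<^sub>m i * \<dots> = (E\<^sub>m i * (S'\<^sub>m * U\<^sub>m)) ^ Suc 1" by (rule e_power[symmetric]) (simp add: e_v)
    finally show ?thesis by (simp only: numeral_2_eq_2 One_nat_def)
  qed
  moreover have "E\<^sub>m (i - j) * y * (E\<^sub>m (k - l) * z) = 0" if "i - j \<noteq> k - l" "y \<in> {U\<^sub>m, S'\<^sub>m * U\<^sub>m}" for i j k l y z
    using that by (auto simp: mult.assoc e_commute_left e_left)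
  moreover have "(E\<^sub>m 0 * U\<^sub>m) ^ (2 * N) + a\<^sub>s 1 *\<^sub>C (E\<^sub>m 1 * U\<^sub>m) ^ (2 * N) = 1"
    unfolding E_upow by (simp add: scaleC_scaleC signs scaleC_one E_sum)
  ultimately show ?thesis
    using assms E_alt[of 0] E_alt[of 1]
    unfolding Suzuki_relations_def by (auto simp: free_eval_simps X\<^sub>m_def signs scaleC_one)
qed

text \<open>Odd powers of \<open>U\<^sub>m\<close> reflect the rotation index, so the source index
  is -1 for them and 0 for even powers; in both cases \<open>U\<^sub>m ^ k\<close> arrives at 0 and
  the rotations then lead to \<open>j\<close>.\<close>

lemma app_word:
  assumes "j < L" "k < 2 * N" "even k \<longleftrightarrow> even k'"
  shows "\<exists>c. c \<noteq> 0 \<and> app (E\<^sub>m i * (S\<^sub>m ^ j * U\<^sub>m ^ k)) (Poly_Mapping.single (i', if even k' then 0 else - 1, 0) 1)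
    = (if i' = i then Poly_Mapping.single (i, int j, int k) c else 0)"
proof -
  obtain c where c: "c \<noteq> 0" "app (U\<^sub>m ^ k) (Poly_Mapping.single (i', if even k' then 0 else - 1, 0) 1)
      = Poly_Mapping.single (i', 0, cyc (2 * N) 0 (int k)) c"
    using app_upow[of k i' "if even k' then 0 else - 1" 0] assms(3) by auto
  have "cyc (2 * N) 0 (int k) = int k" "cyc L 0 (int j) = int j"
    using assms(1,2) by (simp_all add: cyc_def)
  then show ?thesis
    using c \<mu>(2) by (intro exI[of _ "\<mu> i ^ j * c"]) (auto simp: app_simps app_model app_spow)
qed

lemma app_word_other:
  assumes "j < L" "k < 2 * N" "k \<noteq> k'"
  shows "Poly_Mapping.lookup (app (E\<^sub>m i * (S\<^sub>m ^ j * U\<^sub>m ^ k)) (Poly_Mapping.single (i', p, 0) 1)) (d, q, int k') = 0"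
proof -
  obtain c where c: "app (U\<^sub>m ^ k) (Poly_Mapping.single (i', p, 0) 1)
      = Poly_Mapping.single (i', if even k then p else - 1 - p, cyc (2 * N) 0 (int k)) c"
    using app_upow[of k i' p 0] by blast
  have "cyc (2 * N) 0 (int k) = int k"
    using assms(2) by (simp add: cyc_def)
  then show ?thesis
    using c assms(3) by (simp add: app_simps app_model app_spow lookup_single)
qed

end

section \<open>Basis, dimension and regular character of Suzuki's algebra\<close>

context Suzuki
begin

lemma ex_coordinates: "\<exists>\<phi>. coordinates I b \<phi>"
proof -
  have "\<exists>\<kappa>. \<kappa> ^ (2 * N) = a\<^sub>s i \<and> \<kappa> \<noteq> 0" "\<exists>\<mu>. \<mu> ^ L = b\<^sub>s i \<and> \<mu> \<noteq> 0" for i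
  proof -
    have "a\<^sub>s i ^ 2 = 1" "b\<^sub>s i ^ 2 = 1" by (simp_all add: power2_eq_square sign_square)
    then show "\<exists>\<kappa>. \<kappa> ^ (2 * N) = a\<^sub>s i \<and> \<kappa> \<noteq> 0" "\<exists>\<mu>. \<mu> ^ L = b\<^sub>s i \<and> \<mu> \<noteq> 0"
      using N_pos L_ge ex_root_of_root_of_unity[of "a\<^sub>s i" 2 "2 * N"] ex_root_of_root_of_unity[of "b\<^sub>s i" 2 L]
      by (metis mult_pos_pos zero_less_numeral, metis less_le_trans zero_less_numeral)
  qed
  then obtain \<kappa> \<mu> where \<kappa>: "\<And>i. \<kappa> i ^ (2 * N) = a\<^sub>s i" "\<And>i. \<kappa> i \<noteq> 0"
    and \<mu>: "\<And>i. \<mu> i ^ L = b\<^sub>s i" "\<And>i. \<mu> i \<noteq> 0"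
    by metis
  have signs0: "a\<^sub>s 0 = 1" "b\<^sub>s 0 = 1" by (simp_all add: grade_sign_def)
  interpret m: Suzuki_model N L \<kappa> \<mu> "\<lambda>i. a\<^sub>s i" "\<lambda>i. b\<^sub>s i"
    by unfold_locales (fact N_pos L_ge \<kappa> \<mu> sign_square signs0)+
  have sign1: "a\<^sub>s 1 = of_int \<alpha>" "b\<^sub>s 1 = of_int \<beta>" by (simp_all add: grade_sign_def)
  note rel = m.model_relations[unfolded sign1]
  obtain \<Phi> where \<Phi>: "clinear \<Phi>" "\<Phi> 1 = 1" "\<And>y z. \<Phi> (y * z) = \<Phi> y * \<Phi> z"
    and "\<And>p. p \<in> UNIV \<Longrightarrow> \<Phi> (case p of (i, j) \<Rightarrow> x i j) = m.X\<^sub>m p"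
    using presented_by_induced_hom[OF pres rel] by blast
  from this(4)[of "(i, j)" for i j]
  have \<Phi>x: "\<Phi> (x i j) = m.E\<^sub>m (i - j) * (if i = 0 then m.U\<^sub>m else m.S'\<^sub>m * m.U\<^sub>m)" for i j
    by (simp add: m.X\<^sub>m_def)
  have \<Phi>e: "\<Phi> (e i) = m.E\<^sub>m i" for i
    using m.E_upow[of i] sign_square[of i]
    by (cases i) (simp_all add: e_def clinear_scale[OF \<Phi>(1)] hom_power[OF \<Phi>(2,3)] \<Phi>x scaleC_scaleC scaleC_one)
  have \<Phi>u: "\<Phi> u = m.U\<^sub>m" and \<Phi>v: "\<Phi> v = m.S'\<^sub>m * m.U\<^sub>m"
    using m.E_sum by (simp_all add: u_def v_def clinear_add[OF \<Phi>(1)] \<Phi>x add.commute flip: distrib_right)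
  have \<Phi>s: "\<Phi> s = m.S\<^sub>m"
  proof -
    have "\<Phi> s = m.S\<^sub>m * \<Phi> v * \<Phi> v'"
      unfolding s_def \<Phi>(3) \<Phi>u \<Phi>v m.s_v by simp
    also have "\<dots> = m.S\<^sub>m * \<Phi> (v * v')" by (simp add: \<Phi>(3) mult.assoc)
    finally show ?thesis by (simp add: uv_inverse \<Phi>(2))
  qed
  have \<Phi>b: "\<Phi> (b (i, j, k)) = m.E\<^sub>m i * (m.S\<^sub>m ^ j * m.U\<^sub>m ^ k)" for i j k
    by (simp add: b_def \<Phi> \<Phi>e \<Phi>s \<Phi>u hom_power[OF \<Phi>(2,3)])
  define \<psi> where "\<psi> = (\<lambda>(i, j, k) h. Poly_Mapping.lookup
    (app (\<Phi> h) (Poly_Mapping.single (i, if even k then 0 else - 1, 0) 1)) (i, int j, int k))"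
  have "coordinates I b (\<lambda>i h. \<psi> i h / \<psi> i (b i))"
  proof (rule coordinates_of_separating[OF _ _ _ _ span_b])
    show "finite I" by (simp add: I_def UNIV_bit)
    show "clinear (\<psi> p)" for p
      by (cases p) (simp add: \<psi>_def clinear_iff clinear_add[OF \<Phi>(1)] clinear_scale[OF \<Phi>(1)] app_simps
          lookup_add lookup_scaleC)
    fix p q assume pq: "p \<in> I" "q \<in> I"
    obtain i j k where p: "p = (i, j, k)" "j < L" "k < 2 * N"
      using pq(1) unfolding I_def by blast
    obtain i' j' k' where q: "q = (i', j', k')" "j' < L" "k' < 2 * N"
      using pq(2) unfolding I_def by blast
    show "\<psi> p (b p) \<noteq> 0"
      using m.app_word[OF p(2,3) refl, of i i] by (auto simp: \<psi>_def p(1) \<Phi>b)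
    assume ne: "p \<noteq> q"
    show "\<psi> p (b q) = 0"
    proof (cases "k' = k")
      case True
      then show ?thesis
        using ne m.app_word[OF q(2,3), of k i' i] by (auto simp: \<psi>_def p(1) q(1) \<Phi>b lookup_single)
    next
      case False
      then show ?thesis
        using m.app_word_other[OF q(2,3) False] by (simp add: \<psi>_def p(1) q(1) \<Phi>b)
    qed
  qed
  then show ?thesis by blast
qed

definition "coord = (SOME \<phi>. coordinates I b \<phi>)"

sublocale algebra_coordinates I b coord
  unfolding algebra_coordinates_def coord_def by (rule someI_ex[OF ex_coordinates])

lemma dim: "cvec.dim (UNIV :: 'a set) = 4 * N * L"
  by (simp add: dim_eq I_def card_cartesian_product UNIV_bit)

lemma coord_word:
  assumes "p \<in> I"
  shows "coord p (e i * (s ^ a * u ^ c))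
    = (if p = (i, a mod L, c mod (2 * N)) then b\<^sub>s i ^ (a div L) * a\<^sub>s i ^ (c div (2 * N)) else 0)"
  unfolding e_word coord_simps(2)[OF assms] coord_basis[OF assms index_mod] by simp

lemma word_mult:
  "e i * (s ^ a * u ^ c) * b (d, j, k)
    = (if i = d then e i * (s ^ (a + (if even c then j else (2 * L - 1) * j)) * u ^ (c + k)) else 0)"
proof -
  have "u ^ c * (s ^ j * y) = s ^ (if even c then j else (2 * L - 1) * j) * (u ^ c * y)" for y
    by (simp add: upow_spow s'_pow flip: mult.assoc)
  moreover have "s ^ a * (u ^ c * (e d * y)) = e d * (s ^ a * (u ^ c * y))" for y
    using arg_cong[OF e_words_commute(1)[of a c d], of "\<lambda>z. z * y"] by (simp add: mult.assoc)
  ultimately show ?thesis by (simp add: b_def mult.assoc e_left power_add)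
qed

text \<open>The exponent of \<open>u\<close> is shifted by \<open>c\<close>, so diagonal entries
  require \<open>2 * N dvd c\<close>. Then \<open>c\<close> is even, the word merely rotates by
  \<open>a\<close>, and all \<open>2 * N * L\<close> words of its component have the same diagonal
  entry.\<close>

lemma regular_character_word:
  "regular_character (e i * (s ^ a * u ^ c))
    = (if L dvd a \<and> 2 * N dvd c then of_nat (2 * N * L) * (b\<^sub>s i ^ (a div L) * a\<^sub>s i ^ (c div (2 * N))) else 0)"
proof -
  let ?z = "if L dvd a \<and> 2 * N dvd c then b\<^sub>s i ^ (a div L) * a\<^sub>s i ^ (c div (2 * N)) else 0"
  have "regular_character (e i * (s ^ a * u ^ c)) = (\<Sum>p\<in>I. if fst p = i then ?z else 0)"
    unfolding regular_character_eq
  proof (rule sum.cong[OF refl])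
    fix p assume p: "p \<in> I"
    then obtain d j k where p_eq: "p = (d, j, k)" "j < L" "k < 2 * N" unfolding I_def by blast
    show "coord p (e i * (s ^ a * u ^ c) * b p) = (if fst p = i then ?z else 0)"
    proof (cases "2 * N dvd c \<and> d = i")
      case True
      then obtain q where q: "c = 2 * N * q" by blast
      have "j = (a + j) mod L \<longleftrightarrow> L dvd a"
      proof
        assume "j = (a + j) mod L"
        then have "[a + j = 0 + j] (mod L)" using p_eq(2) by (simp add: cong_def)
        then show "L dvd a" by (simp only: cong_add_rcancel_nat cong_0_iff)
      qed (use p_eq(2) in auto)
      moreover have "(a + j) div L = a div L" if "L dvd a"
        using that p_eq(2) by (auto elim!: dvdE)
      moreover have "(c + k) div (2 * N) = q" "(c + k) mod (2 * N) = k" "c div (2 * N) = q"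
        using p_eq(3) N_pos by (simp_all add: q)
      ultimately show ?thesis
        using True unfolding p_eq(1) word_mult using p coord_word[of p i "a + j" "c + k"]
        by (auto simp: p_eq(1) q)
    next
      case False
      have "k \<noteq> (c + k) mod (2 * N)" if "d = i"
      proof
        assume "k = (c + k) mod (2 * N)"
        then have "[c + k = 0 + k] (mod 2 * N)" using p_eq(3) by (simp add: cong_def)
        then have "2 * N dvd c" by (simp only: cong_add_rcancel_nat cong_0_iff)
        with False that show False by simp
      qed
      then have "coord p (e i * (s ^ a' * u ^ (c + k))) = 0" if "d = i" for a'
        using that by (subst coord_word[OF p]) (simp add: p_eq(1))
      then show ?thesis
        using False unfolding word_mult p_eq(1) by (auto simp: coord_simps(4)[OF p, unfolded p_eq(1)])
    qed
  qed
  also have "\<dots> = of_nat (2 * N * L) * ?z"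
  proof -
    have "(\<Sum>p\<in>I. if fst p = i then ?z else 0) = (\<Sum>d\<in>UNIV. \<Sum>jk\<in>{..<L} \<times> {..<2 * N}. if d = i then ?z else 0)"
      unfolding I_def by (simp only: sum.cartesian_product) (simp add: case_prod_unfold)
    then show ?thesis by (cases i) (simp_all add: UNIV_bit card_cartesian_product)
  qed
  finally show ?thesis by simp
qed

end

lemma sum_lessThan_double: "(\<Sum>k<2 * n. f k) = (\<Sum>i<n. f (2 * i) + f (2 * i + 1))" for f :: "nat \<Rightarrow> 'a::comm_monoid_add"
  by (induction n) (simp_all add: add.assoc)

lemma card_annihilator_nat:
  fixes n M :: nat
  assumes "n > 0" "M > 0"
  shows "(\<Sum>j<M. if M dvd n * j then 1 else 0) = (of_nat (gcd n M) :: 'a::semiring_1)"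
proof -
  obtain d a b where *: "n = d * a" "M = d * b" "coprime a b" "d > 0" "b > 0"
    using assms by (rule gcd_factors)
  have "M dvd n * j \<longleftrightarrow> b dvd j" for j
    unfolding *(1,2) by (rule dvd_mult_gcd_iff[OF *(3,4)])
  then have "(\<Sum>j<M. if M dvd n * j then 1 else 0) = (\<Sum>j<b * d. if b dvd j then 1 else 0 :: 'a)"
    by (simp add: *(2) mult.commute)
  also have "\<dots> = of_nat d"
    by (subst sum_multiples[OF *(5)]) simp
  also have "d = gcd n M"
    using *(3) by (simp add: *(1,2) gcd_mult_distrib_nat[symmetric] coprime_iff_gcd_eq_1)
  finally show ?thesis .
qed

section \<open>Sweedler powers, integral and indicator of Suzuki's algebra\<close>

context Suzuki
begin

text \<open>Generators from different components multiply to 0, so the powers of the two-term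
  coproduct have no mixed terms. This determines the coproduct of \<open>e 0\<close>.\<close>

lemma comult_x_power: "\<Delta> (x 0 0 ^ Suc n) = x 0 0 ^ Suc n \<otimes>\<^sub>C x 0 0 ^ Suc n + x 0 1 ^ Suc n \<otimes>\<^sub>C x 1 0 ^ Suc n"
proof (induction n)
  case 0
  show ?case by (simp add: comult_x)
next
  case (Suc n)
  have "x i j * (x k l * y) = 0" if "i - j \<noteq> k - l" for i j k l y
    using x_zero[OF that] by (simp flip: mult.assoc)
  then have "x 0 0 * x 0 1 ^ Suc n = 0" "x 0 1 * x 0 0 ^ Suc n = 0" by simp_all
  then show ?case
    unfolding power_Suc[of _ "Suc n"] comult_mult Suc
    by (simp add: comult_x tensor_mult_simps del: power_Suc)
qed

lemma comult_e: "\<Delta> (e 0) = e 0 \<otimes>\<^sub>C e 0 + e 1 \<otimes>\<^sub>C e 1" "\<Delta> (e 1) = e 0 \<otimes>\<^sub>C e 1 + e 1 \<otimes>\<^sub>C e 0"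
proof -
  have "x 0 1 ^ (2 * N) = a\<^sub>s 1 *\<^sub>C e 1"
    by (simp add: e_def scaleC_scaleC sign_square scaleC_one)
  moreover have "x 1 0 ^ (2 * N) = x 0 1 ^ (2 * N)"
    by (simp add: power_mult power2_eq_square x_squares)
  moreover have "e 0 = x 0 0 ^ (2 * N)" by (simp add: e_def grade_sign_def scaleC_one)
  moreover obtain n where "2 * N = Suc n" using N_pos by (cases N) auto
  ultimately show e0: "\<Delta> (e 0) = e 0 \<otimes>\<^sub>C e 0 + e 1 \<otimes>\<^sub>C e 1"
    using comult_x_power[of n] by (simp add: tensor_elem_bilinear scaleC_scaleC sign_square scaleC_one)
  have "\<Delta> (e 0) + \<Delta> (e 1) = (e 0 + e 1) \<otimes>\<^sub>C (e 0 + e 1)"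
    by (simp only: sum_e comult_one flip: comult_simps)
  then show "\<Delta> (e 1) = e 0 \<otimes>\<^sub>C e 1 + e 1 \<otimes>\<^sub>C e 0"
    by (simp add: e0 tensor_elem_bilinear algebra_simps)
qed

lemma counit_e: "\<epsilon> (e i) = (if i = 0 then 1 else 0)"
proof -
  have "\<epsilon> (x 0 i ^ n) = \<epsilon> (x 0 i) ^ n" for n
    by (induction n) (simp_all add: counit_one counit_mult)
  then show ?thesis using N_pos by (cases i) (simp_all add: e_def counit_simps counit_x grade_sign_def)
qed

text \<open>For partners \<open>w\<close>, \<open>w'\<close> the coproduct behaves as for a pair of group-like elements interchanged by
  the \<open>\<int>\<^sub>2\<close>-grading; the property is multiplicative and holds for \<open>u\<close>, \<open>v\<close>, hence for all basis words.\<close>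

definition partners :: "'a \<Rightarrow> 'a \<Rightarrow> bool"
  where "partners w w' \<longleftrightarrow>
    \<Delta> w = (e 0 * w) \<otimes>\<^sub>C w + (e 1 * w) \<otimes>\<^sub>C w' \<and> \<Delta> w' = (e 0 * w') \<otimes>\<^sub>C w' + (e 1 * w') \<otimes>\<^sub>C w \<and>
    \<epsilon> w = 1 \<and> \<epsilon> w' = 1 \<and> (\<forall>i. w * e i = e i * w \<and> w' * e i = e i * w')"

lemma partners_1: "partners 1 1"
  by (simp add: partners_def comult_one counit_one sum_e flip: tensor_elem_bilinear)

lemma partners_sym: "partners w w' \<Longrightarrow> partners w' w"
  by (simp add: partners_def)

lemma partners_mult:
  assumes "partners w w'" "partners z z'"
  shows "partners (w * z) (w' * z')"
proof -
  have "w * (e i * y) = e i * (w * y)" "w' * (e i * y) = e i * (w' * y)"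
    "z * (e i * y) = e i * (z * y)" "z' * (e i * y) = e i * (z' * y)" for i y
    using assms by (simp_all add: partners_def flip: mult.assoc)
  moreover have "w * e i = e i * w" "w' * e i = e i * w'" "z * e i = e i * z" "z' * e i = e i * z'" for i
    using assms by (simp_all add: partners_def)
  ultimately show ?thesis
    using assms by (simp add: partners_def comult_mult counit_mult tensor_mult_simps mult.assoc e_left)
qed

lemma partners_power: "partners w w' \<Longrightarrow> partners (w ^ n) (w' ^ n)"
  by (induction n) (simp_all add: partners_1 partners_mult)

lemma partners_uv: "partners u v"
  unfolding partners_def e_uv
  by (simp add: u_def v_def comult_simps comult_x counit_simps counit_x tensor_elem_bilinear e_x distrib_left distrib_right)

lemma partners_word: "partners (s ^ j * u ^ k) (s' ^ j * v ^ k)"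
  unfolding s_def s'_def u'_def v'_def
  by (intro partners_mult partners_power partners_uv partners_sym[OF partners_uv])

text \<open>Factors from different components multiply to 0, so only terms with all factors in one
  component survive. In component 0 this is \<open>w ^ n\<close>; in component 1 the factors
  \<open>w\<close> and \<open>w'\<close> alternate, and adding the degrees of \<open>n\<close>
  factors fixes the parity of \<open>n\<close>.\<close>

lemma sweedler_power_partners:
  assumes w: "partners w w'"
  shows "sweedler_power \<Delta> \<epsilon> n (e 0 * w) = e 0 * w ^ n + (if even n then e 1 * (w * w') ^ (n div 2) else 0)"
    and "sweedler_power \<Delta> \<epsilon> n (e 1 * w) = (if odd n then e 1 * ((w * w') ^ (n div 2) * w) else 0)"
proof -
  have com: "w * e i = e i * w" "w' * e i = e i * w'" for i
    using w by (simp_all add: partners_def)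
  have com_pow: "w ^ m * (e i * y) = e i * (w ^ m * y)" "(w * w') ^ m * (e i * y) = e i * ((w * w') ^ m * y)"
    "w * (e i * y) = e i * (w * y)" for m i y
  proof -
    have "w * w' * e i = e i * (w * w')" by (simp add: mult.assoc com) (simp add: com flip: mult.assoc)
    then show "w ^ m * (e i * y) = e i * (w ^ m * y)" "(w * w') ^ m * (e i * y) = e i * ((w * w') ^ m * y)"
      "w * (e i * y) = e i * (w * y)"
      by (simp_all add: power_commuting_commutes com flip: mult.assoc)
  qed
  have comult: "\<Delta> (e 0 * w) = (e 0 * w) \<otimes>\<^sub>C (e 0 * w) + (e 1 * w) \<otimes>\<^sub>C (e 1 * w')"
    "\<Delta> (e 1 * w) = (e 0 * w) \<otimes>\<^sub>C (e 1 * w) + (e 1 * w) \<otimes>\<^sub>C (e 0 * w')"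
    using w by (simp_all add: comult_mult comult_e partners_def tensor_mult_simps e_left)
  have counit: "\<epsilon> (e 0 * w) = 1" "\<epsilon> (e 1 * w) = 0"
    using w by (simp_all add: counit_mult counit_e partners_def)
  have "sweedler_power \<Delta> \<epsilon> n (e 0 * w) = e 0 * w ^ n + (if even n then e 1 * (w * w') ^ (n div 2) else 0)
    \<and> sweedler_power \<Delta> \<epsilon> n (e 1 * w) = (if odd n then e 1 * ((w * w') ^ (n div 2) * w) else 0)"
  proof (induction n)
    case 0
    show ?case by (simp add: counit scaleC_one sum_e)
  next
    case (Suc n)
    have "Suc n div 2 = (if even n then n div 2 else Suc (n div 2))" by simp
    then show ?case
      using Suc by (cases "even n")
        (simp_all add: comult sweedler_lift_simps distrib_right mult.assoc com_pow e_left power_commutes power_Suc2 del: power_Suc)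
  qed
  then show "sweedler_power \<Delta> \<epsilon> n (e 0 * w) = e 0 * w ^ n + (if even n then e 1 * (w * w') ^ (n div 2) else 0)"
    "sweedler_power \<Delta> \<epsilon> n (e 1 * w) = (if odd n then e 1 * ((w * w') ^ (n div 2) * w) else 0)"
    by simp_all
qed

text \<open>Sums over the two cyclic directions in component 0, where both signs are 1. Each absorbs
  its own generator, and the product of the two sums is the integral up to a scalar.\<close>

definition "\<Sigma>\<^sub>s = (\<Sum>j<L. e 0 * s ^ j)"
definition "\<Sigma>\<^sub>u = (\<Sum>k<2 * N. e 0 * u ^ k)"
definition "\<Lambda> = (1 / of_nat (2 * N * L)) *\<^sub>C (\<Sum>j<L. \<Sum>k<2 * N. e 0 * (s ^ j * u ^ k))"

lemma periodic_sum_shift: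
  fixes g :: "nat \<Rightarrow> 'b::ab_group_add"
  assumes "g n = g 0" shows "(\<Sum>i<n. g (Suc i)) = (\<Sum>i<n. g i)"
  using assms sum.lessThan_Suc_shift[of g n] by simp

lemma e0: "e 0 * s ^ L = e 0" "e 0 * u ^ (2 * N) = e 0"
  using e_s_L[of 0] e_u_2N[of 0] by (simp_all add: grade_sign_def scaleC_one)

lemma absorb: "\<Sigma>\<^sub>s * s = \<Sigma>\<^sub>s" "\<Sigma>\<^sub>u * u = \<Sigma>\<^sub>u" "u * \<Sigma>\<^sub>u = \<Sigma>\<^sub>u" "s * \<Sigma>\<^sub>s = \<Sigma>\<^sub>s"
proof -
  have s: "(\<Sum>j<L. e 0 * s ^ Suc j) = \<Sigma>\<^sub>s" and u: "(\<Sum>k<2 * N. e 0 * u ^ Suc k) = \<Sigma>\<^sub>u"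
    unfolding \<Sigma>\<^sub>s_def \<Sigma>\<^sub>u_def by (rule periodic_sum_shift, simp add: e0)+
  show "\<Sigma>\<^sub>s * s = \<Sigma>\<^sub>s" "\<Sigma>\<^sub>u * u = \<Sigma>\<^sub>u"
    using s u by (simp_all only: \<Sigma>\<^sub>s_def \<Sigma>\<^sub>u_def sum_distrib_right mult.assoc power_Suc2)
  show "u * \<Sigma>\<^sub>u = \<Sigma>\<^sub>u" "s * \<Sigma>\<^sub>s = \<Sigma>\<^sub>s"
    using s u by (simp_all only: \<Sigma>\<^sub>s_def \<Sigma>\<^sub>u_def sum_distrib_left e_commute_left power_Suc)
qed

text \<open>\<open>u\<close> inverts rotations, and inversion permutes the powers of
  \<open>s\<close> in component 0 because \<open>e 0 * s ^ L = e 0\<close>.\<close>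

lemma u_sum_s: "u * \<Sigma>\<^sub>s = \<Sigma>\<^sub>s * u"
proof -
  have "u * \<Sigma>\<^sub>s = (\<Sum>j<L. e 0 * s' ^ j) * u"
    by (simp add: \<Sigma>\<^sub>s_def sum_distrib_left sum_distrib_right e_commute_left u_spow mult.assoc)
  also have "(\<Sum>j<L. e 0 * s' ^ j) = (\<Sum>j<L. e 0 * s ^ (L - Suc j) * s)"
  proof (rule sum.cong[OF refl])
    fix j assume "j \<in> {..<L}"
    then have L: "L = Suc (L - Suc j) + j" by simp
    have "e 0 * s' ^ j = e 0 * s ^ L * s' ^ j" by (simp add: e0)
    also have "s ^ L = s ^ (L - Suc j) * s * s ^ j"
      by (subst L) (simp only: power_add power_Suc2)
    also have "e 0 * (s ^ (L - Suc j) * s * s ^ j) * s' ^ j = e 0 * s ^ (L - Suc j) * s"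
      by (simp add: mult.assoc left_right_inverse_power[OF inv(1)])
    finally show "e 0 * s' ^ j = e 0 * s ^ (L - Suc j) * s" .
  qed
  also have "\<dots> = (\<Sum>j<L. e 0 * s ^ (L - Suc j)) * s" by (simp add: sum_distrib_right)
  also have "(\<Sum>j<L. e 0 * s ^ (L - Suc j)) = \<Sigma>\<^sub>s"
    unfolding \<Sigma>\<^sub>s_def by (rule sum.nat_diff_reindex)
  finally show ?thesis by (simp add: absorb)
qed

lemma Lambda_eq: "\<Lambda> = (1 / of_nat (2 * N * L)) *\<^sub>C (\<Sigma>\<^sub>s * \<Sigma>\<^sub>u)"
proof -
  have "e 0 * s ^ j * (e 0 * u ^ k) = e 0 * (s ^ j * u ^ k)" for j k
    using e_words_commute(1)[of j 0 0] by (simp add: mult.assoc) (simp add: e_mult flip: mult.assoc)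
  then show ?thesis
    by (simp add: \<Lambda>_def \<Sigma>\<^sub>s_def \<Sigma>\<^sub>u_def sum_product)
qed

lemma normalized_integral: "normalized_integral \<epsilon> = \<Lambda>"
proof (rule normalized_integral_eq)
  have 1: "\<epsilon> (e i * (s ^ j * u ^ k)) = (if i = 0 then 1 else 0)" for i j k
    using partners_word[of j k] by (simp add: counit_mult counit_e partners_def)
  show "\<epsilon> \<Lambda> = 1"
    using N_pos L_ge by (simp add: \<Lambda>_def counit_simps 1)
  have u: "u * \<Lambda> = \<Lambda>" "\<Lambda> * u = \<Lambda>"
    unfolding Lambda_eq scaleC_mult_left scaleC_mult_right
    by (simp_all add: u_sum_s mult.assoc absorb flip: mult.assoc[of u])
  have us: "u ^ k * \<Sigma>\<^sub>s = \<Sigma>\<^sub>s * u ^ k" for k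
    using power_commuting_commutes[OF u_sum_s] .
  have com: "\<Sigma>\<^sub>u * \<Sigma>\<^sub>s = \<Sigma>\<^sub>s * \<Sigma>\<^sub>u"
  proof -
    have "e 0 * \<Sigma>\<^sub>s = \<Sigma>\<^sub>s * e 0"
      using e_words_commute(1)[of _ 0 0] by (simp add: \<Sigma>\<^sub>s_def sum_distrib_left sum_distrib_right mult.assoc)
    then have "e 0 * u ^ k * \<Sigma>\<^sub>s = \<Sigma>\<^sub>s * (e 0 * u ^ k)" for k
      by (simp add: mult.assoc us) (simp flip: mult.assoc)
    then show ?thesis by (simp add: \<Sigma>\<^sub>u_def sum_distrib_left sum_distrib_right)
  qed
  have s: "s * \<Lambda> = \<Lambda>" "\<Lambda> * s = \<Lambda>"
  proof -
    show "s * \<Lambda> = \<Lambda>" by (simp add: Lambda_eq scaleC_mult_right absorb flip: mult.assoc)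
    show "\<Lambda> * s = \<Lambda>" by (simp add: Lambda_eq scaleC_mult_left mult.assoc absorb flip: com)
  qed
  have words: "s ^ j * u ^ k * \<Lambda> = \<Lambda>" "\<Lambda> * (s ^ j * u ^ k) = \<Lambda>" for j k
  proof -
    have "u ^ k * \<Lambda> = \<Lambda>" "s ^ j * \<Lambda> = \<Lambda>"
      by (induction k, simp_all add: u mult.assoc) (induction j, simp_all add: s mult.assoc)
    moreover have "\<Lambda> * u ^ k = \<Lambda>" "\<Lambda> * s ^ j = \<Lambda>"
      by (induction k, simp_all add: u flip: mult.assoc) (induction j, simp_all add: s flip: mult.assoc)
    ultimately show "s ^ j * u ^ k * \<Lambda> = \<Lambda>" "\<Lambda> * (s ^ j * u ^ k) = \<Lambda>"
      by (simp_all add: mult.assoc) (simp flip: mult.assoc)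
  qed
  have e\<Lambda>: "e i * \<Lambda> = (if i = 0 then \<Lambda> else 0)" "\<Lambda> * e i = (if i = 0 then \<Lambda> else 0)" for i
  proof -
    show l: "e i * \<Lambda> = (if i = 0 then \<Lambda> else 0)"
      by (cases i) (simp_all add: \<Lambda>_def scaleC_mult_right sum_distrib_left e_left)
    have "\<Lambda> * e i = e i * \<Lambda>"
      by (simp add: \<Lambda>_def scaleC_mult_left scaleC_mult_right sum_distrib_left sum_distrib_right mult.assoc[of "e 0"] e_words_commute)
        (simp add: e_left e_mult flip: mult.assoc)
    with l show "\<Lambda> * e i = (if i = 0 then \<Lambda> else 0)" by simp
  qed
  have "e i * (s ^ j * u ^ k) * \<Lambda> = (if i = 0 then \<Lambda> else 0)" "\<Lambda> * (e i * (s ^ j * u ^ k)) = (if i = 0 then \<Lambda> else 0)" for i j k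
  proof -
    show "e i * (s ^ j * u ^ k) * \<Lambda> = (if i = 0 then \<Lambda> else 0)"
      by (simp only: mult.assoc[of "e i"] words e\<Lambda>)
    have "\<Lambda> * (e i * (s ^ j * u ^ k)) = \<Lambda> * e i * (s ^ j * u ^ k)" by (simp only: mult.assoc)
    then show "\<Lambda> * (e i * (s ^ j * u ^ k)) = (if i = 0 then \<Lambda> else 0)" by (simp add: e\<Lambda> words)
  qed
  then show "integral_elem \<epsilon> \<Lambda>"
    by (intro integral_elem_of_span[OF span_basis]) (auto simp: b_def 1 scaleC_one)
qed

lemma FS_indicator_eq:
  "FS_indicator \<Delta> \<epsilon> n = (1 / of_nat (2 * N * L)) * (\<Sum>j<L. \<Sum>k<2 * N.
    regular_character (e 0 * (s ^ j * u ^ k) ^ n)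
    + (if even n then regular_character (e 1 * ((s ^ j * u ^ k) * (s' ^ j * v ^ k)) ^ (n div 2)) else 0))"
proof -
  have "regular_character (sweedler_power \<Delta> \<epsilon> n (e 0 * (s ^ j * u ^ k))) =
    regular_character (e 0 * (s ^ j * u ^ k) ^ n)
    + (if even n then regular_character (e 1 * ((s ^ j * u ^ k) * (s' ^ j * v ^ k)) ^ (n div 2)) else 0)" for j k
    unfolding sweedler_power_partners(1)[OF partners_word] by (simp add: regular_character_simps)
  then show ?thesis
    unfolding FS_indicator_def normalized_integral \<Lambda>_def sweedler_power_simps regular_character_simps
    by simp
qed

lemma word_power_odd_exponent:
  assumes "odd k" "odd n"
  shows "(s ^ j * u ^ k) ^ n = s ^ j * u ^ (n * k)"
proof -
  obtain m where n: "n = 2 * m + 1" using assms(2) by (rule oddE)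
  have "(s ^ j * u ^ k) ^ n = (s ^ j * u ^ k) * ((s ^ j * u ^ k) * (s ^ j * u ^ k)) ^ m"
    by (simp add: n power_mult power2_eq_square)
  also have "\<dots> = s ^ j * (u ^ k * u ^ (2 * k * m))"
    unfolding word_square_odd[OF assms(1)] by (simp only: power_mult mult.assoc)
  also have "u ^ k * u ^ (2 * k * m) = u ^ (n * k)"
    by (simp add: n algebra_simps flip: power_add)
  finally show ?thesis .
qed

text \<open>Component 1 contributes only for even \<open>n\<close>. An odd exponent of
  \<open>u\<close> stays odd in the \<open>n\<close>-th power and has character 0, and the even
  exponents give independent conditions modulo \<open>N\<close> and modulo \<open>L\<close>.\<close>

lemma FS_indicator_odd:
  assumes "odd n"
  shows "FS_indicator \<Delta> \<epsilon> n = of_nat (gcd n N * gcd n L)"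
proof -
  have n0: "n > 0" using assms by (cases n) auto
  have signs0: "a\<^sub>s 0 = 1" "b\<^sub>s 0 = 1" by (simp_all add: grade_sign_def)
  have "FS_indicator \<Delta> \<epsilon> n = (1 / of_nat (2 * N * L)) * (\<Sum>j<L. \<Sum>i<N.
      regular_character (e 0 * (s ^ j * u ^ (2 * i)) ^ n) + regular_character (e 0 * (s ^ j * u ^ (2 * i + 1)) ^ n))"
    unfolding FS_indicator_eq sum_lessThan_double using assms by simp
  also have "\<dots> = (1 / of_nat (2 * N * L)) * (\<Sum>j<L. \<Sum>i<N.
      of_nat (2 * N * L) * ((if L dvd n * j then 1 else 0) * (if N dvd n * i then 1 else 0)))"
  proof -
    have "regular_character (e 0 * (s ^ j * u ^ (2 * i)) ^ n)
        = of_nat (2 * N * L) * ((if L dvd n * j then 1 else 0) * (if N dvd n * i then 1 else 0))" for i j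
      by (simp add: word_power_even regular_character_word signs0 mult.left_commute[of n 2])
    moreover have "regular_character (e 0 * (s ^ j * u ^ (2 * i + 1)) ^ n) = 0" for i j
    proof -
      have "odd (n * (2 * i + 1))" using assms by simp
      then have "\<not> 2 * N dvd n * (2 * i + 1)" by (meson dvd_mult_left)
      then show ?thesis
        using word_power_odd_exponent[OF _ assms, of "2 * i + 1" j] by (simp add: regular_character_word)
    qed
    ultimately show ?thesis by simp
  qed
  also have "\<dots> = of_nat (gcd n N) * of_nat (gcd n L)"
    using N_pos L_ge n0 by (simp add: card_annihilator_nat flip: sum_distrib_left sum_distrib_right)
  finally show ?thesis by simp
qed

text \<open>The four terms come from the parity of the exponent of \<open>u\<close> and from the
  component. Rotations cancel in the partner product of an even word and in the square of an odd
  word, so there the sum over \<open>j\<close> is just \<open>L\<close>. The two other cases keep a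
  condition modulo \<open>L\<close>.\<close>

lemma FS_indicator_even:
  "FS_indicator \<Delta> \<epsilon> (2 * m) = of_int (even_sum m N 1 * even_sum m L 1 + int L * even_sum m N \<alpha>
    + int L * odd_sum m N 1 + odd_sum m N \<alpha> * odd_sum m L \<beta>)"
proof -
  have signs01: "a\<^sub>s 0 = 1" "b\<^sub>s 0 = 1" "a\<^sub>s 1 = of_int \<alpha>" "b\<^sub>s 1 = of_int \<beta>" by (simp_all add: grade_sign_def)
  define f where "f M \<sigma> c = (if M dvd c then of_int \<sigma> ^ (c div M) else 0 :: complex)" for M c :: nat and \<sigma> :: int
  have even_f: "of_int (even_sum m M \<sigma>) = (\<Sum>i<M. f M \<sigma> (2 * m * i))" for M \<sigma>
    unfolding even_sum_def f_def of_int_sum by (intro sum.cong refl) simp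
  have odd_f: "of_int (odd_sum m M \<sigma>) = (\<Sum>i<M. f M \<sigma> (m * (2 * i + 1)))" for M \<sigma>
    unfolding odd_sum_def f_def of_int_sum by (intro sum.cong refl) simp
  have f_double: "f (2 * M) \<sigma> (2 * c) = f M \<sigma> c" for M \<sigma> c
    by (simp add: f_def)
  have f_0: "f M \<sigma> 0 = 1" for M \<sigma> by (simp add: f_def)
  have char: "regular_character (e 0 * (s ^ a * u ^ c)) = of_nat (2 * N * L) * (f L 1 a * f (2 * N) 1 c)"
    "regular_character (e 1 * (s ^ a * u ^ c)) = of_nat (2 * N * L) * (f L \<beta> a * f (2 * N) \<alpha> c)" for a c
    by (simp_all add: regular_character_word f_def signs01)
  note char_u = char[of 0, unfolded power_0 mult_1_left f_0]
  have ch_even: "regular_character (e 0 * (s ^ j * u ^ (2 * i)) ^ (2 * m))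
      + regular_character (e 1 * ((s ^ j * u ^ (2 * i)) * (s' ^ j * v ^ (2 * i))) ^ m)
      = of_nat (2 * N * L) * (f L 1 (2 * m * j) * f N 1 (2 * m * i) + f N \<alpha> (2 * m * i))" for i j
  proof -
    have "(s ^ j * u ^ (2 * i)) ^ (2 * m) = s ^ (2 * m * j) * u ^ (2 * (2 * m * i))"
      by (subst word_power_even) (simp_all add: mult_ac)
    moreover have "((s ^ j * u ^ (2 * i)) * (s' ^ j * v ^ (2 * i))) ^ m = u ^ (2 * (2 * m * i))"
      unfolding word_mult_partner by (simp add: mult_ac flip: power_mult)
    ultimately show ?thesis by (simp only: char char_u f_double distrib_left[of "of_nat (2 * N * L)"])
  qed
  have ch_odd: "regular_character (e 0 * (s ^ j * u ^ (2 * i + 1)) ^ (2 * m))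
      + regular_character (e 1 * ((s ^ j * u ^ (2 * i + 1)) * (s' ^ j * v ^ (2 * i + 1))) ^ m)
      = of_nat (2 * N * L) * (f N 1 (m * (2 * i + 1)) + f L \<beta> (m * (2 * j + 1)) * f N \<alpha> (m * (2 * i + 1)))" for i j
  proof -
    have odd: "odd (2 * i + 1)" by simp
    have "(s ^ j * u ^ (2 * i + 1)) ^ (2 * m) = u ^ (2 * (m * (2 * i + 1)))"
      unfolding power_mult[of _ 2 m] power2_eq_square word_square_odd[OF odd] by (simp only: mult_ac flip: power_mult)
    moreover have "((s ^ j * u ^ (2 * i + 1)) * (s' ^ j * v ^ (2 * i + 1))) ^ m
        = s ^ (m * (2 * j + 1)) * u ^ (2 * (m * (2 * i + 1)))"
    proof -
      have "((s ^ j * u ^ (2 * i + 1)) * (s' ^ j * v ^ (2 * i + 1))) ^ m = (s ^ (2 * j + 1) * u ^ (2 * (2 * i + 1))) ^ m"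
        using odd by (simp only: word_mult_partner if_False)
      also have "\<dots> = s ^ (m * (2 * j + 1)) * u ^ (m * (2 * (2 * i + 1)))"
        by (rule word_power_even) simp
      finally show ?thesis by (simp only: mult.left_commute[of m 2])
    qed
    ultimately show ?thesis by (simp only: char char_u f_double distrib_left[of "of_nat (2 * N * L)"])
  qed
  have "FS_indicator \<Delta> \<epsilon> (2 * m) = (1 / of_nat (2 * N * L)) * (\<Sum>j<L. \<Sum>i<N.
      of_nat (2 * N * L) * (f L 1 (2 * m * j) * f N 1 (2 * m * i) + f N \<alpha> (2 * m * i)
        + f N 1 (m * (2 * i + 1)) + f L \<beta> (m * (2 * j + 1)) * f N \<alpha> (m * (2 * i + 1))))"
    unfolding FS_indicator_eq sum_lessThan_double
    by (simp only: dvd_triv_left if_True nonzero_mult_div_cancel_left numeral_eq_iff zero_neq_numeral[symmetric]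
        not_False_eq_True ch_even ch_odd simp_thms) (simp only: add.assoc distrib_left)
  also have "\<dots> = (\<Sum>j<L. \<Sum>i<N. f L 1 (2 * m * j) * f N 1 (2 * m * i) + f N \<alpha> (2 * m * i)
        + f N 1 (m * (2 * i + 1)) + f L \<beta> (m * (2 * j + 1)) * f N \<alpha> (m * (2 * i + 1)))"
    using N_pos L_ge by (simp flip: sum_distrib_left)
  also have "\<dots> = of_int (even_sum m L 1) * of_int (even_sum m N 1) + of_nat L * of_int (even_sum m N \<alpha>)
    + of_nat L * of_int (odd_sum m N 1) + of_int (odd_sum m L \<beta>) * of_int (odd_sum m N \<alpha>)"
    unfolding even_f odd_f by (simp add: sum.distrib flip: sum_distrib_left sum_distrib_right)
  finally show ?thesis by (simp add: mult.commute)
qed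

lemma Frobenius_theorem: "Frobenius_theorem_holds \<Delta> \<epsilon>"
  unfolding Frobenius_theorem_holds_def dim
proof (intro allI impI)
  fix n :: nat assume n: "n > 0" "n dvd 4 * N * L"
  have "\<exists>k :: int. FS_indicator \<Delta> \<epsilon> n = of_nat n * of_int k"
  proof (cases "even n")
    case True
    then obtain m where m: "n = 2 * m" by blast
    have "int (2 * m) dvd even_sum m N 1 * even_sum m L 1 + int L * even_sum m N \<alpha>
        + int L * odd_sum m N 1 + odd_sum m N \<alpha> * odd_sum m L \<beta>"
      by (rule two_mult_dvd_Suzuki_indicator) (use n m N_pos L_ge signs in auto)
    then obtain k where "even_sum m N 1 * even_sum m L 1 + int L * even_sum m N \<alpha>
        + int L * odd_sum m N 1 + odd_sum m N \<alpha> * odd_sum m L \<beta> = int (2 * m) * k" by blast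
    then have "FS_indicator \<Delta> \<epsilon> n = of_nat n * of_int k"
      unfolding m FS_indicator_even by (simp only: of_int_mult of_int_of_nat_eq)
    then show ?thesis by blast
  next
    case False
    then have "coprime n (4 :: nat)" using coprime_power_right_iff[of n 2 2] by (simp add: coprime_right_2_iff_odd)
    then have "n dvd N * L" using n(2) by (simp add: mult.assoc coprime_dvd_mult_right_iff)
    then obtain k where "gcd n N * gcd n L = n * k" using dvd_gcd_mult_gcd by blast
    then have "FS_indicator \<Delta> \<epsilon> n = of_nat n * of_int (int k)"
      unfolding FS_indicator_odd[OF False] by (simp only: of_nat_mult of_int_of_nat_eq)
    then show ?thesis by blast
  qed
  then show "\<exists>z. algebraic_int z \<and> FS_indicator \<Delta> \<epsilon> n = of_nat n * z"
    by (meson int_imp_algebraic_int Ints_of_int)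
qed

end

lemma Frobenius_theorem_Suzuki:
  assumes "hopf_algebra \<Delta> \<epsilon> S" "N \<ge> 1" "L \<ge> 2" "\<alpha> \<in> {1, -1}" "\<beta> \<in> {1, -1}"
    and "iso_Suzuki N L \<alpha> \<beta> \<Delta> \<epsilon> S"
  shows "Frobenius_theorem_holds \<Delta> \<epsilon>"
proof -
  obtain a b :: int where a: "a \<in> {1, -1}" "\<alpha> = of_int a" and b: "b \<in> {1, -1}" "\<beta> = of_int b"
    using assms(4,5) by (metis insert_iff of_int_1 of_int_minus singletonD)
  obtain x where "presented_by UNIV (Suzuki_relations N L \<alpha> \<beta>) (\<lambda>(i, j). x i j)"
    "\<forall>i j. \<Delta> (x i j) = x i 0 \<otimes>\<^sub>C x 0 j + x i 1 \<otimes>\<^sub>C x 1 j \<and> \<epsilon> (x i j) = (if i = j then 1 else 0)"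
    using assms(6) unfolding iso_Suzuki_def by blast
  then have "Suzuki \<Delta> \<epsilon> S N L a b x"
    using assms(1-3) a b unfolding Suzuki_def Suzuki_axioms_def by simp
  then show ?thesis by (rule Suzuki.Frobenius_theorem)
qed

theorem theorem6p5:
  fixes \<Delta> :: "'a::complex_algebra_1 \<Rightarrow> 'a \<otimes>\<^sub>C 'a"
    and \<epsilon> :: "'a \<Rightarrow> complex"
    and S :: "'a \<Rightarrow> 'a"
  assumes "hopf_algebra \<Delta> \<epsilon> S"
    and "finite_dimensional TYPE('a)"
    and "semisimple_algebra TYPE('a)"
    and "(\<exists>(F :: 'f monoid) (G :: 'g monoid) ract lact.
            matched_pair F G ract lact \<and> iso_bismash_product F G ract lact \<Delta>)
       \<or> (\<exists>(N :: nat) \<xi>. N > 1 \<and> \<xi> ^ N = 1 \<and> iso_H2N2 N \<xi> \<Delta> \<epsilon>)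
       \<or> (\<exists>(N :: nat) \<xi> \<zeta>. odd N \<and> \<xi> ^ N = 1 \<and> \<zeta> ^ N = 1 \<and> iso_HN3 N \<xi> \<zeta> \<Delta> \<epsilon>)
       \<or> (\<exists>(N :: nat) (L :: nat) \<alpha> \<beta>. N \<ge> 1 \<and> L \<ge> 2 \<and> \<alpha> \<in> {1, -1} \<and> \<beta> \<in> {1, -1} \<and>
            iso_Suzuki N L \<alpha> \<beta> \<Delta> \<epsilon> S)"
  shows "Frobenius_theorem_holds \<Delta> \<epsilon>"
  using assms(4)
proof (elim disjE exE conjE)
  fix F :: "'f monoid" and G :: "'g monoid" and ract lact
  assume "matched_pair F G ract lact" "iso_bismash_product F G ract lact \<Delta>"
  with assms(1) show ?thesis by (rule Frobenius_theorem_bismash_product)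
next
  fix N :: nat and \<xi>
  assume "N > 1" "\<xi> ^ N = 1" "iso_H2N2 N \<xi> \<Delta> \<epsilon>"
  with assms(1) show ?thesis by (intro Frobenius_theorem_H2N2) auto
next
  fix N :: nat and \<xi> \<zeta>
  assume "odd N" "\<xi> ^ N = 1" "\<zeta> ^ N = 1" "iso_HN3 N \<xi> \<zeta> \<Delta> \<epsilon>"
  with assms(1) show ?thesis by (rule Frobenius_theorem_HN3)
next
  fix N L :: nat and \<alpha> \<beta>
  assume "N \<ge> 1" "L \<ge> 2" "\<alpha> \<in> {1, -1}" "\<beta> \<in> {1, -1}" "iso_Suzuki N L \<alpha> \<beta> \<Delta> \<epsilon> S"
  with assms(1) show ?thesis by (rule Frobenius_theorem_Suzuki)
qed

end
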